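(* Let $X$ be a Kähler manifold. For every closed formal differential form $\alpha=\sum_{k\ge1}\hbar^k\omega_k$ of type $(1,1)$ on $X$, the star product $\star_\alpha$ on $C^\infty(X)[[\hbar]]$ defined by $f\star_\alpha g=\sigma(O_f\star O_g)$ is of Wick type.
   Context: **Kähler conventions.** Summation convention. $\omega=\omega_{\alpha\bar\beta}dz^\alpha\wedge d\bar z^\beta=\sqrt{-1}g_{\alpha\bar\beta}dz^\alpha\wedge d\bar z^\beta$ is the Kähler form, $\omega^{\bar\gamma\alpha}\omega_{\alpha\bar\beta}=\delta^{\bar\gamma}_{\bar\beta}$, $\omega^{\alpha\bar\beta}=-\omega^{\bar\beta\alpha}$. **Weyl bundle.** $\mathcal{W}_X=\widehat{\mathrm{Sym}}(T^*X)[[\hbar]]$ (holomorphic cotangent bundle, local frame $y^i$), $\mathcal{W}_{X,\mathbb{C}}=\mathcal{W}_X\otimes\widehat{\mathrm{Sym}}(\overline{T^*X})[[\hbar]]$ (further variables $\bar y^j$). $\delta=dz^i\wedge\partial_{y^i}+d\bar z^j\wedge\partial_{\bar y^j}$; $(\delta^{1,0})^{-1}a=\frac{1}{p_1+p_2}y^k\iota_{\partial_{z^k}}a$ if $a$ has form type $(p_1,q_1)$ and degree $p_2$ in the $y$'s (zero if $p_1+p_2=0$). The symbol map $\sigma$ sets $y^i,\bar y^j$ to $0$. $\nabla=\nabla^{1,0}+\nabla^{0,1}$ is the Levi-Civita connection. Wick product: $a\star b=\sum_k\frac{\hbar^k}{k!}\omega^{i_1\bar j_1}\cdots\omega^{i_k\bar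 j_k}\partial_{y^{i_1}}\cdots\partial_{y^{i_k}}a\;\partial_{\bar y^{j_1}}\cdots\partial_{\bar y^{j_k}}b$, with form parts wedged; $[-,-]_\star$ is the graded commutator. **The connection $D_{F,\alpha}$.** Curvature: $\nabla^2(y^m)=R_{i\bar jk}^mdz^i\wedge d\bar z^j\otimes y^k$. Put $R_2^*=\frac12R_{i\bar jk}^md\bar z^j\otimes(y^iy^k\otimes\partial_{z^m})$, $R_n^*=(\delta^{1,0})^{-1}\nabla^{1,0}R_{n-1}^*$ for $n\ge3$; write $R_n^*=R_{i_1\cdots i_n,\bar l}^jd\bar z^l\otimes(y^{i_1}\cdots y^{i_n}\otimes\partial_{z^j})$ and $I=\sum_{n\ge2}R_{i_1\cdots i_n,\bar l}^j\omega_{j\bar k}d\bar z^l\otimes y^{i_1}\cdots y^{i_n}\bar y^k$. Choose locally a formal function $g$ with $\alpha=\bar\partial\partial g$ and put $J_\alpha=\sum_{k\ge1}((\delta^{1,0})^{-1}\nabla^{1,0})^k(\bar\partial g)$, which is independent of $g$ and globally defined. Put $I_\alpha=I+J_\alpha$. Then $D_{F,\alpha}=\nabla-\delta+\frac1\hbar[I_\alpha,-]_\star$ is flat. **Star product.** For $f\in C^\infty(X)[[\hbar]]$, $O_f$ is the unique $D_{F,\alpha}$-flat section of $\mathcal{W}_{X,\mathbb{C}}$ with $\sigma(O_f)=f$ (Fedosov). The product $\star_\alpha$ is given by bidifferential operators, hence is also defined on open subsets. A star product $\star$ is of *Wick type* if $f\star g=f\cdot g$ whenever $f$ is (locally) antiholomorphic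 or $g$ is (locally) holomorphic; equivalently its bidifferential operators take only holomorphic derivatives of the first argument and only anti-holomorphic derivatives of the second. *)

theory Defs
  imports "HOL-Analysis.Analysis"
begin

section \<open>Calculus on open subsets of complex coordinate space\<close>

text \<open>Being coinductive, the definition asks for Frechet differentiability of all iterated
  directional derivatives, that is, for real-infinite differentiability on the open set \<open>S\<close>.\<close>

coinductive cinf_on :: "(complex^'n::finite) set \<Rightarrow> (complex^'n \<Rightarrow> complex) \<Rightarrow> bool"
  for S where
  "\<lbrakk>\<forall>z\<in>S. f differentiable (at z);
    \<forall>v. cinf_on S (\<lambda>z. frechet_derivative f (at z) v)\<rbrakk> \<Longrightarrow> cinf_on S f"

text \<open>The coordinate frame of the complexified tangent space is indexed by \<open>'n + 'n\<close>:
  \<open>Inl i\<close> stands for the index \<open>i\<close> and \<open>Inr j\<close> for the barred index \<open>j\<close>.\<close>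

fun wirt :: "'n::finite + 'n \<Rightarrow> (complex^'n \<Rightarrow> complex) \<Rightarrow> complex^'n \<Rightarrow> complex" where
  "wirt (Inl i) f z =
    (frechet_derivative f (at z) (axis i 1) - \<i> * frechet_derivative f (at z) (axis i \<i>)) / 2"
| "wirt (Inr j) f z =
    (frechet_derivative f (at z) (axis j 1) + \<i> * frechet_derivative f (at z) (axis j \<i>)) / 2"

definition holomorphic_map_on :: "(complex^'n::finite) set \<Rightarrow> (complex^'n \<Rightarrow> complex^'n) \<Rightarrow> bool" where
  "holomorphic_map_on S F \<longleftrightarrow>
    (\<forall>i. cinf_on S (\<lambda>z. F z $ i) \<and> (\<forall>z\<in>S. \<forall>j. wirt (Inr j) (\<lambda>z. F z $ i) z = 0))"


section \<open>Kaehler manifolds\<close>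

text \<open>The manifold is the whole type \<open>'a\<close>. A chart is its domain together with its coordinate map;
  tensor fields are families of coordinate expressions indexed by the charts of the atlas, and only
  their values on the coordinate domain matter.\<close>

type_synonym ('a, 'n) chart = "'a set \<times> ('a \<Rightarrow> complex^'n)"
type_synonym 'n matfield = "complex^'n \<Rightarrow> complex^'n^'n"

definition coord :: "('a, 'n::finite) chart \<Rightarrow> 'a set \<Rightarrow> (complex^'n) set" where
  "coord c U = snd c ` (U \<inter> fst c)"

definition point :: "('a, 'n::finite) chart \<Rightarrow> complex^'n \<Rightarrow> 'a" where
  "point c = inv_into (fst c) (snd c)"

definition transition :: "('a, 'n::finite) chart \<Rightarrow> ('a, 'n) chart \<Rightarrow> complex^'n \<Rightarrow> complex^'n" where
  "transition c c' z = snd c' (point c z)"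

definition jac :: "('a, 'n::finite) chart \<Rightarrow> ('a, 'n) chart \<Rightarrow> 'n matfield" where
  "jac c c' z = (\<chi> i j. wirt (Inl j) (\<lambda>w. transition c c' w $ i) z)"

definition complex_atlas ::
  "('a::{t2_space,second_countable_topology}, 'n::finite) chart set \<Rightarrow> bool" where
  "complex_atlas A \<longleftrightarrow>
    (\<Union>c\<in>A. fst c) = UNIV \<and>
    (\<forall>c\<in>A. open (fst c) \<and> open (coord c UNIV) \<and>
       homeomorphism (fst c) (coord c UNIV) (snd c) (point c)) \<and>
    (\<forall>c\<in>A. \<forall>c'\<in>A. holomorphic_map_on (coord c (fst c')) (transition c c'))"

text \<open>A family \<open>h\<close> of matrices represents the form \<open>h\<^sub>i\<^sub>j dz\<^sup>i \<and> d\<bar>z\<^sup>j\<close>.\<close>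

definition form11 :: "('a, 'n::finite) chart set \<Rightarrow> (('a, 'n) chart \<Rightarrow> 'n matfield) \<Rightarrow> bool" where
  "form11 A h \<longleftrightarrow>
    (\<forall>c\<in>A. \<forall>i j. cinf_on (coord c UNIV) (\<lambda>z. h c z $ i $ j)) \<and>
    (\<forall>c\<in>A. \<forall>c'\<in>A. \<forall>z\<in>coord c (fst c'). \<forall>i j.
       h c z $ i $ j = (\<Sum>p\<in>UNIV. \<Sum>q\<in>UNIV.
         h c' (transition c c' z) $ p $ q * jac c c' z $ p $ i * cnj (jac c c' z $ q $ j)))"

definition closed11 :: "('a, 'n::finite) chart set \<Rightarrow> (('a, 'n) chart \<Rightarrow> 'n matfield) \<Rightarrow> bool" where
  "closed11 A h \<longleftrightarrow>
    (\<forall>c\<in>A. \<forall>z\<in>coord c UNIV. \<forall>i j k.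
       wirt (Inl k) (\<lambda>z. h c z $ i $ j) z = wirt (Inl i) (\<lambda>z. h c z $ k $ j) z \<and>
       wirt (Inr k) (\<lambda>z. h c z $ i $ j) z = wirt (Inr j) (\<lambda>z. h c z $ i $ k) z)"

text \<open>The coefficient matrix of \<open>\<omega> = \<i> g\<^sub>i\<^sub>j dz\<^sup>i \<and> d\<bar>z\<^sup>j\<close>.\<close>

definition omega :: "'n::finite matfield \<Rightarrow> 'n matfield" where
  "omega g z = (\<chi> i j. \<i> * g z $ i $ j)"

definition kaehler_manifold :: "('a::{t2_space,second_countable_topology}, 'n::finite) chart set
    \<Rightarrow> (('a, 'n) chart \<Rightarrow> 'n matfield) \<Rightarrow> bool" where
  "kaehler_manifold A g \<longleftrightarrow>
    complex_atlas A \<and>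
    form11 A (\<lambda>c. omega (g c)) \<and> closed11 A (\<lambda>c. omega (g c)) \<and>
    (\<forall>c\<in>A. \<forall>z\<in>coord c UNIV.
       (\<forall>i j. g c z $ j $ i = cnj (g c z $ i $ j)) \<and>
       (\<forall>v. v \<noteq> 0 \<longrightarrow> 0 < Re (\<Sum>i\<in>UNIV. \<Sum>j\<in>UNIV. g c z $ i $ j * v $ i * cnj (v $ j))))"

text \<open>\<open>\<alpha> k\<close> is the coefficient of \<open>\<hbar>\<^sup>k\<close>.\<close>

definition closed_formal_form11 ::
  "('a, 'n::finite) chart set \<Rightarrow> (nat \<Rightarrow> ('a, 'n) chart \<Rightarrow> 'n matfield) \<Rightarrow> bool" where
  "closed_formal_form11 A \<alpha> \<longleftrightarrow>
    (\<forall>c\<in>A. \<forall>z\<in>coord c UNIV. \<alpha> 0 c z = 0) \<and> (\<forall>k. form11 A (\<alpha> k) \<and> closed11 A (\<alpha> k))"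

definition smooth_fun_on ::
  "('a, 'n::finite) chart set \<Rightarrow> 'a set \<Rightarrow> ('a \<Rightarrow> complex) \<Rightarrow> bool" where
  "smooth_fun_on A U f \<longleftrightarrow> (\<forall>c\<in>A. cinf_on (coord c U) (\<lambda>z. f (point c z)))"

definition holomorphic_fun_on ::
  "('a, 'n::finite) chart set \<Rightarrow> 'a set \<Rightarrow> ('a \<Rightarrow> complex) \<Rightarrow> bool" where
  "holomorphic_fun_on A U f \<longleftrightarrow> smooth_fun_on A U f \<and>
    (\<forall>c\<in>A. \<forall>z\<in>coord c U. \<forall>j. wirt (Inr j) (\<lambda>z. f (point c z)) z = 0)"

definition antiholomorphic_fun_on ::
  "('a, 'n::finite) chart set \<Rightarrow> 'a set \<Rightarrow> ('a \<Rightarrow> complex) \<Rightarrow> bool" where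
  "antiholomorphic_fun_on A U f \<longleftrightarrow> smooth_fun_on A U f \<and>
    (\<forall>c\<in>A. \<forall>z\<in>coord c U. \<forall>i. wirt (Inl i) (\<lambda>z. f (point c z)) z = 0)"


section \<open>The Weyl bundle in a chart\<close>

text \<open>\<open>s k e z\<close> is the coefficient of \<open>\<hbar>\<^sup>k\<close> and of the monomial with exponents \<open>e (Inl i)\<close> of
  \<open>y\<^sup>i\<close> and \<open>e (Inr j)\<close> of \<open>\<bar>y\<^sup>j\<close>, at the point with coordinates \<open>z\<close>.\<close>

type_synonym 'n weyl = "nat \<Rightarrow> ('n + 'n \<Rightarrow> nat) \<Rightarrow> complex^'n \<Rightarrow> complex"

definition ydeg :: "('n::finite + 'n \<Rightarrow> nat) \<Rightarrow> nat" where
  "ydeg e = (\<Sum>i\<in>UNIV. e (Inl i))"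

definition ygen :: "'n + 'n \<Rightarrow> 'n weyl" where
  "ygen B k e z = (if k = 0 \<and> e = (\<lambda>_. 0)(B := 1) then 1 else 0)"

definition ymul :: "'n + 'n \<Rightarrow> 'n weyl \<Rightarrow> 'n weyl" where
  "ymul B s k e z = (if e B = 0 then 0 else s k (e(B := e B - 1)) z)"

definition ydiff :: "'n + 'n \<Rightarrow> 'n weyl \<Rightarrow> 'n weyl" where
  "ydiff B s k e z = of_nat (e B + 1) * s k (e(B := e B + 1)) z"

definition wmult :: "'n::finite weyl \<Rightarrow> 'n weyl \<Rightarrow> 'n weyl" where
  "wmult a b k e z =
    (\<Sum>l\<le>k. \<Sum>p | \<forall>B. p B \<le> e B. a l p z * b (k - l) (\<lambda>B. e B - p B) z)"

text \<open>The bivector \<open>\<omega>\<^sup>i\<^sup>j\<close> with \<open>j\<close> barred is minus the transposed inverse of the coefficient matrix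
  of \<open>\<omega>\<close>.\<close>

definition omega_up :: "'n::finite matfield \<Rightarrow> 'n matfield" where
  "omega_up g z = (\<chi> i j. - matrix_inv (omega g z) $ j $ i)"

definition wick :: "'n::finite matfield \<Rightarrow> 'n weyl \<Rightarrow> 'n weyl \<Rightarrow> 'n weyl" where
  "wick g a b r e z =
    (\<Sum>k\<le>r. (\<Sum>is | length is = k. \<Sum>js | length js = k.
        (\<Prod>q<k. omega_up g z $ (is ! q) $ (js ! q)) *
        wmult (foldr (\<lambda>i. ydiff (Inl i)) is a) (foldr (\<lambda>j. ydiff (Inr j)) js b) (r - k) e z)
      / fact k)"


section \<open>Levi-Civita connection and curvature\<close>

text \<open>The complex bilinear extension of the Riemannian metric in the frame of the
  \<open>\<partial>\<close> and \<open>\<bar>\<partial>\<close> coordinate fields, up to a constant factor, which cancels in the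
  Christoffel symbols.\<close>

definition cmetric :: "'n::finite matfield \<Rightarrow> complex^'n \<Rightarrow> complex^('n + 'n)^('n + 'n)" where
  "cmetric g z = (\<chi> B C. case (B, C) of
      (Inl i, Inr j) \<Rightarrow> g z $ i $ j
    | (Inr j, Inl i) \<Rightarrow> g z $ i $ j
    | _ \<Rightarrow> 0)"

definition christoffel ::
  "'n::finite matfield \<Rightarrow> 'n + 'n \<Rightarrow> 'n + 'n \<Rightarrow> 'n + 'n \<Rightarrow> complex^'n \<Rightarrow> complex" where
  "christoffel g B C E z = (\<Sum>F\<in>UNIV. matrix_inv (cmetric g z) $ E $ F *
      (wirt B (\<lambda>w. cmetric g w $ C $ F) z + wirt C (\<lambda>w. cmetric g w $ B $ F) z
        - wirt F (\<lambda>w. cmetric g w $ B $ C) z)) / 2"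

text \<open>Covariant derivative in direction \<open>B\<close>; as \<open>y\<^sup>E\<close> is a frame of the cotangent bundle,
  \<open>\<nabla>\<^sub>B y\<^sup>E = - \<Gamma>\<^sub>B\<^sub>C\<^sup>E y\<^sup>C\<close>.\<close>

definition nabla :: "'n::finite matfield \<Rightarrow> 'n + 'n \<Rightarrow> 'n weyl \<Rightarrow> 'n weyl" where
  "nabla g B s k e z = wirt B (s k e) z
    - (\<Sum>C\<in>UNIV. \<Sum>E\<in>UNIV. christoffel g B C E z * ymul C (ydiff E s) k e z)"

text \<open>\<open>curv g i j k m\<close> is \<open>R\<^sub>i\<^sub>j\<^sub>k\<^sup>m\<close> with \<open>j\<close> barred: the coefficient of
  \<open>dz\<^sup>i \<and> d\<bar>z\<^sup>j \<otimes> y\<^sup>k\<close> in \<open>\<nabla>\<^sup>2 y\<^sup>m\<close>.\<close>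

definition curv :: "'n::finite matfield \<Rightarrow> 'n \<Rightarrow> 'n \<Rightarrow> 'n \<Rightarrow> 'n \<Rightarrow> complex^'n \<Rightarrow> complex" where
  "curv g i j k m z =
     nabla g (Inl i) (nabla g (Inr j) (ygen (Inl m))) 0 ((\<lambda>_. 0)(Inl k := 1)) z
   - nabla g (Inr j) (nabla g (Inl i) (ygen (Inl m))) 0 ((\<lambda>_. 0)(Inl k := 1)) z"


section \<open>The Fedosov connection in a chart\<close>

text \<open>A \<open>(0,1)\<close>-form \<open>a\<^sub>l d\<bar>z\<^sup>l\<close> is given by the family of its components \<open>a l\<close>, a
  \<open>(1,1)\<close>-form \<open>b\<^sub>i\<^sub>l dz\<^sup>i \<and> d\<bar>z\<^sup>l\<close> by \<open>b i l\<close>. In \<open>delta_inv\<close>, the operator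
  \<open>(\<delta>\<^sup>1\<^sup>,\<^sup>0)\<^sup>-\<^sup>1\<close> on \<open>(1,1)\<close>-forms, the divisor \<open>p\<^sub>1 + p\<^sub>2 = 1 + p\<^sub>2\<close> is the \<open>y\<close>-degree
  after the multiplication by \<open>y\<^sup>i\<close>.\<close>

definition delta_inv :: "('n::finite \<Rightarrow> 'n \<Rightarrow> 'n weyl) \<Rightarrow> 'n \<Rightarrow> 'n weyl" where
  "delta_inv b l k e z = (\<Sum>i\<in>UNIV. ymul (Inl i) (b i l) k e z) / of_nat (ydeg e)"

definition nabla10 :: "'n::finite matfield \<Rightarrow> ('n \<Rightarrow> 'n weyl) \<Rightarrow> 'n \<Rightarrow> 'n \<Rightarrow> 'n weyl" where
  "nabla10 g a i l = nabla g (Inl i) (a l)"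

text \<open>\<open>rstar g n j l\<close> is the coefficient of \<open>d\<bar>z\<^sup>l \<otimes> \<partial>\<^bsub>z\<^sup>j\<^esub>\<close> in \<open>R\<^sup>*\<close> with subscript \<open>n + 2\<close>. The
  connection also differentiates the frame of the tangent bundle, which gives the term with a
  Christoffel symbol of positive sign.\<close>

primrec rstar :: "'n::finite matfield \<Rightarrow> nat \<Rightarrow> 'n \<Rightarrow> 'n \<Rightarrow> 'n weyl" where
  "rstar g 0 = (\<lambda>j l k e z. (\<Sum>i\<in>UNIV. \<Sum>p\<in>UNIV.
      curv g i l p j z * ymul (Inl i) (ygen (Inl p)) k e z) / 2)"
| "rstar g (Suc n) = (\<lambda>j. delta_inv (\<lambda>i l k e z. nabla10 g (rstar g n j) i l k e z
      + (\<Sum>q\<in>UNIV. christoffel g (Inl i) (Inl q) (Inl j) z * rstar g n q l k e z)))"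

text \<open>The series \<open>I\<close>, \<open>J\<^sub>\<alpha>\<close> and \<open>J\<close> below have finitely many non-zero contributions in each
  \<open>y\<close>-degree: their \<open>n\<close>-th terms are homogeneous in \<open>y\<close> of degree \<open>n + 2\<close>, \<open>n + 1\<close> and \<open>n\<close>.\<close>

definition fedI :: "'n::finite matfield \<Rightarrow> 'n \<Rightarrow> 'n weyl" where
  "fedI g l k e z = (\<Sum>n\<le>ydeg e. \<Sum>j\<in>UNIV. \<Sum>q\<in>UNIV.
      omega g z $ j $ q * ymul (Inr q) (rstar g n j l) k e z)"

text \<open>If \<open>\<alpha> = \<bar>\<partial>\<partial>u\<close> then \<open>\<nabla>\<^sup>1\<^sup>,\<^sup>0(\<bar>\<partial>u) = \<partial>\<bar>\<partial>u = -\<alpha>\<close>. Hence the first term of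
  \<open>J\<^sub>\<alpha> = \<Sum>\<^sub>k\<^sub>\<ge>\<^sub>1 ((\<delta>\<^sup>1\<^sup>,\<^sup>0)\<^sup>-\<^sup>1\<nabla>\<^sup>1\<^sup>,\<^sup>0)\<^sup>k(\<bar>\<partial>u)\<close> is \<open>-(\<delta>\<^sup>1\<^sup>,\<^sup>0)\<^sup>-\<^sup>1\<alpha>\<close>, and \<open>fedJ\<close> writes the
  sum starting from it, which makes sense globally. The theorem \<open>fedJ_eq_fedJ_pot\<close>
  shows that this is the series \<open>fedJ_pot\<close> for every local potential \<open>u\<close>.\<close>

definition fed_step :: "'n::finite matfield \<Rightarrow> ('n \<Rightarrow> 'n weyl) \<Rightarrow> 'n \<Rightarrow> 'n weyl" where
  "fed_step g a = delta_inv (nabla10 g a)"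

definition fedJ_init :: "(nat \<Rightarrow> 'n::finite matfield) \<Rightarrow> 'n \<Rightarrow> 'n weyl" where
  "fedJ_init \<alpha> = delta_inv (\<lambda>i l k e z. if e = (\<lambda>_. 0) then - \<alpha> k z $ i $ l else 0)"

definition fedJ :: "'n::finite matfield \<Rightarrow> (nat \<Rightarrow> 'n matfield) \<Rightarrow> 'n \<Rightarrow> 'n weyl" where
  "fedJ g \<alpha> l k e z = (\<Sum>n<ydeg e. (fed_step g ^^ n) (fedJ_init \<alpha>) l k e z)"

definition dbar :: "(nat \<Rightarrow> complex^'n::finite \<Rightarrow> complex) \<Rightarrow> 'n \<Rightarrow> 'n weyl" where
  "dbar u l k e z = (if e = (\<lambda>_. 0) then wirt (Inr l) (u k) z else 0)"

definition fedJ_pot ::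
  "'n::finite matfield \<Rightarrow> (nat \<Rightarrow> complex^'n \<Rightarrow> complex) \<Rightarrow> 'n \<Rightarrow> 'n weyl" where
  "fedJ_pot g u l k e z = (\<Sum>n=1..ydeg e. (fed_step g ^^ n) (dbar u) l k e z)"

lemma wirt_cong_open:
  assumes "open S" "z \<in> S" "\<And>w. w \<in> S \<Longrightarrow> f w = h w"
  shows "wirt B f z = wirt B h z"
proof -
  have "(f has_derivative F) (at z) \<longleftrightarrow> (h has_derivative F) (at z)" for F
    using assms has_derivative_transform_within_open[of f F z UNIV S h]
      has_derivative_transform_within_open[of h F z UNIV S f] by auto
  then have "frechet_derivative f (at z) = frechet_derivative h (at z)"
    by (simp add: frechet_derivative_def)
  then show ?thesis by (cases B) simp_all
qed

lemma fed_step_cong_open: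
  assumes "open S" "\<And>l k e w. w \<in> S \<Longrightarrow> a l k e w = b l k e w" "z \<in> S"
  shows "fed_step g a l k e z = fed_step g b l k e z"
proof -
  have w: "wirt B (a l k e) z = wirt B (b l k e) z" for B l k e
    using wirt_cong_open[OF assms(1,3)] assms(2) by blast
  have y: "ymul C (ydiff E (a l)) k e z = ymul C (ydiff E (b l)) k e z" for C E l k e
    using assms(2,3) by (simp add: ymul_def ydiff_def)
  have n: "nabla g B (a l) k e z = nabla g B (b l) k e z" for B l k e
    by (simp only: nabla_def w y)
  have "ymul C (nabla g B (a l)) k e z = ymul C (nabla g B (b l)) k e z" for B C l k e
    unfolding ymul_def n ..
  then show ?thesis
    by (simp add: fed_step_def delta_inv_def nabla10_def)
qed

text \<open>The hypothesis says that \<open>\<alpha> = \<bar>\<partial>\<partial>u\<close> on \<open>S\<close>.\<close>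

theorem fedJ_eq_fedJ_pot:
  assumes "open S" "z \<in> S"
    and pot: "\<And>k w i l. w \<in> S \<Longrightarrow> \<alpha> k w $ i $ l = - wirt (Inl i) (wirt (Inr l) (u k)) w"
  shows "fedJ g \<alpha> l k e z = fedJ_pot g u l k e z"
proof -
  have first: "fed_step g (dbar u) l k e w = fedJ_init \<alpha> l k e w" if w: "w \<in> S" for l k e w
  proof -
    have d: "(\<lambda>w. dbar u l k p w) = (if p = (\<lambda>_. 0) then wirt (Inr l) (u k) else (\<lambda>_. 0))"
      for l k p by (auto simp: dbar_def)
    have z0: "wirt B (\<lambda>_. 0) x = 0" for B and x :: "complex^'n"
      by (cases B) (simp_all add: frechet_derivative_const)
    have y0: "ydiff E (dbar u l) k p w = 0" for E l k p
      by (auto simp: ydiff_def dbar_def fun_eq_iff)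
    have m0: "ymul C (ydiff E (dbar u l)) k p w = 0" for C E l k p
      by (simp add: ymul_def y0)
    have n: "nabla g (Inl i) (dbar u l) k p w = (if p = (\<lambda>_. 0) then - \<alpha> k w $ i $ l else 0)"
      for i l k p
      using pot[OF w, of k i l] z0[of "Inl i" w]
      by (cases "p = (\<lambda>_. 0)") (simp_all only: nabla_def d m0 simp_thms minus_minus if_True if_False mult_zero_right
          sum.neutral_const diff_zero)
    show ?thesis
      by (simp only: fed_step_def delta_inv_def nabla10_def fedJ_init_def ymul_def n)
  qed
  have "(fed_step g ^^ Suc n) (dbar u) l k e w = (fed_step g ^^ n) (fedJ_init \<alpha>) l k e w"
    if "w \<in> S" for n l k e w
    using that
  proof (induction n arbitrary: l k e w)
    case 0
    then show ?case using first by simp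
  next
    case (Suc n)
    then show ?case
      using fed_step_cong_open[OF assms(1), of "(fed_step g ^^ Suc n) (dbar u)"] by simp
  qed
  then have "fedJ g \<alpha> l k e z = (\<Sum>n<ydeg e. (fed_step g ^^ Suc n) (dbar u) l k e z)"
    using assms(2) by (simp add: fedJ_def)
  also have "\<dots> = (\<Sum>n\<in>Suc ` {..<ydeg e}. (fed_step g ^^ n) (dbar u) l k e z)"
    by (subst sum.reindex) simp_all
  finally show ?thesis
    by (simp only: fedJ_pot_def image_Suc_lessThan)
qed

definition fedI_alpha :: "'n::finite matfield \<Rightarrow> (nat \<Rightarrow> 'n matfield) \<Rightarrow> 'n \<Rightarrow> 'n weyl" where
  "fedI_alpha g \<alpha> l k e z = fedI g l k e z + fedJ g \<alpha> l k e z"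

text \<open>The component along \<open>dz\<^sup>i\<close> (for \<open>Inl i\<close>) or \<open>d\<bar>z\<^sup>l\<close> (for \<open>Inr l\<close>) of \<open>\<nabla> - \<delta> + \<hbar>\<^sup>-\<^sup>1 [I\<^sub>\<alpha>, -]\<close>
  on sections of form degree 0. The commutator has no term of order 0 in \<open>\<hbar>\<close>, so the division by
  \<open>\<hbar>\<close> is a shift of coefficients.\<close>

fun fedD :: "'n::finite matfield \<Rightarrow> (nat \<Rightarrow> 'n matfield) \<Rightarrow> 'n + 'n \<Rightarrow> 'n weyl \<Rightarrow> 'n weyl" where
  "fedD g \<alpha> (Inl i) s k e z = nabla g (Inl i) s k e z - ydiff (Inl i) s k e z"
| "fedD g \<alpha> (Inr l) s k e z = nabla g (Inr l) s k e z - ydiff (Inr l) s k e z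
    + (wick g (fedI_alpha g \<alpha> l) s (Suc k) e z - wick g s (fedI_alpha g \<alpha> l) (Suc k) e z)"


section \<open>The star product\<close>

text \<open>A section is compatible with changes of charts if its homogeneous components are the same
  polynomials on the complexified tangent spaces, whose elements have independent components along
  the two halves of \<open>'n + 'n\<close>.\<close>

definition push ::
  "('a, 'n::finite) chart \<Rightarrow> ('a, 'n) chart \<Rightarrow> complex^'n \<Rightarrow> ('n + 'n \<Rightarrow> complex) \<Rightarrow> 'n + 'n \<Rightarrow> complex"
  where
  "push c c' z v B = (case B of
      Inl i \<Rightarrow> \<Sum>j\<in>UNIV. jac c c' z $ i $ j * v (Inl j)
    | Inr i \<Rightarrow> \<Sum>j\<in>UNIV. cnj (jac c c' z $ i $ j) * v (Inr j))"

definition weyl_section ::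
  "('a, 'n::finite) chart set \<Rightarrow> 'a set \<Rightarrow> (('a, 'n) chart \<Rightarrow> 'n weyl) \<Rightarrow> bool" where
  "weyl_section A U s \<longleftrightarrow>
    (\<forall>c\<in>A. \<forall>k e. cinf_on (coord c U) (s c k e)) \<and>
    (\<forall>c\<in>A. \<forall>c'\<in>A. \<forall>z\<in>coord c (U \<inter> fst c'). \<forall>k d v.
       (\<Sum>e | sum e UNIV = d. s c k e z * (\<Prod>B\<in>UNIV. v B ^ e B)) =
       (\<Sum>e | sum e UNIV = d. s c' k e (transition c c' z) * (\<Prod>B\<in>UNIV. push c c' z v B ^ e B)))"

definition flat_section :: "('a, 'n::finite) chart set \<Rightarrow> (('a, 'n) chart \<Rightarrow> 'n matfield)
    \<Rightarrow> (nat \<Rightarrow> ('a, 'n) chart \<Rightarrow> 'n matfield) \<Rightarrow> 'a set \<Rightarrow> (('a, 'n) chart \<Rightarrow> 'n weyl) \<Rightarrow> bool" where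
  "flat_section A g \<alpha> U s \<longleftrightarrow> weyl_section A U s \<and>
    (\<forall>c\<in>A. \<forall>z\<in>coord c U. \<forall>B k e. fedD (g c) (\<lambda>k. \<alpha> k c) B (s c) k e z = 0)"

text \<open>The symbol does not depend on the chart used at \<open>x\<close>.\<close>

definition symbol :: "('a, 'n::finite) chart set \<Rightarrow> (('a, 'n) chart \<Rightarrow> 'n weyl) \<Rightarrow> nat \<Rightarrow> 'a \<Rightarrow> complex"
  where
  "symbol A s k x = (let c = (SOME c. c \<in> A \<and> x \<in> fst c) in s c k (\<lambda>_. 0) (snd c x))"

text \<open>\<open>O\<^sub>f\<close> over the open set \<open>U\<close>. By Fedosov's theorem it is unique over \<open>U\<close>; its values elsewhere
  are irrelevant.\<close>

definition quantization :: "('a, 'n::finite) chart set \<Rightarrow> (('a, 'n) chart \<Rightarrow> 'n matfield)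
    \<Rightarrow> (nat \<Rightarrow> ('a, 'n) chart \<Rightarrow> 'n matfield) \<Rightarrow> 'a set \<Rightarrow> (nat \<Rightarrow> 'a \<Rightarrow> complex)
    \<Rightarrow> ('a, 'n) chart \<Rightarrow> 'n weyl" where
  "quantization A g \<alpha> U f =
    (SOME s. flat_section A g \<alpha> U s \<and> (\<forall>k. \<forall>x\<in>U. symbol A s k x = f k x))"

text \<open>The product of \<open>f\<close> and \<open>h\<close> in \<open>C\<^sup>\<infinity>(U)[[\<hbar>]]\<close>, where \<open>f k\<close> is the coefficient of \<open>\<hbar>\<^sup>k\<close>;
  the product on the manifold itself is the case \<open>U = UNIV\<close>.\<close>

definition fedosov_star :: "('a, 'n::finite) chart set \<Rightarrow> (('a, 'n) chart \<Rightarrow> 'n matfield)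
    \<Rightarrow> (nat \<Rightarrow> ('a, 'n) chart \<Rightarrow> 'n matfield) \<Rightarrow> 'a set
    \<Rightarrow> (nat \<Rightarrow> 'a \<Rightarrow> complex) \<Rightarrow> (nat \<Rightarrow> 'a \<Rightarrow> complex) \<Rightarrow> nat \<Rightarrow> 'a \<Rightarrow> complex" where
  "fedosov_star A g \<alpha> U f h = symbol A
    (\<lambda>c. wick (g c) (quantization A g \<alpha> U f c) (quantization A g \<alpha> U h c))"

text \<open>The set \<open>W\<close> accounts for the word ``locally'': the condition is tested for functions on all
  open sets \<open>U\<close> and on every open part \<open>W\<close> of \<open>U\<close> where one of them is (anti)holomorphic.\<close>

definition wick_type :: "('a::topological_space, 'n::finite) chart set
    \<Rightarrow> ('a set \<Rightarrow> (nat \<Rightarrow> 'a \<Rightarrow> complex) \<Rightarrow> (nat \<Rightarrow> 'a \<Rightarrow> complex) \<Rightarrow> nat \<Rightarrow> 'a \<Rightarrow> complex) \<Rightarrow> bool" where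
  "wick_type A star \<longleftrightarrow>
    (\<forall>U W f h. open U \<and> open W \<and> W \<subseteq> U \<and>
       (\<forall>k. smooth_fun_on A U (f k)) \<and> (\<forall>k. smooth_fun_on A U (h k)) \<and>
       ((\<forall>k. antiholomorphic_fun_on A W (f k)) \<or> (\<forall>k. holomorphic_fun_on A W (h k)))
       \<longrightarrow> (\<forall>x\<in>W. \<forall>k. star U f h k x = (\<Sum>l\<le>k. f l x * h (k - l) x)))"

end

theory Submission
  imports Defs
begin

text \<open>
  Taylor expansion at a point turns all objects in a chart into formal power series in the base
  displacement, the fibre variables and \<open>\<hbar>\<close>, and the operators of the Fedosov construction into
  operators on this ring. Contracting \<open>\<nabla>\<^sup>1\<^sup>,\<^sup>0\<close> with the fibre variables gives an Euler equation for
  \<open>I\<^sub>\<alpha>\<close>, which together with the Bianchi identities shows that the components of the Fedosov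
  connection commute. Equations of the form \<open>euler a = \<Phi> a\<close>, where \<open>\<Phi>\<close> raises the weight, have a
  unique solution. This yields flat sections with prescribed symbol by iteration, and their
  compatibility with changes of charts by uniqueness.

  Let \<open>a = O\<^sub>f\<close> and \<open>b = O\<^sub>h\<close>. The operators \<open>\<nabla>\<^sup>1\<^sup>,\<^sup>0 - \<delta>\<^sup>1\<^sup>,\<^sup>0\<close> preserve the part of \<open>a\<close>
  without \<open>\<bar>y\<^sup>j\<close>. As \<open>I\<^sub>\<alpha>\<close> has no part of degree zero in the \<open>y\<^sup>i\<close>, the antiholomorphic
  components of the connection preserve the part of \<open>b\<close> without \<open>y\<^sup>i\<close>. By uniqueness the former part
  is \<open>f\<close> if \<open>f\<close> is antiholomorphic and the latter is \<open>h\<close> if \<open>h\<close> is holomorphic. In either case all terms of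
  positive order of the Wick product vanish on the zero section.
\<close>

section \<open>Formal power series in finitely many variables\<close>

text \<open>\<open>quantization\<close> is a choice operator, so the product can be computed only
  after flat sections with prescribed symbol have been shown to exist over a whole open set; most of
  the development serves this. Contraction with the fibre variables turns the flatness system into a
  single equation. The information lost is recovered by Cartan's formula for the Euler field: a
  one-form with zero contraction that is closed up to terms of higher weight must vanish
  (\<open>koszul_kernel\<close>). Two gradings occur. Fedosov's weight \<open>fw\<close> counts hbar
  twice; \<open>I\<close> starts in weight 3, so that a bracket with it does not lower the weight
  although hbar has been divided out. The weight \<open>wy\<close> counts only the holomorphic fibre
  variables; the series defining I_alpha converges in it, because each step multiplies by some y^i
  and the Kaehler connection never turns a y^i into a bar y^j. Working with the jet at one point
  replaces all convergence by these filtrations, and the value of a section at that point is again a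
  coefficient of its jet.\<close>

typedef 'v mps = "UNIV :: (('v \<Rightarrow> nat) \<Rightarrow> complex) set"
  morphisms mcoeff Abs_mps by simp

setup_lifting type_definition_mps

lemma mps_eqI: "(\<And>e. mcoeff a e = mcoeff b e) \<Longrightarrow> a = b"
  by (metis mcoeff_inject ext)

lemma finite_exponents_le [simp]: "finite {..e :: 'v::finite \<Rightarrow> nat}"
proof -
  have "{..e} = Pi UNIV (\<lambda>v. {..e v})" by (auto simp: le_fun_def Pi_iff)
  then show ?thesis by (simp add: finite_PiE flip: PiE_UNIV_domain)
qed

instantiation mps :: (finite) comm_ring_1
begin

lift_definition zero_mps :: "'a mps" is "\<lambda>_. 0" .
lift_definition one_mps :: "'a mps" is "\<lambda>e. if e = (\<lambda>_. 0) then 1 else 0" .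
lift_definition plus_mps :: "'a mps \<Rightarrow> 'a mps \<Rightarrow> 'a mps" is "\<lambda>a b e. a e + b e" .
lift_definition minus_mps :: "'a mps \<Rightarrow> 'a mps \<Rightarrow> 'a mps" is "\<lambda>a b e. a e - b e" .
lift_definition uminus_mps :: "'a mps \<Rightarrow> 'a mps" is "\<lambda>a e. - a e" .
lift_definition times_mps :: "'a mps \<Rightarrow> 'a mps \<Rightarrow> 'a mps"
  is "\<lambda>a b e. \<Sum>p\<le>e. a p * b (e - p)" .

instance
proof
  fix a b c :: "'a mps"
  show "a * b * c = a * (b * c)"
  proof (transfer, rule ext)
    fix a b c :: "('a \<Rightarrow> nat) \<Rightarrow> complex" and e
    have "(\<Sum>p\<le>e. (\<Sum>q\<le>p. a q * b (p - q)) * c (e - p)) =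
        (\<Sum>(p, q)\<in>Sigma {..e} (\<lambda>p. {..p}). a q * b (p - q) * c (e - p))"
      by (simp add: sum_distrib_right sum.Sigma)
    \<comment> \<open>Three exponents with sum \<open>e\<close> are described on one side by the
      first one and the sum \<open>p\<close> of the first two, on the other side by the first two;
      hence \<open>r = p - q\<close>.\<close>
    also have "\<dots> = (\<Sum>(q, r)\<in>Sigma {..e} (\<lambda>q. {..e - q}). a q * b r * c (e - q - r))"
    proof (rule sum.reindex_bij_witness
        [where i = "\<lambda>(q, r). ((\<lambda>v. q v + r v), q)" and j = "\<lambda>(p, q). (q, p - q)"], goal_cases)
      case (1 x)
      then show ?case by (auto simp: le_fun_def)
    next
      case (2 x)
      then show ?case by (auto simp: le_fun_def diff_le_mono intro: order_trans)
    next
      case (3 x)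
      then show ?case by auto
    next
      case (4 x)
      obtain q r where x: "x = (q, r)" "\<And>v. q v \<le> e v" "\<And>v. r v \<le> e v - q v"
        using 4 by (cases x) (auto simp: le_fun_def)
      have "q v + r v \<le> e v" for v using x(2,3)[of v] by linarith
      then show ?case by (simp add: x(1) le_fun_def)
    next
      case (5 x)
      obtain p q where x: "x = (p, q)" "\<And>v. q v \<le> p v" "\<And>v. p v \<le> e v"
        using 5 by (cases x) (auto simp: le_fun_def)
      have "e - q - (p - q) = e - p" using x(2) by (auto simp: fun_eq_iff)
      then show ?case by (simp add: x(1))
    qed
    also have "\<dots> = (\<Sum>p\<le>e. a p * (\<Sum>pa\<le>e - p. b pa * c (e - p - pa)))"
      by (simp add: sum_distrib_left sum.Sigma mult.assoc)
    finally show "(\<Sum>p\<le>e. (\<Sum>pa\<le>p. a pa * b (p - pa)) * c (e - p)) =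
        (\<Sum>p\<le>e. a p * (\<Sum>pa\<le>e - p. b pa * c (e - p - pa)))" .
  qed
  show "a * b = b * a"
  proof (transfer, rule ext)
    fix a b :: "('a \<Rightarrow> nat) \<Rightarrow> complex" and e
    show "(\<Sum>p\<le>e. a p * b (e - p)) = (\<Sum>p\<le>e. b p * a (e - p))"
      by (rule sum.reindex_bij_witness[where i = "\<lambda>p. e - p" and j = "\<lambda>p. e - p"])
        (auto simp: le_fun_def fun_eq_iff intro!: arg_cong[where f = a] simp: mult.commute)
  qed
  show "1 * a = a"
  proof (transfer, rule ext)
    fix a :: "('a \<Rightarrow> nat) \<Rightarrow> complex" and e
    have "(\<Sum>p\<le>e. (if p = (\<lambda>_. 0) then 1 else 0) * a (e - p)) =
        (\<Sum>p\<le>e. if p = (\<lambda>_. 0) then a e else 0)"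
      by (intro sum.cong) (auto intro!: arg_cong[where f = a])
    also have "\<dots> = a e"
      by (subst sum.delta) (auto simp: le_fun_def)
    finally show "(\<Sum>p\<le>e. (if p = (\<lambda>_. 0) then 1 else 0) * a (e - p)) = a e" .
  qed
  show "(a + b) * c = a * c + b * c"
    by transfer (simp add: fun_eq_iff distrib_right sum.distrib)
  show "(0::'a mps) \<noteq> 1"
    by transfer (auto simp: fun_eq_iff)
qed (transfer; simp add: fun_eq_iff)+

end

lemma mcoeff_0 [simp]: "mcoeff 0 e = 0" by transfer simp
lemma mcoeff_add [simp]: "mcoeff (a + b) e = mcoeff a e + mcoeff b e" by transfer simp
lemma mcoeff_diff [simp]: "mcoeff (a - b) e = mcoeff a e - mcoeff b e" by transfer simp
lemma mcoeff_uminus [simp]: "mcoeff (- a) e = - mcoeff a e" by transfer simp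
lemma mcoeff_1: "mcoeff 1 e = (if e = (\<lambda>_. 0) then 1 else 0)" by transfer simp
lemma mcoeff_mult: "mcoeff (a * b) e = (\<Sum>p\<le>e. mcoeff a p * mcoeff b (e - p))" by transfer simp
lemma mcoeff_sum [simp]: "mcoeff (sum f S) e = (\<Sum>x\<in>S. mcoeff (f x) e)"
  by (induction S rule: infinite_finite_induct) auto

section \<open>Constants, variables and partial derivatives\<close>

lift_definition K :: "complex \<Rightarrow> 'v::finite mps" is "\<lambda>c e. if e = (\<lambda>_. 0) then c else 0" .

lift_definition X :: "'v::finite \<Rightarrow> 'v mps" is "\<lambda>v e. if e = (\<lambda>_. 0)(v := 1) then 1 else 0" .

lift_definition pd :: "'v::finite \<Rightarrow> 'v mps \<Rightarrow> 'v mps"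
  is "\<lambda>v a e. of_nat (e v + 1) * a (e(v := e v + 1))" .

lemma mcoeff_pd: "mcoeff (pd v a) e = of_nat (e v + 1) * mcoeff a (e(v := e v + 1))"
  by transfer simp

lemma mcoeff_K: "mcoeff (K c) e = (if e = (\<lambda>_. 0) then c else 0)" by transfer simp

lemma mcoeff_X: "mcoeff (X v) e = (if e = (\<lambda>_. 0)(v := 1) then 1 else 0)" by transfer simp

lemma mcoeff_K_mult [simp]: "mcoeff (K c * a) e = c * mcoeff a e"
proof -
  have "mcoeff (K c * a) e = (\<Sum>p\<le>e. if p = (\<lambda>_. 0) then c * mcoeff a e else 0)"
    unfolding mcoeff_mult mcoeff_K
    by (intro sum.cong) (auto intro!: arg_cong[where f = "mcoeff a"])
  also have "\<dots> = c * mcoeff a e"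
    by (subst sum.delta) (auto simp: le_fun_def)
  finally show ?thesis .
qed

lemma mcoeff_X_mult:
  "mcoeff (X v * a) e = (if e v = 0 then 0 else mcoeff a (e(v := e v - 1)))"
proof -
  have "mcoeff (X v * a) e =
      (\<Sum>p\<le>e. if p = (\<lambda>_. 0)(v := 1) then mcoeff a (e(v := e v - 1)) else 0)"
    unfolding mcoeff_mult mcoeff_X
    by (intro sum.cong) (auto intro!: arg_cong[where f = "mcoeff a"])
  also have "\<dots> = (if e v = 0 then 0 else mcoeff a (e(v := e v - 1)))"
    by (subst sum.delta) (auto simp: le_fun_def split: if_splits dest: spec[of _ v])
  finally show ?thesis .
qed

lemma K_0 [simp]: "K 0 = 0" and K_1 [simp]: "K 1 = 1"
  and K_add: "K (c + d) = K c + K d" and K_mult: "K (c * d) = K c * K d"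
  and K_minus: "K (- c) = - K c"
  by (auto intro!: mps_eqI simp: mcoeff_K mcoeff_1)

lemma K_of_nat: "K (of_nat n) = of_nat n"
  by (induction n) (auto simp: K_add)

lemma upd_Suc_neq_zero [simp]: "e(v := Suc n) \<noteq> (\<lambda>_. 0)"
  by (auto dest: fun_cong[where x = v])

lemma pd_add [simp]: "pd v (a + b) = pd v a + pd v b"
  and pd_diff [simp]: "pd v (a - b) = pd v a - pd v b"
  and pd_uminus [simp]: "pd v (- a) = - pd v a"
  and pd_0 [simp]: "pd v 0 = 0"
  and pd_K [simp]: "pd v (K c) = 0"
  by (auto intro!: mps_eqI simp: mcoeff_pd algebra_simps mcoeff_K)

lemma pd_K_mult: "pd v (K c * a) = K c * pd v a"
  by (rule mps_eqI) (simp add: mcoeff_pd)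

lemma pd_sum [simp]: "pd v (sum f S) = (\<Sum>x\<in>S. pd v (f x))"
  by (induction S rule: infinite_finite_induct) auto

lemma pd_1 [simp]: "pd v 1 = 0"
  using pd_K[of v 1] by simp

lemma pd_X: "pd v (X w) = (if v = w then 1 else 0)"
proof (rule mps_eqI)
  fix e
  have "e(v := Suc (e v)) = (\<lambda>_. 0)(w := Suc 0) \<longleftrightarrow> v = w \<and> e = (\<lambda>_. 0)"
    by (auto simp: fun_eq_iff split: if_splits; metis nat.distinct(1) nat.inject)
  then show "mcoeff (pd v (X w)) e = mcoeff (if v = w then 1 else 0) e"
    by (auto simp: mcoeff_pd mcoeff_X mcoeff_1)
qed

lemma pd_X_mult: "pd v (X w * a) = (if v = w then a else 0) + X w * pd v a"
proof (rule mps_eqI)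
  fix e
  show "mcoeff (pd v (X w * a)) e = mcoeff ((if v = w then a else 0) + X w * pd v a) e"
  proof (cases "v = w")
    case True
    have "e w \<noteq> 0 \<Longrightarrow> e(w := Suc (e w - Suc 0)) = e" "e w = 0 \<Longrightarrow> e(w := 0) = e" by auto
    then show ?thesis using True
      by (cases "e w") (auto simp: mcoeff_pd mcoeff_X_mult distrib_right)
  qed (auto simp: fun_upd_twist mcoeff_pd mcoeff_X_mult distrib_right)
qed

lemma pd_commute: "pd v (pd w a) = pd w (pd v a)"
  by (cases "v = w") (auto intro!: mps_eqI simp: mcoeff_pd fun_upd_twist)

section \<open>Weights and the filtrations they define\<close>

definition wdeg :: "('v::finite \<Rightarrow> nat) \<Rightarrow> ('v \<Rightarrow> nat) \<Rightarrow> nat" where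
  "wdeg w e = (\<Sum>v\<in>UNIV. w v * e v)"

definition tot :: "'v \<Rightarrow> nat" where "tot v = 1"

lemma wdeg_tot: "wdeg tot e = sum e UNIV"
  by (simp add: wdeg_def tot_def)

text \<open>The filtration by the ideals of series of weight at least \<open>n\<close>. Variables
  may have weight 0, but every single exponent has finite weight, so a series lying in all of these
  ideals is zero. This replaces limit arguments throughout.\<close>

definition vanishes :: "('v::finite \<Rightarrow> nat) \<Rightarrow> nat \<Rightarrow> 'v mps \<Rightarrow> bool" where
  "vanishes w n a \<longleftrightarrow> (\<forall>e. wdeg w e < n \<longrightarrow> mcoeff a e = 0)"

lemma wdeg_split: "p \<le> e \<Longrightarrow> wdeg w e = wdeg w p + wdeg w (e - p)"
  unfolding wdeg_def sum.distrib[symmetric]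
  by (intro sum.cong) (auto simp: le_fun_def algebra_simps simp flip: distrib_left)

lemma wdeg_zero [simp]: "wdeg w (\<lambda>_. 0) = 0" by (simp add: wdeg_def)

text \<open>The additive form also serves for lowering an exponent, where subtraction of naturals
  would be truncated.\<close>

lemma wdeg_upd: "wdeg w (e(v := k)) + w v * e v = wdeg w e + w v * k"
proof -
  have "wdeg w (e(v := k)) = w v * k + (\<Sum>u\<in>UNIV - {v}. w u * e u)"
    unfolding wdeg_def by (subst sum.remove[of _ v]) (auto intro!: sum.cong)
  moreover have "wdeg w e = w v * e v + (\<Sum>u\<in>UNIV - {v}. w u * e u)"
    unfolding wdeg_def by (subst sum.remove[of _ v]) auto
  ultimately show ?thesis by simp
qed

lemma wdeg_tot_upd: "wdeg tot (e(v := k)) + e v = wdeg tot e + k"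
  using wdeg_upd[of tot e v k] by (simp only: tot_def mult_1)

lemma vanishes_0 [simp]: "vanishes w n 0" by (simp add: vanishes_def)
lemma vanishes_zero [simp]: "vanishes w 0 a" by (simp add: vanishes_def)
lemma vanishes_mono: "vanishes w n a \<Longrightarrow> m \<le> n \<Longrightarrow> vanishes w m a" by (simp add: vanishes_def)
lemma vanishes_add: "vanishes w n a \<Longrightarrow> vanishes w n b \<Longrightarrow> vanishes w n (a + b)"
  by (simp add: vanishes_def)
lemma vanishes_diff: "vanishes w n a \<Longrightarrow> vanishes w n b \<Longrightarrow> vanishes w n (a - b)"
  by (simp add: vanishes_def)
lemma vanishes_sum: "(\<And>x. x \<in> S \<Longrightarrow> vanishes w n (f x)) \<Longrightarrow> vanishes w n (sum f S)"
  by (simp add: vanishes_def)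

lemma vanishes_mult:
  assumes "vanishes w m a" "vanishes w n b"
  shows "vanishes w (m + n) (a * b)"
  unfolding vanishes_def
proof (intro allI impI)
  fix e assume e: "wdeg w e < m + n"
  have "mcoeff a p * mcoeff b (e - p) = 0" if "p \<le> e" for p
  proof -
    have "wdeg w p < m \<or> wdeg w (e - p) < n" using wdeg_split[OF that, of w] e by linarith
    then show ?thesis using assms by (auto simp: vanishes_def)
  qed
  then show "mcoeff (a * b) e = 0" unfolding mcoeff_mult by (intro sum.neutral) auto
qed

lemma vanishes_mult_left: "vanishes w n b \<Longrightarrow> vanishes w n (a * b)"
  using vanishes_mult[of w 0 a n b] by simp

lemma vanishes_X: "vanishes w (w v) (X v)"
  unfolding vanishes_def mcoeff_X using wdeg_upd[of w "\<lambda>_. 0" v 1] by auto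

lemma vanishes_X_mult: "n \<le> w v + m \<Longrightarrow> vanishes w m a \<Longrightarrow> vanishes w n (X v * a)"
  using vanishes_mult[OF vanishes_X] vanishes_mono by metis

lemma vanishes_pd: "vanishes w m a \<Longrightarrow> n + w v \<le> m \<Longrightarrow> vanishes w n (pd v a)"
  unfolding vanishes_def mcoeff_pd
proof (intro allI impI)
  fix e assume a: "\<forall>e. wdeg w e < m \<longrightarrow> mcoeff a e = 0" "n + w v \<le> m" "wdeg w e < n"
  have "wdeg w (e(v := e v + 1)) < m" using wdeg_upd[of w e v "e v + 1"] a by simp
  then show "of_nat (e v + 1) * mcoeff a (e(v := e v + 1)) = 0" using a by simp
qed

lemma vanishes_imp_0: "(\<And>n. vanishes w n a) \<Longrightarrow> a = 0"
  by (rule mps_eqI) (force simp: vanishes_def)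

lemma vanishes_tot_1: "mcoeff a (\<lambda>_. 0) = 0 \<Longrightarrow> vanishes tot 1 a"
  unfolding vanishes_def
proof (intro allI impI)
  fix e :: "'a \<Rightarrow> nat" assume *: "mcoeff a (\<lambda>_. 0) = 0" "wdeg tot e < 1"
  then have "e = (\<lambda>_. 0)" by (auto simp: wdeg_tot)
  with * show "mcoeff a e = 0" by simp
qed

lemma mcoeff_X_zero [simp]: "mcoeff (X v) (\<lambda>_. 0) = 0"
  by (auto simp: mcoeff_X fun_eq_iff)

text \<open>Each series is the sum of its constant term and of multiples of the variables;
  the weights \<open>e v / |e|\<close> make this choice symmetric.\<close>

lemma mps_decompose:
  fixes a :: "'v::finite mps"
  obtains t where "a = K (mcoeff a (\<lambda>_. 0)) + (\<Sum>v\<in>UNIV. X v * t v)"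
proof -
  define t :: "'v \<Rightarrow> 'v mps" where "t v = Abs_mps (\<lambda>e. mcoeff a (e(v := e v + 1)) * of_nat (e v + 1)
      / of_nat (sum e UNIV + 1))" for v
  have t: "mcoeff (t v) e = mcoeff a (e(v := e v + 1)) * of_nat (e v + 1) / of_nat (sum e UNIV + 1)" for v e
    by (simp add: t_def Abs_mps_inverse)
  have "a = K (mcoeff a (\<lambda>_. 0)) + (\<Sum>v\<in>UNIV. X v * t v)"
  proof (rule mps_eqI)
    fix e
    have *: "mcoeff (X v * t v) e = mcoeff a e * of_nat (e v) / of_nat (sum e UNIV)" for v
    proof (cases "e v = 0")
      case False
      have "sum (e(v := e v - 1)) UNIV + 1 = sum e UNIV"
      proof -
        have "sum (e(v := e v - 1)) UNIV = (e v - 1) + sum e (UNIV - {v})"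
          by (subst sum.remove[of _ v]) (auto intro!: sum.cong)
        moreover have "sum e UNIV = e v + sum e (UNIV - {v})"
          by (subst sum.remove[of _ v]) auto
        ultimately show ?thesis using False by simp
      qed
      then show ?thesis using False by (simp add: mcoeff_X_mult t flip: of_nat_Suc)
    qed (simp add: mcoeff_X_mult)
    show "mcoeff a e = mcoeff (K (mcoeff a (\<lambda>_. 0)) + (\<Sum>v\<in>UNIV. X v * t v)) e"
    proof (cases "e = (\<lambda>_. 0)")
      case True
      then show ?thesis by (simp add: mcoeff_X_mult mcoeff_K)
    next
      case False
      then have "sum e UNIV \<noteq> 0" by auto
      then have "(of_nat (sum e UNIV) :: complex) \<noteq> 0" by (metis of_nat_eq_0_iff)
      then show ?thesis using False
        by (simp add: * mcoeff_K flip: sum_divide_distrib sum_distrib_left)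
    qed
  qed
  then show ?thesis using that by blast
qed

text \<open>An induction principle for infinite series. Splitting off the constant term and one
  variable from each remaining monomial expresses \<open>D a\<close> through terms
  \<open>L w * D (t w)\<close>, so the order to which all values of \<open>D\<close> vanish rises by
  one in every round. Applied to the difference of two operators, it reduces an identity to
  constants and generators.\<close>

lemma series_ext:
  fixes D :: "'v::finite mps \<Rightarrow> 'w::finite mps"
  assumes add: "\<And>a b. D (a + b) = D a + D b"
    and const: "\<And>c. D (K c) = 0"
    and var: "\<And>w a. D (X w * a) = L w * D a"
    and L: "\<And>w. mcoeff (L w) (\<lambda>_. 0) = 0"
  shows "D a = 0"
proof -
  have D_sum: "D (sum f S) = (\<Sum>x\<in>S. D (f x))" if "finite S" for f and S :: "'v set"
    using that by (induction S) (use add const[of 0] in auto)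
  have L1: "vanishes tot 1 (L w)" for w
    using L by (rule vanishes_tot_1)
  have "vanishes tot n (D a)" for n
  proof (induction n arbitrary: a)
    case (Suc n)
    obtain t where a: "a = K (mcoeff a (\<lambda>_. 0)) + (\<Sum>v\<in>UNIV. X v * t v)"
      using mps_decompose by blast
    have "D a = (\<Sum>v\<in>UNIV. L v * D (t v))"
      by (subst a) (simp add: add const D_sum var)
    moreover have "vanishes tot (Suc n) (L v * D (t v))" for v
      using vanishes_mult[OF L1 Suc[of "t v"], of v] by simp
    ultimately show ?case by (simp add: vanishes_sum)
  qed simp
  then show ?thesis by (rule vanishes_imp_0)
qed

lemma pd_mult: "pd v (a * b) = pd v a * b + a * pd v b"
proof -
  define D where "D a = pd v (a * b) - (pd v a * b + a * pd v b)" for a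
  have "D a = 0"
  proof (rule series_ext[where D = D and a = a and L = X])
    show "D (X w * a) = X w * D a" for w a
      unfolding D_def mult.assoc pd_X_mult by (simp add: algebra_simps)
  qed (simp_all only: D_def pd_K_mult distrib_right distrib_left pd_add mcoeff_X_zero pd_K, simp_all)
  then show ?thesis by (simp add: D_def)
qed

section \<open>Derivations and the Euler field\<close>

definition derivation :: "('v::finite mps \<Rightarrow> 'v mps) \<Rightarrow> bool" where
  "derivation D \<longleftrightarrow> (\<forall>a b. D (a + b) = D a + D b \<and> D (a * b) = D a * b + a * D b) \<and> (\<forall>c. D (K c) = 0)"

lemma derivation_add: "derivation D \<Longrightarrow> D (a + b) = D a + D b"
  and derivation_mult: "derivation D \<Longrightarrow> D (a * b) = D a * b + a * D b"
  and derivation_K: "derivation D \<Longrightarrow> D (K c) = 0"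
  by (auto simp: derivation_def)

lemma derivation_ext:
  assumes P: "derivation P" "derivation Q" and X: "\<And>v. P (X v) = Q (X v)"
  shows "P a = Q a"
proof -
  define D where "D a = P a - Q a" for a
  have "D a = 0"
    by (rule series_ext[where D = D and a = a and L = X])
      (auto simp: D_def derivation_add[OF P(1)] derivation_add[OF P(2)] derivation_mult[OF P(1)]
         derivation_mult[OF P(2)] derivation_K[OF P(1)] derivation_K[OF P(2)] X algebra_simps
         mcoeff_X fun_eq_iff)
  then show ?thesis by (simp add: D_def)
qed

definition euler :: "'v::finite set \<Rightarrow> 'v mps \<Rightarrow> 'v mps" where
  "euler S a = (\<Sum>v\<in>S. X v * pd v a)"

lemma mcoeff_euler: "mcoeff (euler S a) e = of_nat (sum e S) * mcoeff a e"
proof -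
  have "mcoeff (X v * pd v a) e = of_nat (e v) * mcoeff a e" for v
  proof (cases "e v")
    case (Suc k)
    have "e(v := Suc k) = e" using Suc by auto
    then show ?thesis using Suc by (simp add: mcoeff_X_mult mcoeff_pd)
  qed (simp add: mcoeff_X_mult)
  then show ?thesis by (simp add: euler_def sum_distrib_right)
qed

text \<open>On series without terms of \<open>S\<close>-degree zero, the Euler field is injective and respects every
  weight filtration. Hence a fixed point equation \<open>euler S E = \<Phi> E\<close> with a right-hand side that
  raises the weight has at most one solution.\<close>

lemma euler_unique:
  assumes step: "\<And>n. vanishes w n E \<Longrightarrow> vanishes w (Suc n) (euler S E)"
    and pos: "\<And>e. sum e S = 0 \<Longrightarrow> mcoeff E e = 0"
  shows "E = 0"
proof (rule vanishes_imp_0)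
  show "vanishes w n E" for n
  proof (induction n)
    case (Suc n)
    show ?case
      unfolding vanishes_def
    proof (intro allI impI)
      fix e assume "wdeg w e < Suc n"
      then have "of_nat (sum e S) * mcoeff E e = 0"
        using step[OF Suc] by (simp add: vanishes_def mcoeff_euler)
      then show "mcoeff E e = 0" using pos[of e] by (metis mult_eq_0_iff of_nat_eq_0_iff)
    qed
  qed simp
qed

text \<open>The basic step of Fedosov's method: a one-form that is annihilated by the contraction with
  the Euler field and closed for \<open>P - \<delta>\<close> vanishes.\<close>

lemma koszul_kernel:
  assumes fin: "finite S" and w: "\<And>B. B \<in> S \<Longrightarrow> w B \<ge> 1"
    and contr: "(\<Sum>B\<in>S. X B * A B) = 0"
    and closed: "\<And>B C. B \<in> S \<Longrightarrow> C \<in> S \<Longrightarrow> P B (A C) - pd B (A C) = P C (A B) - pd C (A B)"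
    and P: "\<And>B n a. B \<in> S \<Longrightarrow> vanishes w n a \<Longrightarrow> vanishes w n (P B a)"
    and C: "C \<in> S"
  shows "A C = 0"
proof (rule vanishes_imp_0)
  \<comment> \<open>Cartan's formula: the left side is the Lie derivative of the one-form
    \<open>A\<close> along the Euler field, hence the differential of its contraction, which is
    zero, plus the contraction of its differential, which \<open>closed\<close> expresses by
    \<open>P\<close>.\<close>
  have eq: "A C + euler S (A C) = (\<Sum>B\<in>S. X B * (P B (A C) - P C (A B)))" if C: "C \<in> S" for C
  proof -
    have "0 = pd C (\<Sum>B\<in>S. X B * A B)" by (simp add: contr)
    also have "\<dots> = (\<Sum>B\<in>S. (if B = C then A B else 0) + X B * pd C (A B))"
      by (simp add: pd_X_mult eq_commute)
    also have "\<dots> = A C + (\<Sum>B\<in>S. X B * pd C (A B))"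
      using fin C by (simp add: sum.distrib)
    also have "(\<Sum>B\<in>S. X B * pd C (A B)) = (\<Sum>B\<in>S. X B * pd B (A C) - X B * (P B (A C) - P C (A B)))"
    proof (intro sum.cong refl)
      fix B assume "B \<in> S"
      then have "pd C (A B) = pd B (A C) - (P B (A C) - P C (A B))"
        using closed[of B C] C by (simp add: algebra_simps)
      then show "X B * pd C (A B) = X B * pd B (A C) - X B * (P B (A C) - P C (A B))"
        by (simp add: right_diff_distrib)
    qed
    finally show ?thesis by (simp add: euler_def sum_subtractf add_diff_eq eq_diff_eq)
  qed
  have "\<forall>C\<in>S. vanishes w n (A C)" for n
  proof (induction n)
    case (Suc n)
    show ?case
    proof
      fix C assume C: "C \<in> S"
      have "vanishes w (Suc n) (X B * (P B (A C) - P C (A B)))" if "B \<in> S" for B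
        using Suc C that w[OF that] P by (intro vanishes_X_mult[where m = n] vanishes_diff) auto
      then have *: "vanishes w (Suc n) (A C + euler S (A C))"
        by (simp only: eq[OF C] vanishes_sum)
      show "vanishes w (Suc n) (A C)"
        unfolding vanishes_def
      proof (intro allI impI)
        fix e assume "wdeg w e < Suc n"
        \<comment> \<open>The operator on the left multiplies by the degree plus one, which is
          non-zero in every degree, including degree zero.\<close>
        then have "of_nat (Suc (sum e S)) * mcoeff (A C) e = 0"
          using * by (simp only: vanishes_def mcoeff_add mcoeff_euler)
            (simp add: algebra_simps)
        then show "mcoeff (A C) e = 0"
          by (metis mult_eq_0_iff of_nat_eq_0_iff nat.distinct(1))
      qed
    qed
  qed simp
  then show "vanishes w n (A C)" for n using C by blast
qed


subsection \<open>Substitution\<close>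

lemma finite_degree_le [simp]: "finite {e :: 'v::finite \<Rightarrow> nat. wdeg tot e \<le> n}"
proof (rule finite_subset)
  have le: "e v \<le> wdeg tot e" for e :: "'v \<Rightarrow> nat" and v
    unfolding wdeg_tot by (rule member_le_sum) auto
  have "e v \<le> n" if "wdeg tot e \<le> n" for e :: "'v \<Rightarrow> nat" and v
    using le[of e v] that by linarith
  then show "{e :: 'v \<Rightarrow> nat. wdeg tot e \<le> n} \<subseteq> {..\<lambda>_. n}"
    by (simp add: le_fun_def subset_eq)
qed simp

definition mpow :: "('v::finite \<Rightarrow> 'w::finite mps) \<Rightarrow> ('v \<Rightarrow> nat) \<Rightarrow> 'w mps" where
  "mpow L e = (\<Prod>v\<in>UNIV. L v ^ e v)"

text \<open>The value up to degree \<open>n\<close> of a substitution by series without constant terms, to which only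
  monomials of degree at most \<open>n\<close> contribute. With constant terms the result is meaningless.\<close>

definition psub :: "('v::finite \<Rightarrow> 'w::finite mps) \<Rightarrow> nat \<Rightarrow> 'v mps \<Rightarrow> 'w mps" where
  "psub L n a = (\<Sum>e | wdeg tot e \<le> n. K (mcoeff a e) * mpow L e)"

text \<open>If \<open>L\<close> has no constant terms, a coefficient of degree n receives
  contributions only from monomials of degree at most n. Each coefficient is therefore taken from
  the truncation at its own degree; by \<open>mcoeff_psub\<close> any later truncation gives the
  same value.\<close>

lift_definition subst :: "('v::finite \<Rightarrow> 'w::finite mps) \<Rightarrow> 'v mps \<Rightarrow> 'w mps"
  is "\<lambda>L a e. mcoeff (psub L (wdeg tot e) (Abs_mps a)) e" .

lemma mcoeff_subst: "mcoeff (subst L a) e = mcoeff (psub L (wdeg tot e) a) e"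
  unfolding subst.rep_eq mcoeff_inverse ..

lemma mpow_upd: "mpow L (e(v := Suc (e v))) = L v * mpow L e"
  unfolding mpow_def
  by (subst (1 2) prod.remove[of _ v]) (auto intro!: prod.cong simp: mult.assoc)

lemma subst_add: "subst L (a + b) = subst L a + subst L b"
  by (rule mps_eqI) (simp add: mcoeff_subst psub_def K_add distrib_right sum.distrib)

lemma subst_diff: "subst L (a - b) = subst L a - subst L b"
  using subst_add[of L "a - b" b] by (simp add: algebra_simps)

lemma subst_0 [simp]: "subst L 0 = 0"
  using subst_diff[of L 0 0] by simp

lemma subst_sum: "subst L (sum f S) = (\<Sum>x\<in>S. subst L (f x))"
  by (induction S rule: infinite_finite_induct) (auto simp: subst_add)

lemma subst_K_mult: "subst L (K c * a) = K c * subst L a"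
  by (rule mps_eqI) (simp add: mcoeff_subst psub_def K_mult mult.assoc sum_distrib_left)

lemma subst_K [simp]: "subst L (K c) = K c"
proof (rule mps_eqI)
  fix e
  have "K (mcoeff (K c) e') * mpow L e' = (if e' = (\<lambda>_. 0) then K c else 0)" for e'
    by (auto simp: mcoeff_K mpow_def)
  then show "mcoeff (subst L (K c)) e = mcoeff (K c) e"
    by (simp add: mcoeff_subst psub_def del: mcoeff_sum)
qed

lemma subst_1 [simp]: "subst L 1 = 1"
  using subst_K[of L 1] by simp

locale substitution =
  fixes L :: "'v::finite \<Rightarrow> 'w::finite mps"
  assumes const_free: "mcoeff (L v) (\<lambda>_. 0) = 0"
begin

lemma vanishes_L: "vanishes tot 1 (L v)"
  using const_free by (rule vanishes_tot_1)

lemma vanishes_mpow: "vanishes tot (wdeg tot e) (mpow L e)"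
proof -
  have pow: "vanishes tot k (L v ^ k)" for k v
  proof (induction k)
    case (Suc k)
    then show ?case using vanishes_mult[OF vanishes_L Suc, of v] by simp
  qed simp
  have "vanishes tot (sum e F) (\<Prod>v\<in>F. L v ^ e v)" if "finite F" for F
    using that by (induction F) (simp_all add: vanishes_mult pow)
  then show ?thesis by (simp add: mpow_def wdeg_tot)
qed

lemma mcoeff_psub:
  assumes "wdeg tot e \<le> n"
  shows "mcoeff (psub L n a) e = mcoeff (subst L a) e"
  unfolding mcoeff_subst psub_def mcoeff_sum
  by (rule sum.mono_neutral_right)
    (use assms vanishes_mpow in \<open>auto simp: vanishes_def\<close>)

lemma psub_X_mult: "psub L (Suc n) (X v * a) = L v * psub L n a"
proof -
  have "psub L (Suc n) (X v * a) =
      (\<Sum>e | wdeg tot e \<le> Suc n \<and> e v \<noteq> 0. K (mcoeff a (e(v := e v - 1))) * mpow L e)"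
    unfolding psub_def
    by (rule sum.mono_neutral_cong_right) (auto simp: mcoeff_X_mult)
  also have "\<dots> = (\<Sum>e | wdeg tot e \<le> n. K (mcoeff a e) * mpow L (e(v := Suc (e v))))"
  proof (rule sum.reindex_bij_witness
      [where i = "\<lambda>e. e(v := Suc (e v))" and j = "\<lambda>e. e(v := e v - 1)"])
    fix e :: "'v \<Rightarrow> nat" assume e: "e \<in> {e. wdeg tot e \<le> Suc n \<and> e v \<noteq> 0}"
    then show "e(v := e v - 1) \<in> {e. wdeg tot e \<le> n}"
      using wdeg_tot_upd[of e v "e v - 1"] by auto
  next
    fix e :: "'v \<Rightarrow> nat" assume e: "e \<in> {e. wdeg tot e \<le> n}"
    then show "e(v := Suc (e v)) \<in> {e. wdeg tot e \<le> Suc n \<and> e v \<noteq> 0}"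
      using wdeg_tot_upd[of e v "Suc (e v)"] by auto
  qed auto
  also have "\<dots> = L v * psub L n a"
    by (simp add: psub_def mpow_upd sum_distrib_left mult.left_commute)
  finally show ?thesis .
qed

lemma subst_X_mult: "subst L (X v * a) = L v * subst L a"
proof (rule mps_eqI)
  fix e :: "'w \<Rightarrow> nat"
  let ?n = "wdeg tot e"
  have "mcoeff (subst L (X v * a)) e = mcoeff (L v * psub L ?n a) e"
    by (subst mcoeff_psub[where n = "Suc ?n", symmetric]) (auto simp: psub_X_mult)
  also have "\<dots> = mcoeff (L v * subst L a) e"
    unfolding mcoeff_mult
  proof (intro sum.cong refl)
    fix p assume "p \<in> {..e}"
    then have "wdeg tot (e - p) \<le> ?n" using wdeg_split[of p e tot] by simp
    then show "mcoeff (L v) p * mcoeff (psub L ?n a) (e - p) = mcoeff (L v) p * mcoeff (subst L a) (e - p)"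
      by (simp add: mcoeff_psub)
  qed
  finally show "mcoeff (subst L (X v * a)) e = mcoeff (L v * subst L a) e" .
qed

lemma subst_X: "subst L (X v) = L v"
  using subst_X_mult[of v 1] by simp

lemma subst_mult: "subst L (a * b) = subst L a * subst L b"
proof -
  define D where "D a = subst L (a * b) - subst L a * subst L b" for a
  have "D a = 0"
    by (rule series_ext[where D = D and a = a and L = L])
      (simp_all only: D_def subst_add subst_K_mult subst_K subst_X_mult const_free mult.assoc
        distrib_right distrib_left right_diff_distrib, simp_all add: algebra_simps)
  then show ?thesis by (simp add: D_def)
qed

lemma pd_subst: "pd x (subst L a) = (\<Sum>v\<in>UNIV. pd x (L v) * subst L (pd v a))"
proof -
  define D where "D a = pd x (subst L a) - (\<Sum>v\<in>UNIV. pd x (L v) * subst L (pd v a))" for a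
  have "D a = 0"
  proof (rule series_ext[where D = D and a = a and L = L])
    fix u a
    have "(\<Sum>v\<in>UNIV. pd x (L v) * subst L (pd v (X u * a))) =
        (\<Sum>v\<in>UNIV. (if v = u then pd x (L v) * subst L a else 0) + L u * (pd x (L v) * subst L (pd v a)))"
    proof (intro sum.cong refl)
      fix v
      show "pd x (L v) * subst L (pd v (X u * a)) =
          (if v = u then pd x (L v) * subst L a else 0) + L u * (pd x (L v) * subst L (pd v a))"
        unfolding pd_X_mult subst_add subst_X_mult by (simp add: algebra_simps)
    qed
    also have "\<dots> = pd x (L u) * subst L a + L u * (\<Sum>v\<in>UNIV. pd x (L v) * subst L (pd v a))"
      by (simp add: sum.distrib sum_distrib_left)
    finally show "D (X u * a) = L u * D a"
      unfolding D_def subst_X_mult pd_mult[of x "L u"] by (simp add: algebra_simps)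
  qed (auto simp: D_def subst_add const_free sum.distrib algebra_simps)
  then show ?thesis by (simp add: D_def)
qed

end

section \<open>The Wick product on formal power series\<close>

text \<open>The variables of a section of the Weyl bundle at a point are the displacement of the base
  point, the fibre variables and \<open>\<hbar>\<close>.\<close>

type_synonym 'b wvar = "('b + 'b) + unit"

abbreviation Zv :: "'b \<Rightarrow> 'b wvar" where "Zv B \<equiv> Inl (Inl B)"
abbreviation Yv :: "'b \<Rightarrow> 'b wvar" where "Yv B \<equiv> Inl (Inr B)"
abbreviation Hv :: "'b wvar" where "Hv \<equiv> Inr ()"
abbreviation dZ :: "'b::finite \<Rightarrow> 'b wvar mps \<Rightarrow> 'b wvar mps" where "dZ B \<equiv> pd (Zv B)"
abbreviation dY :: "'b::finite \<Rightarrow> 'b wvar mps \<Rightarrow> 'b wvar mps" where "dY B \<equiv> pd (Yv B)"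

lemma X_cancel: "X v * a = X v * b \<Longrightarrow> a = b"
proof (rule mps_eqI)
  fix e assume "X v * a = X v * b"
  then have "mcoeff (X v * a) (e(v := Suc (e v))) = mcoeff (X v * b) (e(v := Suc (e v)))" by simp
  then show "mcoeff a e = mcoeff b e" by (simp add: mcoeff_X_mult)
qed

subsection \<open>Series in the deformation parameter\<close>

text \<open>The sum of all hbar^k F_k. The terms may contain hbar themselves, so the coefficient of
  a given power of hbar collects contributions of several \<open>k\<close>, but only finitely
  many.\<close>

lift_definition hsum :: "(nat \<Rightarrow> 'b::finite wvar mps) \<Rightarrow> 'b wvar mps"
  is "\<lambda>F e. \<Sum>k\<le>e Hv. F k (e(Hv := e Hv - k))" .

lemma mcoeff_hsum: "mcoeff (hsum F) e = (\<Sum>k\<le>e Hv. mcoeff (F k) (e(Hv := e Hv - k)))"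
  by (simp add: hsum.rep_eq)

lemma hsum_add: "hsum (\<lambda>k. F k + G k) = hsum F + hsum G"
  by (rule mps_eqI) (simp add: mcoeff_hsum sum.distrib)

lemma hsum_diff: "hsum (\<lambda>k. F k - G k) = hsum F - hsum G"
  by (rule mps_eqI) (simp add: mcoeff_hsum sum_subtractf)

lemma hsum_0 [simp]: "hsum (\<lambda>k. 0) = 0"
  by (rule mps_eqI) (simp add: mcoeff_hsum)

lemma hsum_unfold: "hsum F = F 0 + X Hv * hsum (\<lambda>k. F (Suc k))"
proof (rule mps_eqI)
  fix e
  show "mcoeff (hsum F) e = mcoeff (F 0 + X Hv * hsum (\<lambda>k. F (Suc k))) e"
  proof (cases "e Hv")
    case 0
    then have "e(Hv := 0) = e" by auto
    then show ?thesis using 0 by (simp add: mcoeff_hsum mcoeff_X_mult)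
  next
    case (Suc m)
    then have "e(Hv := Suc m) = e" by auto
    then show ?thesis using Suc by (simp add: mcoeff_hsum mcoeff_X_mult sum.atMost_Suc_shift del: sum.atMost_Suc)
  qed
qed

lemma vanishes_hsum:
  assumes "\<And>k. vanishes w (n - k * w Hv) (F k)"
  shows "vanishes w n (hsum F)"
  unfolding vanishes_def mcoeff_hsum
proof (intro allI impI sum.neutral ballI)
  fix e k assume e: "wdeg w e < n" "k \<in> {..e Hv}"
  have "wdeg w (e(Hv := e Hv - k)) + w Hv * k = wdeg w e"
  proof -
    have "w Hv * (e Hv - k) + w Hv * k = w Hv * e Hv"
      using e(2) by (simp flip: distrib_left)
    then show ?thesis using wdeg_upd[of w e Hv "e Hv - k"] by linarith
  qed
  then have "wdeg w (e(Hv := e Hv - k)) < n - k * w Hv" using e(1) by (simp add: mult.commute)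
  then show "mcoeff (F k) (e(Hv := e Hv - k)) = 0" using assms[of k] by (simp add: vanishes_def)
qed

text \<open>Every member of \<open>S\<close> is divisible by arbitrarily high powers of
  \<open>X v\<close>. With \<open>S\<close> a family of defects indexed by sequences, a single
  unfolding of \<open>hsum\<close> on both sides is enough to prove an identity between such
  sums.\<close>

lemma X_divisible_imp_0:
  assumes "\<And>x. x \<in> S \<Longrightarrow> \<exists>y\<in>S. x = X v * y" "x \<in> S"
  shows "x = 0"
proof (rule vanishes_imp_0)
  have "\<forall>x\<in>S. vanishes tot n x" for n
  proof (induction n)
    case (Suc n)
    then show ?case
      using assms(1) vanishes_X_mult[of "Suc n" tot v n] by (metis add.commute plus_1_eq_Suc tot_def order_refl)
  qed simp
  then show "vanishes tot n x" for n using assms(2) by blast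
qed

definition hlinear :: "('b::finite wvar mps \<Rightarrow> 'c::finite wvar mps) \<Rightarrow> bool" where
  "hlinear D \<longleftrightarrow> (\<forall>a b. D (a + b) = D a + D b) \<and> (\<forall>a. D (X Hv * a) = X Hv * D a)"

lemma hlinear_hsum:
  assumes "hlinear D"
  shows "D (hsum F) = hsum (\<lambda>k. D (F k))"
proof -
  have "D (hsum F) - hsum (\<lambda>k. D (F k)) = 0"
  proof (rule X_divisible_imp_0[where v = Hv and S = "range (\<lambda>F. D (hsum F) - hsum (\<lambda>k. D (F k)))"])
    fix x assume "x \<in> range (\<lambda>F. D (hsum F) - hsum (\<lambda>k. D (F k)))"
    then obtain F where x: "x = D (hsum F) - hsum (\<lambda>k. D (F k))" by blast
    have "x = X Hv * (D (hsum (\<lambda>k. F (Suc k))) - hsum (\<lambda>k. D (F (Suc k))))"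
      unfolding x using assms
      by (subst (1 2) hsum_unfold) (simp add: hlinear_def right_diff_distrib)
    then show "\<exists>y\<in>range (\<lambda>F. D (hsum F) - hsum (\<lambda>k. D (F k))). x = X Hv * y"
      by (intro bexI[of _ "D (hsum (\<lambda>k. F (Suc k))) - hsum (\<lambda>k. D (F (Suc k)))"]) auto
  qed blast
  then show ?thesis by simp
qed

lemma hlinear_pd: "v \<noteq> Hv \<Longrightarrow> hlinear (pd v)"
  by (auto simp: hlinear_def pd_X_mult)

lemma hlinear_mult: "hlinear (\<lambda>a. c * a)"
  by (auto simp: hlinear_def algebra_simps)

lemma hsum_hsum:
  "hsum (\<lambda>m. hsum (F m)) = hsum (\<lambda>p. \<Sum>m\<le>p. F m (p - m))"
proof -
  define D where "D F = hsum (\<lambda>m. hsum (F m)) - hsum (\<lambda>p. \<Sum>m\<le>p. F m (p - m))"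
    for F :: "nat \<Rightarrow> nat \<Rightarrow> 'a wvar mps"
  have D: "D F = X Hv * D (\<lambda>m. F (Suc m))" for F
  proof -
    have "hsum (\<lambda>p. \<Sum>m\<le>p. F m (p - m)) =
        F 0 0 + X Hv * (hsum (\<lambda>p. F 0 (Suc p)) + hsum (\<lambda>p. \<Sum>m\<le>p. F (Suc m) (p - m)))"
      by (subst hsum_unfold) (simp add: sum.atMost_Suc_shift hsum_add del: sum.atMost_Suc)
    also have "\<dots> = hsum (F 0) + X Hv * hsum (\<lambda>p. \<Sum>m\<le>p. F (Suc m) (p - m))"
      by (subst (3) hsum_unfold) (simp add: algebra_simps)
    finally show ?thesis
      unfolding D_def by (subst hsum_unfold) (simp add: algebra_simps)
  qed
  have "D F = 0"
    by (rule X_divisible_imp_0[where v = Hv and S = "range D"]) (use D in blast)+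
  then show ?thesis by (simp add: D_def)
qed

text \<open>Pascal's rule in the shape of a Leibniz expansion: each term of order \<open>m\<close>
  contributes once by raising the first index and once by raising the second.\<close>

lemma sum_choose_Suc:
  fixes f :: "nat \<Rightarrow> nat \<Rightarrow> 'r::comm_ring_1"
  shows "(\<Sum>n\<le>Suc m. of_nat (Suc m choose n) * f n (Suc m - n)) =
    (\<Sum>n\<le>m. of_nat (m choose n) * (f n (Suc (m - n)) + f (Suc n) (m - n)))"
proof -
  have "(\<Sum>n\<le>m. of_nat (m choose n) * f n (Suc (m - n))) =
      (\<Sum>n\<le>Suc m. of_nat (m choose n) * f n (Suc m - n))"
    by (simp add: Suc_diff_le binomial_eq_0)
  also have "\<dots> = f 0 (Suc m) + (\<Sum>n\<le>m. of_nat (m choose Suc n) * f (Suc n) (m - n))"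
    by (subst sum.atMost_Suc_shift) simp
  finally show ?thesis
    by (subst sum.atMost_Suc_shift) (simp add: distrib_right distrib_left sum.distrib algebra_simps)
qed

lemma sum_exchange:
  fixes t :: "nat \<Rightarrow> 'b \<Rightarrow> 'b \<Rightarrow> 'r::comm_ring_1"
  shows "(\<Sum>n\<in>A. w n * (\<Sum>B\<in>S. \<Sum>C\<in>T. \<theta> B C * t n B C)) =
    (\<Sum>B\<in>S. \<Sum>C\<in>T. \<theta> B C * (\<Sum>n\<in>A. w n * t n B C))"
proof -
  have "(\<Sum>n\<in>A. w n * (\<Sum>B\<in>S. \<Sum>C\<in>T. \<theta> B C * t n B C)) =
      (\<Sum>B\<in>S. \<Sum>n\<in>A. \<Sum>C\<in>T. \<theta> B C * (w n * t n B C))"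
    unfolding sum_distrib_left by (subst sum.swap) (simp only: mult.left_commute)
  also have "\<dots> = (\<Sum>B\<in>S. \<Sum>C\<in>T. \<theta> B C * (\<Sum>n\<in>A. w n * t n B C))"
    unfolding sum_distrib_left by (intro sum.cong refl sum.swap)
  finally show ?thesis .
qed

subsection \<open>Product and bracket\<close>

definition fibre_const :: "'b::finite wvar mps \<Rightarrow> bool" where
  "fibre_const c \<longleftrightarrow> (\<forall>B. dY B c = 0)"

text \<open>Fedosov's weight. It is preserved by the Wick product, where each factor \<open>\<hbar>\<close> comes with two
  fibre derivatives.\<close>

definition fw :: "'b wvar \<Rightarrow> nat" where
  "fw v = (case v of Inl (Inl B) \<Rightarrow> 0 | Inl (Inr B) \<Rightarrow> 1 | Inr _ \<Rightarrow> 2)"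

lemma fw_simps [simp]: "fw (Zv B) = 0" "fw (Yv B) = 1" "fw (Inr u) = 2"
  by (auto simp: fw_def)

text \<open>The tensor has no prescribed type here. Its being constant along the fibres lets fibre
  derivatives pass through contractions, and associativity rests on this.\<close>

locale wick_algebra =
  fixes \<Theta> :: "'b::finite \<Rightarrow> 'b \<Rightarrow> 'b wvar mps"
  assumes fibre_const_\<Theta>: "fibre_const (\<Theta> B C)"
begin

text \<open>The k-fold contraction without the factor 1/k!, which is supplied in
  \<open>star\<close>.\<close>

primrec Phi :: "nat \<Rightarrow> 'b wvar mps \<Rightarrow> 'b wvar mps \<Rightarrow> 'b wvar mps" where
  "Phi 0 a b = a * b"
| "Phi (Suc k) a b = (\<Sum>B\<in>UNIV. \<Sum>C\<in>UNIV. \<Theta> B C * Phi k (dY B a) (dY C b))"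

lemma Phi_add_left: "Phi k (a + a') b = Phi k a b + Phi k a' b"
  by (induction k arbitrary: a a' b) (auto simp: algebra_simps sum.distrib)

lemma Phi_add_right: "Phi k a (b + b') = Phi k a b + Phi k a b'"
  by (induction k arbitrary: a b b') (auto simp: algebra_simps sum.distrib)

lemma Phi_0 [simp]: "Phi k 0 b = 0" "Phi k a 0 = 0"
  using Phi_add_left[of k 0 0 b] Phi_add_right[of k a 0 0] by auto

lemma Phi_scalar_left: "fibre_const c \<Longrightarrow> Phi k (c * a) b = c * Phi k a b"
  by (induction k arbitrary: a b) (auto simp: fibre_const_def pd_mult sum_distrib_left mult.left_commute mult.assoc)

lemma Phi_scalar_right: "fibre_const c \<Longrightarrow> Phi k a (c * b) = c * Phi k a b"
  by (induction k arbitrary: a b) (auto simp: fibre_const_def pd_mult sum_distrib_left mult.left_commute mult.assoc)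

lemma Phi_sum_left: "Phi k (sum f S) b = (\<Sum>x\<in>S. Phi k (f x) b)"
  by (induction S rule: infinite_finite_induct) (auto simp: Phi_add_left)

lemma Phi_sum_right: "Phi k a (sum f S) = (\<Sum>x\<in>S. Phi k a (f x))"
  by (induction S rule: infinite_finite_induct) (auto simp: Phi_add_right)

lemma dY_Phi: "dY A (Phi k a b) = Phi k (dY A a) b + Phi k a (dY A b)"
proof (induction k arbitrary: a b)
  case (Suc k)
  have [simp]: "dY A (\<Theta> B C) = 0" for B C using fibre_const_\<Theta> by (simp add: fibre_const_def)
  show ?case
    by (simp add: pd_mult Suc pd_commute[of "Yv A"] distrib_left sum.distrib)
qed (simp add: pd_mult)

lemma Phi_Suc_fibre_const: "fibre_const c \<Longrightarrow> Phi (Suc k) c a = 0" "fibre_const c \<Longrightarrow> Phi (Suc k) a c = 0"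
  by (simp_all add: fibre_const_def)

lemma vanishes_Phi:
  "vanishes fw m a \<Longrightarrow> vanishes fw n b \<Longrightarrow> vanishes fw (m + n - 2 * k) (Phi k a b)"
proof (induction k arbitrary: a b m n)
  case (Suc k)
  have "vanishes fw (m + n - 2 * Suc k) (Phi k (dY B a) (dY C b))" for B C
  proof -
    have "vanishes fw (m - 1) (dY B a)" "vanishes fw (n - 1) (dY C b)"
      using Suc.prems
      by (cases m; cases n; auto intro: vanishes_pd)+
    from Suc.IH[OF this] show ?thesis by (rule vanishes_mono) auto
  qed
  then show ?case by (auto intro!: vanishes_sum vanishes_mult_left)
qed (auto intro: vanishes_mult)

definition star :: "'b wvar mps \<Rightarrow> 'b wvar mps \<Rightarrow> 'b wvar mps" where
  "star a b = hsum (\<lambda>k. K (1 / fact k) * Phi k a b)"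

text \<open>The commutator divided by hbar. Its term without contraction is a b - b a = 0, and
  dropping it shifts the index by one.\<close>

definition br :: "'b wvar mps \<Rightarrow> 'b wvar mps \<Rightarrow> 'b wvar mps" where
  "br a b = hsum (\<lambda>k. K (1 / fact (Suc k)) * (Phi (Suc k) a b - Phi (Suc k) b a))"

lemma X_br: "X Hv * br a b = star a b - star b a"
proof -
  have "star a b - star b a = hsum (\<lambda>k. K (1 / fact k) * (Phi k a b - Phi k b a))"
    by (simp add: star_def right_diff_distrib hsum_diff)
  also have "\<dots> = X Hv * br a b"
    by (subst hsum_unfold) (simp add: br_def mult.commute)
  finally show ?thesis by simp
qed

lemma fibre_const_H: "fibre_const (X Hv)"
  by (auto simp: fibre_const_def pd_X)

lemma fibre_const_K: "fibre_const (K c)"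
  by (auto simp: fibre_const_def)

lemma hlinear_Phi_left: "hlinear (\<lambda>a. Phi k a b)"
  by (simp add: hlinear_def Phi_add_left Phi_scalar_left fibre_const_H)

lemma hlinear_Phi_right: "hlinear (\<lambda>b. Phi k a b)"
  by (simp add: hlinear_def Phi_add_right Phi_scalar_right fibre_const_H)

text \<open>The m-fold contractions of three factors that occur in \<open>star (star a b) c\<close>
  and, for \<open>Phi_right\<close>, in \<open>star a (star b c)\<close>. Passing from
  \<open>m\<close> to \<open>Suc m\<close> contracts one of the three pairs of factors once more, in
  the same way for both bracketings. This common recursion is the reason for associativity.\<close>

definition Phi_left :: "nat \<Rightarrow> 'b wvar mps \<Rightarrow> 'b wvar mps \<Rightarrow> 'b wvar mps \<Rightarrow> 'b wvar mps" where
  "Phi_left m a b c = (\<Sum>n\<le>m. of_nat (m choose n) * Phi n (Phi (m - n) a b) c)"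

definition Phi_right :: "nat \<Rightarrow> 'b wvar mps \<Rightarrow> 'b wvar mps \<Rightarrow> 'b wvar mps \<Rightarrow> 'b wvar mps" where
  "Phi_right m a b c = (\<Sum>n\<le>m. of_nat (m choose n) * Phi n a (Phi (m - n) b c))"

lemma Phi_left_Suc: "Phi_left (Suc m) a b c = (\<Sum>B\<in>UNIV. \<Sum>C\<in>UNIV. \<Theta> B C *
    (Phi_left m (dY B a) (dY C b) c + Phi_left m (dY B a) b (dY C c) + Phi_left m a (dY B b) (dY C c)))"
proof -
  have "Phi n (Phi (Suc k) a b) c + Phi (Suc n) (Phi k a b) c =
      (\<Sum>B\<in>UNIV. \<Sum>C\<in>UNIV. \<Theta> B C * (Phi n (Phi k (dY B a) (dY C b)) c +
        Phi n (Phi k (dY B a) b) (dY C c) + Phi n (Phi k a (dY B b)) (dY C c)))" for n k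
    by (simp add: Phi_sum_left Phi_scalar_left fibre_const_\<Theta> dY_Phi Phi_add_left
        sum.distrib distrib_left)
  then show ?thesis
    unfolding Phi_left_def sum_choose_Suc[of m "\<lambda>n k. Phi n (Phi k a b) c"]
    by (simp only: sum_exchange distrib_left sum.distrib)
qed

lemma Phi_right_Suc: "Phi_right (Suc m) a b c = (\<Sum>B\<in>UNIV. \<Sum>C\<in>UNIV. \<Theta> B C *
    (Phi_right m (dY B a) (dY C b) c + Phi_right m (dY B a) b (dY C c) + Phi_right m a (dY B b) (dY C c)))"
proof -
  have "Phi n a (Phi (Suc k) b c) + Phi (Suc n) a (Phi k b c) =
      (\<Sum>B\<in>UNIV. \<Sum>C\<in>UNIV. \<Theta> B C * (Phi n (dY B a) (Phi k (dY C b) c) +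
        Phi n (dY B a) (Phi k b (dY C c)) + Phi n a (Phi k (dY B b) (dY C c))))" for n k
    by (simp add: Phi_sum_right Phi_scalar_right fibre_const_\<Theta> dY_Phi Phi_add_right
        sum.distrib distrib_left)
  then show ?thesis
    unfolding Phi_right_def sum_choose_Suc[of m "\<lambda>n k. Phi n a (Phi k b c)"]
    by (simp only: sum_exchange distrib_left sum.distrib)
qed

lemma Phi_left_eq_right: "Phi_left m a b c = Phi_right m a b c"
proof (induction m arbitrary: a b c)
  case 0
  show ?case by (simp add: Phi_left_def Phi_right_def mult.assoc)
qed (simp add: Phi_left_Suc Phi_right_Suc)

lemma K_binomial:
  assumes "n \<le> p"
  shows "K (1 / fact n) * (K (1 / fact (p - n)) * x) = K (1 / fact p) * (of_nat (p choose n) * x)"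
proof -
  have "1 / fact n * (1 / fact (p - n)) = (1 / fact p * of_nat (p choose n) :: complex)"
    using binomial_fact[OF assms, where ?'a = complex] by simp
  then have "K (1 / fact n) * K (1 / fact (p - n)) * x = K (1 / fact p) * K (of_nat (p choose n)) * x"
    by (simp only: K_mult[symmetric])
  then show ?thesis by (simp only: K_of_nat mult.assoc)
qed

lemma star_star_left: "star (star a b) c = hsum (\<lambda>p. K (1 / fact p) * Phi_left p a b c)"
proof -
  have "star (star a b) c = hsum (\<lambda>n. hsum (\<lambda>m. K (1 / fact n) * (K (1 / fact m) * Phi n (Phi m a b) c)))"
    unfolding star_def
    by (simp add: hlinear_hsum[OF hlinear_Phi_left] Phi_scalar_left fibre_const_K hlinear_hsum[OF hlinear_mult])
  also have "\<dots> = hsum (\<lambda>p. \<Sum>n\<le>p. K (1 / fact n) * (K (1 / fact (p - n)) * Phi n (Phi (p - n) a b) c))"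
    by (rule hsum_hsum)
  also have "\<dots> = hsum (\<lambda>p. K (1 / fact p) * Phi_left p a b c)"
    unfolding Phi_left_def sum_distrib_left
    by (intro arg_cong[where f = hsum] ext sum.cong refl)
      (simp only: K_binomial atMost_iff)
  finally show ?thesis .
qed

lemma star_star_right: "star a (star b c) = hsum (\<lambda>p. K (1 / fact p) * Phi_right p a b c)"
proof -
  have "star a (star b c) = hsum (\<lambda>n. hsum (\<lambda>m. K (1 / fact n) * (K (1 / fact m) * Phi n a (Phi m b c))))"
    unfolding star_def
    by (simp add: hlinear_hsum[OF hlinear_Phi_right] Phi_scalar_right fibre_const_K hlinear_hsum[OF hlinear_mult])
  also have "\<dots> = hsum (\<lambda>p. \<Sum>n\<le>p. K (1 / fact n) * (K (1 / fact (p - n)) * Phi n a (Phi (p - n) b c)))"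
    by (rule hsum_hsum)
  also have "\<dots> = hsum (\<lambda>p. K (1 / fact p) * Phi_right p a b c)"
    unfolding Phi_right_def sum_distrib_left
    by (intro arg_cong[where f = hsum] ext sum.cong refl)
      (simp only: K_binomial atMost_iff)
  finally show ?thesis .
qed

lemma star_assoc: "star (star a b) c = star a (star b c)"
  by (simp add: star_star_left star_star_right Phi_left_eq_right)

lemma star_add: "star (a + a') b = star a b + star a' b" "star a (b + b') = star a b + star a b'"
  by (simp_all add: star_def Phi_add_left Phi_add_right distrib_left hsum_add)

lemma star_diff: "star (a - a') b = star a b - star a' b" "star a (b - b') = star a b - star a b'"
  using star_add(1)[of "a - a'" a' b] star_add(2)[of a "b - b'" b'] by (simp_all add: algebra_simps)

lemma star_X: "star (X Hv * a) b = X Hv * star a b" "star a (X Hv * b) = X Hv * star a b"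
  by (simp_all add: star_def Phi_scalar_left Phi_scalar_right fibre_const_H mult.left_commute
      hlinear_hsum[OF hlinear_mult])

text \<open>After two multiplications by hbar this is the Jacobi identity for the commutators of an
  associative product; hbar is then cancelled.\<close>

lemma br_jacobi: "br a (br b c) = br (br a b) c + br b (br a c)"
proof -
  have r: "X Hv * (X Hv * br a (br b c)) = star a (star b c - star c b) - star (star b c - star c b) a"
    for a b c
    unfolding X_br[of b c, symmetric] by (simp only: X_br[of a "br b c"] right_diff_distrib star_X)
  have l: "X Hv * (X Hv * br (br a b) c) = star (star a b - star b a) c - star c (star a b - star b a)"
    unfolding X_br[of a b, symmetric] by (simp only: X_br[of "br a b" c] right_diff_distrib star_X)
  have "X Hv * (X Hv * br a (br b c)) = X Hv * (X Hv * (br (br a b) c + br b (br a c)))"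
    unfolding distrib_left r l by (simp add: star_diff star_assoc)
  then show ?thesis by (blast dest: X_cancel)
qed

lemma br_add: "br (a + a') b = br a b + br a' b" "br a (b + b') = br a b + br a b'"
  by (simp_all add: br_def Phi_add_left Phi_add_right algebra_simps flip: hsum_add hsum_diff)

lemma br_0 [simp]: "br 0 a = 0" "br a 0 = 0"
  by (simp_all add: br_def)

lemma br_minus: "br (- a) b = - br a b" "br a (- b) = - br a b"
  using br_add(1)[of a "- a" b] br_add(2)[of a b "- b"]
  by (simp_all add: eq_neg_iff_add_eq_0 add.commute)

lemma br_diff: "br (a - a') b = br a b - br a' b" "br a (b - b') = br a b - br a b'"
  using br_add(1)[of "a" "- a'" b] br_add(2)[of a b "- b'"] by (simp_all add: br_minus)

lemma br_antisym: "br a b = - br b a"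
proof -
  have "br a b + br b a = 0"
    unfolding br_def by (simp add: algebra_simps flip: hsum_add)
  then show ?thesis by (simp add: eq_neg_iff_add_eq_0)
qed

lemma br_fibre_const: "fibre_const c \<Longrightarrow> br c a = 0" "fibre_const c \<Longrightarrow> br a c = 0"
  using Phi_Suc_fibre_const[of c] by (simp_all add: br_def del: Phi.simps)

text \<open>The first contraction takes two fibre derivatives, whence the loss of 2. Every further
  one comes with a factor hbar of weight 2, which makes up for it.\<close>

lemma vanishes_br:
  assumes "vanishes fw m a" "vanishes fw n b"
  shows "vanishes fw (m + n - 2) (br a b)"
  unfolding br_def
proof (rule vanishes_hsum)
  fix k
  have "vanishes fw (m + n - 2 * Suc k) (Phi (Suc k) a b)" "vanishes fw (m + n - 2 * Suc k) (Phi (Suc k) b a)"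
    using vanishes_Phi[OF assms, of "Suc k"] vanishes_Phi[OF assms(2,1), of "Suc k"]
    by (simp_all only: add.commute)
  then have "vanishes fw (m + n - 2 * Suc k) (K (1 / fact (Suc k)) * (Phi (Suc k) a b - Phi (Suc k) b a))"
    by (intro vanishes_mult_left vanishes_diff)
  then show "vanishes fw (m + n - 2 - k * fw Hv) (K (1 / fact (Suc k)) * (Phi (Suc k) a b - Phi (Suc k) b a))"
    by (rule vanishes_mono) simp
qed

lemma hlinear_derivation_br:
  assumes D: "hlinear D" and K: "\<And>c a. D (K c * a) = K c * D a"
    and Phi: "\<And>k a b. D (Phi k a b) = Phi k (D a) b + Phi k a (D b)"
  shows "D (br a b) = br (D a) b + br a (D b)"
proof -
  have diff: "D (a - b) = D a - D b" for a b
    using D[unfolded hlinear_def, THEN conjunct1, rule_format, of "a - b" b] by (simp add: algebra_simps)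
  show ?thesis
    unfolding br_def hlinear_hsum[OF D] hsum_add[symmetric]
    by (intro arg_cong[where f = hsum] ext)
      (simp only: K diff Phi, simp add: algebra_simps)
qed

end

section \<open>Restriction to vanishing variables\<close>

definition restr :: "'v::finite set \<Rightarrow> 'v mps \<Rightarrow> 'v mps" where
  "restr S = subst (\<lambda>v. if v \<in> S then 0 else X v)"

interpretation restr: substitution "\<lambda>v. if v \<in> S then 0 else X v" for S :: "'v::finite set"
  by unfold_locales simp

lemma restr_add: "restr S (a + b) = restr S a + restr S b"
  and restr_diff: "restr S (a - b) = restr S a - restr S b"
  and restr_mult: "restr S (a * b) = restr S a * restr S b"
  and restr_K [simp]: "restr S (K c) = K c"
  and restr_0 [simp]: "restr S 0 = 0"
  and restr_sum: "restr S (sum f A) = (\<Sum>x\<in>A. restr S (f x))"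
  and restr_X: "restr S (X v) = (if v \<in> S then 0 else X v)"
  by (simp_all add: restr_def subst_add subst_diff restr.subst_mult subst_sum restr.subst_X)

lemma pd_restr: "pd x (restr S a) = (if x \<in> S then 0 else restr S (pd x a))"
proof -
  have "pd x (restr S a) = (\<Sum>v\<in>UNIV. pd x (if v \<in> S then 0 else X v) * restr S (pd v a))"
    unfolding restr_def by (rule restr.pd_subst)
  also have "\<dots> = (\<Sum>v\<in>UNIV. if v = x then (if x \<in> S then 0 else restr S (pd x a)) else 0)"
    by (intro sum.cong) (auto simp: pd_X)
  finally show ?thesis by simp
qed

lemma mcoeff_restr: "mcoeff (restr S a) e = (if sum e S = 0 then mcoeff a e else 0)"
proof -
  define R where "R a = Abs_mps (\<lambda>e. if sum e S = 0 then mcoeff a e else 0)" for a :: "'a mps"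
  have R: "mcoeff (R a) e = (if sum e S = 0 then mcoeff a e else 0)" for a e
    by (simp add: R_def Abs_mps_inverse)
  define D where "D a = restr S a - R a" for a
  have "D a = 0"
  proof (rule series_ext[where D = D and a = a and L = "\<lambda>v. if v \<in> S then 0 else X v"])
    fix w a
    have "R (X w * a) = (if w \<in> S then 0 else X w) * R a"
    proof (rule mps_eqI)
      fix e :: "'a \<Rightarrow> nat"
      have S: "sum (e(w := k)) S = sum e S" if "w \<notin> S" for k
        using that by (intro sum.cong) auto
      have "e w = 0" if "w \<in> S" "sum e S = 0"
        using that sum_eq_0_iff[of S e] by simp
      then show "mcoeff (R (X w * a)) e = mcoeff ((if w \<in> S then 0 else X w) * R a) e"
        by (auto simp: R mcoeff_X_mult S)
    qed
    then show "D (X w * a) = (if w \<in> S then 0 else X w) * D a"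
      by (simp add: D_def restr_mult restr_X right_diff_distrib)
  next
    show "D (a + b) = D a + D b" for a b
      by (rule mps_eqI) (simp add: D_def restr_add R)
    show "D (K c) = 0" for c
      by (rule mps_eqI) (simp add: D_def R mcoeff_K)
  qed simp
  then show ?thesis using R[of a e] by (simp add: D_def)
qed

lemma restr_eq_0_iff: "restr S a = 0 \<longleftrightarrow> (\<forall>e. sum e S = 0 \<longrightarrow> mcoeff a e = 0)"
  by (metis mcoeff_0 mcoeff_restr mps_eqI)

lemma vanishes_restr: "vanishes w n a \<Longrightarrow> vanishes w n (restr S a)"
  by (simp add: vanishes_def mcoeff_restr)

lemma restr_restr: "restr S (restr T a) = restr (S \<union> T) a"
  by (rule mps_eqI) (auto simp: mcoeff_restr)

lemma restr_const:
  assumes "\<And>v. v \<in> S \<Longrightarrow> pd v c = 0"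
  shows "restr S c = c"
proof (rule mps_eqI)
  fix e
  have "mcoeff c e = 0" if "sum e S \<noteq> 0"
  proof -
    obtain v where v: "v \<in> S" "e v \<noteq> 0"
      using \<open>sum e S \<noteq> 0\<close> by (rule sum.not_neutral_contains_not_neutral)
    have "e(v := Suc (e v - 1)) = e" using v(2) by auto
    moreover have "mcoeff (pd v c) (e(v := e v - 1)) = 0" using assms[OF v(1)] by simp
    ultimately show ?thesis using v(2) by (simp add: mcoeff_pd del: of_nat_Suc)
  qed
  then show "mcoeff (restr S c) e = mcoeff c e" by (simp add: mcoeff_restr)
qed

text \<open>Without terms of \<open>S\<close>-degree zero, the Euler field multiplies each occurring
  coefficient by a non-zero number, so it can be undone without loss of weight.\<close>

lemma vanishes_euler:
  assumes "restr S E = 0" "vanishes w n (euler S E)"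
  shows "vanishes w n E"
  unfolding vanishes_def
proof (intro allI impI)
  fix e assume "wdeg w e < n"
  then have "of_nat (sum e S) * mcoeff E e = 0"
    using assms(2) by (simp add: vanishes_def mcoeff_euler)
  then show "mcoeff E e = 0" using assms(1) by (auto simp: restr_eq_0_iff simp flip: of_nat_sum)
qed

lemma sum_UNIV_Plus:
  "(\<Sum>B\<in>(UNIV :: ('m::finite + 'n::finite) set). f B) = (\<Sum>i\<in>UNIV. f (Inl i)) + (\<Sum>j\<in>UNIV. f (Inr j))"
  by (subst UNIV_Plus_UNIV[symmetric], subst sum.Plus) auto

section \<open>Connections on the formal Weyl bundle\<close>

lemma fibre_const_mult: "fibre_const a \<Longrightarrow> fibre_const b \<Longrightarrow> fibre_const (a * b)"
  and fibre_const_add: "fibre_const a \<Longrightarrow> fibre_const b \<Longrightarrow> fibre_const (a + b)"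
  and fibre_const_diff: "fibre_const a \<Longrightarrow> fibre_const b \<Longrightarrow> fibre_const (a - b)"
  and fibre_const_uminus: "fibre_const a \<Longrightarrow> fibre_const (- a)"
  and fibre_const_0: "fibre_const 0"
  and fibre_const_dZ: "fibre_const a \<Longrightarrow> fibre_const (dZ B a)"
  and fibre_const_XZ: "fibre_const (X (Zv B))"
  and fibre_const_XH: "fibre_const (X Hv)"
  by (auto simp: fibre_const_def pd_mult pd_commute[of _ "Zv B"] pd_X)

lemma fibre_const_sum: "(\<And>x. x \<in> S \<Longrightarrow> fibre_const (f x)) \<Longrightarrow> fibre_const (sum f S)"
  by (simp add: fibre_const_def)

lemmas fibre_const_intros = fibre_const_mult fibre_const_add fibre_const_diff fibre_const_uminus
  fibre_const_0 fibre_const_dZ fibre_const_XZ fibre_const_XH fibre_const_sum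

definition nab :: "('b::finite \<Rightarrow> 'b \<Rightarrow> 'b \<Rightarrow> 'b wvar mps) \<Rightarrow> 'b \<Rightarrow> 'b wvar mps \<Rightarrow> 'b wvar mps" where
  "nab \<Gamma> A a = dZ A a - (\<Sum>C\<in>UNIV. \<Sum>E\<in>UNIV. \<Gamma> A C E * (X (Yv C) * dY E a))"

lemma derivation_nab: "derivation (nab \<Gamma> A)"
proof -
  have "nab \<Gamma> A (a + b) = nab \<Gamma> A a + nab \<Gamma> A b" for a b
    by (simp add: nab_def distrib_left sum.distrib)
  moreover have "nab \<Gamma> A (a * b) = nab \<Gamma> A a * b + a * nab \<Gamma> A b" for a b
  proof -
    have "(\<Sum>C\<in>UNIV. \<Sum>E\<in>UNIV. \<Gamma> A C E * (X (Yv C) * dY E (a * b))) =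
        (\<Sum>C\<in>UNIV. \<Sum>E\<in>UNIV. \<Gamma> A C E * (X (Yv C) * dY E a)) * b +
        a * (\<Sum>C\<in>UNIV. \<Sum>E\<in>UNIV. \<Gamma> A C E * (X (Yv C) * dY E b))"
      unfolding sum_distrib_left sum_distrib_right sum.distrib[symmetric]
      by (intro sum.cong refl) (simp add: pd_mult algebra_simps)
    then show ?thesis by (simp add: nab_def pd_mult algebra_simps)
  qed
  ultimately show ?thesis by (simp add: derivation_def nab_def)
qed

lemmas nab_add = derivation_add[OF derivation_nab]
  and nab_mult = derivation_mult[OF derivation_nab]
  and nab_K = derivation_K[OF derivation_nab]

lemma nab_0 [simp]: "nab \<Gamma> A 0 = 0"
  by (simp add: nab_def)

lemma nab_sum: "nab \<Gamma> A (sum f S) = (\<Sum>x\<in>S. nab \<Gamma> A (f x))"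
  by (induction S rule: infinite_finite_induct) (auto simp: nab_add)

lemma nab_diff: "nab \<Gamma> A (a - b) = nab \<Gamma> A a - nab \<Gamma> A b"
  using nab_add[of \<Gamma> A "a - b" b] by (simp add: algebra_simps)

lemma nab_minus: "nab \<Gamma> A (- a) = - nab \<Gamma> A a"
  using nab_diff[of \<Gamma> A 0 a] by simp

lemma nab_fibre_const: "fibre_const c \<Longrightarrow> nab \<Gamma> A c = dZ A c"
  by (simp add: nab_def fibre_const_def)

lemma nab_Y: "nab \<Gamma> A (X (Yv E)) = - (\<Sum>C\<in>UNIV. \<Gamma> A C E * X (Yv C))"
proof -
  have "(\<Sum>E'\<in>UNIV. \<Gamma> A C E' * (X (Yv C) * dY E' (X (Yv E)))) = \<Gamma> A C E * X (Yv C)" for C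
  proof -
    have "(\<Sum>E'\<in>UNIV. \<Gamma> A C E' * (X (Yv C) * dY E' (X (Yv E)))) =
        (\<Sum>E'\<in>UNIV. if E' = E then \<Gamma> A C E * X (Yv C) else 0)"
      by (intro sum.cong) (auto simp: pd_X)
    then show ?thesis by simp
  qed
  then show ?thesis by (simp add: nab_def pd_X)
qed

lemma hlinear_nab: "hlinear (nab \<Gamma> A)"
  by (simp add: hlinear_def nab_add nab_mult nab_fibre_const fibre_const_XH pd_X)

text \<open>The condition on \<open>\<Gamma>\<close> says that no fibre variable is replaced by one
  of smaller weight. It covers \<open>fw\<close>, where all fibre variables weigh the same, and
  later \<open>wy\<close>, where it expresses that the Kaehler connection preserves types.\<close>

lemma vanishes_nab:
  assumes "w (Zv A) = 0" "\<And>C E. \<Gamma> A C E = 0 \<or> w (Yv E) \<le> w (Yv C)" "vanishes w n a"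
  shows "vanishes w n (nab \<Gamma> A a)"
proof -
  have "vanishes w n (\<Gamma> A C E * (X (Yv C) * dY E a))" for C E
  proof (cases "\<Gamma> A C E = 0")
    case False
    then have "w (Yv E) \<le> w (Yv C)" using assms(2) by blast
    moreover have "vanishes w (n - w (Yv E)) (dY E a)"
      by (cases "w (Yv E) \<le> n") (auto intro: vanishes_pd[OF assms(3)])
    ultimately show ?thesis
      by (intro vanishes_mult_left vanishes_X_mult[where m = "n - w (Yv E)"]) auto
  qed simp
  moreover have "vanishes w n (dZ A a)"
    by (rule vanishes_pd[OF assms(3)]) (simp add: assms(1))
  ultimately show ?thesis
    unfolding nab_def by (intro vanishes_diff vanishes_sum) auto
qed

lemma vanishes_fw_nab: "vanishes fw n a \<Longrightarrow> vanishes fw n (nab \<Gamma> A a)"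
  by (rule vanishes_nab) auto

lemma derivation_commutator:
  assumes "derivation P" "derivation Q"
  shows "derivation (\<lambda>a. P (Q a) - Q (P a))"
  using assms derivation_K[OF assms(1), of 0] derivation_K[OF assms(2), of 0]
  by (auto simp: derivation_def algebra_simps)

lemma derivation_zero: "derivation (\<lambda>a. 0)"
  by (simp add: derivation_def)

text \<open>\<open>\<Gamma>_sym\<close> is the absence of torsion and makes the connection
  compatible with delta; \<open>\<Theta>_parallel\<close> says that the bivector is parallel and
  makes the connection a derivation of all contractions, hence of the bracket.\<close>

locale weyl_connection = wick_algebra \<Theta> for \<Theta> :: "'b::finite \<Rightarrow> 'b \<Rightarrow> 'b wvar mps" +
  fixes \<Gamma> :: "'b \<Rightarrow> 'b \<Rightarrow> 'b \<Rightarrow> 'b wvar mps"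
  assumes fibre_const_\<Gamma>: "fibre_const (\<Gamma> A B C)"
    and \<Gamma>_sym: "\<Gamma> A B C = \<Gamma> B A C"
    and \<Theta>_parallel: "dZ A (\<Theta> B C) + (\<Sum>E\<in>UNIV. \<Gamma> A E B * \<Theta> E C + \<Gamma> A E C * \<Theta> B E) = 0"
begin

abbreviation nb where "nb \<equiv> nab \<Gamma>"

lemma dY_nab: "dY B (nb A a) = nb A (dY B a) - (\<Sum>E\<in>UNIV. \<Gamma> A B E * dY E a)"
proof -
  have [simp]: "dY B (\<Gamma> A C E) = 0" for C E using fibre_const_\<Gamma> by (simp add: fibre_const_def)
  have "dY B (\<Gamma> A C E * (X (Yv C) * dY E a)) =
      (if C = B then \<Gamma> A B E * dY E a else 0) + \<Gamma> A C E * (X (Yv C) * dY E (dY B a))" for C E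
    by (auto simp: pd_mult pd_X algebra_simps pd_commute[of "Yv B"])
  then have "dY B (nb A a) = dZ A (dY B a) - (\<Sum>C\<in>UNIV. \<Sum>E\<in>UNIV. (if C = B then \<Gamma> A B E * dY E a else 0))
      - (\<Sum>C\<in>UNIV. \<Sum>E\<in>UNIV. \<Gamma> A C E * (X (Yv C) * dY E (dY B a)))"
    by (simp add: nab_def sum.distrib pd_commute[of "Yv B"])
  also have "(\<Sum>C\<in>UNIV. \<Sum>E\<in>UNIV. (if C = B then \<Gamma> A B E * dY E a else 0)) =
      (\<Sum>E\<in>UNIV. \<Gamma> A B E * dY E a)"
    by (subst sum.swap) simp
  finally show ?thesis by (simp add: nab_def)
qed

lemma nab_Phi: "nb A (Phi k a b) = Phi k (nb A a) b + Phi k a (nb A b)"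
proof (induction k arbitrary: a b)
  case (Suc k)
  let ?S = "\<lambda>f. \<Sum>B\<in>UNIV. \<Sum>C\<in>UNIV. f B C"
  have nd: "nb A (dY B x) = dY B (nb A x) + (\<Sum>E\<in>UNIV. \<Gamma> A B E * dY E x)" for B x
    by (simp add: dY_nab)
  have "nb A (Phi (Suc k) a b) = ?S (\<lambda>B C. dZ A (\<Theta> B C) * Phi k (dY B a) (dY C b)) +
     ?S (\<lambda>B C. \<Theta> B C * Phi k (nb A (dY B a)) (dY C b)) +
     ?S (\<lambda>B C. \<Theta> B C * Phi k (dY B a) (nb A (dY C b)))"
    by (simp add: nab_sum nab_mult Suc nab_fibre_const fibre_const_\<Theta> sum.distrib distrib_left add.assoc)
  also have "?S (\<lambda>B C. \<Theta> B C * Phi k (nb A (dY B a)) (dY C b)) = Phi (Suc k) (nb A a) b +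
     ?S (\<lambda>B C. \<Sum>E\<in>UNIV. \<Theta> B C * \<Gamma> A B E * Phi k (dY E a) (dY C b))"
    unfolding nd Phi_add_left Phi_sum_left
    by (simp add: Phi_scalar_left fibre_const_\<Gamma> distrib_left sum.distrib sum_distrib_left mult.assoc)
  \<comment> \<open>Renaming the summed indices moves the Christoffel symbol from the argument to
    the bivector. Together with the derivative of \<open>\<Theta>\<close> and the analogous term for
    the second argument, it forms the covariant derivative of the bivector, which is zero.\<close>
  also have "?S (\<lambda>B C. \<Sum>E\<in>UNIV. \<Theta> B C * \<Gamma> A B E * Phi k (dY E a) (dY C b)) =
     ?S (\<lambda>B C. (\<Sum>E\<in>UNIV. \<Gamma> A E B * \<Theta> E C) * Phi k (dY B a) (dY C b))"
  proof -
    have "?S (\<lambda>B C. \<Sum>E\<in>UNIV. \<Theta> B C * \<Gamma> A B E * Phi k (dY E a) (dY C b)) =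
        (\<Sum>C\<in>UNIV. \<Sum>B\<in>UNIV. \<Sum>E\<in>UNIV. \<Theta> B C * \<Gamma> A B E * Phi k (dY E a) (dY C b))"
      by (rule sum.swap)
    also have "\<dots> = (\<Sum>C\<in>UNIV. \<Sum>E\<in>UNIV. \<Sum>B\<in>UNIV. \<Theta> B C * \<Gamma> A B E * Phi k (dY E a) (dY C b))"
      by (intro sum.cong refl sum.swap)
    also have "\<dots> = ?S (\<lambda>E C. \<Sum>B\<in>UNIV. \<Theta> B C * \<Gamma> A B E * Phi k (dY E a) (dY C b))"
      by (rule sum.swap)
    finally show ?thesis by (simp add: sum_distrib_right mult.commute[of "\<Theta> _ _"])
  qed
  also have "?S (\<lambda>B C. \<Theta> B C * Phi k (dY B a) (nb A (dY C b))) = Phi (Suc k) a (nb A b) +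
     ?S (\<lambda>B C. \<Sum>E\<in>UNIV. \<Theta> B C * \<Gamma> A C E * Phi k (dY B a) (dY E b))"
    unfolding nd Phi_add_right Phi_sum_right
    by (simp add: Phi_scalar_right fibre_const_\<Gamma> distrib_left sum.distrib sum_distrib_left mult.assoc)
  also have "?S (\<lambda>B C. \<Sum>E\<in>UNIV. \<Theta> B C * \<Gamma> A C E * Phi k (dY B a) (dY E b)) =
     ?S (\<lambda>B C. (\<Sum>E\<in>UNIV. \<Gamma> A E C * \<Theta> B E) * Phi k (dY B a) (dY C b))"
  proof -
    have "?S (\<lambda>B C. \<Sum>E\<in>UNIV. \<Theta> B C * \<Gamma> A C E * Phi k (dY B a) (dY E b)) =
       ?S (\<lambda>B E. \<Sum>C\<in>UNIV. \<Theta> B C * \<Gamma> A C E * Phi k (dY B a) (dY E b))"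
      by (intro sum.cong refl sum.swap)
    then show ?thesis by (simp add: sum_distrib_right mult.commute[of "\<Theta> _ _"])
  qed
  finally have "nb A (Phi (Suc k) a b) = Phi (Suc k) (nb A a) b + Phi (Suc k) a (nb A b) +
     (?S (\<lambda>B C. dZ A (\<Theta> B C) * Phi k (dY B a) (dY C b)) +
      ?S (\<lambda>B C. (\<Sum>E\<in>UNIV. \<Gamma> A E B * \<Theta> E C) * Phi k (dY B a) (dY C b)) +
      ?S (\<lambda>B C. (\<Sum>E\<in>UNIV. \<Gamma> A E C * \<Theta> B E) * Phi k (dY B a) (dY C b)))"
    by (simp only: add_ac)
  also have "?S (\<lambda>B C. dZ A (\<Theta> B C) * Phi k (dY B a) (dY C b)) +
      ?S (\<lambda>B C. (\<Sum>E\<in>UNIV. \<Gamma> A E B * \<Theta> E C) * Phi k (dY B a) (dY C b)) +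
      ?S (\<lambda>B C. (\<Sum>E\<in>UNIV. \<Gamma> A E C * \<Theta> B E) * Phi k (dY B a) (dY C b)) =
      ?S (\<lambda>B C. (dZ A (\<Theta> B C) + (\<Sum>E\<in>UNIV. \<Gamma> A E B * \<Theta> E C + \<Gamma> A E C * \<Theta> B E)) * Phi k (dY B a) (dY C b))"
    by (simp only: sum.distrib distrib_right add.assoc)
  finally show ?case by (simp add: \<Theta>_parallel)
qed (simp add: nab_mult)

lemma nab_K_mult: "nb A (K c * a) = K c * nb A a"
  by (simp add: nab_mult nab_K)

lemma nab_br: "nb A (br a b) = br (nb A a) b + br a (nb A b)"
  by (rule hlinear_derivation_br[OF hlinear_nab nab_K_mult nab_Phi])

lemma dY_br: "dY A (br a b) = br (dY A a) b + br a (dY A b)"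
  by (rule hlinear_derivation_br[OF hlinear_pd pd_K_mult dY_Phi]) simp

definition dd :: "'b \<Rightarrow> 'b wvar mps \<Rightarrow> 'b wvar mps" where
  "dd A a = nb A a - dY A a"

lemma dd_add: "dd A (a + b) = dd A a + dd A b"
  and dd_diff: "dd A (a - b) = dd A a - dd A b"
  and dd_minus: "dd A (- a) = - dd A a"
  and dd_br: "dd A (br a b) = br (dd A a) b + br a (dd A b)"
  by (simp_all add: dd_def nab_add nab_diff nab_minus nab_br dY_br br_diff)

text \<open>The mixed terms of the connection and delta cancel because the Christoffel symbols are
  symmetric, so delta contributes no curvature.\<close>

lemma dd_commutator: "dd A (dd B a) - dd B (dd A a) = nb A (nb B a) - nb B (nb A a)"
  by (simp add: dd_def nab_diff dY_nab pd_commute[of "Yv A" "Yv B"] \<Gamma>_sym[of A B])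

end

section \<open>The formal Fedosov connection of a Kaehler metric\<close>

lemma sum_matrix_assoc:
  fixes f :: "'x \<Rightarrow> 'r::comm_ring_1"
  shows "(\<Sum>x\<in>S. f x * (\<Sum>y\<in>T. h x y * k y)) = (\<Sum>y\<in>T. (\<Sum>x\<in>S. f x * h x y) * k y)"
  unfolding sum_distrib_left sum_distrib_right
  by (subst sum.swap) (simp add: mult.assoc)

lemma wvar_cases:
  obtains C where "v = Zv C" | "v = Hv" | m where "v = Yv (Inl m)" | q where "v = Yv (Inr q)"
proof (cases v)
  case (Inl x)
  show ?thesis
  proof (cases x)
    case (Inl C)
    with \<open>v = Inl x\<close> show ?thesis using that(1) by simp
  next
    case (Inr B)
    then show ?thesis using \<open>v = Inl x\<close> that(3,4) by (cases B) simp_all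
  qed
next
  case (Inr u)
  then show ?thesis using that(2) by simp
qed

text \<open>\<open>om\<close> and \<open>\<theta>\<close> are the coefficient matrices of \<open>\<omega>\<close> and of the bivector; \<open>\<Gamma>\<close> are the
  Christoffel symbols.\<close>

locale kaehler_series =
  fixes om :: "'n::finite \<Rightarrow> 'n \<Rightarrow> ('n + 'n) wvar mps"
    and \<theta> :: "'n \<Rightarrow> 'n \<Rightarrow> ('n + 'n) wvar mps"
    and \<Gamma> :: "'n + 'n \<Rightarrow> 'n + 'n \<Rightarrow> 'n + 'n \<Rightarrow> ('n + 'n) wvar mps"
  assumes fc_om: "fibre_const (om i j)"
    and fc_\<theta>: "fibre_const (\<theta> i j)"
    and closed_om: "dZ (Inl k) (om i j) = dZ (Inl i) (om k j)"
      "dZ (Inr k) (om i j) = dZ (Inr j) (om i k)"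
    and inv1: "(\<Sum>q\<in>UNIV. \<theta> m q * om m' q) = (if m = m' then -1 else 0)"
    and inv2: "(\<Sum>m\<in>UNIV. \<theta> m q * om m q') = (if q = q' then -1 else 0)"
    and \<Gamma>_pure: "\<Gamma> (Inl i) (Inr j) E = 0" "\<Gamma> (Inr i) (Inl j) E = 0"
      "\<Gamma> (Inl i) (Inl k) (Inr l) = 0" "\<Gamma> (Inr i) (Inr k) (Inl l) = 0"
    and \<Gamma>_hol: "(\<Sum>m\<in>UNIV. \<Gamma> (Inl i) (Inl k) (Inl m) * om m q) = dZ (Inl i) (om k q)"
    and \<Gamma>_anti: "(\<Sum>r\<in>UNIV. \<Gamma> (Inr l) (Inr q) (Inr r) * om k r) = dZ (Inr l) (om k q)"
begin

abbreviation "gh i k m \<equiv> \<Gamma> (Inl i) (Inl k) (Inl m)"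
abbreviation "ga l q r \<equiv> \<Gamma> (Inr l) (Inr q) (Inr r)"
abbreviation "yl i \<equiv> X (Yv (Inl i)) :: ('n + 'n) wvar mps"
abbreviation "yr i \<equiv> X (Yv (Inr i)) :: ('n + 'n) wvar mps"

text \<open>Only the block from holomorphic to antiholomorphic indices is non-zero: a contraction
  differentiates the left factor along the y^i and the right factor along the bar y^j. The Wick
  property has its origin here.\<close>

definition TH :: "'n + 'n \<Rightarrow> 'n + 'n \<Rightarrow> ('n + 'n) wvar mps" where
  "TH B C = (case (B, C) of (Inl i, Inr j) \<Rightarrow> \<theta> i j | _ \<Rightarrow> 0)"

lemma TH_simps [simp]: "TH (Inl i) (Inr j) = \<theta> i j" "TH (Inr i) C = 0" "TH B (Inl j) = 0"
  by (auto simp: TH_def split: sum.splits)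

text \<open>The sign is that of \<open>inv1\<close>: the bivector is minus the transposed inverse of
  the matrix of the Kaehler form.\<close>

lemma solve_om: "(\<And>q. (\<Sum>m\<in>UNIV. a m * om m q) = b q) \<Longrightarrow> a m = - (\<Sum>q\<in>UNIV. \<theta> m q * b q)"
proof -
  assume *: "\<And>q. (\<Sum>m\<in>UNIV. a m * om m q) = b q"
  have "(\<Sum>q\<in>UNIV. \<theta> m q * b q) = (\<Sum>q\<in>UNIV. \<theta> m q * (\<Sum>m'\<in>UNIV. om m' q * a m'))"
    by (simp add: mult.commute flip: *)
  also have "\<dots> = (\<Sum>m'\<in>UNIV. if m' = m then - a m' else 0)"
    unfolding sum_matrix_assoc inv1 by (intro sum.cong) auto
  finally show "a m = - (\<Sum>q\<in>UNIV. \<theta> m q * b q)" by simp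
qed

lemma solve_om': "(\<And>k. (\<Sum>r\<in>UNIV. a r * om k r) = b k) \<Longrightarrow> a r = - (\<Sum>k\<in>UNIV. \<theta> k r * b k)"
proof -
  assume *: "\<And>k. (\<Sum>r\<in>UNIV. a r * om k r) = b k"
  have "(\<Sum>k\<in>UNIV. \<theta> k r * b k) = (\<Sum>k\<in>UNIV. \<theta> k r * (\<Sum>r'\<in>UNIV. om k r' * a r'))"
    by (simp add: mult.commute flip: *)
  also have "\<dots> = (\<Sum>r'\<in>UNIV. if r' = r then - a r' else 0)"
    unfolding sum_matrix_assoc inv2 by (intro sum.cong) auto
  finally show "a r = - (\<Sum>k\<in>UNIV. \<theta> k r * b k)" by simp
qed

lemma solve_\<theta>: "(\<And>m. (\<Sum>q\<in>UNIV. \<theta> m q * c q) = 0) \<Longrightarrow> c q = 0"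
proof -
  assume *: "\<And>m. (\<Sum>q\<in>UNIV. \<theta> m q * c q) = 0"
  have "0 = (\<Sum>m\<in>UNIV. om m q * (\<Sum>q'\<in>UNIV. \<theta> m q' * c q'))" by (simp add: *)
  also have "\<dots> = (\<Sum>q'\<in>UNIV. if q' = q then - c q' else 0)"
    unfolding sum_matrix_assoc inv2[unfolded mult.commute[of "\<theta> _ _"]] by (intro sum.cong) auto
  finally show "c q = 0" by simp
qed

lemma solve_\<theta>': "(\<And>q. (\<Sum>m\<in>UNIV. \<theta> m q * c m) = 0) \<Longrightarrow> c m = 0"
proof -
  assume *: "\<And>q. (\<Sum>m\<in>UNIV. \<theta> m q * c m) = 0"
  have "0 = (\<Sum>q\<in>UNIV. om m q * (\<Sum>m'\<in>UNIV. \<theta> m' q * c m'))" by (simp add: *)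
  also have "\<dots> = (\<Sum>m'\<in>UNIV. if m' = m then - c m' else 0)"
    unfolding sum_matrix_assoc inv1[unfolded mult.commute[of "\<theta> _ _"]] by (intro sum.cong) auto
  finally show "c m = 0" by simp
qed

section \<open>Christoffel symbols of the formal Kaehler metric and the parallel bivector\<close>

lemma gh_eq: "gh i k m = - (\<Sum>q\<in>UNIV. \<theta> m q * dZ (Inl i) (om k q))"
  by (rule solve_om) (rule \<Gamma>_hol)

lemma ga_eq: "ga l q r = - (\<Sum>k\<in>UNIV. \<theta> k r * dZ (Inr l) (om k q))"
  by (rule solve_om') (rule \<Gamma>_anti)

text \<open>For a Kaehler metric, the absence of torsion is the closedness of the Kaehler
  form.\<close>

lemma gh_sym: "gh i k m = gh k i m"
  unfolding gh_eq by (simp add: closed_om(1)[of i k])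

lemma ga_sym: "ga l q r = ga q l r"
  unfolding ga_eq by (simp add: closed_om(2)[of l _ q])

lemma fc_gh: "fibre_const (gh i k m)" and fc_ga: "fibre_const (ga l q r)"
  unfolding gh_eq ga_eq by (intro fibre_const_intros fc_\<theta> fc_om)+

lemma \<theta>_parallel_hol: "dZ (Inl i) (\<theta> m q) + (\<Sum>k\<in>UNIV. gh i k m * \<theta> k q) = 0"
proof -
  have "(\<Sum>q\<in>UNIV. dZ (Inl i) (\<theta> m q) * om m' q) = gh i m' m" for m'
  proof -
    have "0 = dZ (Inl i) (\<Sum>q\<in>UNIV. \<theta> m q * om m' q)" unfolding inv1 by simp
    then show ?thesis by (simp add: pd_mult sum.distrib gh_eq eq_neg_iff_add_eq_0)
  qed
  from solve_om'[OF this] show ?thesis by (simp add: mult.commute)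
qed

lemma \<theta>_parallel_anti: "dZ (Inr l) (\<theta> m q) + (\<Sum>s\<in>UNIV. ga l s q * \<theta> m s) = 0"
proof -
  have "(\<Sum>m\<in>UNIV. dZ (Inr l) (\<theta> m q) * om m q') = ga l q' q" for q'
  proof -
    have "0 = dZ (Inr l) (\<Sum>m\<in>UNIV. \<theta> m q * om m q')" unfolding inv2 by simp
    then show ?thesis by (simp add: pd_mult sum.distrib ga_eq eq_neg_iff_add_eq_0)
  qed
  from solve_om[OF this] show ?thesis by (simp add: mult.commute)
qed

sublocale weyl_connection TH \<Gamma>
proof
  show "fibre_const (TH B C)" for B C
    by (cases B; cases C) (auto simp: fc_\<theta> fibre_const_0)
  show "fibre_const (\<Gamma> A B C)" for A B C
    by (cases A; cases B; cases C) (auto simp: \<Gamma>_pure fc_gh fc_ga fibre_const_0)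
  show "\<Gamma> A B C = \<Gamma> B A C" for A B C
    using gh_sym ga_sym by (cases A; cases B; cases C) (auto simp: \<Gamma>_pure)
  show "dZ A (TH B C) + (\<Sum>E\<in>UNIV. \<Gamma> A E B * TH E C + \<Gamma> A E C * TH B E) = 0" for A B C
    using \<theta>_parallel_hol \<theta>_parallel_anti
    by (cases A; cases B; cases C) (auto simp: sum_UNIV_Plus \<Gamma>_pure)
qed

lemma Phi_Suc: "Phi (Suc k) a b = (\<Sum>i\<in>UNIV. \<Sum>j\<in>UNIV. \<theta> i j * Phi k (dY (Inl i) a) (dY (Inr j) b))"
  by (simp add: sum_UNIV_Plus)

lemma nab_yl: "nb (Inl i) (yl m) = - (\<Sum>k\<in>UNIV. gh i k m * yl k)" "nb (Inr l) (yl m) = 0"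
  by (simp_all add: nab_Y sum_UNIV_Plus \<Gamma>_pure)

lemma nab_yr: "nb (Inr l) (yr r) = - (\<Sum>q\<in>UNIV. ga l q r * yr q)" "nb (Inl i) (yr r) = 0"
  by (simp_all add: nab_Y sum_UNIV_Plus \<Gamma>_pure)

lemma dY_nab_mixed: "dY (Inr l) (nb (Inl i) a) = nb (Inl i) (dY (Inr l) a)"
  "dY (Inl i) (nb (Inr l) a) = nb (Inr l) (dY (Inl i) a)"
  by (simp_all add: dY_nab \<Gamma>_pure)

lemma nab_1 [simp]: "nb A 1 = 0"
  using nab_K[of \<Gamma> A 1] by simp

lemma nab_const_XZ: "nb A (nb B (X (Zv C))) = 0" "nb A (nb B (X Hv)) = 0"
  by (auto simp: nab_fibre_const fibre_const_intros pd_X)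

text \<open>The curvature acts on the Weyl bundle as the inner derivation by the series \<open>curv_series\<close>
  below; \<open>rho\<close> is the curvature tensor with its upper index lowered by \<open>\<omega>\<close>.\<close>

definition rho :: "'n \<Rightarrow> 'n \<Rightarrow> 'n \<Rightarrow> 'n \<Rightarrow> ('n + 'n) wvar mps" where
  "rho i l k q = (\<Sum>m\<in>UNIV. om m q * dZ (Inr l) (gh i k m))"

definition curv_series :: "'n \<Rightarrow> 'n \<Rightarrow> ('n + 'n) wvar mps" where
  "curv_series i l = (\<Sum>k\<in>UNIV. \<Sum>q\<in>UNIV. rho i l k q * (yl k * yr q))"

text \<open>The mixed second derivative of \<open>om k q\<close> is computed in both orders, by
  \<open>\<Gamma>_hol\<close> and by \<open>\<Gamma>_anti\<close>. The terms quadratic in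
  Christoffel symbols agree and cancel, which gives the curvature in terms of either half of the
  connection and thereby the symmetries \<open>rho_sym\<close>.\<close>

lemma rho_alt: "rho i l k q = (\<Sum>r\<in>UNIV. om k r * dZ (Inl i) (ga l q r))"
proof -
  have "rho i l k q + (\<Sum>m\<in>UNIV. gh i k m * (\<Sum>r\<in>UNIV. om m r * ga l q r)) =
      dZ (Inr l) (\<Sum>m\<in>UNIV. gh i k m * om m q)"
    using \<Gamma>_anti[of l q] by (simp add: rho_def pd_mult sum.distrib mult.commute)
  also have "\<dots> = dZ (Inl i) (\<Sum>r\<in>UNIV. ga l q r * om k r)"
    unfolding \<Gamma>_hol \<Gamma>_anti by (rule pd_commute)
  also have "\<dots> = (\<Sum>r\<in>UNIV. om k r * dZ (Inl i) (ga l q r)) +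
      (\<Sum>r\<in>UNIV. (\<Sum>m\<in>UNIV. gh i k m * om m r) * ga l q r)"
    unfolding \<Gamma>_hol by (simp add: pd_mult sum.distrib mult.commute)
  finally show ?thesis by (simp add: sum_matrix_assoc)
qed

lemma rho_sym: "rho i l k q = rho k l i q" "rho i l k q = rho i q k l"
  by (simp add: rho_def gh_sym[of i k], simp add: rho_alt ga_sym[of l q])

lemma fc_rho: "fibre_const (rho i l k q)"
  unfolding rho_def by (intro fibre_const_intros fc_om fc_gh)

lemma dY_rho [simp]: "dY B (rho i l k q) = 0"
  using fc_rho by (simp add: fibre_const_def)

lemma dY_curv_series: "dY (Inl j) (curv_series i l) = (\<Sum>q\<in>UNIV. rho i l j q * yr q)"
  "dY (Inr q) (curv_series i l) = (\<Sum>k\<in>UNIV. rho i l k q * yl k)"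
proof -
  have "dY (Inl j) (curv_series i l) = (\<Sum>k\<in>UNIV. if k = j then (\<Sum>q\<in>UNIV. rho i l j q * yr q) else 0)"
    unfolding curv_series_def pd_sum by (intro sum.cong) (auto simp: pd_mult pd_X)
  then show "dY (Inl j) (curv_series i l) = (\<Sum>q\<in>UNIV. rho i l j q * yr q)" by simp
  have "dY (Inr q) (curv_series i l) = (\<Sum>k\<in>UNIV. \<Sum>q'\<in>UNIV. if q' = q then rho i l k q * yl k else 0)"
    unfolding curv_series_def pd_sum by (intro sum.cong) (auto simp: pd_mult pd_X)
  then show "dY (Inr q) (curv_series i l) = (\<Sum>k\<in>UNIV. rho i l k q * yl k)" by simp
qed


section \<open>Curvature as an inner derivation\<close>

lemma br_Phi1:
  assumes "\<And>k. Phi (Suc (Suc k)) a b = 0" "\<And>k. Phi (Suc (Suc k)) b a = 0"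
  shows "br a b = Phi 1 a b - Phi 1 b a"
  unfolding br_def by (subst hsum_unfold) (simp add: assms del: Phi.simps)

lemma Phi_SucSuc_0:
  "(\<And>i j. dY (Inl i) (dY (Inl j) a) = 0) \<Longrightarrow> Phi (Suc (Suc k)) a b = 0"
  "(\<And>i j. dY (Inr i) (dY (Inr j) b) = 0) \<Longrightarrow> Phi (Suc (Suc k)) a b = 0"
  unfolding Phi_Suc by simp_all

lemma dY_dY_curv_series: "dY (Inl i) (dY (Inl j) (curv_series i' l)) = 0" "dY (Inr i) (dY (Inr j) (curv_series i' l)) = 0"
  by (simp_all add: dY_curv_series pd_mult pd_X)

lemma Phi_1: "Phi (Suc 0) a b = (\<Sum>i\<in>UNIV. \<Sum>j\<in>UNIV. \<theta> i j * (dY (Inl i) a * dY (Inr j) b))"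
  using Phi_Suc[of 0] by simp

text \<open>The series is linear in the y^i and linear in the bar y^j, so two contractions kill it
  in either position. The bracket with it is thus a Poisson bracket and a derivation of the
  commutative product, which allows \<open>curvature_mixed\<close> to be checked on
  generators.\<close>

lemma br_curv_series: "br (curv_series i l) a = (\<Sum>i'\<in>UNIV. \<Sum>j\<in>UNIV. \<theta> i' j * (dY (Inl i') (curv_series i l) * dY (Inr j) a)) -
    (\<Sum>i'\<in>UNIV. \<Sum>j\<in>UNIV. \<theta> i' j * (dY (Inl i') a * dY (Inr j) (curv_series i l)))"
  unfolding Phi_1[symmetric] One_nat_def[symmetric] by (intro br_Phi1 Phi_SucSuc_0 dY_dY_curv_series)

lemma derivation_br_curv_series: "derivation (br (curv_series i l))"
proof -
  have "br (curv_series i l) (a * b) = br (curv_series i l) a * b + a * br (curv_series i l) b" for a b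
    unfolding br_curv_series
    by (simp add: pd_mult distrib_left sum.distrib sum_distrib_left sum_distrib_right right_diff_distrib
        left_diff_distrib mult_ac)
  moreover have "br (curv_series i l) (K c) = 0" for c
    by (simp add: br_fibre_const fibre_const_K)
  ultimately show ?thesis by (simp add: derivation_def br_add)
qed

lemma br_yl:
  assumes "\<And>k. Phi (Suc (Suc k)) c (yl m) = 0"
  shows "br c (yl m) = - (\<Sum>q\<in>UNIV. \<theta> m q * dY (Inr q) c)"
proof -
  have "Phi (Suc (Suc k)) (yl m) c = 0" for k
    by (rule Phi_SucSuc_0) (simp add: pd_X)
  with assms have "br c (yl m) = Phi (Suc 0) c (yl m) - Phi (Suc 0) (yl m) c" by (simp add: br_Phi1 del: Phi.simps)
  also have "Phi (Suc 0) c (yl m) = 0" by (simp add: Phi_Suc pd_X del: Phi.simps(2))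
  also have "Phi (Suc 0) (yl m) c = (\<Sum>i\<in>UNIV. if i = m then (\<Sum>q\<in>UNIV. \<theta> m q * dY (Inr q) c) else 0)"
    unfolding Phi_Suc by (intro sum.cong) (auto simp: pd_X)
  finally show ?thesis by simp
qed

lemma br_yr:
  "br c (yr q) = (\<Sum>m\<in>UNIV. \<theta> m q * dY (Inl m) c)"
proof -
  have 1: "Phi (Suc (Suc k)) c (yr q) = 0" for k
    by (rule Phi_SucSuc_0(2)) (simp add: pd_X)
  have 2: "Phi (Suc k) (yr q) c = 0" for k
    unfolding Phi_Suc by (simp add: pd_X)
  have "br c (yr q) = Phi (Suc 0) c (yr q) - Phi (Suc 0) (yr q) c"
    by (simp add: br_Phi1 1 2 del: Phi.simps)
  also have "Phi (Suc 0) c (yr q) = (\<Sum>i\<in>UNIV. \<Sum>j\<in>UNIV. if j = q then \<theta> i q * dY (Inl i) c else 0)"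
    unfolding Phi_Suc by (intro sum.cong) (auto simp: pd_X)
  finally show ?thesis by (simp add: 2 del: Phi.simps)
qed

lemma Phi_yl_right: "Phi (Suc k) c (yl m) = 0"
  unfolding Phi_Suc by (simp add: pd_X)

lemma curvature_mixed: "nb (Inl i) (nb (Inr l) a) - nb (Inr l) (nb (Inl i) a) = br (curv_series i l) a"
proof (rule derivation_ext[OF derivation_commutator[OF derivation_nab derivation_nab] derivation_br_curv_series])
  fix v :: "('n + 'n) wvar"
  consider C where "v = Zv C" | "v = Hv" | m where "v = Yv (Inl m)" | q where "v = Yv (Inr q)"
    by (rule wvar_cases)
  then show "nb (Inl i) (nb (Inr l) (X v)) - nb (Inr l) (nb (Inl i) (X v)) = br (curv_series i l) (X v)"
  proof cases
    case 3
    have "nb (Inl i) (nb (Inr l) (yl m)) - nb (Inr l) (nb (Inl i) (yl m)) =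
        (\<Sum>k\<in>UNIV. dZ (Inr l) (gh i k m) * yl k)"
      by (simp add: nab_yl nab_minus nab_sum nab_mult nab_fibre_const fc_gh)
    also have "\<dots> = - (\<Sum>q\<in>UNIV. \<theta> m q * (\<Sum>k\<in>UNIV. rho i l k q * yl k))"
    proof -
      have "dZ (Inr l) (gh i k m) = - (\<Sum>q\<in>UNIV. \<theta> m q * rho i l k q)" for k
        by (rule solve_om) (simp add: rho_def mult.commute)
      then show ?thesis by (simp add: sum_matrix_assoc sum_negf)
    qed
    also have "\<dots> = br (curv_series i l) (yl m)"
      by (subst br_yl) (simp_all add: Phi_yl_right dY_curv_series del: Phi.simps)
    finally show ?thesis by (simp add: 3)
  next
    case 4
    have "nb (Inl i) (nb (Inr l) (yr q)) - nb (Inr l) (nb (Inl i) (yr q)) =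
        - (\<Sum>s\<in>UNIV. dZ (Inl i) (ga l s q) * yr s)"
      by (simp add: nab_yr nab_minus nab_sum nab_mult nab_fibre_const fc_ga)
    also have "\<dots> = (\<Sum>m\<in>UNIV. \<theta> m q * (\<Sum>s\<in>UNIV. rho i l m s * yr s))"
    proof -
      have "dZ (Inl i) (ga l s q) = - (\<Sum>k\<in>UNIV. \<theta> k q * rho i l k s)" for s
        by (rule solve_om') (simp add: rho_alt mult.commute)
      then show ?thesis by (simp add: sum_matrix_assoc sum_negf)
    qed
    finally show ?thesis by (simp add: 4 br_yr dY_curv_series)
  qed (auto simp: nab_const_XZ br_fibre_const fibre_const_intros)
qed

text \<open>Lowering the index of y^m with \<open>om\<close> yields series \<open>u q\<close> that
  are parallel in holomorphic directions. In terms of them, second covariant derivatives of y^m only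
  hit the coefficients \<open>\<theta>\<close>, where they are ordinary derivatives and commute.
  \<open>curvature_anti\<close> is the mirror image.\<close>

lemma curvature_hol: "nb (Inl i) (nb (Inl j) a) - nb (Inl j) (nb (Inl i) a) = 0"
proof (rule derivation_ext[OF derivation_commutator[OF derivation_nab derivation_nab] derivation_zero])
  fix v :: "('n + 'n) wvar"
  consider C where "v = Zv C" | "v = Hv" | m where "v = Yv (Inl m)" | q where "v = Yv (Inr q)"
    by (rule wvar_cases)
  then show "nb (Inl i) (nb (Inl j) (X v)) - nb (Inl j) (nb (Inl i) (X v)) = 0"
  proof cases
    case 3
    define u where "u q = (\<Sum>m\<in>UNIV. yl m * om m q)" for q
    have u: "nb (Inl i) (u q) = 0" for i q
    proof -
      have "nb (Inl i) (u q) = (\<Sum>m\<in>UNIV. yl m * dZ (Inl i) (om m q)) -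
          (\<Sum>m\<in>UNIV. (\<Sum>k\<in>UNIV. yl k * gh i k m) * om m q)"
        by (simp add: u_def nab_sum nab_mult nab_yl nab_fibre_const fc_om sum.distrib mult.commute
            sum_subtractf sum_negf)
      then show ?thesis by (simp add: \<Gamma>_hol flip: sum_matrix_assoc)
    qed
    have y: "yl m = - (\<Sum>q\<in>UNIV. \<theta> m q * u q)"
      by (rule solve_om) (simp add: u_def)
    have "nb (Inl i) (nb (Inl j) (yl m)) = - (\<Sum>q\<in>UNIV. dZ (Inl i) (dZ (Inl j) (\<theta> m q)) * u q)" for i j
      unfolding y by (simp add: nab_minus nab_sum nab_mult u nab_fibre_const fc_\<theta> fibre_const_dZ)
    then show ?thesis by (simp add: 3 pd_commute[of "Zv (Inl i)" "Zv (Inl j)"])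
  qed (auto simp: nab_const_XZ nab_yr)
qed

lemma curvature_anti: "nb (Inr i) (nb (Inr j) a) - nb (Inr j) (nb (Inr i) a) = 0"
proof (rule derivation_ext[OF derivation_commutator[OF derivation_nab derivation_nab] derivation_zero])
  fix v :: "('n + 'n) wvar"
  consider C where "v = Zv C" | "v = Hv" | m where "v = Yv (Inl m)" | q where "v = Yv (Inr q)"
    by (rule wvar_cases)
  then show "nb (Inr i) (nb (Inr j) (X v)) - nb (Inr j) (nb (Inr i) (X v)) = 0"
  proof cases
    case 4
    define u where "u k = (\<Sum>q\<in>UNIV. yr q * om k q)" for k
    have u: "nb (Inr l) (u k) = 0" for l k
    proof -
      have "nb (Inr l) (u k) = (\<Sum>q\<in>UNIV. yr q * dZ (Inr l) (om k q)) -
          (\<Sum>r\<in>UNIV. (\<Sum>q\<in>UNIV. yr q * ga l q r) * om k r)"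
        by (simp add: u_def nab_sum nab_mult nab_yr nab_fibre_const fc_om sum.distrib mult.commute
            sum_subtractf sum_negf)
      then show ?thesis by (simp add: \<Gamma>_anti flip: sum_matrix_assoc)
    qed
    have y: "yr q = - (\<Sum>k\<in>UNIV. \<theta> k q * u k)"
      by (rule solve_om') (simp add: u_def)
    have "nb (Inr i) (nb (Inr j) (yr q)) = - (\<Sum>k\<in>UNIV. dZ (Inr i) (dZ (Inr j) (\<theta> k q)) * u k)" for i j
      unfolding y by (simp add: nab_minus nab_sum nab_mult u nab_fibre_const fc_\<theta> fibre_const_dZ)
    then show ?thesis by (simp add: 4 pd_commute[of "Zv (Inr i)" "Zv (Inr j)"])
  qed (auto simp: nab_const_XZ nab_yl)
qed

text \<open>The second Bianchi identities: the Jacobi identity of the connection shows that the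
  difference is central, and it is linear in the fibre variables detected by the bracket.\<close>

lemma curv_series_bianchi_hol: "nb (Inl a) (curv_series i l) = nb (Inl i) (curv_series a l)"
proof -
  define c where "c = nb (Inl a) (curv_series i l) - nb (Inl i) (curv_series a l)"
  have c0: "br c x = 0" for x
  proof -
    have R: "br (nb A (curv_series i l)) x = nb A (br (curv_series i l) x) - br (curv_series i l) (nb A x)" for A i l x
      by (simp add: nab_br)
    have h: "nb (Inl a) (nb (Inl i) y) = nb (Inl i) (nb (Inl a) y)" for y
      using curvature_hol[of a i y] by simp
    show ?thesis
      unfolding c_def br_diff R curvature_mixed[symmetric]
      by (simp add: nab_diff h)
  qed
  have "dY (Inr q) c = 0" for q
    by (rule solve_\<theta>) (use c0[of "yl _"] in \<open>simp add: br_yl Phi_yl_right del: Phi.simps\<close>)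
  \<comment> \<open>Euler's relation: \<open>c\<close> is homogeneous of degree one in the bar y^q,
    because the curvature series is and the connection preserves this degree. So \<open>c\<close>
    vanishes with its derivatives.\<close>
  moreover have "c = (\<Sum>q\<in>UNIV. yr q * dY (Inr q) c)"
  proof -
    have 1: "(\<Sum>q\<in>UNIV. yr q * dY (Inr q) (curv_series i l)) = curv_series i l" for i l
      unfolding dY_curv_series unfolding curv_series_def by (subst sum.swap) (simp add: sum_distrib_left mult_ac)
    have "(\<Sum>q\<in>UNIV. yr q * dY (Inr q) (nb (Inl a) (curv_series i l))) =
        nb (Inl a) (\<Sum>q\<in>UNIV. yr q * dY (Inr q) (curv_series i l))" for a i l
      by (simp add: nab_sum nab_mult nab_yr dY_nab_mixed)
    then show ?thesis by (simp add: c_def right_diff_distrib sum_subtractf 1)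
  qed
  ultimately have "c = 0" by simp
  then show ?thesis by (simp add: c_def)
qed

lemma curv_series_bianchi_anti: "nb (Inr a) (curv_series i l) = nb (Inr l) (curv_series i a)"
proof -
  define c where "c = nb (Inr a) (curv_series i l) - nb (Inr l) (curv_series i a)"
  have c0: "br c x = 0" for x
  proof -
    have R: "br (nb A (curv_series i l)) x = nb A (br (curv_series i l) x) - br (curv_series i l) (nb A x)" for A i l x
      by (simp add: nab_br)
    have h: "nb (Inr a) (nb (Inr l) y) = nb (Inr l) (nb (Inr a) y)" for y
      using curvature_anti[of a l y] by simp
    show ?thesis
      unfolding c_def br_diff R curvature_mixed[symmetric]
      by (simp add: nab_diff h)
  qed
  have "dY (Inl m) c = 0" for m
    by (rule solve_\<theta>') (use c0[of "yr _"] in \<open>simp add: br_yr\<close>)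
  moreover have "c = (\<Sum>m\<in>UNIV. yl m * dY (Inl m) c)"
  proof -
    have 1: "(\<Sum>m\<in>UNIV. yl m * dY (Inl m) (curv_series i l)) = curv_series i l" for i l
      unfolding dY_curv_series unfolding curv_series_def by (simp add: sum_distrib_left mult_ac)
    have "(\<Sum>m\<in>UNIV. yl m * dY (Inl m) (nb (Inr a) (curv_series i l))) =
        nb (Inr a) (\<Sum>m\<in>UNIV. yl m * dY (Inl m) (curv_series i l))" for a i l
      by (simp add: nab_sum nab_mult nab_yl dY_nab_mixed)
    then show ?thesis by (simp add: c_def right_diff_distrib sum_subtractf 1)
  qed
  ultimately have "c = 0" by simp
  then show ?thesis by (simp add: c_def)
qed

lemma vanishes_curv_series: "vanishes fw 2 (curv_series i l)"
proof -
  have "vanishes fw (1 + 1) (yl k * yr q)" for k q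
    using vanishes_X[of fw "Yv (Inl k)"] vanishes_X[of fw "Yv (Inr q)"]
    by (intro vanishes_mult) simp_all
  then have "vanishes fw 2 (rho i l k q * (yl k * yr q))" for k q
    by - (rule vanishes_mult_left, simp only: one_add_one)
  then show ?thesis
    unfolding curv_series_def by (intro vanishes_sum)
qed

end

text \<open>The assumption \<open>I_euler\<close> is the contraction with the y^i of the equation
  that \<open>dd_I\<close> recovers, and \<open>I_restr\<close> fixes the part that the Euler field
  does not see. The weight of \<open>\<alpha>\<close> is at least 2 because it starts with
  hbar.\<close>

locale fedosov_series = kaehler_series om \<theta> \<Gamma>
  for om :: "'n::finite \<Rightarrow> 'n \<Rightarrow> ('n + 'n) wvar mps" and \<theta> \<Gamma> +
  fixes \<alpha> :: "'n \<Rightarrow> 'n \<Rightarrow> ('n + 'n) wvar mps"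
    and I :: "'n \<Rightarrow> ('n + 'n) wvar mps"
  assumes fc_\<alpha>: "fibre_const (\<alpha> i l)"
    and vanishes_\<alpha>: "vanishes fw 2 (\<alpha> i l)"
    and closed_\<alpha>: "dZ (Inl k) (\<alpha> i l) = dZ (Inl i) (\<alpha> k l)"
      "dZ (Inr k) (\<alpha> i l) = dZ (Inr l) (\<alpha> i k)"
    and I_euler: "euler (range (\<lambda>i. Yv (Inl i))) (I l) =
      (\<Sum>i\<in>UNIV. X (Yv (Inl i)) * (nab \<Gamma> (Inl i) (I l) + curv_series i l - \<alpha> i l))"
    and I_restr: "restr (range (\<lambda>i. Yv (Inl i))) (I l) = 0"
begin

abbreviation "YL \<equiv> range (\<lambda>i. Yv (Inl i)) :: ('n + 'n) wvar set"
abbreviation "YR \<equiv> range (\<lambda>i. Yv (Inr i)) :: ('n + 'n) wvar set"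
abbreviation "YA \<equiv> range Yv :: ('n + 'n) wvar set"

lemma YA_eq: "YL \<union> YR = YA" "YR \<union> YL = YA"
proof -
  have "x \<in> YL \<union> YR" if x: "x \<in> YA" for x
  proof -
    obtain B where "x = Yv B" using x by blast
    then show ?thesis by (cases B) auto
  qed
  then show "YL \<union> YR = YA" "YR \<union> YL = YA" by auto
qed

lemma notin_Y [simp]: "Yv (Inl m) \<notin> YR" "Yv (Inr m) \<notin> YL" "Zv B \<notin> YL" "Zv B \<notin> YR" "Zv B \<notin> YA"
  "Hv \<notin> YL" "Hv \<notin> YR" "Hv \<notin> YA"
  by auto

lemma in_Y [simp]: "Yv (Inl m) \<in> YL" "Yv (Inr m) \<in> YR" "Yv B \<in> YA"
  by auto

lemma YL_subset: "YL \<subseteq> YA" and YR_subset: "YR \<subseteq> YA"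
  using YA_eq by blast+

lemma sum_YL: "(\<Sum>v\<in>YL. f v) = (\<Sum>i\<in>UNIV. f (Yv (Inl i)))"
  and sum_YR: "(\<Sum>v\<in>YR. f v) = (\<Sum>i\<in>UNIV. f (Yv (Inr i)))"
  and sum_YA: "(\<Sum>v\<in>YA. f v) = (\<Sum>B\<in>UNIV. f (Yv B))"
  by (subst sum.reindex; simp add: inj_on_def)+

text \<open>Curvature series and \<open>\<alpha>\<close> have weight 2 and the factor y^i adds 1.
  Since \<open>I\<close> also occurs on the right of its equation, the bound is reached in three
  rounds, each gaining one.\<close>

lemma vanishes_I: "vanishes fw 3 (I l)"
proof -
  have step: "vanishes fw (Suc n) (I l)" if "vanishes fw n (I l)" "n \<le> 2" for n
  proof (rule vanishes_euler[OF I_restr])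
    have "vanishes fw n (nb (Inl i) (I l) + curv_series i l - \<alpha> i l)" for i
      using that by (intro vanishes_diff vanishes_add vanishes_fw_nab)
        (auto intro: vanishes_mono[OF vanishes_curv_series] vanishes_mono[OF vanishes_\<alpha>])
    then show "vanishes fw (Suc n) (euler YL (I l))"
      unfolding I_euler by (intro vanishes_sum vanishes_X_mult[where m = n]) auto
  qed
  have "vanishes fw 0 (I l)" by simp
  from step[OF step[OF step[OF this]]] show ?thesis by (simp add: numeral_3_eq_3)
qed

lemma dY_\<alpha> [simp]: "dY B (\<alpha> i l) = 0"
  using fc_\<alpha> by (simp add: fibre_const_def)

lemma dd_\<alpha>: "dd B (\<alpha> i l) = dZ B (\<alpha> i l)"
  by (simp add: dd_def nab_fibre_const fc_\<alpha>)

lemma dd_curv_series_hol: "dd (Inl a) (curv_series i l) = dd (Inl i) (curv_series a l)"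
  by (simp add: dd_def curv_series_bianchi_hol[of a] dY_curv_series rho_sym(1)[of i l a])

lemma dd_curv_series_anti: "dd (Inr a) (curv_series i l) = dd (Inr l) (curv_series i a)"
  by (simp add: dd_def curv_series_bianchi_anti[of a] dY_curv_series rho_sym(2)[of i l _ a])

text \<open>The defect \<open>E\<close> of this equation is a one-form in the y^i with zero
  contraction by \<open>I_euler\<close>. It is closed, because the holomorphic directions commute
  and both \<open>\<alpha>\<close> and the curvature series are closed, so Koszul's argument makes
  it vanish.\<close>

lemma dd_I: "dd (Inl i) (I l) = \<alpha> i l - curv_series i l"
proof -
  define E where "E i = dY (Inl i) (I l) - nb (Inl i) (I l) - curv_series i l + \<alpha> i l" for i
  \<comment> \<open>\<open>koszul_kernel\<close> indexes forms and operators by variables; outside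
    \<open>YL\<close> the values are dummies.\<close>
  define A where "A v = (case v of Inl (Inr (Inl i)) \<Rightarrow> E i | _ \<Rightarrow> 0)" for v :: "('n + 'n) wvar"
  define P where "P v = (case v of Inl (Inr (Inl i)) \<Rightarrow> nb (Inl i) | _ \<Rightarrow> (\<lambda>_. 0))" for v :: "('n + 'n) wvar"
  have [simp]: "A (Yv (Inl i)) = E i" "P (Yv (Inl i)) = nb (Inl i)" for i
    by (simp_all add: A_def P_def)
  have E: "E i = - dd (Inl i) (I l) - curv_series i l + \<alpha> i l" for i
    by (simp add: E_def dd_def)
  have "dd (Inl j) (E i) = dd (Inl i) (E j)" for i j
  proof -
    have "dd (Inl j) (dd (Inl i) (I l)) = dd (Inl i) (dd (Inl j) (I l))"
      using dd_commutator[of "Inl j" "Inl i" "I l"] curvature_hol[of j i "I l"] by simp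
    then show ?thesis
      unfolding E dd_add dd_diff dd_minus
      by (simp add: dd_\<alpha> closed_\<alpha>(1)[of j] dd_curv_series_hol[of j])
  qed
  then have closed: "P B (A C) - pd B (A C) = P C (A B) - pd C (A B)" if "B \<in> YL" "C \<in> YL" for B C
    using that by (auto simp flip: dd_def)
  have "A (Yv (Inl i)) = 0"
  proof (rule koszul_kernel[where S = YL and w = fw and P = P and A = A])
    have "(\<Sum>B\<in>YL. X B * A B) = euler YL (I l) - (\<Sum>i\<in>UNIV. X (Yv (Inl i)) * (nb (Inl i) (I l) + curv_series i l - \<alpha> i l))"
      unfolding euler_def sum_YL sum_subtractf[symmetric]
      by (intro sum.cong) (auto simp: E_def algebra_simps)
    then show "(\<Sum>B\<in>YL. X B * A B) = 0" by (simp add: I_euler)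
    show "\<And>B C. B \<in> YL \<Longrightarrow> C \<in> YL \<Longrightarrow> P B (A C) - pd B (A C) = P C (A B) - pd C (A B)"
      by (rule closed)
    show "\<And>B n a. B \<in> YL \<Longrightarrow> vanishes fw n a \<Longrightarrow> vanishes fw n (P B a)"
      by (auto intro: vanishes_fw_nab)
  qed auto
  then show ?thesis by (simp add: E algebra_simps)
qed

definition fd :: "'n + 'n \<Rightarrow> ('n + 'n) wvar mps \<Rightarrow> ('n + 'n) wvar mps" where
  "fd B a = (case B of Inl i \<Rightarrow> dd (Inl i) a | Inr l \<Rightarrow> dd (Inr l) a + br (I l) a)"

lemma fd_simps [simp]: "fd (Inl i) a = dd (Inl i) a" "fd (Inr l) a = dd (Inr l) a + br (I l) a"
  by (simp_all add: fd_def)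

text \<open>The curvature of the Levi-Civita connection is cancelled by the one created by
  \<open>I\<close>. What remains is the bracket with \<open>\<alpha>\<close>, which is central since
  it does not contain fibre variables.\<close>

lemma fd_commute_mixed: "fd (Inl i) (fd (Inr l) a) = fd (Inr l) (fd (Inl i) a)"
proof -
  have "fd (Inl i) (fd (Inr l) a) - fd (Inr l) (fd (Inl i) a) =
      (dd (Inl i) (dd (Inr l) a) - dd (Inr l) (dd (Inl i) a)) + br (dd (Inl i) (I l)) a"
    by (simp add: dd_add dd_br)
  also have "\<dots> = br (curv_series i l) a + br (\<alpha> i l - curv_series i l) a"
    by (simp only: dd_commutator curvature_mixed dd_I)
  also have "\<dots> = 0" by (simp add: br_diff br_fibre_const fc_\<alpha>)
  finally show ?thesis by simp
qed

text \<open>The Maurer-Cartan expression of \<open>I\<close>: two antiholomorphic components of the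
  connection commute up to the bracket with it.\<close>

definition curv_anti :: "'n \<Rightarrow> 'n \<Rightarrow> ('n + 'n) wvar mps" where
  "curv_anti l m = dd (Inr l) (I m) - dd (Inr m) (I l) + br (I l) (I m)"

lemma dd_anti_commute: "dd (Inr l) (dd (Inr m) a) = dd (Inr m) (dd (Inr l) a)"
  using dd_commutator[of "Inr l" "Inr m" a] curvature_anti[of l m a] by simp

text \<open>Moving the holomorphic direction past the antiholomorphic ones creates brackets with the
  curvature series, and these cancel against those coming from \<open>dd_I\<close>. The rest
  vanishes by closedness of \<open>\<alpha>\<close> and of the curvature series and by antisymmetry
  of the bracket.\<close>

lemma dd_curv_anti: "dd (Inl i) (curv_anti l m) = 0"
proof -
  have mix: "dd (Inl i) (dd (Inr l) a) = dd (Inr l) (dd (Inl i) a) + br (curv_series i l) a" for l a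
    using dd_commutator[of "Inl i" "Inr l" a] curvature_mixed[of i l a] by (simp add: algebra_simps)
  have "dd (Inl i) (curv_anti l m) = dd (Inr l) (\<alpha> i m - curv_series i m) - dd (Inr m) (\<alpha> i l - curv_series i l)
      + br (curv_series i l) (I m) - br (curv_series i m) (I l) + br (\<alpha> i l - curv_series i l) (I m) + br (I l) (\<alpha> i m - curv_series i m)"
    unfolding curv_anti_def dd_add dd_diff dd_br mix dd_I by (simp add: algebra_simps)
  also have "\<dots> = (dd (Inr l) (\<alpha> i m) - dd (Inr m) (\<alpha> i l)) - (dd (Inr l) (curv_series i m) - dd (Inr m) (curv_series i l))
      - (br (curv_series i m) (I l) + br (I l) (curv_series i m))"
    by (simp add: br_diff dd_diff br_fibre_const fc_\<alpha> algebra_simps)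
  also have "\<dots> = 0"
    using br_antisym[of "curv_series i m" "I l"] by (simp add: dd_\<alpha> closed_\<alpha>(2)[of l i m] dd_curv_series_anti[of l])
  finally show ?thesis .
qed

section \<open>Restriction to vanishing y or vanishing bar y\<close>

lemma restr_dY: "v \<notin> S \<Longrightarrow> restr S (pd v a) = pd v (restr S a)"
  by (simp add: pd_restr)

lemma hlinear_restr: "Hv \<notin> S \<Longrightarrow> hlinear (restr S)"
  by (simp add: hlinear_def restr_add restr_mult restr_X)

text \<open>The right factor is differentiated only along the bar y^j, which preserves its vanishing
  at y = 0. For the left factor and bar y = 0 the same holds in
  \<open>restr_Phi_left\<close>.\<close>

lemma restr_Phi_right: "restr YL b = 0 \<Longrightarrow> restr YL (Phi k a b) = 0"
proof (induction k arbitrary: a b)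
  case (Suc k)
  have "restr YL (dY (Inr j) b) = 0" for j
    using Suc.prems by (subst restr_dY) auto
  with Suc.IH show ?case
    unfolding Phi_Suc by (simp add: restr_sum restr_mult)
qed (simp add: restr_mult)

lemma restr_Phi_left: "restr YR a = 0 \<Longrightarrow> restr YR (Phi k a b) = 0"
proof (induction k arbitrary: a b)
  case (Suc k)
  have "restr YR (dY (Inl j) a) = 0" for j
    using Suc.prems by (subst restr_dY) auto
  with Suc.IH show ?case
    unfolding Phi_Suc by (simp add: restr_sum restr_mult)
qed (simp add: restr_mult)

lemma restr_hsum: "Hv \<notin> S \<Longrightarrow> restr S (hsum F) = hsum (\<lambda>k. restr S (F k))"
  by (rule hlinear_hsum[OF hlinear_restr])

lemma restr_br: "restr YL a = 0 \<Longrightarrow> restr YL b = 0 \<Longrightarrow> restr YL (br a b) = 0"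
  unfolding br_def by (subst restr_hsum) (auto simp: restr_mult restr_diff restr_Phi_right simp del: Phi.simps)

lemma restr_fibre_const: "fibre_const c \<Longrightarrow> S \<subseteq> YA \<Longrightarrow> restr S c = c"
  by (rule restr_const) (auto simp: fibre_const_def)

lemma restr_nab_hol: "restr YR (nb (Inl i) a) = nb (Inl i) (restr YR a)"
proof -
  have "restr YR (gh i k m * (yl k * dY (Inl m) a)) = gh i k m * (yl k * dY (Inl m) (restr YR a))" for k m
    by (simp add: restr_mult restr_X restr_dY restr_fibre_const[OF _ YR_subset] fc_gh)
  moreover have "restr YR (dZ (Inl i) a) = dZ (Inl i) (restr YR a)" by (auto intro: restr_dY)
  ultimately show ?thesis
    by (simp add: nab_def sum_UNIV_Plus \<Gamma>_pure restr_diff restr_sum)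
qed

lemma restr_nab_anti: "restr YL (nb (Inr l) a) = nb (Inr l) (restr YL a)"
proof -
  have "restr YL (ga l k m * (yr k * dY (Inr m) a)) = ga l k m * (yr k * dY (Inr m) (restr YL a))" for k m
    by (simp add: restr_mult restr_X restr_dY restr_fibre_const[OF _ YL_subset] fc_ga)
  moreover have "restr YL (dZ (Inr l) a) = dZ (Inr l) (restr YL a)" by (auto intro: restr_dY)
  ultimately show ?thesis
    by (simp add: nab_def sum_UNIV_Plus \<Gamma>_pure restr_diff restr_sum)
qed

text \<open>By \<open>dd_curv_anti\<close> it satisfies a homogeneous Euler equation in the y^i, and
  it has no part without y^i because \<open>I\<close> has none and the operations involved keep it
  that way. So uniqueness applies.\<close>

lemma curv_anti_0: "curv_anti l m = 0"
proof (rule euler_unique[where w = fw and S = YL])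
  have "restr YL (dd (Inr l) (I m)) = 0" for l m
  proof -
    have "restr YL (dY (Inr l) (I m)) = 0" by (subst restr_dY) (auto simp: I_restr)
    then show ?thesis by (simp add: dd_def restr_diff restr_nab_anti I_restr)
  qed
  then have "restr YL (curv_anti l m) = 0"
    by (simp add: curv_anti_def restr_add restr_diff restr_br I_restr)
  then show "mcoeff (curv_anti l m) e = 0" if "sum e YL = 0" for e
    using that by (simp add: restr_eq_0_iff)
  fix n assume n: "vanishes fw n (curv_anti l m)"
  have "euler YL (curv_anti l m) = (\<Sum>i\<in>UNIV. yl i * nb (Inl i) (curv_anti l m))"
    unfolding euler_def sum_YL using dd_curv_anti[of _ l m] by (simp add: dd_def)
  then show "vanishes fw (Suc n) (euler YL (curv_anti l m))"
    using n by (auto intro!: vanishes_sum vanishes_X_mult[where m = n] vanishes_fw_nab)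
qed

lemma fd_commute: "fd B (fd C a) = fd C (fd B a)"
proof -
  have hh: "fd (Inl i) (fd (Inl j) a) = fd (Inl j) (fd (Inl i) a)" for i j a
    using dd_commutator[of "Inl i" "Inl j" a] curvature_hol[of i j a] by simp
  have aa: "fd (Inr l) (fd (Inr m) a) = fd (Inr m) (fd (Inr l) a)" for l m a
  proof -
    have "fd (Inr l) (fd (Inr m) a) - fd (Inr m) (fd (Inr l) a) =
        br (dd (Inr l) (I m)) a - br (dd (Inr m) (I l)) a + (br (I l) (br (I m) a) - br (I m) (br (I l) a))"
      by (simp add: dd_add dd_br br_add dd_anti_commute[of l m])
    also have "\<dots> = br (curv_anti l m) a"
      unfolding curv_anti_def br_add br_diff using br_jacobi[of "I l" "I m" a] by simp
    finally show ?thesis by (simp add: curv_anti_0)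
  qed
  show ?thesis
    using hh aa fd_commute_mixed by (cases B; cases C) (simp_all only:)
qed

text \<open>Flatness of \<open>a\<close> reads \<open>dY B a = fx B a\<close>. Contraction with the fibre variables turns it into the
  fixed point equation \<open>euler a = \<Sum>\<^sub>B y\<^sup>B fx B a\<close>, whose right-hand side raises the weight.\<close>

definition fx :: "'n + 'n \<Rightarrow> ('n + 'n) wvar mps \<Rightarrow> ('n + 'n) wvar mps" where
  "fx B a = (case B of Inl i \<Rightarrow> nb (Inl i) a | Inr l \<Rightarrow> nb (Inr l) a + br (I l) a)"

lemma fx_simps [simp]: "fx (Inl i) a = nb (Inl i) a" "fx (Inr l) a = nb (Inr l) a + br (I l) a"
  by (simp_all add: fx_def)

lemma fx_diff: "fx B (a - b) = fx B a - fx B b"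
  by (cases B) (simp_all add: nab_diff br_diff)

lemma fd_eq: "fd B a = fx B a - dY B a"
  by (cases B) (simp_all add: dd_def)

lemma vanishes_fx: "vanishes fw n a \<Longrightarrow> vanishes fw n (fx B a)"
proof (cases B)
  case (Inr l)
  assume n: "vanishes fw n a"
  have "vanishes fw n (br (I l) a)"
    using vanishes_br[OF vanishes_I n] by (rule vanishes_mono) simp
  then show ?thesis using n Inr by (simp add: vanishes_add vanishes_fw_nab)
qed (simp add: vanishes_fw_nab)

text \<open>The one-form with components \<open>fd B s\<close> has zero contraction by the
  hypothesis, and it is closed because the components of the connection commute.\<close>

theorem fixpoint_flat:
  assumes "euler YA s = (\<Sum>B\<in>UNIV. X (Yv B) * fx B s)"
  shows "fd B s = 0"
proof -
  define A where "A v = (case v of Inl (Inr B) \<Rightarrow> fd B s | _ \<Rightarrow> 0)" for v :: "('n + 'n) wvar"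
  define P where "P v = (case v of Inl (Inr B) \<Rightarrow> fx B | _ \<Rightarrow> (\<lambda>_. 0))" for v :: "('n + 'n) wvar"
  have [simp]: "A (Yv B) = fd B s" "P (Yv B) = fx B" for B
    by (simp_all add: A_def P_def)
  have "A (Yv B) = 0"
  proof (rule koszul_kernel[where S = YA and w = fw and P = P and A = A])
    show "(\<Sum>B\<in>YA. X B * A B) = 0"
      using assms by (simp add: sum_YA fd_eq right_diff_distrib sum_subtractf euler_def)
    show "P B (A C) - pd B (A C) = P C (A B) - pd C (A B)" if "B \<in> YA" "C \<in> YA" for B C
      using that fd_commute by (auto simp flip: fd_eq)
    show "\<And>B n a. B \<in> YA \<Longrightarrow> vanishes fw n a \<Longrightarrow> vanishes fw n (P B a)"
      by (auto intro: vanishes_fx)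
  qed auto
  then show ?thesis by simp
qed

lemma fixpoint_unique:
  assumes "euler YA s = (\<Sum>B\<in>UNIV. X (Yv B) * fx B s)" "euler YA t = (\<Sum>B\<in>UNIV. X (Yv B) * fx B t)"
    and "restr YA s = restr YA t"
  shows "s = t"
proof -
  have "s - t = 0"
  proof (rule euler_unique[where w = fw and S = YA])
    have "restr YA (s - t) = 0" by (simp add: restr_diff assms(3))
    then show "mcoeff (s - t) e = 0" if "sum e YA = 0" for e
      using that by (simp only: restr_eq_0_iff)
    fix n assume n: "vanishes fw n (s - t)"
    have "euler YA (s - t) = (\<Sum>B\<in>UNIV. X (Yv B) * fx B (s - t))"
      using assms(1,2) by (simp add: euler_def right_diff_distrib sum_subtractf fx_diff)
    then show "vanishes fw (Suc n) (euler YA (s - t))"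
      using n by (auto intro!: vanishes_sum vanishes_X_mult[where m = n] vanishes_fx)
  qed
  then show ?thesis by simp
qed

lemma fibre_const_restr: "fibre_const (restr YA a)"
  by (simp add: fibre_const_def pd_restr)

lemma flat_antiholomorphic:
  assumes flat: "\<And>i. fd (Inl i) a = 0" and f: "\<And>i. dZ (Inl i) (restr YA a) = 0"
  shows "restr YR a = restr YA a"
proof -
  have "restr YR a - restr YA a = 0" (is "?E = 0")
  proof (rule euler_unique[where w = fw and S = YL])
    have "restr YL ?E = 0"
      by (simp add: restr_diff restr_restr YA_eq Un_absorb1[OF YL_subset])
    then show "mcoeff ?E e = 0" if "sum e YL = 0" for e
      using that by (simp only: restr_eq_0_iff)
    fix n assume n: "vanishes fw n ?E"
    \<comment> \<open>Discarding the bar y^j commutes with the holomorphic derivatives since the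
      Christoffel symbols do not mix types. The subtracted symbol satisfies the same equation with
      both sides zero, by \<open>f\<close>.\<close>
    have "dY (Inl i) ?E = nb (Inl i) ?E" for i
    proof -
      have "dY (Inl i) (restr YR a) = restr YR (nb (Inl i) a)"
        using flat[of i] by (subst restr_dY[symmetric]) (auto simp: dd_def)
      then show ?thesis
        using f[of i] by (simp add: restr_nab_hol nab_diff pd_restr nab_fibre_const fibre_const_restr)
    qed
    then have "euler YL ?E = (\<Sum>i\<in>UNIV. yl i * nb (Inl i) ?E)"
      by (simp only: euler_def sum_YL)
    then show "vanishes fw (Suc n) (euler YL ?E)"
      using n by (auto intro!: vanishes_sum vanishes_X_mult[where m = n] vanishes_fw_nab)
  qed
  then show ?thesis by simp
qed

lemma flat_holomorphic:
  assumes flat: "\<And>l. fd (Inr l) b = 0" and h: "\<And>l. dZ (Inr l) (restr YA b) = 0"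
  shows "restr YL b = restr YA b"
proof -
  \<comment> \<open>Since \<open>I l\<close> vanishes at y = 0, the bracket modulo y depends only on
    \<open>b\<close> modulo y. The flatness equation thus closes up on the part of \<open>b\<close>
    without y^i.\<close>
  have br_restr: "restr YL (br (I l) b) = restr YL (br (I l) (restr YL b))" for l
  proof -
    have "restr YL (br (I l) (b - restr YL b)) = 0"
      by (rule restr_br) (simp_all add: I_restr restr_diff restr_restr)
    then show ?thesis by (simp add: br_diff restr_diff)
  qed
  have "restr YL b - restr YA b = 0" (is "?E = 0")
  proof (rule euler_unique[where w = fw and S = YR])
    have "restr YR ?E = 0"
      by (simp add: restr_diff restr_restr YA_eq Un_absorb1[OF YR_subset])
    then show "mcoeff ?E e = 0" if "sum e YR = 0" for e
      using that by (simp only: restr_eq_0_iff)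
    fix n assume n: "vanishes fw n ?E"
    have "dY (Inr l) ?E = nb (Inr l) ?E + restr YL (br (I l) ?E)" for l
    proof -
      have "nb (Inr l) b + br (I l) b - dY (Inr l) b = 0"
        using flat[of l] by (simp add: dd_def algebra_simps)
      then have "dY (Inr l) b = nb (Inr l) b + br (I l) b" by simp
      then have "dY (Inr l) (restr YL b) = restr YL (nb (Inr l) b + br (I l) b)"
        by (subst restr_dY[symmetric]) auto
      then show ?thesis
        using h[of l] br_restr[of l]
        by (simp add: restr_nab_anti nab_diff pd_restr nab_fibre_const fibre_const_restr br_diff
            br_fibre_const restr_add)
    qed
    then have "euler YR ?E = (\<Sum>l\<in>UNIV. yr l * (nb (Inr l) ?E + restr YL (br (I l) ?E)))"
      by (simp only: euler_def sum_YR)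
    moreover have "vanishes fw n (br (I l) ?E)" for l
      using vanishes_br[OF vanishes_I n] by (rule vanishes_mono) simp
    ultimately show "vanishes fw (Suc n) (euler YR ?E)"
      using n by (auto intro!: vanishes_sum vanishes_X_mult[where m = n] vanishes_add vanishes_fw_nab vanishes_restr)
  qed
  then show ?thesis by simp
qed

theorem flat_wick:
  assumes "(\<forall>i. fd (Inl i) a = 0 \<and> dZ (Inl i) (restr YA a) = 0) \<or>
    (\<forall>l. fd (Inr l) b = 0 \<and> dZ (Inr l) (restr YA b) = 0)"
  shows "restr YA (star a b) = restr YA a * restr YA b"
proof -
  have "restr YA (Phi (Suc k) a b) = 0" for k
  proof -
    have "restr YA (Phi k (dY (Inl i) a) (dY (Inr j) b)) = 0" for i j
      using assms
    proof
      assume "\<forall>i. fd (Inl i) a = 0 \<and> dZ (Inl i) (restr YA a) = 0"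
      then have "restr YR a = restr YA a" by (intro flat_antiholomorphic) blast+
      then have "restr YR (dY (Inl i) a) = 0"
        by (subst restr_dY) (auto simp: pd_restr)
      then have "restr YL (restr YR (Phi k (dY (Inl i) a) (dY (Inr j) b))) = 0"
        by (simp add: restr_Phi_left)
      then show ?thesis by (simp add: restr_restr YA_eq)
    next
      assume "\<forall>l. fd (Inr l) b = 0 \<and> dZ (Inr l) (restr YA b) = 0"
      then have "restr YL b = restr YA b" by (intro flat_holomorphic) blast+
      then have "restr YL (dY (Inr j) b) = 0"
        by (subst restr_dY) (auto simp: pd_restr)
      then have "restr YR (restr YL (Phi k (dY (Inl i) a) (dY (Inr j) b))) = 0"
        by (simp add: restr_Phi_right)
      then show ?thesis by (simp add: restr_restr YA_eq)
    qed
    then show ?thesis unfolding Phi_Suc by (simp add: restr_sum restr_mult)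
  qed
  then have "restr YA (K (1 / fact k) * Phi k a b) = (if k = 0 then restr YA a * restr YA b else 0)" for k
    by (cases k) (simp_all add: restr_mult del: Phi.simps(2))
  then have "restr YA (star a b) = hsum (\<lambda>k. if k = 0 then restr YA a * restr YA b else 0)"
    unfolding star_def by (subst restr_hsum) auto
  then show ?thesis by (subst (asm) hsum_unfold) simp
qed

end

section \<open>Smooth functions\<close>

lemma has_derivative_cong_open:
  assumes "open S" "z \<in> S" "\<And>w. w \<in> S \<Longrightarrow> f w = h w"
  shows "(f has_derivative F) (at z) \<longleftrightarrow> (h has_derivative F) (at z)"
  using assms has_derivative_transform_within_open[of f F z UNIV S h]
    has_derivative_transform_within_open[of h F z UNIV S f] by auto

lemma frechet_derivative_cong_open:
  assumes "open S" "z \<in> S" "\<And>w. w \<in> S \<Longrightarrow> f w = h w"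
  shows "frechet_derivative f (at z) = frechet_derivative h (at z)"
  using has_derivative_cong_open[OF assms] by (simp add: frechet_derivative_def)

text \<open>Finite approximations of the coinductive \<open>cinf_on\<close>. Closure under products,
  inverses and compositions is shown by induction on the order, where sums of several terms in the
  derivative cause no difficulty.\<close>

primrec Ck :: "nat \<Rightarrow> (complex^'n::finite) set \<Rightarrow> (complex^'n \<Rightarrow> complex) \<Rightarrow> bool" where
  "Ck 0 S f = True"
| "Ck (Suc n) S f = ((\<forall>z\<in>S. f differentiable (at z)) \<and> (\<forall>v. Ck n S (\<lambda>z. frechet_derivative f (at z) v)))"

lemma cinf_on_iff_Ck: "cinf_on S f \<longleftrightarrow> (\<forall>n. Ck n S f)"
proof
  have "Ck n S f" if "cinf_on S f" for n
    using that
  proof (induction n arbitrary: f)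
    case (Suc n)
    from Suc.prems show ?case by (cases rule: cinf_on.cases) (simp add: Suc.IH)
  qed simp
  then show "cinf_on S f \<Longrightarrow> \<forall>n. Ck n S f" by blast
next
  assume "\<forall>n. Ck n S f"
  then show "cinf_on S f"
  proof (coinduction arbitrary: f)
    case cinf_on
    then have "Ck (Suc n) S f" for n by blast
    then show ?case by auto
  qed
qed

lemma Ck_cong:
  assumes "open S" "\<And>w. w \<in> S \<Longrightarrow> f w = h w" "Ck n S f"
  shows "Ck n S h"
  using assms(2,3)
proof (induction n arbitrary: f h)
  case (Suc n)
  have "h differentiable (at z)" if z: "z \<in> S" for z
  proof -
    obtain D where "(f has_derivative D) (at z)"
      using Suc.prems(2) z by (auto simp: differentiable_def)
    then have "(h has_derivative D) (at z)"
      using has_derivative_cong_open[OF assms(1) z, of f h] Suc.prems(1) by blast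
    then show ?thesis unfolding differentiable_def by blast
  qed
  moreover have "Ck n S (\<lambda>z. frechet_derivative h (at z) v)" for v
  proof (rule Suc.IH)
    show "Ck n S (\<lambda>z. frechet_derivative f (at z) v)" using Suc.prems by simp
  qed (simp add: frechet_derivative_cong_open[OF assms(1) _ Suc.prems(1)])
  ultimately show ?case by simp
qed simp

lemma Ck_Suc_imp: "Ck (Suc n) S f \<Longrightarrow> Ck n S f"
  by (induction n arbitrary: f) auto

lemma Ck_SucI:
  assumes "open S" "\<And>z. z \<in> S \<Longrightarrow> (f has_derivative D z) (at z)" "\<And>v. Ck n S (\<lambda>z. D z v)"
  shows "Ck (Suc n) S f"
proof -
  have "frechet_derivative f (at z) = D z" if "z \<in> S" for z
    using frechet_derivative_at[OF assms(2)[OF that]] by simp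
  then have "Ck n S (\<lambda>z. frechet_derivative f (at z) v)" for v
    using Ck_cong[OF assms(1) _ assms(3)[of v]] by simp
  then show ?thesis using assms(2) by (auto simp: differentiable_def)
qed

lemma Ck_SucD:
  assumes "Ck (Suc n) S f" "z \<in> S"
  shows "(f has_derivative frechet_derivative f (at z)) (at z)"
  using assms frechet_derivative_works by (simp add: frechet_derivative_works)

lemma Ck_const: "open S \<Longrightarrow> Ck n S (\<lambda>_. c)"
  by (induction n arbitrary: c) (auto intro!: Ck_SucI[where D = "\<lambda>_ _. 0"] simp del: Ck.simps(2))

lemma Ck_add: "open S \<Longrightarrow> Ck n S f \<Longrightarrow> Ck n S h \<Longrightarrow> Ck n S (\<lambda>z. f z + h z)"
proof (induction n arbitrary: f h)
  case (Suc n)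
  show ?case
  proof (rule Ck_SucI[OF Suc.prems(1)])
    show "((\<lambda>z. f z + h z) has_derivative
        (\<lambda>v. frechet_derivative f (at z) v + frechet_derivative h (at z) v)) (at z)" if "z \<in> S" for z
      by (intro has_derivative_add Ck_SucD[OF Suc.prems(2) that] Ck_SucD[OF Suc.prems(3) that])
  qed (use Suc in simp)
qed simp

lemma Ck_mult: "open S \<Longrightarrow> Ck n S f \<Longrightarrow> Ck n S h \<Longrightarrow> Ck n S (\<lambda>z. f z * h z)"
proof (induction n arbitrary: f h)
  case (Suc n)
  show ?case
  proof (rule Ck_SucI[OF Suc.prems(1)])
    show "((\<lambda>z. f z * h z) has_derivative
        (\<lambda>v. f z * frechet_derivative h (at z) v + frechet_derivative f (at z) v * h z)) (at z)" if "z \<in> S" for z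
      by (intro has_derivative_mult Ck_SucD[OF Suc.prems(2) that] Ck_SucD[OF Suc.prems(3) that])
    show "Ck n S (\<lambda>z. f z * frechet_derivative h (at z) v + frechet_derivative f (at z) v * h z)" for v
      using Suc.prems Ck_Suc_imp[OF Suc.prems(2)] Ck_Suc_imp[OF Suc.prems(3)]
      by (intro Ck_add Suc.IH) auto
  qed
qed simp

lemma Ck_cnj: "open S \<Longrightarrow> Ck n S f \<Longrightarrow> Ck n S (\<lambda>z. cnj (f z))"
proof (induction n arbitrary: f)
  case (Suc n)
  show ?case
  proof (rule Ck_SucI[OF Suc.prems(1)])
    show "((\<lambda>z. cnj (f z)) has_derivative (\<lambda>v. cnj (frechet_derivative f (at z) v))) (at z)" if "z \<in> S" for z
      by (rule has_derivative_cnj[OF Ck_SucD[OF Suc.prems(2) that]])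
  qed (use Suc in simp)
qed simp

lemma Ck_inverse:
  assumes "open S" "\<And>z. z \<in> S \<Longrightarrow> f z \<noteq> 0"
  shows "Ck n S f \<Longrightarrow> Ck n S (\<lambda>z. inverse (f z))"
proof (induction n)
  case (Suc n)
  show ?case
  proof (rule Ck_SucI[OF assms(1)])
    show "((\<lambda>z. inverse (f z)) has_derivative
        (\<lambda>v. (- 1) * (inverse (f z) * frechet_derivative f (at z) v * inverse (f z)))) (at z)" if "z \<in> S" for z
      using Deriv.has_derivative_inverse[OF assms(2)[OF that] Ck_SucD[OF Suc.prems that]] by simp
    show "Ck n S (\<lambda>z. (- 1) * (inverse (f z) * frechet_derivative f (at z) v * inverse (f z)))" for v
      using Suc.prems Suc.IH Ck_Suc_imp[OF Suc.prems]
      by (intro Ck_mult Ck_const assms(1)) auto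
  qed
qed simp

lemma Ck_component: "open S \<Longrightarrow> Ck n S (\<lambda>z. z $ i)"
proof (cases n)
  case (Suc m)
  assume S: "open S"
  show ?thesis
    unfolding Suc
  proof (rule Ck_SucI[OF S])
    show "((\<lambda>z. z $ i) has_derivative (\<lambda>v. v $ i)) (at z)" for z :: "complex^'a"
      by (rule bounded_linear.has_derivative[OF bounded_linear_vec_nth]) simp
  qed (rule Ck_const[OF S])
qed simp

lemma cinf_on_const: "open S \<Longrightarrow> cinf_on S (\<lambda>_. c)"
  and cinf_on_add: "open S \<Longrightarrow> cinf_on S f \<Longrightarrow> cinf_on S h \<Longrightarrow> cinf_on S (\<lambda>z. f z + h z)"
  and cinf_on_mult: "open S \<Longrightarrow> cinf_on S f \<Longrightarrow> cinf_on S h \<Longrightarrow> cinf_on S (\<lambda>z. f z * h z)"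
  and cinf_on_cnj: "open S \<Longrightarrow> cinf_on S f \<Longrightarrow> cinf_on S (\<lambda>z. cnj (f z))"
  and cinf_on_inverse: "open S \<Longrightarrow> (\<And>z. z \<in> S \<Longrightarrow> f z \<noteq> 0) \<Longrightarrow> cinf_on S f \<Longrightarrow> cinf_on S (\<lambda>z. inverse (f z))"
  and cinf_on_component: "open S \<Longrightarrow> cinf_on S (\<lambda>z. z $ i)"
  by (simp_all add: cinf_on_iff_Ck Ck_const Ck_add Ck_mult Ck_cnj Ck_inverse Ck_component)

lemma cinf_on_cong:
  assumes "open S" "\<And>w. w \<in> S \<Longrightarrow> f w = h w" "cinf_on S f"
  shows "cinf_on S h"
  using Ck_cong[OF assms(1,2)] assms(3) by (simp add: cinf_on_iff_Ck)

lemma cinf_on_uminus: "open S \<Longrightarrow> cinf_on S f \<Longrightarrow> cinf_on S (\<lambda>z. - f z)"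
  using cinf_on_mult[of S "\<lambda>_. -1" f] cinf_on_const[of S "-1"] by simp

lemma cinf_on_diff: "open S \<Longrightarrow> cinf_on S f \<Longrightarrow> cinf_on S h \<Longrightarrow> cinf_on S (\<lambda>z. f z - h z)"
  using cinf_on_add[of S f "\<lambda>z. - h z"] cinf_on_uminus[of S h] by simp

lemma cinf_on_divide_const: "open S \<Longrightarrow> cinf_on S f \<Longrightarrow> cinf_on S (\<lambda>z. f z / c)"
  using cinf_on_mult[of S "\<lambda>_. inverse c" f] cinf_on_const[of S "inverse c"]
  by (simp add: divide_inverse mult.commute)

lemma cinf_on_sum: "open S \<Longrightarrow> (\<And>x. x \<in> A \<Longrightarrow> cinf_on S (f x)) \<Longrightarrow> cinf_on S (\<lambda>z. \<Sum>x\<in>A. f x z)"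
  by (induction A rule: infinite_finite_induct) (auto intro: cinf_on_add cinf_on_const)

lemma cinf_on_prod: "open S \<Longrightarrow> (\<And>x. x \<in> A \<Longrightarrow> cinf_on S (f x)) \<Longrightarrow> cinf_on S (\<lambda>z. \<Prod>x\<in>A. f x z)"
  by (induction A rule: infinite_finite_induct) (auto intro: cinf_on_mult cinf_on_const)

lemma cinf_on_subset:
  assumes "cinf_on S f" "T \<subseteq> S"
  shows "cinf_on T f"
proof -
  have "Ck n S f \<Longrightarrow> Ck n T f" for n
    using assms(2) by (induction n arbitrary: f) auto
  then show ?thesis using assms(1) by (simp add: cinf_on_iff_Ck)
qed

lemma cinf_on_has_derivative:
  "cinf_on S f \<Longrightarrow> z \<in> S \<Longrightarrow> (f has_derivative frechet_derivative f (at z)) (at z)"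
  using Ck_SucD[of 0 S f z] by (simp add: cinf_on_iff_Ck del: Ck.simps)

lemma cinf_on_frechet: "cinf_on S f \<Longrightarrow> cinf_on S (\<lambda>z. frechet_derivative f (at z) v)"
  by (auto elim: cinf_on.cases)

lemma cinf_on_wirt: "open S \<Longrightarrow> cinf_on S f \<Longrightarrow> cinf_on S (wirt B f)"
proof -
  assume S: "open S" and f: "cinf_on S f"
  have 1: "wirt (Inl i) f = (\<lambda>z. (frechet_derivative f (at z) (axis i 1) - \<i> * frechet_derivative f (at z) (axis i \<i>)) / 2)"
    "wirt (Inr i) f = (\<lambda>z. (frechet_derivative f (at z) (axis i 1) + \<i> * frechet_derivative f (at z) (axis i \<i>)) / 2)" for i
    by (simp_all add: fun_eq_iff)
  show ?thesis
    by (cases B) (simp_all only: 1 cinf_on_divide_const cinf_on_diff cinf_on_add cinf_on_mult cinf_on_const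
        cinf_on_frechet S f)
qed

lemma cinf_on_continuous: "cinf_on S f \<Longrightarrow> z \<in> S \<Longrightarrow> isCont f z"
  by (rule has_derivative_continuous[OF cinf_on_has_derivative])

subsection \<open>Symmetry of second derivatives\<close>

text \<open>The mean value theorem, applied once in each direction. It is available for real values
  only, hence the functional \<open>l\<close>, for which the real and the imaginary part are taken
  later.\<close>

lemma second_difference:
  fixes f :: "complex^'n::finite \<Rightarrow> complex" and l :: "complex \<Rightarrow> real"
  assumes l: "bounded_linear l" and f: "cinf_on S f" and s: "0 < s"
    and seg: "\<And>x y. 0 \<le> x \<Longrightarrow> x \<le> s \<Longrightarrow> 0 \<le> y \<Longrightarrow> y \<le> s \<Longrightarrow> z + (x *\<^sub>R u + y *\<^sub>R v) \<in> S"
  obtains x y where "0 < x" "x < s" "0 < y" "y < s"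
    "l (f (z + (s *\<^sub>R u + s *\<^sub>R v))) - l (f (z + s *\<^sub>R u)) - l (f (z + s *\<^sub>R v)) + l (f z) =
      s * s * l (frechet_derivative (\<lambda>w. frechet_derivative f (at w) u) (at (z + (x *\<^sub>R u + y *\<^sub>R v))) v)"
proof -
  define f1 where "f1 w = frechet_derivative f (at w) u" for w
  define f2 where "f2 w = frechet_derivative f1 (at w) v" for w
  have f1: "cinf_on S f1" unfolding f1_def by (rule cinf_on_frechet[OF f])
  have d1: "((\<lambda>x. l (f (z + (x *\<^sub>R u + y *\<^sub>R v)))) has_real_derivative l (f1 (z + (x *\<^sub>R u + y *\<^sub>R v)))) (at x)"
    if "0 \<le> x" "x \<le> s" "0 \<le> y" "y \<le> s" for x y
  proof -
    let ?p = "z + (x *\<^sub>R u + y *\<^sub>R v)"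
    have "((\<lambda>x. l (f (z + (x *\<^sub>R u + y *\<^sub>R v)))) has_derivative
        (\<lambda>h. l (frechet_derivative f (at ?p) (h *\<^sub>R u)))) (at x)"
      by (rule bounded_linear.has_derivative[OF l],
          rule has_derivative_compose[where f = "\<lambda>x. z + (x *\<^sub>R u + y *\<^sub>R v)" and f' = "\<lambda>h. h *\<^sub>R u"],
          auto intro!: derivative_eq_intros intro: cinf_on_has_derivative[OF f seg[OF that]])
    moreover have "l (frechet_derivative f (at ?p) (h *\<^sub>R u)) = l (f1 ?p) * h" for h
      using cinf_on_has_derivative[OF f seg[OF that]] bounded_linear.linear[OF l]
      by (simp add: f1_def linear_cmul[OF has_derivative_linear] linear_cmul mult.commute)
    ultimately show ?thesis by (simp add: has_field_derivative_def)
  qed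
  have d2: "((\<lambda>y. l (f1 (z + (x *\<^sub>R u + y *\<^sub>R v)))) has_real_derivative l (f2 (z + (x *\<^sub>R u + y *\<^sub>R v)))) (at y)"
    if "0 \<le> x" "x \<le> s" "0 \<le> y" "y \<le> s" for x y
  proof -
    let ?p = "z + (x *\<^sub>R u + y *\<^sub>R v)"
    have "((\<lambda>y. l (f1 (z + (x *\<^sub>R u + y *\<^sub>R v)))) has_derivative
        (\<lambda>h. l (frechet_derivative f1 (at ?p) (h *\<^sub>R v)))) (at y)"
      by (rule bounded_linear.has_derivative[OF l],
          rule has_derivative_compose[where f = "\<lambda>y. z + (x *\<^sub>R u + y *\<^sub>R v)" and f' = "\<lambda>h. h *\<^sub>R v"],
          auto intro!: derivative_eq_intros intro: cinf_on_has_derivative[OF f1 seg[OF that]])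
    moreover have "l (frechet_derivative f1 (at ?p) (h *\<^sub>R v)) = l (f2 ?p) * h" for h
      using cinf_on_has_derivative[OF f1 seg[OF that]] bounded_linear.linear[OF l]
      by (simp add: f2_def linear_cmul[OF has_derivative_linear] linear_cmul mult.commute)
    ultimately show ?thesis by (simp add: has_field_derivative_def)
  qed
  have "\<exists>x>0. x < s \<and> (l (f (z + (s *\<^sub>R u + s *\<^sub>R v))) - l (f (z + (s *\<^sub>R u + 0 *\<^sub>R v)))) -
      (l (f (z + (0 *\<^sub>R u + s *\<^sub>R v))) - l (f (z + (0 *\<^sub>R u + 0 *\<^sub>R v)))) =
      (s - 0) * (l (f1 (z + (x *\<^sub>R u + s *\<^sub>R v))) - l (f1 (z + (x *\<^sub>R u + 0 *\<^sub>R v))))"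
    using s by (intro MVT2 DERIV_diff d1) auto
  then obtain x where x: "0 < x" "x < s"
    "l (f (z + (s *\<^sub>R u + s *\<^sub>R v))) - l (f (z + s *\<^sub>R u)) - l (f (z + s *\<^sub>R v)) + l (f z) =
      s * (l (f1 (z + (x *\<^sub>R u + s *\<^sub>R v))) - l (f1 (z + (x *\<^sub>R u + 0 *\<^sub>R v))))" by auto
  have "\<exists>y>0. y < s \<and> l (f1 (z + (x *\<^sub>R u + s *\<^sub>R v))) - l (f1 (z + (x *\<^sub>R u + 0 *\<^sub>R v))) =
      (s - 0) * l (f2 (z + (x *\<^sub>R u + y *\<^sub>R v)))"
    using s x by (intro MVT2 d2) auto
  then obtain y where "0 < y" "y < s" "l (f1 (z + (x *\<^sub>R u + s *\<^sub>R v))) - l (f1 (z + (x *\<^sub>R u + 0 *\<^sub>R v))) =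
      s * l (f2 (z + (x *\<^sub>R u + y *\<^sub>R v)))" by auto
  with x that show ?thesis by (simp add: f2_def f1_def[abs_def])
qed

lemma frechet_derivative_symmetric:
  assumes S: "open S" "z \<in> S" and f: "cinf_on S f"
  shows "frechet_derivative (\<lambda>w. frechet_derivative f (at w) u) (at z) v =
    frechet_derivative (\<lambda>w. frechet_derivative f (at w) v) (at z) u"
proof -
  define g where "g w = frechet_derivative (\<lambda>w. frechet_derivative f (at w) u) (at w) v" for w
  define h where "h w = frechet_derivative (\<lambda>w. frechet_derivative f (at w) v) (at w) u" for w
  have cont: "isCont g z" "isCont h z"
    unfolding g_def[abs_def] h_def[abs_def] using f S(2) by (auto intro!: cinf_on_continuous cinf_on_frechet)
  have "l (g z) = l (h z)" if l: "bounded_linear l" for l :: "complex \<Rightarrow> real"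
  proof (rule ccontr)
    assume ne: "l (g z) \<noteq> l (h z)"
    define d where "d = \<bar>l (g z) - l (h z)\<bar> / 2"
    have d: "0 < d" using ne by (simp add: d_def)
    have "isCont (\<lambda>w. l (g w)) z" "isCont (\<lambda>w. l (h w)) z"
      using cont by (auto intro: bounded_linear.isCont[OF l])
    then obtain r1 r2 where r: "r1 > 0" "\<And>w. dist w z < r1 \<Longrightarrow> \<bar>l (g w) - l (g z)\<bar> < d"
      "r2 > 0" "\<And>w. dist w z < r2 \<Longrightarrow> \<bar>l (h w) - l (h z)\<bar> < d"
      using d unfolding continuous_at_eps_delta dist_real_def by metis
    obtain r3 where r3: "r3 > 0" "ball z r3 \<subseteq> S" using S openE by blast
    define r where "r = min r1 (min r2 r3)"
    have r0: "r > 0" using r r3 by (simp add: r_def)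
    \<comment> \<open>Small enough for the parallelogram spanned by the scaled vectors to stay
      within distance \<open>r\<close> of \<open>z\<close>; the summand 1 keeps the divisor positive
      when both vectors are zero.\<close>
    define s where "s = r / (2 * (norm u + norm v + 1))"
    have nuv: "0 < norm u + norm v + 1" by (simp add: add_nonneg_pos)
    have s: "s > 0" using r0 nuv by (simp add: s_def)
    have near: "dist (z + (x *\<^sub>R a + y *\<^sub>R b)) z < r"
      if "0 \<le> x" "x \<le> s" "0 \<le> y" "y \<le> s" "norm a + norm b = norm u + norm v" for x y a b
    proof -
      have "dist (z + (x *\<^sub>R a + y *\<^sub>R b)) z \<le> x * norm a + y * norm b"
        using norm_triangle_ineq[of "x *\<^sub>R a" "y *\<^sub>R b"] that by (simp add: dist_norm)
      also have "\<dots> \<le> s * norm a + s * norm b" using that by (intro add_mono mult_right_mono) auto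
      also have "\<dots> = s * (norm u + norm v)" using that(5) by (simp flip: distrib_left)
      also have "\<dots> < s * (2 * (norm u + norm v + 1))"
      proof (rule mult_strict_left_mono[OF _ s])
        show "norm u + norm v < 2 * (norm u + norm v + 1)"
          by (simp add: algebra_simps add_nonneg_pos)
      qed
      also have "\<dots> = r" using nuv by (simp add: s_def)
      finally show ?thesis .
    qed
    have inS: "z + (x *\<^sub>R a + y *\<^sub>R b) \<in> S"
      if "0 \<le> x" "x \<le> s" "0 \<le> y" "y \<le> s" "norm a + norm b = norm u + norm v" for x y a b
      using near[OF that] r3(2) by (auto simp: r_def dist_commute mem_ball subset_iff)
    obtain x y where 1: "0 < x" "x < s" "0 < y" "y < s"
      "l (f (z + (s *\<^sub>R u + s *\<^sub>R v))) - l (f (z + s *\<^sub>R u)) - l (f (z + s *\<^sub>R v)) + l (f z) =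
        s * s * l (g (z + (x *\<^sub>R u + y *\<^sub>R v)))"
      unfolding g_def by (rule second_difference[OF l f s, of z u v]) (use inS in auto)
    obtain x' y' where 2: "0 < x'" "x' < s" "0 < y'" "y' < s"
      "l (f (z + (s *\<^sub>R v + s *\<^sub>R u))) - l (f (z + s *\<^sub>R v)) - l (f (z + s *\<^sub>R u)) + l (f z) =
        s * s * l (h (z + (x' *\<^sub>R v + y' *\<^sub>R u)))"
      unfolding h_def by (rule second_difference[OF l f s, of z v u]) (use inS in \<open>auto simp: add.commute\<close>)
    have "s * s * l (g (z + (x *\<^sub>R u + y *\<^sub>R v))) = s * s * l (h (z + (x' *\<^sub>R v + y' *\<^sub>R u)))"
      using 1(5) 2(5)[unfolded add.commute[of "s *\<^sub>R v"]] by linarith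
    then have "l (g (z + (x *\<^sub>R u + y *\<^sub>R v))) = l (h (z + (x' *\<^sub>R v + y' *\<^sub>R u)))"
      using s by simp
    moreover have "\<bar>l (g (z + (x *\<^sub>R u + y *\<^sub>R v))) - l (g z)\<bar> < d"
      using near[of x y u v] 1 r by (simp add: r_def)
    moreover have "\<bar>l (h (z + (x' *\<^sub>R v + y' *\<^sub>R u))) - l (h z)\<bar> < d"
      using near[of x' y' v u] 2 r by (simp add: r_def add.commute)
    ultimately have "\<bar>l (g z) - l (h z)\<bar> < 2 * d" by linarith
    then show False by (simp add: d_def)
  qed
  from this[OF bounded_linear_Re] this[OF bounded_linear_Im] show ?thesis
    by (simp add: g_def h_def complex_eq_iff)
qed

section \<open>Wirtinger calculus\<close>

definition widx :: "'n + 'n \<Rightarrow> 'n" where "widx B = (case B of Inl i \<Rightarrow> i | Inr i \<Rightarrow> i)"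
definition wsgn :: "'n + 'n \<Rightarrow> complex" where "wsgn B = (case B of Inl i \<Rightarrow> - \<i> | Inr i \<Rightarrow> \<i>)"

lemma wirt_eq: "wirt B f z = (frechet_derivative f (at z) (axis (widx B) 1) +
    wsgn B * frechet_derivative f (at z) (axis (widx B) \<i>)) / 2"
  by (cases B) (simp_all add: widx_def wsgn_def)

lemma wirt_has_derivative:
  "(f has_derivative F) (at z) \<Longrightarrow> wirt B f z = (F (axis (widx B) 1) + wsgn B * F (axis (widx B) \<i>)) / 2"
  by (simp add: wirt_eq frechet_derivative_at[symmetric])

lemma wirt_const: "wirt B (\<lambda>_. c) z = 0"
  by (simp add: wirt_eq frechet_derivative_const)

lemma wirt_add: "cinf_on S f \<Longrightarrow> cinf_on S h \<Longrightarrow> z \<in> S \<Longrightarrow> wirt B (\<lambda>z. f z + h z) z = wirt B f z + wirt B h z"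
  by (subst wirt_has_derivative[OF has_derivative_add[OF cinf_on_has_derivative cinf_on_has_derivative]], assumption+)
    (simp add: wirt_eq algebra_simps add_divide_distrib)

lemma wirt_mult: "cinf_on S f \<Longrightarrow> cinf_on S h \<Longrightarrow> z \<in> S \<Longrightarrow>
    wirt B (\<lambda>z. f z * h z) z = wirt B f z * h z + f z * wirt B h z"
  by (subst wirt_has_derivative[OF has_derivative_mult[OF cinf_on_has_derivative cinf_on_has_derivative]], assumption+)
    (simp add: wirt_eq algebra_simps add_divide_distrib)

lemma wirt_commute:
  assumes S: "open S" "z \<in> S" and f: "cinf_on S f"
  shows "wirt B (wirt C f) z = wirt C (wirt B f) z"
proof -
  define d where "d v w = frechet_derivative f (at w) v" for v w
  have d: "cinf_on S (d v)" for v unfolding d_def by (rule cinf_on_frechet[OF f])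
  have w: "wirt B f = (\<lambda>w. (d (axis (widx B) 1) w + wsgn B * d (axis (widx B) \<i>) w) * (1/2))" for B
    by (simp add: fun_eq_iff wirt_eq d_def)
  have h: "(wirt B f has_derivative (\<lambda>u. (frechet_derivative (d (axis (widx B) 1)) (at z) u +
      wsgn B * frechet_derivative (d (axis (widx B) \<i>)) (at z) u) * (1/2))) (at z)" for B
    unfolding w
    by (intro has_derivative_mult_left has_derivative_add has_derivative_mult_right
        cinf_on_has_derivative[OF d S(2)])
  have sym: "frechet_derivative (d u) (at z) v = frechet_derivative (d v) (at z) u" for u v
    unfolding d_def[abs_def] by (rule frechet_derivative_symmetric[OF S f])
  show ?thesis
    unfolding wirt_has_derivative[OF h]
    by (simp add: sym[of "axis (widx C) 1" "axis (widx B) 1"] sym[of "axis (widx C) \<i>" "axis (widx B) 1"]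
        sym[of "axis (widx C) 1" "axis (widx B) \<i>"] sym[of "axis (widx C) \<i>" "axis (widx B) \<i>"] algebra_simps)
qed

lemma frechet_derivative_wirt:
  assumes "cinf_on S f" "z \<in> S"
  shows "frechet_derivative f (at z) v = (\<Sum>j\<in>UNIV. wirt (Inl j) f z * v $ j + wirt (Inr j) f z * cnj (v $ j))"
proof -
  define L where "L = frechet_derivative f (at z)"
  have L: "linear L"
    using has_derivative_linear[OF cinf_on_has_derivative[OF assms]] by (simp add: L_def)
  have "v = (\<Sum>j\<in>UNIV. Re (v $ j) *\<^sub>R axis j 1 + Im (v $ j) *\<^sub>R axis j \<i>)"
  proof (rule vec_eq_iff[THEN iffD2], rule allI)
    fix i
    have "(\<Sum>j\<in>UNIV. Re (v $ j) *\<^sub>R axis j 1 + Im (v $ j) *\<^sub>R axis j \<i>) $ i =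
        (\<Sum>j\<in>UNIV. if j = i then Re (v $ j) *\<^sub>R 1 + Im (v $ j) *\<^sub>R \<i> else 0)"
      unfolding sum_component by (intro sum.cong) (auto simp: axis_def)
    then show "v $ i = (\<Sum>j\<in>UNIV. Re (v $ j) *\<^sub>R axis j 1 + Im (v $ j) *\<^sub>R axis j \<i>) $ i"
      by (simp add: complex_eq_iff)
  qed
  then have "L v = L (\<Sum>j\<in>UNIV. Re (v $ j) *\<^sub>R axis j 1 + Im (v $ j) *\<^sub>R axis j \<i>)" by simp
  also have "\<dots> = (\<Sum>j\<in>UNIV. Re (v $ j) *\<^sub>R L (axis j 1) + Im (v $ j) *\<^sub>R L (axis j \<i>))"
    by (simp add: linear_sum[OF L] linear_add[OF L] linear_cmul[OF L])
  also have "\<dots> = (\<Sum>j\<in>UNIV. wirt (Inl j) f z * v $ j + wirt (Inr j) f z * cnj (v $ j))"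
  proof (intro sum.cong refl)
    fix j
    have "of_real (Re c) * a + of_real (Im c) * b = (a - \<i> * b) / 2 * c + (a + \<i> * b) / 2 * cnj c" for a b c :: complex
      by (simp add: complex_eq_iff field_simps)
    from this[of "v $ j" "L (axis j 1)" "L (axis j \<i>)"]
    show "Re (v $ j) *\<^sub>R L (axis j 1) + Im (v $ j) *\<^sub>R L (axis j \<i>) =
        wirt (Inl j) f z * v $ j + wirt (Inr j) f z * cnj (v $ j)"
      by (simp add: L_def scaleR_conv_of_real)
  qed
  finally show ?thesis by (simp add: L_def)
qed

lemma wirt_cnj:
  assumes "cinf_on S f" "z \<in> S"
  shows "wirt (Inl i) (\<lambda>z. cnj (f z)) z = cnj (wirt (Inr i) f z)"
    and "wirt (Inr i) (\<lambda>z. cnj (f z)) z = cnj (wirt (Inl i) f z)"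
  by (subst wirt_has_derivative[OF has_derivative_cnj[OF cinf_on_has_derivative[OF assms]]];
      simp add: widx_def wsgn_def)+

subsection \<open>Taylor coefficients\<close>

text \<open>One derivative is taken at a time, in some direction that still occurs in the exponent.
  Dividing by the current exponent builds up the inverse factorials of a Taylor coefficient. The
  choice of the direction is immaterial by symmetry of second derivatives
  (\<open>jetn_rec\<close>).\<close>

primrec jetn :: "nat \<Rightarrow> (complex^'n::finite \<Rightarrow> complex) \<Rightarrow> complex^'n \<Rightarrow> ('n + 'n \<Rightarrow> nat) \<Rightarrow> complex" where
  "jetn 0 f z e = f z"
| "jetn (Suc d) f z e = (let B = (SOME B. e B \<noteq> 0) in jetn d (wirt B f) z (e(B := e B - 1)) / of_nat (e B))"

definition jet :: "(complex^'n::finite \<Rightarrow> complex) \<Rightarrow> complex^'n \<Rightarrow> ('n + 'n \<Rightarrow> nat) \<Rightarrow> complex" where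
  "jet f z e = jetn (wdeg tot e) f z e"

lemma jetn_cong:
  assumes "open S" "z \<in> S" "\<And>w. w \<in> S \<Longrightarrow> f w = h w"
  shows "jetn d f z e = jetn d h z e"
  using assms(3)
proof (induction d arbitrary: f h e)
  case (Suc d)
  have *: "jetn d (wirt B f) z e = jetn d (wirt B h) z e" for B e
    by (rule Suc.IH) (rule wirt_cong_open[OF assms(1) _ Suc.prems])
  show ?case by (simp only: jetn.simps Let_def *)
qed (use assms(2) in simp)

lemma jet_cong: "open S \<Longrightarrow> z \<in> S \<Longrightarrow> (\<And>w. w \<in> S \<Longrightarrow> f w = h w) \<Longrightarrow> jet f z e = jet h z e"
  unfolding jet_def by (rule jetn_cong)

lemma wdeg_tot_dec: "e B \<noteq> 0 \<Longrightarrow> Suc (wdeg tot (e(B := e B - 1))) = wdeg tot e"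
  using wdeg_tot_upd[of e B "e B - 1"] by simp

lemma jetn_rec:
  assumes "open S" "z \<in> S" "cinf_on S f" "wdeg tot e = Suc d" "e C \<noteq> 0"
  shows "jetn (Suc d) f z e = jetn d (wirt C f) z (e(C := e C - 1)) / of_nat (e C)"
  using assms(3-)
proof (induction d arbitrary: f e C)
  case 0
  define B where "B = (SOME B. e B \<noteq> 0)"
  have B: "e B \<noteq> 0" unfolding B_def by (rule someI) (rule 0)
  have "B = C"
  proof (rule ccontr)
    assume "B \<noteq> C"
    have "e B + e C \<le> sum e UNIV"
      using sum_mono2[of UNIV "{B, C}" e] \<open>B \<noteq> C\<close> by simp
    then show False using 0 B by (simp add: wdeg_tot)
  qed
  then show ?case by (simp add: Let_def B_def)
next
  case (Suc d)
  define B where "B = (SOME B. e B \<noteq> 0)"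
  have B: "e B \<noteq> 0" unfolding B_def by (rule someI) (rule Suc.prems)
  have *: "jetn (Suc (Suc d)) f z e = jetn (Suc d) (wirt B f) z (e(B := e B - 1)) / of_nat (e B)"
    by (simp only: jetn.simps Let_def B_def)
  show ?case
  proof (cases "B = C")
    case False
    define e1 where "e1 = e(B := e B - 1)"
    define e2 where "e2 = e(C := e C - 1)"
    have e12: "e1 C = e C" "e2 B = e B" using False by (simp_all add: e1_def e2_def)
    have w: "wdeg tot e1 = Suc d" "wdeg tot e2 = Suc d"
      using wdeg_tot_dec[of e B, OF B] wdeg_tot_dec[of e C, OF Suc.prems(3)] Suc.prems(2)
      by (simp_all add: e1_def e2_def)
    have 1: "jetn (Suc d) (wirt B f) z e1 =
        jetn d (wirt C (wirt B f)) z (e1(C := e C - 1)) / of_nat (e C)"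
      using Suc.IH[of "wirt B f" e1 C, OF cinf_on_wirt[OF assms(1) Suc.prems(1)] w(1)] Suc.prems(3)
      by (simp only: e12 simp_thms)
    have 2: "jetn (Suc d) (wirt C f) z e2 =
        jetn d (wirt B (wirt C f)) z (e2(B := e B - 1)) / of_nat (e B)"
      using Suc.IH[of "wirt C f" e2 B, OF cinf_on_wirt[OF assms(1) Suc.prems(1)] w(2)] B
      by (simp only: e12 simp_thms)
    have 3: "jetn d (wirt C (wirt B f)) z x = jetn d (wirt B (wirt C f)) z x" for x
      by (rule jetn_cong[OF assms(1,2)]) (rule wirt_commute[OF assms(1) _ Suc.prems(1)])
    have 4: "e1(C := e C - 1) = e2(B := e B - 1)"
      unfolding e1_def e2_def using False by (rule fun_upd_twist)
    show ?thesis unfolding * e1_def[symmetric] e2_def[symmetric] 1 2 3 4 by simp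
  next
    case True
    show ?thesis unfolding * unfolding True ..
  qed
qed

lemma jet_rec:
  assumes "open S" "z \<in> S" "cinf_on S f" "e C \<noteq> 0"
  shows "of_nat (e C) * jet f z e = jet (wirt C f) z (e(C := e C - 1))"
proof -
  obtain d where d: "wdeg tot e = Suc d" using wdeg_tot_dec[of e C] assms(4) by metis
  then have "wdeg tot (e(C := e C - 1)) = d" using wdeg_tot_dec[of e C] assms(4) by simp
  then show ?thesis
    using jetn_rec[OF assms(1-3) d assms(4)] assms(4) by (simp add: jet_def d del: jetn.simps)
qed

lemma jet_zero: "jet f z (\<lambda>_. 0) = f z"
  by (simp add: jet_def)

lemma jet_wirt:
  assumes "open S" "z \<in> S" "cinf_on S f"
  shows "jet (wirt C f) z e = of_nat (e C + 1) * jet f z (e(C := e C + 1))"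
  using jet_rec[OF assms, of "e(C := e C + 1)" C] by simp

text \<open>The step hypothesis ranges over all smooth functions, because passing to a smaller
  exponent replaces the function by one of its derivatives.\<close>

lemma jet_induct [consumes 3, case_names zero step]:
  fixes e :: "'n::finite + 'n \<Rightarrow> nat"
  assumes "open S" "z \<in> S" "cinf_on S f"
    and zero: "\<And>f. cinf_on S f \<Longrightarrow> P f (\<lambda>_. 0)"
    and step: "\<And>f e C. cinf_on S f \<Longrightarrow> e C \<noteq> 0 \<Longrightarrow> (\<And>h. cinf_on S h \<Longrightarrow> P h (e(C := e C - 1))) \<Longrightarrow> P f e"
  shows "P f e"
  using assms(3)
proof (induction "wdeg tot e" arbitrary: f e)
  case 0
  then have "e = (\<lambda>_. 0)" by (auto simp: wdeg_tot)
  then show ?case using zero 0 by simp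
next
  case (Suc d)
  then obtain C where C: "e C \<noteq> 0"
    by (metis Zero_neq_Suc sum.neutral wdeg_tot)
  then have "d = wdeg tot (e(C := e C - 1))" using wdeg_tot_dec[of e C] Suc.hyps(2) by simp
  with Suc C show ?case by (intro step[of f e C]) auto
qed

lemma jet_add:
  assumes S: "open S" "z \<in> S" and "cinf_on S f" "cinf_on S h"
  shows "jet (\<lambda>z. f z + h z) z e = jet f z e + jet h z e"
proof -
  have "\<forall>h. cinf_on S h \<longrightarrow> jet (\<lambda>z. f z + h z) z e = jet f z e + jet h z e"
    using S assms(3)
  proof (induction rule: jet_induct)
    case (zero f)
    then show ?case by (simp add: jet_zero)
  next
    case (step f e C)
    show ?case
    proof (intro allI impI)
      fix h assume h: "cinf_on S h"
      have "of_nat (e C) * jet (\<lambda>z. f z + h z) z e = jet (wirt C (\<lambda>z. f z + h z)) z (e(C := e C - 1))"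
        by (rule jet_rec[where C = C and e = e, OF S cinf_on_add[OF S(1) step(1) h] step(2)])
      also have "\<dots> = jet (\<lambda>z. wirt C f z + wirt C h z) z (e(C := e C - 1))"
        by (rule jet_cong[OF S]) (rule wirt_add[OF step(1) h])
      also have "\<dots> = jet (wirt C f) z (e(C := e C - 1)) + jet (wirt C h) z (e(C := e C - 1))"
        using step(3)[OF cinf_on_wirt[OF S(1) step(1)]] cinf_on_wirt[OF S(1) h] by blast
      also have "\<dots> = of_nat (e C) * (jet f z e + jet h z e)"
        by (simp only: distrib_left jet_rec[where C = C and e = e, OF S step(1,2)]
            jet_rec[where C = C and e = e, OF S h step(2)])
      finally show "jet (\<lambda>z. f z + h z) z e = jet f z e + jet h z e"
        using step(2) by (simp del: fun_upd_apply)
    qed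
  qed
  then show ?thesis using assms by blast
qed

lemma jet_const: "open S \<Longrightarrow> z \<in> S \<Longrightarrow> jet (\<lambda>_. c) z e = (if e = (\<lambda>_. 0) then c else 0)"
proof -
  assume S: "open S" "z \<in> S"
  have "jetn d (\<lambda>_. 0) z e = 0" for d e
  proof (induction d arbitrary: e)
    case (Suc d)
    have *: "wirt B (\<lambda>_. 0) = (\<lambda>_. 0)" for B by (rule ext) (rule wirt_const)
    show ?case by (simp only: jetn.simps Let_def * Suc div_0)
  qed simp
  moreover have *: "wirt B (\<lambda>_. c) = (\<lambda>_. 0)" for B by (rule ext) (rule wirt_const)
  ultimately have "jetn (Suc d) (\<lambda>_. c) z e = 0" for d e by (simp only: jetn.simps Let_def * div_0)
  moreover have "wdeg tot e = 0 \<longleftrightarrow> e = (\<lambda>_. 0)" by (auto simp: wdeg_tot fun_eq_iff)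
  ultimately show ?thesis
    by (cases "wdeg tot e") (auto simp: jet_def simp del: jetn.simps(2))
qed

lemma jet_mult:
  assumes S: "open S" "z \<in> S" and "cinf_on S f" "cinf_on S h"
  shows "jet (\<lambda>z. f z * h z) z e = (\<Sum>p\<le>e. jet f z p * jet h z (e - p))"
proof -
  \<comment> \<open>As a series, the jet turns derivatives into \<open>pd\<close>, so the product
    rule on jets becomes \<open>pd_mult\<close> and no multinomial identity is needed.\<close>
  define J where "J f = Abs_mps (jet f z)" for f
  have J: "mcoeff (J f) e = jet f z e" for f e by (simp add: J_def Abs_mps_inverse)
  have pdJ: "J (wirt C f) = pd C (J f)" if "cinf_on S f" for C f
    by (rule mps_eqI) (simp add: J mcoeff_pd jet_wirt[OF S that])
  have "\<forall>h. cinf_on S h \<longrightarrow> mcoeff (J (\<lambda>z. f z * h z)) e = mcoeff (J f * J h) e"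
    using S assms(3)
  proof (induction rule: jet_induct)
    case (zero f)
    then show ?case by (simp add: jet_zero J mcoeff_mult atMost_def le_fun_def fun_eq_iff
          flip: fun_eq_iff)
  next
    case (step f e C)
    show ?case
    proof (intro allI impI)
      fix h assume h: "cinf_on S h"
      let ?e = "e(C := e C - 1)"
      have cf: "cinf_on S (wirt C f)" "cinf_on S (wirt C h)"
        using step(1) h cinf_on_wirt[OF S(1)] by auto
      have "of_nat (e C) * mcoeff (J (\<lambda>z. f z * h z)) e = mcoeff (J (wirt C (\<lambda>z. f z * h z))) ?e"
        unfolding J by (rule jet_rec[where C = C and e = e, OF S cinf_on_mult[OF S(1) step(1) h] step(2)])
      also have "\<dots> = jet (\<lambda>z. wirt C f z * h z + f z * wirt C h z) z ?e"
        unfolding J by (rule jet_cong[OF S]) (rule wirt_mult[OF step(1) h])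
      also have "\<dots> = mcoeff (J (\<lambda>z. wirt C f z * h z)) ?e + mcoeff (J (\<lambda>z. f z * wirt C h z)) ?e"
        unfolding J using cf h step(1) by (intro jet_add[OF S] cinf_on_mult S(1)) auto
      also have "\<dots> = mcoeff (J (wirt C f) * J h) ?e + mcoeff (J f * J (wirt C h)) ?e"
        using step(3)[OF cf(1), rule_format, OF h] step(3)[OF step(1), rule_format, OF cf(2)] by (simp only:)
      also have "\<dots> = mcoeff (pd C (J f * J h)) ?e"
        by (simp add: pdJ step(1) h pd_mult)
      also have "\<dots> = of_nat (e C) * mcoeff (J f * J h) e"
        using step(2) by (simp add: mcoeff_pd del: of_nat_Suc)
      finally show "mcoeff (J (\<lambda>z. f z * h z)) e = mcoeff (J f * J h) e"
        using step(2) by simp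
    qed
  qed
  then show ?thesis using assms(4) by (simp add: J mcoeff_mult)
qed

section \<open>Jets of sections of the Weyl bundle\<close>

definition wsmooth :: "(complex^'n::finite) set \<Rightarrow> 'n weyl \<Rightarrow> bool" where
  "wsmooth S s \<longleftrightarrow> (\<forall>k e. cinf_on S (s k e))"

text \<open>Only the base variables are expanded; the dependence on hbar and on the fibre variables
  is formal from the outset.\<close>

definition jW :: "complex^'n::finite \<Rightarrow> 'n weyl \<Rightarrow> ('n + 'n) wvar mps" where
  "jW z s = Abs_mps (\<lambda>e. jet (s (e Hv) (\<lambda>B. e (Yv B))) z (\<lambda>B. e (Zv B)))"

definition scalar_fun :: "(complex^'n \<Rightarrow> complex) \<Rightarrow> 'n::finite weyl" where
  "scalar_fun f k e z = (if k = 0 \<and> e = (\<lambda>_. 0) then f z else 0)"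

abbreviation jF :: "complex^'n::finite \<Rightarrow> (complex^'n \<Rightarrow> complex) \<Rightarrow> ('n + 'n) wvar mps" where
  "jF z f \<equiv> jW z (scalar_fun f)"

text \<open>An exponent without base displacement: the coefficient of a jet there is the value of
  the section at the base point.\<close>

definition wmon :: "nat \<Rightarrow> ('b \<Rightarrow> nat) \<Rightarrow> 'b wvar \<Rightarrow> nat" where
  "wmon k e v = (case v of Inl (Inl _) \<Rightarrow> 0 | Inl (Inr B) \<Rightarrow> e B | Inr _ \<Rightarrow> k)"

lemma wmon_simps [simp]: "wmon k e (Zv B) = 0" "wmon k e (Yv B) = e B" "wmon k e Hv = k"
  by (simp_all add: wmon_def)

lemma mcoeff_jW: "mcoeff (jW z s) e = jet (s (e Hv) (\<lambda>B. e (Yv B))) z (\<lambda>B. e (Zv B))"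
  by (simp add: jW_def Abs_mps_inverse)

lemma mcoeff_jW_wmon: "mcoeff (jW z s) (wmon k e) = s k e z"
  by (simp add: mcoeff_jW jet_zero)

lemma upd_components [simp]:
  "(\<lambda>C. (e(Yv B := n)) (Yv C)) = (\<lambda>C. e (Yv C))(B := n)" "(\<lambda>C. (e(Yv B := n)) (Zv C)) = (\<lambda>C. e (Zv C))"
  "(\<lambda>C. (e(Zv B := n)) (Zv C)) = (\<lambda>C. e (Zv C))(B := n)" "(\<lambda>C. (e(Zv B := n)) (Yv C)) = (\<lambda>C. e (Yv C))"
  "(\<lambda>C. (e(Hv := n)) (Yv C)) = (\<lambda>C. e (Yv C))" "(\<lambda>C. (e(Hv := n)) (Zv C)) = (\<lambda>C. e (Zv C))"
  by auto

lemma wmult_alt: "wmult a b k e z = (\<Sum>l\<le>k. \<Sum>p\<le>e. a l p z * b (k - l) (e - p) z)"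
  by (simp add: wmult_def atMost_def le_fun_def fun_diff_def)

text \<open>The contraction in the recursive form of \<open>Phi\<close>, as a bridge from the index
  lists in \<open>wick\<close>.\<close>

primrec wPhi :: "'n::finite matfield \<Rightarrow> nat \<Rightarrow> 'n weyl \<Rightarrow> 'n weyl \<Rightarrow> 'n weyl" where
  "wPhi g 0 a b = wmult a b"
| "wPhi g (Suc k) a b = (\<lambda>r e z. \<Sum>i\<in>UNIV. \<Sum>j\<in>UNIV. omega_up g z $ i $ j *
      wPhi g k (ydiff (Inl i) a) (ydiff (Inr j) b) r e z)"

text \<open>The last element is split off because \<open>foldr\<close> applies it first, as the
  recursion of \<open>wPhi\<close> does.\<close>

lemma sum_lists_Suc:
  fixes F :: "'n::finite list \<Rightarrow> 'r::comm_monoid_add"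
  shows "(\<Sum>is | length is = Suc k. F is) = (\<Sum>i\<in>UNIV. \<Sum>is | length is = k. F (is @ [i]))"
proof -
  have bl: "butlast is @ [last is] = is" if "length is = Suc k" for "is" :: "'n list"
    by (rule append_butlast_last_id) (use that in auto)
  have "(\<Sum>is | length is = Suc k. F is) = (\<Sum>(i, is)\<in>UNIV \<times> {is. length is = k}. F (is @ [i]))"
    by (rule sum.reindex_bij_witness[where i = "\<lambda>(i, is). is @ [i]" and j = "\<lambda>is. (last is, butlast is)"])
      (auto simp: bl)
  also have "\<dots> = (\<Sum>i\<in>UNIV. \<Sum>is | length is = k. F (is @ [i]))"
    by (simp add: sum.cartesian_product)
  finally show ?thesis .
qed

lemma wPhi_lists: "wPhi g k a b r e z = (\<Sum>is | length is = k. \<Sum>js | length js = k.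
    (\<Prod>q<k. omega_up g z $ (is ! q) $ (js ! q)) *
    wmult (foldr (\<lambda>i. ydiff (Inl i)) is a) (foldr (\<lambda>j. ydiff (Inr j)) js b) r e z)"
proof (induction k arbitrary: a b)
  case 0
  have "{is. length is = 0} = {[]}" by auto
  then show ?case by simp
next
  case (Suc k)
  have eq: "(\<Prod>q<Suc k. omega_up g z $ ((is @ [i]) ! q) $ ((js @ [j]) ! q)) =
      omega_up g z $ i $ j * (\<Prod>q<k. omega_up g z $ (is ! q) $ (js ! q))"
    if "length is = k" "length js = k" for "is" js i j
    using that by (simp add: nth_append mult.commute)
  have "(\<Sum>is | length is = Suc k. \<Sum>js | length js = Suc k.
    (\<Prod>q<Suc k. omega_up g z $ (is ! q) $ (js ! q)) *
    wmult (foldr (\<lambda>i. ydiff (Inl i)) is a) (foldr (\<lambda>j. ydiff (Inr j)) js b) r e z) =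
    (\<Sum>i\<in>UNIV. \<Sum>is | length is = k. \<Sum>j\<in>UNIV. \<Sum>js | length js = k.
      (\<Prod>q<Suc k. omega_up g z $ ((is @ [i]) ! q) $ ((js @ [j]) ! q)) *
      wmult (foldr (\<lambda>i. ydiff (Inl i)) (is @ [i]) a) (foldr (\<lambda>j. ydiff (Inr j)) (js @ [j]) b) r e z)"
    by (simp only: sum_lists_Suc)
  also have "\<dots> = (\<Sum>i\<in>UNIV. \<Sum>is | length is = k. \<Sum>j\<in>UNIV. \<Sum>js | length js = k.
      omega_up g z $ i $ j * ((\<Prod>q<k. omega_up g z $ (is ! q) $ (js ! q)) *
      wmult (foldr (\<lambda>i. ydiff (Inl i)) is (ydiff (Inl i) a)) (foldr (\<lambda>j. ydiff (Inr j)) js (ydiff (Inr j) b)) r e z))"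
    by (intro sum.cong refl) (simp only: mem_Collect_eq eq foldr_append foldr_Cons foldr_Nil o_apply id_apply mult.assoc)
  also have "\<dots> = (\<Sum>i\<in>UNIV. \<Sum>j\<in>UNIV. \<Sum>is | length is = k. \<Sum>js | length js = k.
      omega_up g z $ i $ j * ((\<Prod>q<k. omega_up g z $ (is ! q) $ (js ! q)) *
      wmult (foldr (\<lambda>i. ydiff (Inl i)) is (ydiff (Inl i) a)) (foldr (\<lambda>j. ydiff (Inr j)) js (ydiff (Inr j) b)) r e z))"
    by (intro sum.cong refl sum.swap)
  also have "\<dots> = wPhi g (Suc k) a b r e z"
    by (simp only: wPhi.simps Suc sum_distrib_left)
  finally show ?case by simp
qed

lemma wick_alt: "wick g a b r e z = (\<Sum>k\<le>r. wPhi g k a b (r - k) e z / fact k)"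
  unfolding wick_def wPhi_lists ..

locale jet_point =
  fixes S :: "(complex^'n::finite) set" and z :: "complex^'n"
  assumes open_S: "open S" and z_S: "z \<in> S"
begin

lemma jet_mult_const: "cinf_on S f \<Longrightarrow> jet (\<lambda>z. c * f z) z e = c * jet f z e"
proof -
  assume f: "cinf_on S f"
  have "jet (\<lambda>z. c * f z) z e = (\<Sum>p\<le>e. if p = (\<lambda>_. 0) then c * jet f z (e - p) else 0)"
    unfolding jet_mult[OF open_S z_S cinf_on_const[OF open_S] f] jet_const[OF open_S z_S]
    by (intro sum.cong) auto
  also have "\<dots> = c * jet f z e"
    by (simp add: le_fun_def fun_diff_def)
  finally show ?thesis .
qed

lemma jet_diff: "cinf_on S f \<Longrightarrow> cinf_on S h \<Longrightarrow> jet (\<lambda>z. f z - h z) z e = jet f z e - jet h z e"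
  using jet_add[OF open_S z_S, of f "\<lambda>z. (-1) * h z" e] jet_mult_const[of h "-1" e]
    cinf_on_mult[OF open_S cinf_on_const[OF open_S], of h "-1"] by simp

lemma jet_sum: "(\<And>x. x \<in> A \<Longrightarrow> cinf_on S (f x)) \<Longrightarrow> jet (\<lambda>z. \<Sum>x\<in>A. f x z) z e = (\<Sum>x\<in>A. jet (f x) z e)"
  by (induction A rule: infinite_finite_induct)
    (auto simp: jet_const[OF open_S z_S] jet_add[OF open_S z_S] cinf_on_sum[OF open_S])

lemma wsmooth_ymul: "wsmooth S s \<Longrightarrow> wsmooth S (ymul B s)"
  unfolding wsmooth_def
proof (intro allI)
  fix k e assume s: "\<forall>k e. cinf_on S (s k e)"
  have "ymul B s k e = (if e B = 0 then (\<lambda>_. 0) else s k (e(B := e B - 1)))"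
    by (simp add: fun_eq_iff ymul_def)
  then show "cinf_on S (ymul B s k e)" using s by (simp add: cinf_on_const open_S)
qed

lemma wsmooth_ydiff: "wsmooth S s \<Longrightarrow> wsmooth S (ydiff B s)"
  unfolding wsmooth_def ydiff_def[abs_def] by (intro allI cinf_on_mult cinf_on_const open_S) auto

lemma wsmooth_add: "wsmooth S s \<Longrightarrow> wsmooth S t \<Longrightarrow> wsmooth S (\<lambda>k e z. s k e z + t k e z)"
  and wsmooth_diff: "wsmooth S s \<Longrightarrow> wsmooth S t \<Longrightarrow> wsmooth S (\<lambda>k e z. s k e z - t k e z)"
  unfolding wsmooth_def by (intro allI cinf_on_add cinf_on_diff open_S; blast)+

lemma wsmooth_scale: "cinf_on S f \<Longrightarrow> wsmooth S s \<Longrightarrow> wsmooth S (\<lambda>k e z. f z * s k e z)"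
  unfolding wsmooth_def by (intro allI cinf_on_mult open_S; blast)

lemma wsmooth_wirt: "wsmooth S s \<Longrightarrow> wsmooth S (\<lambda>k e. wirt B (s k e))"
  unfolding wsmooth_def by (intro allI cinf_on_wirt open_S; blast)

lemma wsmooth_sum: "(\<And>x. x \<in> A \<Longrightarrow> wsmooth S (s x)) \<Longrightarrow> wsmooth S (\<lambda>k e z. \<Sum>x\<in>A. s x k e z)"
  unfolding wsmooth_def by (intro allI cinf_on_sum open_S; blast)

lemma wsmooth_scalar_fun: "cinf_on S f \<Longrightarrow> wsmooth S (scalar_fun f)"
  unfolding wsmooth_def
proof (intro allI)
  fix k e assume f: "cinf_on S f"
  have "scalar_fun f k e = (if k = 0 \<and> e = (\<lambda>_. 0) then f else (\<lambda>_. 0))" by (auto simp: scalar_fun_def)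
  then show "cinf_on S (scalar_fun f k e)" using f by (simp add: cinf_on_const open_S)
qed

lemma wsmooth_wmult: "wsmooth S a \<Longrightarrow> wsmooth S b \<Longrightarrow> wsmooth S (wmult a b)"
  unfolding wsmooth_def wmult_def[abs_def]
  by (intro allI cinf_on_sum cinf_on_mult open_S; blast)

lemma jW_cong: "(\<And>k e w. w \<in> S \<Longrightarrow> s k e w = t k e w) \<Longrightarrow> jW z s = jW z t"
  by (rule mps_eqI, unfold mcoeff_jW, rule jet_cong[OF open_S z_S])

lemma jW_add: "wsmooth S s \<Longrightarrow> wsmooth S t \<Longrightarrow> jW z (\<lambda>k e z. s k e z + t k e z) = jW z s + jW z t"
  and jW_diff: "wsmooth S s \<Longrightarrow> wsmooth S t \<Longrightarrow> jW z (\<lambda>k e z. s k e z - t k e z) = jW z s - jW z t"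
  by (rule mps_eqI; simp add: mcoeff_jW wsmooth_def jet_add[OF open_S z_S] jet_diff)+

lemma jW_sum: "(\<And>x. x \<in> A \<Longrightarrow> wsmooth S (s x)) \<Longrightarrow>
    jW z (\<lambda>k e z. \<Sum>x\<in>A. s x k e z) = (\<Sum>x\<in>A. jW z (s x))"
  by (rule mps_eqI) (simp add: mcoeff_jW wsmooth_def jet_sum)

lemma jW_0 [simp]: "jW z (\<lambda>k e z. 0) = 0"
  by (rule mps_eqI) (simp add: mcoeff_jW jet_const[OF open_S z_S])

lemma jW_ymul: "jW z (ymul B s) = X (Yv B) * jW z s"
proof (rule mps_eqI)
  fix e
  have "ymul B s k e = (if e B = 0 then (\<lambda>_. 0) else s k (e(B := e B - 1)))" for k e
    by (simp add: fun_eq_iff ymul_def)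
  then show "mcoeff (jW z (ymul B s)) e = mcoeff (X (Yv B) * jW z s) e"
    by (simp add: mcoeff_jW mcoeff_X_mult jet_const[OF open_S z_S] del: fun_upd_apply)
      (simp add: fun_upd_other)
qed

lemma jW_ydiff: "wsmooth S s \<Longrightarrow> jW z (ydiff B s) = dY B (jW z s)"
proof (rule mps_eqI)
  fix e assume s: "wsmooth S s"
  have "ydiff B s k e = (\<lambda>z. of_nat (e B + 1) * s k (e(B := e B + 1)) z)" for k e
    by (simp add: fun_eq_iff ydiff_def)
  then show "mcoeff (jW z (ydiff B s)) e = mcoeff (dY B (jW z s)) e"
    unfolding mcoeff_pd mcoeff_jW upd_components
    using s by (simp add: wsmooth_def jet_mult_const fun_upd_other del: of_nat_Suc)
qed

lemma jW_wirt: "wsmooth S s \<Longrightarrow> jW z (\<lambda>k e. wirt B (s k e)) = dZ B (jW z s)"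
  by (rule mps_eqI) (simp add: mcoeff_jW mcoeff_pd wsmooth_def jet_wirt[OF open_S z_S] del: of_nat_Suc fun_upd_apply,
      simp add: fun_upd_other)

lemma jW_wmult:
  assumes "wsmooth S a" "wsmooth S b"
  shows "jW z (wmult a b) = jW z a * jW z b"
proof (rule mps_eqI)
  fix e :: "('n + 'n) wvar \<Rightarrow> nat"
  let ?Z = "\<lambda>p. (\<lambda>B. p (Zv B)) :: 'n + 'n \<Rightarrow> nat" and ?Y = "\<lambda>p. (\<lambda>B. p (Yv B)) :: 'n + 'n \<Rightarrow> nat"
  let ?j = "\<lambda>l p r. jet (a l p) z r * jet (b (e Hv - l) (?Y e - p)) z (?Z e - r)"
  define mk where "mk l p r v = (case v of Inl (Inl B) \<Rightarrow> r B | Inl (Inr B) \<Rightarrow> p B | Inr _ \<Rightarrow> l)"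
    for l :: nat and p r :: "'n + 'n \<Rightarrow> nat" and v :: "('n + 'n) wvar"
  have sm: "cinf_on S (\<lambda>z. a l p z * b (k - l) (e - p) z)" for k l e p
    using assms by (intro cinf_on_mult open_S) (simp_all add: wsmooth_def)
  have "mcoeff (jW z (wmult a b)) e = (\<Sum>l\<le>e Hv. \<Sum>p\<le>?Y e. jet (\<lambda>z. a l p z * b (e Hv - l) (?Y e - p) z) z (?Z e))"
    unfolding mcoeff_jW wmult_alt[abs_def]
    by (simp only: jet_sum cinf_on_sum[OF open_S] sm)
  also have "\<dots> = (\<Sum>l\<le>e Hv. \<Sum>p\<le>?Y e. \<Sum>r\<le>?Z e. ?j l p r)"
    by (intro sum.cong refl jet_mult[OF open_S z_S]) (use assms in \<open>simp_all add: wsmooth_def\<close>)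
  also have "\<dots> = (\<Sum>(l, p, r)\<in>{..e Hv} \<times> {..?Y e} \<times> {..?Z e}. ?j l p r)"
    by (simp add: sum.cartesian_product)
  also have "\<dots> = (\<Sum>q\<le>e. mcoeff (jW z a) q * mcoeff (jW z b) (e - q))"
  proof (rule sum.reindex_bij_witness[where j = "\<lambda>(l, p, r). mk l p r" and i = "\<lambda>q. (q Hv, ?Y q, ?Z q)"], goal_cases)
    case (1 x)
    then show ?case by (auto simp: mk_def)
  next
    case (2 x)
    then show ?case by (auto simp: mk_def le_fun_def split: sum.splits)
  next
    case (3 q)
    have "mk (q Hv) (?Y q) (?Z q) v = q v" for v
      by (auto simp: mk_def split: sum.splits)
    then show ?case by (simp add: fun_eq_iff)
  next
    case (4 q)
    then show ?case by (auto simp: le_fun_def)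
  next
    case (5 x)
    then show ?case by (auto simp: mk_def mcoeff_jW fun_diff_def)
  qed
  also have "\<dots> = mcoeff (jW z a * jW z b) e" by (simp add: mcoeff_mult)
  finally show "mcoeff (jW z (wmult a b)) e = mcoeff (jW z a * jW z b) e" .
qed

lemma wmult_scalar_fun: "wmult (scalar_fun f) s k e w = f w * s k e w"
proof -
  have "wmult (scalar_fun f) s k e w = (\<Sum>l\<le>k. \<Sum>p\<le>e. if l = 0 \<and> p = (\<lambda>_. 0) then f w * s k e w else 0)"
    unfolding wmult_alt scalar_fun_def by (intro sum.cong) (auto simp: fun_diff_def)
  also have "\<dots> = (\<Sum>l\<le>k. if l = 0 then (\<Sum>p\<le>e. if p = (\<lambda>_. 0) then f w * s k e w else 0) else 0)"
    by (intro sum.cong) auto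
  also have "\<dots> = f w * s k e w" by (simp add: le_fun_def)
  finally show ?thesis .
qed

lemma jW_scale: "cinf_on S f \<Longrightarrow> wsmooth S s \<Longrightarrow> jW z (\<lambda>k e z. f z * s k e z) = jF z f * jW z s"
  using jW_wmult[OF wsmooth_scalar_fun, of f s] by (simp add: wmult_scalar_fun[abs_def])

lemma jF_mult: "cinf_on S f \<Longrightarrow> cinf_on S h \<Longrightarrow> jF z (\<lambda>z. f z * h z) = jF z f * jF z h"
  by (subst jW_scale[symmetric]) (auto simp: wsmooth_scalar_fun scalar_fun_def intro!: jW_cong)

lemma jF_sum: "(\<And>x. x \<in> A \<Longrightarrow> cinf_on S (f x)) \<Longrightarrow> jF z (\<lambda>z. \<Sum>x\<in>A. f x z) = (\<Sum>x\<in>A. jF z (f x))"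
  by (subst jW_sum[symmetric]) (auto simp: wsmooth_scalar_fun scalar_fun_def intro!: jW_cong)

lemma scalar_fun_eq: "scalar_fun f k e = (if k = 0 \<and> e = (\<lambda>_. 0) then f else (\<lambda>_. 0))"
  by (auto simp: scalar_fun_def)

lemma jF_wirt: "cinf_on S f \<Longrightarrow> jF z (wirt B f) = dZ B (jF z f)"
proof -
  assume f: "cinf_on S f"
  have "scalar_fun (wirt B f) k e w = wirt B (scalar_fun f k e) w" for k e w
    by (simp add: scalar_fun_eq wirt_const)
  then have "jF z (wirt B f) = jW z (\<lambda>k e. wirt B (scalar_fun f k e))" by (rule jW_cong)
  also have "\<dots> = dZ B (jF z f)" by (rule jW_wirt[OF wsmooth_scalar_fun[OF f]])
  finally show ?thesis .
qed

lemma jF_cong: "(\<And>w. w \<in> S \<Longrightarrow> f w = h w) \<Longrightarrow> jF z f = jF z h"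
  by (rule jW_cong, unfold scalar_fun_def, simp)

lemma jF_const: "jF z (\<lambda>_. c) = K c"
proof (rule mps_eqI)
  fix e :: "('n + 'n) wvar \<Rightarrow> nat"
  have "e = (\<lambda>_. 0) \<longleftrightarrow> e Hv = 0 \<and> (\<lambda>B. e (Yv B)) = (\<lambda>_. 0) \<and> (\<lambda>B. e (Zv B)) = (\<lambda>_. 0)"
  proof
    assume *: "e Hv = 0 \<and> (\<lambda>B. e (Yv B)) = (\<lambda>_. 0) \<and> (\<lambda>B. e (Zv B)) = (\<lambda>_. 0)"
    show "e = (\<lambda>_. 0)"
    proof
      fix v show "e v = 0"
      proof (cases v)
        case (Inl x)
        with * show ?thesis by (cases x) (simp_all add: fun_eq_iff)
      next
        case (Inr u)
        with * show ?thesis by simp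
      qed
    qed
  qed auto
  then show "mcoeff (jF z (\<lambda>_. c)) e = mcoeff (K c) e"
    by (simp add: mcoeff_jW mcoeff_K scalar_fun_eq jet_const[OF open_S z_S])
qed

lemma fibre_const_jF: "fibre_const (jF z f)"
  unfolding fibre_const_def
proof (intro allI mps_eqI)
  fix B e
  have "scalar_fun f k (e'(B := Suc n)) = (\<lambda>_. 0)" for k e' n
    by (simp add: scalar_fun_eq)
  then show "mcoeff (dY B (jF z f)) e = mcoeff 0 e"
    by (simp add: mcoeff_pd mcoeff_jW jet_const[OF open_S z_S] del: fun_upd_apply)
qed

lemma jW_ygen: "jW z (ygen B) = X (Yv B)"
proof -
  have "ygen B k e w = ymul B (scalar_fun (\<lambda>_. 1)) k e w" for k e w
  proof (cases "e B")
    case (Suc n)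
    have "e = (\<lambda>_. 0)(B := 1) \<longleftrightarrow> e(B := e B - 1) = (\<lambda>_. 0)"
      using Suc by (auto simp: fun_eq_iff split: if_splits)
    then show ?thesis using Suc by (simp add: ygen_def ymul_def scalar_fun_def)
  qed (auto simp: ygen_def ymul_def)
  then have "jW z (ygen B) = jW z (ymul B (scalar_fun (\<lambda>_. 1)))" by (rule jW_cong)
  then show ?thesis by (simp add: jW_ymul jF_const)
qed

lemma wsmooth_ygen: "wsmooth S (ygen B)"
  unfolding wsmooth_def ygen_def[abs_def] by (simp add: cinf_on_const open_S)

end

section \<open>Kaehler metrics on coordinate domains\<close>

declare wirt.simps [simp del]

lemma invertible_kernel:
  fixes A :: "complex^'m::finite^'m"
  assumes "\<And>x. (\<And>i. (\<Sum>j\<in>UNIV. A $ i $ j * x $ j) = 0) \<Longrightarrow> x = 0"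
  shows "invertible A"
proof -
  have "x = 0" if "A *v x = 0" for x
  proof (rule assms)
    show "(\<Sum>j\<in>UNIV. A $ i $ j * x $ j) = 0" for i
      using arg_cong[OF that, of "\<lambda>v. v $ i"] by (simp only: matrix_vector_mult_def vec_lambda_beta zero_index)
  qed
  then show ?thesis
    by (simp add: invertible_left_inverse matrix_left_invertible_ker)
qed

lemma matrix_inv_right_sum:
  fixes A :: "complex^'m::finite^'m"
  assumes "invertible A"
  shows "(\<Sum>k\<in>UNIV. A $ i $ k * matrix_inv A $ k $ j) = (if i = j then 1 else 0)"
    "(\<Sum>k\<in>UNIV. matrix_inv A $ i $ k * A $ k $ j) = (if i = j then 1 else 0)"
proof -
  have "(A ** matrix_inv A) $ i $ j = mat 1 $ i $ j" "(matrix_inv A ** A) $ i $ j = mat 1 $ i $ j"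
    using someI_ex[OF assms[unfolded invertible_def]] by (simp_all add: matrix_inv_def)
  then show "(\<Sum>k\<in>UNIV. A $ i $ k * matrix_inv A $ k $ j) = (if i = j then 1 else 0)"
    "(\<Sum>k\<in>UNIV. matrix_inv A $ i $ k * A $ k $ j) = (if i = j then 1 else 0)"
    by (simp_all add: matrix_matrix_mult_def mat_def)
qed

text \<open>A quotient of determinants is visibly smooth, whereas \<open>matrix_inv\<close> is
  defined by choice.\<close>

lemma matrix_inv_cramer:
  fixes A :: "complex^'m::finite^'m"
  assumes "invertible A"
  shows "matrix_inv A $ k $ j = det (\<chi> i l. if l = k then (if i = j then 1 else 0) else A $ i $ l) / det A"
proof -
  define x where "x = (\<chi> k. matrix_inv A $ k $ j)"
  define b :: "complex^'m" where "b = (\<chi> i. if i = j then 1 else 0)"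
  have "A *v x = b"
    by (simp add: vec_eq_iff matrix_vector_mult_def x_def b_def matrix_inv_right_sum[OF assms])
  then have "x = (\<chi> k. det (\<chi> i l. if l = k then b $ i else A $ i $ l) / det A)"
    using assms by (subst (asm) cramer) (simp_all add: invertible_det_nz)
  then have "x $ k = det (\<chi> i l. if l = k then b $ i else A $ i $ l) / det A"
    by (simp add: vec_eq_iff)
  moreover have "(\<chi> i l. if l = k then b $ i else A $ i $ l) =
      (\<chi> i l. if l = k then (if i = j then 1 else 0) else A $ i $ l)"
    by (simp add: b_def vec_eq_iff)
  ultimately show ?thesis by (simp add: x_def)
qed

lemma cinf_on_det:
  fixes A :: "complex^'n::finite \<Rightarrow> complex^'m::finite^'m"
  assumes "open S" "\<And>i j. cinf_on S (\<lambda>z. A z $ i $ j)"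
  shows "cinf_on S (\<lambda>z. det (A z))"
  unfolding det_def by (intro cinf_on_sum cinf_on_mult cinf_on_const cinf_on_prod assms)

lemma cinf_on_matrix_inv:
  fixes A :: "complex^'n::finite \<Rightarrow> complex^'m::finite^'m"
  assumes S: "open S" and A: "\<And>i j. cinf_on S (\<lambda>z. A z $ i $ j)"
    and inv: "\<And>z. z \<in> S \<Longrightarrow> invertible (A z)"
  shows "cinf_on S (\<lambda>z. matrix_inv (A z) $ k $ j)"
proof (rule cinf_on_cong[OF S])
  let ?B = "\<lambda>z. \<chi> i l. if l = k then (if i = j then 1 else 0) else A z $ i $ l"
  show "det (?B z) * inverse (det (A z)) = matrix_inv (A z) $ k $ j" if "z \<in> S" for z
    by (simp only: matrix_inv_cramer[OF inv[OF that]] divide_inverse)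
  have "cinf_on S (\<lambda>z. ?B z $ i $ l)" for i l
    by (cases "l = k") (simp_all add: A cinf_on_const[OF S])
  then show "cinf_on S (\<lambda>z. det (?B z) * inverse (det (A z)))"
    using inv by (intro cinf_on_mult cinf_on_inverse cinf_on_det S A) (auto simp: invertible_det_nz)
qed

locale kaehler_patch =
  fixes S :: "(complex^'n::finite) set" and g :: "'n matfield" and \<alpha> :: "nat \<Rightarrow> 'n matfield"
  assumes open_S: "open S"
    and smooth_omega: "cinf_on S (\<lambda>z. omega g z $ i $ j)"
    and closed_omega: "z \<in> S \<Longrightarrow> wirt (Inl k) (\<lambda>z. omega g z $ i $ j) z = wirt (Inl i) (\<lambda>z. omega g z $ k $ j) z"
      "z \<in> S \<Longrightarrow> wirt (Inr k) (\<lambda>z. omega g z $ i $ j) z = wirt (Inr j) (\<lambda>z. omega g z $ i $ k) z"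
    and positive: "z \<in> S \<Longrightarrow> v \<noteq> 0 \<Longrightarrow> 0 < Re (\<Sum>i\<in>UNIV. \<Sum>j\<in>UNIV. g z $ i $ j * v $ i * cnj (v $ j))"
    and \<alpha>_0: "z \<in> S \<Longrightarrow> \<alpha> 0 z = 0"
    and smooth_\<alpha>: "cinf_on S (\<lambda>z. \<alpha> d z $ i $ j)"
    and closed_form_\<alpha>: "z \<in> S \<Longrightarrow> wirt (Inl k) (\<lambda>z. \<alpha> d z $ i $ j) z = wirt (Inl i) (\<lambda>z. \<alpha> d z $ k $ j) z"
      "z \<in> S \<Longrightarrow> wirt (Inr k) (\<lambda>z. \<alpha> d z $ i $ j) z = wirt (Inr j) (\<lambda>z. \<alpha> d z $ i $ k) z"
begin

lemma smooth_g: "cinf_on S (\<lambda>z. g z $ i $ j)"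
  using cinf_on_mult[OF open_S cinf_on_const[OF open_S] smooth_omega[of i j], of "- \<i>"]
  by (simp add: omega_def)

lemma wirt_omega: "z \<in> S \<Longrightarrow> wirt B (\<lambda>z. omega g z $ i $ j) z = \<i> * wirt B (\<lambda>z. g z $ i $ j) z"
  using wirt_mult[OF cinf_on_const[OF open_S] smooth_g, of z B "\<i>" i j]
  by (simp add: omega_def wirt_const)

lemma closed_g: "z \<in> S \<Longrightarrow> wirt (Inl k) (\<lambda>z. g z $ i $ j) z = wirt (Inl i) (\<lambda>z. g z $ k $ j) z"
  "z \<in> S \<Longrightarrow> wirt (Inr k) (\<lambda>z. g z $ i $ j) z = wirt (Inr j) (\<lambda>z. g z $ i $ k) z"
  using closed_omega[of z k i j] by (simp_all add: wirt_omega)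

text \<open>Positivity is tested on the conjugate of \<open>x\<close> for the right kernel and on
  \<open>x\<close> itself for the left kernel.\<close>

lemma g_kernel:
  assumes z: "z \<in> S"
  shows "(\<And>i. (\<Sum>j\<in>UNIV. g z $ i $ j * x j) = 0) \<Longrightarrow> x j = 0"
    and "(\<And>j. (\<Sum>i\<in>UNIV. g z $ i $ j * x i) = 0) \<Longrightarrow> x i = 0"
proof -
  assume *: "\<And>i. (\<Sum>j\<in>UNIV. g z $ i $ j * x j) = 0"
  define v where "v = (\<chi> i. cnj (x i))"
  have "(\<Sum>i\<in>UNIV. \<Sum>j\<in>UNIV. g z $ i $ j * v $ i * cnj (v $ j)) =
      (\<Sum>i\<in>UNIV. v $ i * (\<Sum>j\<in>UNIV. g z $ i $ j * x j))"
    by (simp add: v_def sum_distrib_left mult_ac)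
  then have "v = 0" using positive[OF z, of v] by (auto simp: *)
  then show "x j = 0" by (simp add: v_def vec_eq_iff)
next
  assume *: "\<And>j. (\<Sum>i\<in>UNIV. g z $ i $ j * x i) = 0"
  define v where "v = (\<chi> i. x i)"
  have "(\<Sum>i\<in>UNIV. \<Sum>j\<in>UNIV. g z $ i $ j * v $ i * cnj (v $ j)) =
      (\<Sum>j\<in>UNIV. cnj (x j) * (\<Sum>i\<in>UNIV. g z $ i $ j * x i))"
    by (subst sum.swap) (simp add: v_def sum_distrib_left mult_ac)
  then have "v = 0" using positive[OF z, of v] by (auto simp: *)
  then show "x i = 0" by (simp add: v_def vec_eq_iff)
qed

lemma invertible_omega: "z \<in> S \<Longrightarrow> invertible (omega g z)"
proof (rule invertible_kernel)
  fix x :: "complex^'n" assume z: "z \<in> S" and x: "\<And>i. (\<Sum>j\<in>UNIV. omega g z $ i $ j * x $ j) = 0"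
  have "\<i> * (\<Sum>j\<in>UNIV. g z $ i $ j * x $ j) = 0" for i
    using x[of i] by (simp add: omega_def sum_distrib_left mult.assoc)
  then show "x = 0" using g_kernel(1)[OF z, of "\<lambda>j. x $ j"] by (simp add: vec_eq_iff)
qed

lemma cmetric_simps [simp]:
  "cmetric g w $ Inl i $ Inl j = 0" "cmetric g w $ Inr i $ Inr j = 0"
  "cmetric g w $ Inl i $ Inr j = g w $ i $ j" "cmetric g w $ Inr j $ Inl i = g w $ i $ j"
  by (simp_all add: cmetric_def)

lemma invertible_cmetric: "z \<in> S \<Longrightarrow> invertible (cmetric g z)"
proof (rule invertible_kernel)
  fix x :: "complex^('n + 'n)"
  assume z: "z \<in> S" and x: "\<And>B. (\<Sum>C\<in>UNIV. cmetric g z $ B $ C * x $ C) = 0"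
  have "x $ Inr j = 0" for j
    by (rule g_kernel(1)[OF z]) (use x[of "Inl _"] in \<open>simp add: sum_UNIV_Plus\<close>)
  moreover have "x $ Inl j = 0" for j
    by (rule g_kernel(2)[OF z]) (use x[of "Inr _"] in \<open>simp add: sum_UNIV_Plus\<close>)
  ultimately have "x $ B = 0" for B by (cases B) auto
  then show "x = 0" by (simp add: vec_eq_iff)
qed

lemma smooth_omega_up: "cinf_on S (\<lambda>z. omega_up g z $ i $ j)"
  unfolding omega_up_def by (simp add: cinf_on_uminus cinf_on_matrix_inv open_S smooth_omega invertible_omega)

lemma smooth_cmetric: "cinf_on S (\<lambda>z. cmetric g z $ B $ C)"
  by (cases B; cases C) (simp_all add: smooth_g cinf_on_const open_S)

lemma smooth_christoffel: "cinf_on S (christoffel g B C E)"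
  unfolding christoffel_def[abs_def]
  by (intro cinf_on_divide_const cinf_on_sum cinf_on_mult cinf_on_diff cinf_on_add cinf_on_wirt
      cinf_on_matrix_inv smooth_cmetric open_S invertible_cmetric)

text \<open>In the symbols of the first kind no inverse matrix occurs, so closedness of the Kaehler
  form can be applied directly.\<close>

lemma christoffel_lower:
  assumes z: "z \<in> S"
  shows "(\<Sum>E\<in>UNIV. cmetric g z $ H $ E * christoffel g B C E z) =
    (wirt B (\<lambda>w. cmetric g w $ C $ H) z + wirt C (\<lambda>w. cmetric g w $ B $ H) z
      - wirt H (\<lambda>w. cmetric g w $ B $ C) z) / 2"
proof -
  let ?T = "\<lambda>H. wirt B (\<lambda>w. cmetric g w $ C $ H) z + wirt C (\<lambda>w. cmetric g w $ B $ H) z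
      - wirt H (\<lambda>w. cmetric g w $ B $ C) z"
  have "(\<Sum>E\<in>UNIV. cmetric g z $ H $ E * christoffel g B C E z) =
      (\<Sum>E\<in>UNIV. cmetric g z $ H $ E * (\<Sum>F\<in>UNIV. matrix_inv (cmetric g z) $ E $ F * ?T F)) / 2"
    by (simp only: christoffel_def times_divide_eq_right sum_divide_distrib[symmetric])
  also have "(\<Sum>E\<in>UNIV. cmetric g z $ H $ E * (\<Sum>F\<in>UNIV. matrix_inv (cmetric g z) $ E $ F * ?T F)) =
      (\<Sum>F\<in>UNIV. if F = H then ?T H else 0)"
    unfolding sum_matrix_assoc matrix_inv_right_sum(1)[OF invertible_cmetric[OF z]]
    by (intro sum.cong) auto
  finally show ?thesis by simp
qed

lemma christoffel_lower_Inr: "z \<in> S \<Longrightarrow> (\<Sum>m\<in>UNIV. g z $ m $ q * christoffel g B C (Inl m) z) =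
    (wirt B (\<lambda>w. cmetric g w $ C $ Inr q) z + wirt C (\<lambda>w. cmetric g w $ B $ Inr q) z
      - wirt (Inr q) (\<lambda>w. cmetric g w $ B $ C) z) / 2"
  using christoffel_lower[of z "Inr q" B C] by (simp add: sum_UNIV_Plus)

lemma christoffel_lower_Inl: "z \<in> S \<Longrightarrow> (\<Sum>r\<in>UNIV. g z $ k $ r * christoffel g B C (Inr r) z) =
    (wirt B (\<lambda>w. cmetric g w $ C $ Inl k) z + wirt C (\<lambda>w. cmetric g w $ B $ Inl k) z
      - wirt (Inl k) (\<lambda>w. cmetric g w $ B $ C) z) / 2"
  using christoffel_lower[of z "Inl k" B C] by (simp add: sum_UNIV_Plus)

text \<open>After lowering an index, the mixed symbols are differences of derivatives of the metric
  that cancel by closedness or involve its zero blocks; \<open>g_kernel\<close> raises the index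
  again.\<close>

lemma christoffel_pure:
  assumes z: "z \<in> S"
  shows "christoffel g (Inl i) (Inr j) E z = 0" "christoffel g (Inr j) (Inl i) E z = 0"
    "christoffel g (Inl i) (Inl k) (Inr l) z = 0" "christoffel g (Inr i) (Inr k) (Inl l) z = 0"
proof -
  have "christoffel g (Inl i) (Inr j) (Inl m) z = 0" "christoffel g (Inr j) (Inl i) (Inl m) z = 0"
    "christoffel g (Inr i) (Inr k) (Inl m) z = 0" for i j k m
    by (rule g_kernel(2)[OF z, where x = "\<lambda>m. christoffel g _ _ (Inl m) z"],
        simp add: christoffel_lower_Inr[OF z] wirt_const closed_g(2)[OF z, of _ i])+
  moreover have "christoffel g (Inl i) (Inr j) (Inr m) z = 0" "christoffel g (Inr j) (Inl i) (Inr m) z = 0"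
    "christoffel g (Inl i) (Inl k) (Inr m) z = 0" for i j k m
    by (rule g_kernel(1)[OF z, where x = "\<lambda>m. christoffel g _ _ (Inr m) z"],
        simp add: christoffel_lower_Inl[OF z] wirt_const closed_g(1)[OF z, of i])+
  ultimately show "christoffel g (Inl i) (Inr j) E z = 0" "christoffel g (Inr j) (Inl i) E z = 0"
    "christoffel g (Inl i) (Inl k) (Inr l) z = 0" "christoffel g (Inr i) (Inr k) (Inl l) z = 0"
    by (cases E; simp)+
qed

lemma christoffel_hol: "z \<in> S \<Longrightarrow> (\<Sum>m\<in>UNIV. christoffel g (Inl i) (Inl k) (Inl m) z * omega g z $ m $ q) =
    wirt (Inl i) (\<lambda>z. omega g z $ k $ q) z"
proof -
  assume z: "z \<in> S"
  have "(\<Sum>m\<in>UNIV. christoffel g (Inl i) (Inl k) (Inl m) z * omega g z $ m $ q) =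
      \<i> * (\<Sum>m\<in>UNIV. g z $ m $ q * christoffel g (Inl i) (Inl k) (Inl m) z)"
    by (simp add: omega_def sum_distrib_left mult_ac)
  then show ?thesis
    using closed_g(1)[OF z, of k i q] by (simp add: christoffel_lower_Inr z wirt_const wirt_omega)
qed

lemma christoffel_anti: "z \<in> S \<Longrightarrow> (\<Sum>r\<in>UNIV. christoffel g (Inr l) (Inr q) (Inr r) z * omega g z $ k $ r) =
    wirt (Inr l) (\<lambda>z. omega g z $ k $ q) z"
proof -
  assume z: "z \<in> S"
  have "(\<Sum>r\<in>UNIV. christoffel g (Inr l) (Inr q) (Inr r) z * omega g z $ k $ r) =
      \<i> * (\<Sum>r\<in>UNIV. g z $ k $ r * christoffel g (Inr l) (Inr q) (Inr r) z)"
    by (simp add: omega_def sum_distrib_left mult_ac)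
  then show ?thesis
    using closed_g(2)[OF z, of q k l] by (simp add: christoffel_lower_Inl z wirt_const wirt_omega)
qed

definition alpha_form :: "'n \<Rightarrow> 'n \<Rightarrow> 'n weyl" where
  "alpha_form i l k e w = (if e = (\<lambda>_. 0) then \<alpha> k w $ i $ l else 0)"

lemma alpha_form_eq: "alpha_form i l k e = (if e = (\<lambda>_. 0) then (\<lambda>w. \<alpha> k w $ i $ l) else (\<lambda>_. 0))"
  by (auto simp: alpha_form_def)

end

locale kaehler_point = kaehler_patch S g \<alpha> + jet_point S z
  for S :: "(complex^'n::finite) set" and g \<alpha> z
begin

abbreviation "Jom i j \<equiv> jF z (\<lambda>w. omega g w $ i $ j)"
abbreviation "J\<theta> i j \<equiv> jF z (\<lambda>w. omega_up g w $ i $ j)"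
abbreviation "J\<Gamma> B C E \<equiv> jF z (christoffel g B C E)"

sublocale kaehler_series Jom J\<theta> J\<Gamma>
proof
  show "fibre_const (Jom i j)" "fibre_const (J\<theta> i j)" for i j by (rule fibre_const_jF)+
  show "dZ (Inl k) (Jom i j) = dZ (Inl i) (Jom k j)" for i j k
    unfolding jF_wirt[OF smooth_omega, symmetric] by (rule jF_cong) (rule closed_omega)
  show "dZ (Inr k) (Jom i j) = dZ (Inr j) (Jom i k)" for i j k
    unfolding jF_wirt[OF smooth_omega, symmetric] by (rule jF_cong) (rule closed_omega)
  show "(\<Sum>q\<in>UNIV. J\<theta> m q * Jom m' q) = (if m = m' then -1 else 0)" for m m'
  proof -
    have "(\<Sum>q\<in>UNIV. J\<theta> m q * Jom m' q) = jF z (\<lambda>w. \<Sum>q\<in>UNIV. omega_up g w $ m $ q * omega g w $ m' $ q)"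
      by (simp add: jF_sum jF_mult cinf_on_mult open_S smooth_omega smooth_omega_up)
    also have "\<dots> = jF z (\<lambda>w. if m = m' then -1 else 0)"
    proof (rule jF_cong)
      fix w assume "w \<in> S"
      then show "(\<Sum>q\<in>UNIV. omega_up g w $ m $ q * omega g w $ m' $ q) = (if m = m' then -1 else 0)"
        using matrix_inv_right_sum(1)[OF invertible_omega, of w m' m]
        by (simp add: omega_up_def sum_negf mult.commute)
    qed
    also have "\<dots> = (if m = m' then -1 else 0)" by (simp add: jF_const K_minus)
    finally show ?thesis .
  qed
  show "(\<Sum>m\<in>UNIV. J\<theta> m q * Jom m q') = (if q = q' then -1 else 0)" for q q'
  proof -
    have "(\<Sum>m\<in>UNIV. J\<theta> m q * Jom m q') = jF z (\<lambda>w. \<Sum>m\<in>UNIV. omega_up g w $ m $ q * omega g w $ m $ q')"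
      by (simp add: jF_sum jF_mult cinf_on_mult open_S smooth_omega smooth_omega_up)
    also have "\<dots> = jF z (\<lambda>w. if q = q' then -1 else 0)"
    proof (rule jF_cong)
      fix w assume "w \<in> S"
      then show "(\<Sum>m\<in>UNIV. omega_up g w $ m $ q * omega g w $ m $ q') = (if q = q' then -1 else 0)"
        using matrix_inv_right_sum(2)[OF invertible_omega, of w q q']
        by (simp add: omega_up_def sum_negf mult.commute)
    qed
    also have "\<dots> = (if q = q' then -1 else 0)" by (simp add: jF_const K_minus)
    finally show ?thesis .
  qed
  have zero: "jF z f = 0" if "\<And>w. w \<in> S \<Longrightarrow> f w = 0" for f
    using jF_cong[of f "\<lambda>_. 0"] that by (simp add: jF_const)
  show "J\<Gamma> (Inl i) (Inr j) E = 0" "J\<Gamma> (Inr i) (Inl j) E = 0"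
    "J\<Gamma> (Inl i) (Inl k) (Inr l) = 0" "J\<Gamma> (Inr i) (Inr k) (Inl l) = 0" for i j k l E
    by (rule zero; simp add: christoffel_pure)+
  show "(\<Sum>m\<in>UNIV. J\<Gamma> (Inl i) (Inl k) (Inl m) * Jom m q) = dZ (Inl i) (Jom k q)" for i k q
    unfolding jF_wirt[OF smooth_omega, symmetric]
    by (simp add: christoffel_hol jF_mult[symmetric] jF_sum[symmetric] cinf_on_mult open_S smooth_omega
        smooth_christoffel cong: jF_cong)
  show "(\<Sum>r\<in>UNIV. J\<Gamma> (Inr l) (Inr q) (Inr r) * Jom k r) = dZ (Inr l) (Jom k q)" for k l q
    unfolding jF_wirt[OF smooth_omega, symmetric]
    by (simp add: jF_mult[symmetric] jF_sum[symmetric] cinf_on_mult open_S smooth_omega smooth_christoffel)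
      (rule jF_cong, rule christoffel_anti)
qed

section \<open>Transfer of connection, Wick product and bracket to jets\<close>

lemma wsmooth_nabla: "wsmooth S s \<Longrightarrow> wsmooth S (nabla g B s)"
  unfolding nabla_def[abs_def]
  by (intro wsmooth_diff wsmooth_wirt wsmooth_sum wsmooth_scale smooth_christoffel wsmooth_ymul wsmooth_ydiff)

lemma jW_nabla: "wsmooth S s \<Longrightarrow> jW z (nabla g B s) = nb B (jW z s)"
  unfolding nabla_def[abs_def] nab_def
  by (simp add: jW_diff jW_sum jW_scale jW_wirt jW_ymul jW_ydiff wsmooth_wirt wsmooth_sum wsmooth_scale
      smooth_christoffel wsmooth_ymul wsmooth_ydiff)

lemma wPhi_transfer: "wsmooth S a \<Longrightarrow> wsmooth S b \<Longrightarrow>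
    wsmooth S (wPhi g k a b) \<and> jW z (wPhi g k a b) = Phi k (jW z a) (jW z b)"
proof (induction k arbitrary: a b)
  case 0
  then show ?case by (simp add: wsmooth_wmult jW_wmult)
next
  case (Suc k)
  have IH: "wsmooth S (wPhi g k (ydiff (Inl i) a) (ydiff (Inr j) b))"
    "jW z (wPhi g k (ydiff (Inl i) a) (ydiff (Inr j) b)) = Phi k (dY (Inl i) (jW z a)) (dY (Inr j) (jW z b))" for i j
    using Suc.IH[OF wsmooth_ydiff[OF Suc.prems(1)] wsmooth_ydiff[OF Suc.prems(2)]] Suc.prems
    by (auto simp: jW_ydiff)
  have "wsmooth S (wPhi g (Suc k) a b)"
    unfolding wPhi.simps by (intro wsmooth_sum wsmooth_scale smooth_omega_up IH)
  moreover have "jW z (wPhi g (Suc k) a b) = Phi (Suc k) (jW z a) (jW z b)"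
    unfolding wPhi.simps Phi_Suc
    by (simp add: jW_sum jW_scale wsmooth_sum wsmooth_scale smooth_omega_up IH)
  ultimately show ?case ..
qed

lemma wsmooth_wick:
  assumes "wsmooth S a" "wsmooth S b"
  shows "wsmooth S (wick g a b)"
proof -
  have "cinf_on S (wPhi g k a b r e)" for k r e
    using wPhi_transfer[OF assms, of k] by (simp add: wsmooth_def)
  then show ?thesis
    unfolding wsmooth_def wick_alt[abs_def] by (intro allI cinf_on_sum cinf_on_divide_const open_S)
qed

lemma jW_wick:
  assumes "wsmooth S a" "wsmooth S b"
  shows "jW z (wick g a b) = star (jW z a) (jW z b)"
proof (rule mps_eqI)
  fix e
  have sm: "cinf_on S (wPhi g k a b r e)" for k r e
    using wPhi_transfer[OF assms, of k] by (simp add: wsmooth_def)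
  have "mcoeff (jW z (wick g a b)) e =
      jet (\<lambda>w. \<Sum>k\<le>e Hv. (1 / fact k) * wPhi g k a b (e Hv - k) (\<lambda>B. e (Yv B)) w) z (\<lambda>B. e (Zv B))"
    by (simp add: mcoeff_jW wick_alt[abs_def])
  also have "\<dots> = (\<Sum>k\<le>e Hv. 1 / fact k * jet (wPhi g k a b (e Hv - k) (\<lambda>B. e (Yv B))) z (\<lambda>B. e (Zv B)))"
    by (simp only: jet_sum jet_mult_const sm cinf_on_mult[OF open_S cinf_on_const[OF open_S]])
  also have "\<dots> = (\<Sum>k\<le>e Hv. mcoeff (K (1 / fact k) * jW z (wPhi g k a b)) (e(Hv := e Hv - k)))"
    by (simp add: mcoeff_jW del: fun_upd_apply) (simp add: fun_upd_same)
  also have "\<dots> = mcoeff (star (jW z a) (jW z b)) e"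
    using wPhi_transfer[OF assms] by (simp add: star_def mcoeff_hsum)
  finally show "mcoeff (jW z (wick g a b)) e = mcoeff (star (jW z a) (jW z b)) e" .
qed

definition wick_bracket :: "'n weyl \<Rightarrow> 'n weyl \<Rightarrow> 'n weyl" where
  "wick_bracket a b k e w = wick g a b (Suc k) e w - wick g b a (Suc k) e w"

lemma wsmooth_wick_bracket: "wsmooth S a \<Longrightarrow> wsmooth S b \<Longrightarrow> wsmooth S (wick_bracket a b)"
  unfolding wick_bracket_def[abs_def] using wsmooth_wick[of a b] wsmooth_wick[of b a]
  by (intro wsmooth_diff) (auto simp: wsmooth_def)

lemma jW_wick_bracket:
  assumes "wsmooth S a" "wsmooth S b"
  shows "jW z (wick_bracket a b) = br (jW z a) (jW z b)"
proof (rule mps_eqI)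
  fix e
  have sm: "cinf_on S (wick g a b k e)" "cinf_on S (wick g b a k e)" for k e
    using wsmooth_wick[OF assms] wsmooth_wick[OF assms(2,1)] by (auto simp: wsmooth_def)
  have "mcoeff (jW z (wick_bracket a b)) e =
      mcoeff (jW z (wick g a b) - jW z (wick g b a)) (e(Hv := Suc (e Hv)))"
    by (simp add: mcoeff_jW wick_bracket_def[abs_def] jet_diff sm del: fun_upd_apply) (simp add: fun_upd_same)
  also have "\<dots> = mcoeff (X Hv * br (jW z a) (jW z b)) (e(Hv := Suc (e Hv)))"
    by (simp add: X_br jW_wick assms)
  also have "\<dots> = mcoeff (br (jW z a) (jW z b)) e"
    by (simp add: mcoeff_X_mult)
  finally show "mcoeff (jW z (wick_bracket a b)) e = mcoeff (br (jW z a) (jW z b)) e" .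
qed

end

text \<open>The degree in the holomorphic fibre variables alone. It is the number by which
  \<open>delta_inv\<close> divides and the cut-off in \<open>fedI\<close> and
  \<open>fedJ\<close>.\<close>

definition wy :: "('n + 'n) wvar \<Rightarrow> nat" where
  "wy v = (case v of Inl (Inr (Inl i)) \<Rightarrow> 1 | _ \<Rightarrow> 0)"

lemma wy_simps [simp]: "wy (Zv B) = 0" "wy (Yv (Inl i)) = 1" "wy (Yv (Inr i)) = 0" "wy (Inr u) = 0"
  by (simp_all add: wy_def)

lemma wdeg_wy: "wdeg wy e = sum e (range (\<lambda>i. Yv (Inl i)))"
proof -
  have "wdeg wy e = (\<Sum>v\<in>UNIV. if v \<in> range (\<lambda>i. Yv (Inl i)) then e v else 0)"
    unfolding wdeg_def by (intro sum.cong) (auto simp: wy_def split: sum.splits)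
  then show ?thesis by (simp add: sum.If_cases)
qed

lemma sum_range_Yl: "(\<Sum>v\<in>range (\<lambda>i. Yv (Inl i)). f v) = (\<Sum>i\<in>UNIV. f (Yv (Inl i)))"
  by (subst sum.reindex) (simp_all add: inj_on_def)

lemma derivation_euler: "derivation (euler S)"
  unfolding derivation_def euler_def
  by (simp add: pd_mult distrib_left sum.distrib sum_distrib_left sum_distrib_right mult_ac)

lemmas euler_add = derivation_add[OF derivation_euler]
  and euler_mult = derivation_mult[OF derivation_euler]

lemma euler_sum: "euler S (sum f A) = (\<Sum>x\<in>A. euler S (f x))"
  by (simp add: euler_def sum_distrib_left) (rule sum.swap)

lemma euler_diff: "euler S (a - b) = euler S a - euler S b"
  by (simp add: euler_def right_diff_distrib sum_subtractf)

lemma vanishes_euler_op: "vanishes w n a \<Longrightarrow> vanishes w n (euler S a)"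
  by (simp add: vanishes_def mcoeff_euler)

lemma euler_fibre_const: "fibre_const c \<Longrightarrow> S \<subseteq> range Yv \<Longrightarrow> euler S c = 0"
  unfolding euler_def by (intro sum.neutral) (auto simp: fibre_const_def)

context kaehler_point
begin

abbreviation "Yl \<equiv> range (\<lambda>i. Yv (Inl i)) :: ('n + 'n) wvar set"

lemma euler_scalar: "fibre_const c \<Longrightarrow> euler Yl (c * a) = c * euler Yl a"
proof -
  have "Yl \<subseteq> range Yv" by auto
  then show "fibre_const c \<Longrightarrow> euler Yl (c * a) = c * euler Yl a"
    by (simp add: euler_mult euler_fibre_const)
qed

lemma euler_yl: "euler Yl (yl i) = yl i"
proof -
  have "euler Yl (yl i) = (\<Sum>j\<in>UNIV. if j = i then yl i else 0)"
    unfolding euler_def sum_range_Yl by (intro sum.cong) (auto simp: pd_X)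
  then show ?thesis by simp
qed

lemma euler_yr: "euler Yl (yr i) = 0"
  unfolding euler_def sum_range_Yl by (simp add: pd_X)

lemma ydeg_eq: "ydeg (\<lambda>B. e (Yv B)) = wdeg wy e"
  unfolding wdeg_wy sum_range_Yl by (simp add: ydeg_def)

lemma jW_mult_const: "wsmooth S s \<Longrightarrow> jW z (\<lambda>k e z. c * s k e z) = K c * jW z s"
  using jW_scale[OF cinf_on_const[OF open_S], of s c] by (simp add: jF_const)

text \<open>Division by the degree inverts the Euler field. On jets, \<open>delta_inv\<close> is
  therefore described by an Euler equation together with the vanishing of the part without y^i, and
  it is used below only through this description.\<close>

lemma delta_inv_transfer:
  assumes b: "\<And>i. wsmooth S (b i l)"
  shows "wsmooth S (delta_inv b l)"
    and "euler Yl (jW z (delta_inv b l)) = (\<Sum>i\<in>UNIV. yl i * jW z (b i l))"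
    and "restr Yl (jW z (delta_inv b l)) = 0"
proof -
  define s where "s k e w = (\<Sum>i\<in>UNIV. ymul (Inl i) (b i l) k e w)" for k e w
  have s: "wsmooth S s" unfolding s_def[abs_def] by (intro wsmooth_sum wsmooth_ymul b)
  have d: "delta_inv b l k e = (\<lambda>w. (1 / of_nat (ydeg e)) * s k e w)" for k e
    by (simp add: delta_inv_def s_def fun_eq_iff)
  show "wsmooth S (delta_inv b l)"
    unfolding wsmooth_def d using s[unfolded wsmooth_def]
    by (intro allI cinf_on_mult cinf_on_const open_S) blast
  have js: "jW z s = (\<Sum>i\<in>UNIV. yl i * jW z (b i l))"
    unfolding s_def[abs_def] by (simp add: jW_sum jW_ymul wsmooth_ymul b)
  have c: "mcoeff (jW z (delta_inv b l)) e = 1 / of_nat (wdeg wy e) * mcoeff (jW z s) e" for e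
    unfolding mcoeff_jW d ydeg_eq using s by (intro jet_mult_const) (simp add: wsmooth_def)
  show "restr Yl (jW z (delta_inv b l)) = 0"
    unfolding restr_eq_0_iff
  proof (intro allI impI)
    fix e :: "('n + 'n) wvar \<Rightarrow> nat" assume "sum e Yl = 0"
    then show "mcoeff (jW z (delta_inv b l)) e = 0"
      \<comment> \<open>In degree zero the divisor is 0, and division by 0 yields 0.\<close>
      by (simp only: c wdeg_wy of_nat_0 div_by_0 mult_zero_left)
  qed
  have "of_nat (sum e Yl) * mcoeff (jW z (delta_inv b l)) e = mcoeff (jW z s) e" for e
  proof (cases "sum e Yl = 0")
    case True
    then have "e (Yv (Inl i)) = 0" for i by simp
    then have "mcoeff (jW z s) e = 0" by (simp add: js mcoeff_X_mult)
    then show ?thesis by (simp only: True of_nat_0 mult_zero_left)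
  next
    case False
    then have "(of_nat (sum e Yl) :: complex) \<noteq> 0" by (simp only: of_nat_eq_0_iff not_False_eq_True)
    then show ?thesis unfolding c wdeg_wy by (simp del: of_nat_sum)
  qed
  then show "euler Yl (jW z (delta_inv b l)) = (\<Sum>i\<in>UNIV. yl i * jW z (b i l))"
    unfolding js[symmetric] by (intro mps_eqI) (simp only: mcoeff_euler)
qed

end

lemma (in kaehler_patch) kaehler_point: "w \<in> S \<Longrightarrow> kaehler_point S g \<alpha> w"
  using kaehler_patch_axioms open_S
  by (simp add: kaehler_point_def jet_point_def)

text \<open>As y^m is annihilated by the antiholomorphic covariant derivatives, only the
  antiholomorphic derivative of the Christoffel symbol survives in the commutator. It is read off at
  the exponent of the single variable y^k.\<close>

lemma (in kaehler_patch) curv_eq: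
  assumes w: "w \<in> S"
  shows "curv g i l k m w = wirt (Inr l) (christoffel g (Inl i) (Inl k) (Inl m)) w"
proof -
  interpret p: kaehler_point S g \<alpha> w by (rule kaehler_point[OF w])
  let ?y = "ygen (Inl m) :: 'n weyl"
  let ?e = "wmon 0 ((\<lambda>_. 0)(Inl k := 1)) :: ('n + 'n) wvar \<Rightarrow> nat"
  have sm: "wsmooth S ?y" by (rule p.wsmooth_ygen)
  have "curv g i l k m w = mcoeff (jW w (nabla g (Inl i) (nabla g (Inr l) ?y)) - jW w (nabla g (Inr l) (nabla g (Inl i) ?y))) ?e"
    by (simp add: curv_def mcoeff_jW_wmon)
  also have "jW w (nabla g (Inl i) (nabla g (Inr l) ?y)) - jW w (nabla g (Inr l) (nabla g (Inl i) ?y)) =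
      (\<Sum>k\<in>UNIV. p.yl k * dZ (Inr l) (p.gh i k m))"
    by (simp add: p.jW_nabla p.wsmooth_nabla sm p.jW_ygen p.nab_yl nab_minus nab_sum nab_mult
        nab_fibre_const p.fc_gh mult.commute)
  also have "mcoeff (p.yl k' * dZ (Inr l) (p.gh i k' m)) ?e =
      (if k' = k then wirt (Inr l) (christoffel g (Inl i) (Inl k) (Inl m)) w else 0)" for k'
  proof -
    have "?e(Yv (Inl k) := 0) = wmon 0 (\<lambda>_. 0)"
      by (auto simp: fun_eq_iff wmon_def split: sum.splits)
    then show ?thesis
      by (simp add: mcoeff_X_mult p.jF_wirt[OF smooth_christoffel, symmetric] mcoeff_jW_wmon scalar_fun_def)
  qed
  then have "mcoeff (\<Sum>k'\<in>UNIV. p.yl k' * dZ (Inr l) (p.gh i k' m)) ?e =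
      wirt (Inr l) (christoffel g (Inl i) (Inl k) (Inl m)) w"
    by simp
  finally show ?thesis .
qed

context kaehler_point
begin

section \<open>Jets of the curvature and of the series I\<close>

lemma smooth_curv: "cinf_on S (curv g i l k m)"
  by (rule cinf_on_cong[OF open_S curv_eq[symmetric]]) (simp_all add: cinf_on_wirt open_S smooth_christoffel)

lemma jF_curv: "jF z (curv g i l k m) = dZ (Inr l) (gh i k m)"
  unfolding jF_wirt[OF smooth_christoffel, symmetric] by (rule jF_cong) (rule curv_eq)

lemma wsmooth_rstar: "wsmooth S (rstar g n j l)"
proof (induction n arbitrary: j l)
  case 0
  have "wsmooth S (\<lambda>k e z. (1/2) * (\<Sum>i\<in>UNIV. \<Sum>p\<in>UNIV. curv g i l p j z * ymul (Inl i) (ygen (Inl p)) k e z))"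
    by (intro wsmooth_scale wsmooth_sum wsmooth_ymul wsmooth_ygen smooth_curv cinf_on_const open_S)
  then show ?case by simp
next
  case (Suc n)
  show ?case
    unfolding rstar.simps nabla10_def
    by (intro delta_inv_transfer(1) wsmooth_add wsmooth_sum wsmooth_scale wsmooth_nabla smooth_christoffel Suc)
qed

definition lowered_yr :: "'n \<Rightarrow> ('n + 'n) wvar mps" where
  "lowered_yr j = (\<Sum>q\<in>UNIV. Jom j q * yr q)"

text \<open>The lowered variable transforms like the tangent vector of index \<open>j\<close>.
  Contracted with it, the Christoffel term in \<open>rstar\<close>, which differentiates the frame
  of the tangent bundle, is absorbed into the connection on the Weyl bundle.\<close>

lemma nab_lowered_yr: "nb (Inl i) (lowered_yr j) = (\<Sum>m\<in>UNIV. gh i j m * lowered_yr m)"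
proof -
  have "nb (Inl i) (lowered_yr j) = (\<Sum>q\<in>UNIV. (\<Sum>m\<in>UNIV. gh i j m * Jom m q) * yr q)"
    by (simp add: lowered_yr_def nab_sum nab_mult nab_yr nab_fibre_const fc_om \<Gamma>_hol)
  then show ?thesis by (simp add: lowered_yr_def flip: sum_matrix_assoc)
qed

lemma euler_lowered_yr: "euler Yl (lowered_yr j) = 0"
  by (simp add: lowered_yr_def euler_sum euler_scalar fc_om euler_yr)

definition fedI_term :: "nat \<Rightarrow> 'n \<Rightarrow> 'n weyl" where
  "fedI_term n l k e w = (\<Sum>j\<in>UNIV. \<Sum>q\<in>UNIV. omega g w $ j $ q * ymul (Inr q) (rstar g n j l) k e w)"

lemma wsmooth_fedI_term: "wsmooth S (fedI_term n l)"
  unfolding fedI_term_def[abs_def] by (intro wsmooth_sum wsmooth_scale wsmooth_ymul wsmooth_rstar smooth_omega)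

lemma jW_fedI_term: "jW z (fedI_term n l) = (\<Sum>j\<in>UNIV. lowered_yr j * jW z (rstar g n j l))"
  unfolding fedI_term_def[abs_def] lowered_yr_def
  by (simp add: jW_sum jW_scale jW_ymul wsmooth_sum wsmooth_scale wsmooth_ymul wsmooth_rstar smooth_omega
      sum_distrib_right mult.assoc)

lemma rstar_Suc_transfer:
  "euler Yl (jW z (rstar g (Suc n) j l)) = (\<Sum>i\<in>UNIV. yl i *
      (nb (Inl i) (jW z (rstar g n j l)) + (\<Sum>q\<in>UNIV. gh i q j * jW z (rstar g n q l))))"
  "restr Yl (jW z (rstar g (Suc n) j l)) = 0"
proof -
  define b where "b i l k e w = nabla10 g (rstar g n j) i l k e w +
      (\<Sum>q\<in>UNIV. christoffel g (Inl i) (Inl q) (Inl j) w * rstar g n q l k e w)" for i l k e w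
  have sb: "wsmooth S (b i l)" for i l
    unfolding b_def[abs_def] nabla10_def
    by (intro wsmooth_add wsmooth_sum wsmooth_scale wsmooth_nabla smooth_christoffel wsmooth_rstar)
  have jb: "jW z (b i l) = nb (Inl i) (jW z (rstar g n j l)) + (\<Sum>q\<in>UNIV. gh i q j * jW z (rstar g n q l))" for i l
    unfolding b_def[abs_def] nabla10_def
    by (simp add: jW_add jW_sum jW_scale jW_nabla wsmooth_sum wsmooth_scale wsmooth_nabla
        smooth_christoffel wsmooth_rstar)
  have r: "rstar g (Suc n) j l = delta_inv b l"
    by (simp add: b_def[abs_def])
  show "euler Yl (jW z (rstar g (Suc n) j l)) = (\<Sum>i\<in>UNIV. yl i *
      (nb (Inl i) (jW z (rstar g n j l)) + (\<Sum>q\<in>UNIV. gh i q j * jW z (rstar g n q l))))"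
    "restr Yl (jW z (rstar g (Suc n) j l)) = 0"
    unfolding r using delta_inv_transfer[of b l, OF sb] by (simp_all add: jb)
qed

lemma jW_rstar_0: "jW z (rstar g 0 j l) = K (1/2) * (\<Sum>i\<in>UNIV. \<Sum>p\<in>UNIV. dZ (Inr l) (gh i p j) * (yl i * yl p))"
proof -
  define s where "s k e w = (\<Sum>i\<in>UNIV. \<Sum>p\<in>UNIV. curv g i l p j w * ymul (Inl i) (ygen (Inl p)) k e w)" for k e w
  have "wsmooth S s"
    unfolding s_def[abs_def] by (intro wsmooth_scale wsmooth_sum wsmooth_ymul wsmooth_ygen smooth_curv)
  moreover have "jW z s = (\<Sum>i\<in>UNIV. \<Sum>p\<in>UNIV. dZ (Inr l) (gh i p j) * (yl i * yl p))"
    unfolding s_def[abs_def]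
    by (simp add: jW_sum jW_scale jW_ymul jW_ygen wsmooth_scale wsmooth_sum wsmooth_ymul wsmooth_ygen
        smooth_curv jF_curv)
  moreover have "rstar g 0 j l = (\<lambda>k e w. (1/2) * s k e w)"
    by (simp add: s_def fun_eq_iff)
  ultimately show ?thesis by (simp only: jW_mult_const)
qed

text \<open>The first term is quadratic in the y^i, so the Euler field cancels its factor 1/2. The
  lowering by \<open>omega\<close> turns the curvature tensor into \<open>rho\<close>.\<close>

lemma euler_fedI_term_0: "euler Yl (jW z (fedI_term 0 l)) = (\<Sum>i\<in>UNIV. yl i * curv_series i l)"
proof -
  have R: "euler Yl (jW z (rstar g 0 j l)) = (\<Sum>i\<in>UNIV. \<Sum>p\<in>UNIV. dZ (Inr l) (gh i p j) * (yl i * yl p))" for j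
  proof -
    have E: "euler Yl (yl i * yl p) = K 2 * (yl i * yl p)" for i p
    proof -
      have "(K 2 :: ('n + 'n) wvar mps) = 2" using K_of_nat[of 2] by simp
      then show ?thesis by (simp add: euler_mult euler_yl)
    qed
    have "euler Yl (jW z (rstar g 0 j l)) =
        K (1/2) * (K 2 * (\<Sum>i\<in>UNIV. \<Sum>p\<in>UNIV. dZ (Inr l) (gh i p j) * (yl i * yl p)))"
      by (simp only: jW_rstar_0 euler_scalar[OF fibre_const_K] euler_sum
          euler_scalar[OF fibre_const_dZ[OF fc_gh]] E)
        (simp only: sum_distrib_left mult_ac)
    then show ?thesis by (simp add: mult.assoc[symmetric] K_mult[symmetric])
  qed
  have "euler Yl (jW z (fedI_term 0 l)) = (\<Sum>j\<in>UNIV. lowered_yr j * (\<Sum>i\<in>UNIV. \<Sum>p\<in>UNIV. dZ (Inr l) (gh i p j) * (yl i * yl p)))"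
    by (simp add: jW_fedI_term euler_sum euler_mult euler_lowered_yr R del: rstar.simps)
  also have "\<dots> = (\<Sum>i\<in>UNIV. \<Sum>p\<in>UNIV. (\<Sum>j\<in>UNIV. lowered_yr j * dZ (Inr l) (gh i p j)) * (yl i * yl p))"
    unfolding sum_distrib_left sum_distrib_right
    by (subst sum.swap, rule sum.cong[OF refl], subst sum.swap) (simp add: mult.assoc)
  also have "\<dots> = (\<Sum>i\<in>UNIV. yl i * curv_series i l)"
  proof (rule sum.cong[OF refl])
    fix i
    have "(\<Sum>j\<in>UNIV. lowered_yr j * dZ (Inr l) (gh i p j)) = (\<Sum>q\<in>UNIV. rho i l p q * yr q)" for p
      unfolding lowered_yr_def rho_def sum_distrib_right
      by (subst sum.swap) (simp add: mult_ac)
    then show "(\<Sum>p\<in>UNIV. (\<Sum>j\<in>UNIV. lowered_yr j * dZ (Inr l) (gh i p j)) * (yl i * yl p)) = yl i * curv_series i l"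
      by (simp add: curv_series_def sum_distrib_left sum_distrib_right mult_ac)
  qed
  finally show ?thesis .
qed

lemma restr_fedI_term: "restr Yl (jW z (fedI_term n l)) = 0"
proof -
  have "restr Yl (jW z (rstar g n j l)) = 0" for j
  proof (cases n)
    case 0
    have "restr Yl (dZ (Inr l) (gh i p j) * (yl i * yl p)) = 0" for i p
      by (simp add: restr_mult restr_X)
    then show ?thesis unfolding 0 jW_rstar_0 by (simp add: restr_mult restr_sum)
  qed (simp only: rstar_Suc_transfer(2))
  then show ?thesis by (simp add: jW_fedI_term restr_sum restr_mult)
qed

lemma euler_fedI_term_Suc: "euler Yl (jW z (fedI_term (Suc n) l)) = (\<Sum>i\<in>UNIV. yl i * nb (Inl i) (jW z (fedI_term n l)))"
proof -
  let ?R = "\<lambda>j. jW z (rstar g n j l)"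
  have "nb (Inl i) (jW z (fedI_term n l)) =
      (\<Sum>j\<in>UNIV. lowered_yr j * (nb (Inl i) (?R j) + (\<Sum>q\<in>UNIV. gh i q j * ?R q)))" for i
  proof -
    have "nb (Inl i) (jW z (fedI_term n l)) = (\<Sum>j\<in>UNIV. lowered_yr j * nb (Inl i) (?R j)) +
        (\<Sum>q\<in>UNIV. (\<Sum>j\<in>UNIV. lowered_yr j * gh i q j) * ?R q)"
      by (simp add: jW_fedI_term nab_sum nab_mult nab_lowered_yr sum.distrib mult.commute add.commute)
    then show ?thesis by (simp add: distrib_left sum.distrib flip: sum_matrix_assoc)
  qed
  then have "(\<Sum>i\<in>UNIV. yl i * nb (Inl i) (jW z (fedI_term n l))) =
      (\<Sum>j\<in>UNIV. \<Sum>i\<in>UNIV. lowered_yr j * (yl i * (nb (Inl i) (?R j) + (\<Sum>q\<in>UNIV. gh i q j * ?R q))))"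
    unfolding sum_distrib_left[of "yl _"] by (subst sum.swap) (simp add: mult.left_commute sum_distrib_left)
  also have "\<dots> = euler Yl (jW z (fedI_term (Suc n) l))"
    by (simp add: jW_fedI_term euler_sum euler_mult euler_lowered_yr rstar_Suc_transfer sum_distrib_left del: rstar.simps)
  finally show ?thesis ..
qed

section \<open>Jets of J_alpha and the Euler equation for the sum\<close>

definition fedJ_term :: "nat \<Rightarrow> 'n \<Rightarrow> 'n weyl" where
  "fedJ_term n = (fed_step g ^^ n) (fedJ_init \<alpha>)"

lemma wsmooth_alpha_form: "wsmooth S (alpha_form i l)"
  unfolding wsmooth_def alpha_form_eq by (simp add: smooth_\<alpha> cinf_on_const open_S)

lemma fedJ_init_eq: "fedJ_init \<alpha> = delta_inv (\<lambda>i l k e w. (-1) * alpha_form i l k e w)"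
  unfolding fedJ_init_def alpha_form_def by (intro arg_cong[where f = delta_inv] ext) simp

lemma wsmooth_fedJ_term: "wsmooth S (fedJ_term n l)"
proof (induction n arbitrary: l)
  case 0
  show ?case
    unfolding fedJ_term_def funpow_0 fedJ_init_eq
    by (intro delta_inv_transfer(1) wsmooth_scale wsmooth_alpha_form cinf_on_const open_S)
next
  case (Suc n)
  have "fedJ_term (Suc n) = delta_inv (nabla10 g (fedJ_term n))"
    by (simp add: fedJ_term_def fed_step_def)
  then show ?case
    by (simp add: delta_inv_transfer(1) nabla10_def wsmooth_nabla Suc)
qed

lemma fedJ_term_transfer:
  "euler Yl (jW z (fedJ_term 0 l)) = - (\<Sum>i\<in>UNIV. yl i * jW z (alpha_form i l))"
  "euler Yl (jW z (fedJ_term (Suc n) l)) = (\<Sum>i\<in>UNIV. yl i * nb (Inl i) (jW z (fedJ_term n l)))"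
  "restr Yl (jW z (fedJ_term n l)) = 0"
proof -
  have s: "wsmooth S (\<lambda>k e w. (-1) * alpha_form i l k e w)" for i l
    by (intro wsmooth_scale wsmooth_alpha_form cinf_on_const open_S)
  have j: "jW z (\<lambda>k e w. (-1) * alpha_form i l k e w) = - jW z (alpha_form i l)" for i l
    by (subst jW_mult_const[OF wsmooth_alpha_form]) (simp add: K_minus)
  have 0: "fedJ_term 0 = delta_inv (\<lambda>i l k e w. (-1) * alpha_form i l k e w)"
    by (simp add: fedJ_term_def fedJ_init_eq)
  have S: "fedJ_term (Suc n) = delta_inv (nabla10 g (fedJ_term n))" for n
    by (simp add: fedJ_term_def fed_step_def)
  have sn: "wsmooth S (nabla10 g (fedJ_term n) i l)" "jW z (nabla10 g (fedJ_term n) i l) = nb (Inl i) (jW z (fedJ_term n l))" for n i l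
    by (simp_all add: nabla10_def wsmooth_nabla jW_nabla wsmooth_fedJ_term)
  show "euler Yl (jW z (fedJ_term 0 l)) = - (\<Sum>i\<in>UNIV. yl i * jW z (alpha_form i l))"
    unfolding 0 delta_inv_transfer(2)[OF s] j by (simp add: sum_negf)
  show "euler Yl (jW z (fedJ_term (Suc n) l)) = (\<Sum>i\<in>UNIV. yl i * nb (Inl i) (jW z (fedJ_term n l)))"
    unfolding S delta_inv_transfer(2)[OF sn(1)] sn(2) ..
  show "restr Yl (jW z (fedJ_term n l)) = 0"
    by (cases n) (simp_all only: 0 S delta_inv_transfer(3)[OF s] delta_inv_transfer(3)[OF sn(1)])
qed

lemma vanishes_wy_nab: "vanishes wy n a \<Longrightarrow> vanishes wy n (nb A a)"
proof (rule vanishes_nab)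
  show "J\<Gamma> A C E = 0 \<or> wy (Yv E) \<le> wy (Yv C)" for C E
    using \<Gamma>_pure by (cases A; cases C; cases E) auto
qed auto

text \<open>Each step multiplies by some y^i, and the connection does not lower the degree in the
  y^i. The initial term already has no part of degree zero, whence \<open>Suc n\<close>.\<close>

lemma homogeneous_vanishes:
  assumes restr: "\<And>n. restr Yl (H n) = 0"
    and step: "\<And>n. euler Yl (H (Suc n)) = (\<Sum>i\<in>UNIV. yl i * nb (Inl i) (H n))"
  shows "vanishes wy (Suc n) (H n)"
proof (induction n)
  case 0
  show ?case
    by (rule vanishes_euler[OF restr]) (auto simp: euler_def intro!: vanishes_sum vanishes_X_mult[where m = 0])
next
  case (Suc n)
  show ?case
    by (rule vanishes_euler[OF restr], unfold step)
      (intro vanishes_sum vanishes_X_mult[where m = "Suc n"] vanishes_wy_nab Suc, simp)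
qed

definition fedI_alpha_term :: "nat \<Rightarrow> 'n \<Rightarrow> ('n + 'n) wvar mps" where
  "fedI_alpha_term n l = jW z (fedI_term n l) + jW z (fedJ_term n l)"

lemma fedI_alpha_term_props:
  "euler Yl (fedI_alpha_term 0 l) = (\<Sum>i\<in>UNIV. yl i * (curv_series i l - jW z (alpha_form i l)))"
  "euler Yl (fedI_alpha_term (Suc n) l) = (\<Sum>i\<in>UNIV. yl i * nb (Inl i) (fedI_alpha_term n l))"
  by (simp_all add: fedI_alpha_term_def euler_add euler_fedI_term_0 euler_fedI_term_Suc fedJ_term_transfer right_diff_distrib sum_subtractf
      nab_add distrib_left sum.distrib)

lemma wsmooth_fedI_alpha: "wsmooth S (fedI_alpha g \<alpha> l)"
  and fedI_alpha_approx: "vanishes wy m (jW z (fedI_alpha g \<alpha> l) - (\<Sum>n<m. fedI_alpha_term n l))"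
proof -
  have eq: "fedI_alpha g \<alpha> l k e w = (\<Sum>n\<le>ydeg e. fedI_term n l k e w) + (\<Sum>n<ydeg e. fedJ_term n l k e w)" for k e w
    by (simp add: fedI_alpha_def fedI_def fedJ_def fedI_term_def fedJ_term_def)
  have sm: "cinf_on S (fedI_term n l k e)" "cinf_on S (fedJ_term n l k e)" for n k e
    using wsmooth_fedI_term wsmooth_fedJ_term by (auto simp: wsmooth_def)
  show "wsmooth S (fedI_alpha g \<alpha> l)"
    unfolding wsmooth_def eq[abs_def] by (intro allI cinf_on_add cinf_on_sum sm open_S)
  have V: "vanishes wy (Suc n) (jW z (fedI_term n l))" "vanishes wy (Suc n) (jW z (fedJ_term n l))" for n
    using homogeneous_vanishes[of "\<lambda>n. jW z (fedI_term n l)", OF restr_fedI_term euler_fedI_term_Suc]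
      homogeneous_vanishes[of "\<lambda>n. jW z (fedJ_term n l)", OF fedJ_term_transfer(3,2)] by auto
  show "vanishes wy m (jW z (fedI_alpha g \<alpha> l) - (\<Sum>n<m. fedI_alpha_term n l))"
    unfolding vanishes_def
  proof (intro allI impI)
    fix e :: "('n + 'n) wvar \<Rightarrow> nat" assume m: "wdeg wy e < m"
    have "mcoeff (jW z (fedI_alpha g \<alpha> l)) e =
        (\<Sum>n\<le>wdeg wy e. mcoeff (jW z (fedI_term n l)) e) + (\<Sum>n<wdeg wy e. mcoeff (jW z (fedJ_term n l)) e)"
      unfolding mcoeff_jW eq[abs_def] ydeg_eq
      by (simp only: jet_add[OF open_S z_S] jet_sum sm cinf_on_sum[OF open_S])
    \<comment> \<open>The n-th terms have degree at least n + 1 in the y^i. Hence both sums may be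
      extended up to \<open>m\<close>, although one of them stops at the degree and the other just
      before it.\<close>
    also have "(\<Sum>n\<le>wdeg wy e. mcoeff (jW z (fedI_term n l)) e) = (\<Sum>n<m. mcoeff (jW z (fedI_term n l)) e)"
      using m V(1) by (intro sum.mono_neutral_left) (auto simp: vanishes_def)
    also have "(\<Sum>n<wdeg wy e. mcoeff (jW z (fedJ_term n l)) e) = (\<Sum>n<m. mcoeff (jW z (fedJ_term n l)) e)"
      using m V(2) by (intro sum.mono_neutral_left) (auto simp: vanishes_def)
    finally show "mcoeff (jW z (fedI_alpha g \<alpha> l) - (\<Sum>n<m. fedI_alpha_term n l)) e = 0"
      by (simp add: fedI_alpha_term_def sum.distrib)
  qed
qed

text \<open>The Euler field maps the partial sum with one more term to the covariant derivative of
  the preceding one plus the initial data. The equation follows by letting the partial sums approach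
  the series in the \<open>wy\<close>-filtration.\<close>

lemma fedI_alpha_euler: "euler Yl (jW z (fedI_alpha g \<alpha> l)) =
    (\<Sum>i\<in>UNIV. yl i * (nb (Inl i) (jW z (fedI_alpha g \<alpha> l)) + curv_series i l - jW z (alpha_form i l)))"
proof -
  let ?I = "jW z (fedI_alpha g \<alpha> l)"
  define P where "P m = (\<Sum>n<m. fedI_alpha_term n l)" for m
  have P: "euler Yl (P (Suc m)) = (\<Sum>i\<in>UNIV. yl i * (nb (Inl i) (P m) + curv_series i l - jW z (alpha_form i l)))" for m
  proof -
    have "euler Yl (P (Suc m)) = euler Yl (fedI_alpha_term 0 l) + (\<Sum>n<m. euler Yl (fedI_alpha_term (Suc n) l))"
      by (simp add: P_def euler_sum euler_add sum.lessThan_Suc_shift del: sum.lessThan_Suc)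
    also have "(\<Sum>n<m. euler Yl (fedI_alpha_term (Suc n) l)) = (\<Sum>i\<in>UNIV. yl i * nb (Inl i) (P m))"
      unfolding fedI_alpha_term_props by (subst sum.swap) (simp add: P_def nab_sum sum_distrib_left)
    finally show ?thesis
      by (simp add: fedI_alpha_term_props(1) distrib_left right_diff_distrib sum.distrib sum_subtractf)
  qed
  have "vanishes wy m (euler Yl ?I - (\<Sum>i\<in>UNIV. yl i * (nb (Inl i) ?I + curv_series i l - jW z (alpha_form i l))))" for m
  proof -
    have "vanishes wy (Suc m) (euler Yl (?I - P (Suc m)))"
      unfolding P_def by (rule vanishes_euler_op[OF fedI_alpha_approx])
    moreover have "vanishes wy (Suc m) (\<Sum>i\<in>UNIV. yl i * nb (Inl i) (?I - P m))"
      using fedI_alpha_approx[of m l]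
      by (intro vanishes_sum vanishes_X_mult[where m = m] vanishes_wy_nab) (auto simp: P_def)
    ultimately have "vanishes wy (Suc m) (euler Yl (?I - P (Suc m)) - (\<Sum>i\<in>UNIV. yl i * nb (Inl i) (?I - P m)))"
      by (rule vanishes_diff)
    then have "vanishes wy (Suc m) (euler Yl ?I - (\<Sum>i\<in>UNIV. yl i * (nb (Inl i) ?I + curv_series i l - jW z (alpha_form i l))))"
      unfolding euler_diff P by (simp add: nab_diff right_diff_distrib distrib_left sum.distrib sum_subtractf algebra_simps)
    then show ?thesis by (rule vanishes_mono) simp
  qed
  then have "euler Yl ?I - (\<Sum>i\<in>UNIV. yl i * (nb (Inl i) ?I + curv_series i l - jW z (alpha_form i l))) = 0"
    by (rule vanishes_imp_0)
  then show ?thesis by simp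
qed

lemma restr_fedI_alpha: "restr Yl (jW z (fedI_alpha g \<alpha> l)) = 0"
proof -
  have "vanishes wy 1 (jW z (fedI_alpha g \<alpha> l) - fedI_alpha_term 0 l)" using fedI_alpha_approx[of 1 l] by simp
  then have "restr Yl (jW z (fedI_alpha g \<alpha> l) - fedI_alpha_term 0 l) = 0"
    unfolding restr_eq_0_iff vanishes_def wdeg_wy by simp
  then show ?thesis by (simp add: restr_diff fedI_alpha_term_def restr_add restr_fedI_term fedJ_term_transfer)
qed

abbreviation "Jal i l \<equiv> jW z (alpha_form i l)"
abbreviation "JI l \<equiv> jW z (fedI_alpha g \<alpha> l)"

sublocale fedosov_series Jom J\<theta> J\<Gamma> Jal JI
proof
  show "fibre_const (Jal i l)" for i l
    unfolding fibre_const_def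
  proof (intro allI mps_eqI)
    fix B e
    show "mcoeff (dY B (Jal i l)) e = mcoeff 0 e"
      by (simp add: mcoeff_pd mcoeff_jW alpha_form_eq jet_const[OF open_S z_S] del: fun_upd_apply)
  qed
  show "vanishes fw 2 (Jal i l)" for i l
    unfolding vanishes_def
  proof (intro allI impI)
    fix e :: "('n + 'n) wvar \<Rightarrow> nat" assume e: "wdeg fw e < 2"
    \<comment> \<open>Below weight 2 there is no factor hbar, and \<open>\<alpha>\<close> has no
      term of order zero in hbar.\<close>
    have "fw Hv * e Hv \<le> wdeg fw e" unfolding wdeg_def using member_le_sum[of Hv UNIV "\<lambda>v. fw v * e v"] by simp
    then have "e Hv = 0" using e by simp
    moreover have "jet (\<lambda>w. \<alpha> 0 w $ i $ l) z x = jet (\<lambda>w. 0) z x" for x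
      by (rule jet_cong[OF open_S z_S]) (simp add: \<alpha>_0)
    ultimately show "mcoeff (Jal i l) e = 0"
      by (simp add: mcoeff_jW alpha_form_eq jet_const[OF open_S z_S])
  qed
  show "dZ (Inl k) (Jal i l) = dZ (Inl i) (Jal k l)" "dZ (Inr k) (Jal i l) = dZ (Inr l) (Jal i k)" for i k l
    unfolding jW_wirt[OF wsmooth_alpha_form, symmetric]
    by (rule jW_cong, simp add: alpha_form_eq wirt_const closed_form_\<alpha>[of _ k])+
qed (rule fedI_alpha_euler restr_fedI_alpha)+

lemma fedD_transfer:
  assumes "wsmooth S s"
  shows "wsmooth S (fedD g \<alpha> B s)" "jW z (fedD g \<alpha> B s) = fd B (jW z s)"
proof -
  have l: "fedD g \<alpha> (Inl i) s = (\<lambda>k e w. nabla g (Inl i) s k e w - ydiff (Inl i) s k e w)"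
    "fedD g \<alpha> (Inr l) s = (\<lambda>k e w. (nabla g (Inr l) s k e w - ydiff (Inr l) s k e w) + wick_bracket (fedI_alpha g \<alpha> l) s k e w)" for i l
    by (simp_all add: fun_eq_iff wick_bracket_def)
  show "wsmooth S (fedD g \<alpha> B s)"
    by (cases B; simp only: l; intro wsmooth_add wsmooth_diff wsmooth_nabla wsmooth_ydiff wsmooth_wick_bracket
        wsmooth_fedI_alpha assms)
  show "jW z (fedD g \<alpha> B s) = fd B (jW z s)"
    by (cases B) (simp_all only: l jW_add jW_diff jW_nabla jW_ydiff jW_wick_bracket wsmooth_add wsmooth_diff
        wsmooth_nabla wsmooth_ydiff wsmooth_wick_bracket wsmooth_fedI_alpha assms fd_simps dd_def)
qed

end

section \<open>Flat sections in a chart\<close>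

definition scalar_section :: "(nat \<Rightarrow> complex^'n \<Rightarrow> complex) \<Rightarrow> 'n::finite weyl" where
  "scalar_section f k e z = (if e = (\<lambda>_. 0) then f k z else 0)"

lemma scalar_section_eq: "scalar_section f k e = (if e = (\<lambda>_. 0) then f k else (\<lambda>_. 0))"
  by (auto simp: scalar_section_def)

context jet_point
begin

lemma sum_YA: "(\<Sum>v\<in>range Yv. e v) = (\<Sum>B\<in>UNIV. e (Yv B))"
  by (subst sum.reindex) (simp_all add: inj_on_def)

lemma restr_jW: "restr (range Yv) (jW z s) = jW z (scalar_section (\<lambda>k. s k (\<lambda>_. 0)))"
proof (rule mps_eqI)
  fix e :: "('n + 'n) wvar \<Rightarrow> nat"
  have "sum e (range Yv) = 0 \<longleftrightarrow> (\<lambda>B. e (Yv B)) = (\<lambda>_. 0)"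
    by (simp add: fun_eq_iff)
  then show "mcoeff (restr (range Yv) (jW z s)) e = mcoeff (jW z (scalar_section (\<lambda>k. s k (\<lambda>_. 0)))) e"
    by (simp add: mcoeff_restr mcoeff_jW scalar_section_eq jet_const[OF open_S z_S])
qed

lemma wsmooth_scalar_section: "(\<And>k. cinf_on S (f k)) \<Longrightarrow> wsmooth S (scalar_section f)"
  unfolding wsmooth_def scalar_section_eq by (simp add: cinf_on_const open_S)

lemma dZ_jW_scalar_section_0:
  assumes "\<And>k. cinf_on S (f k)" "\<And>k w. w \<in> S \<Longrightarrow> wirt B (f k) w = 0"
  shows "dZ B (jW z (scalar_section f)) = 0"
proof -
  have "dZ B (jW z (scalar_section f)) = jW z (\<lambda>k e. wirt B (scalar_section f k e))"
    by (rule jW_wirt[OF wsmooth_scalar_section[OF assms(1)], symmetric])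
  also have "\<dots> = jW z (\<lambda>k e w. 0)"
    by (rule jW_cong) (simp add: scalar_section_eq assms(2) wirt_const)
  finally show ?thesis by simp
qed

end

context kaehler_point
begin

definition fedD_delta :: "'n + 'n \<Rightarrow> 'n weyl \<Rightarrow> 'n weyl" where
  "fedD_delta B s k e w = fedD g \<alpha> B s k e w + ydiff B s k e w"

lemma fedD_delta_transfer:
  assumes "wsmooth S s"
  shows "wsmooth S (fedD_delta B s)" "jW z (fedD_delta B s) = fx B (jW z s)"
  unfolding fedD_delta_def[abs_def] using fedD_transfer[OF assms, of B] wsmooth_ydiff[OF assms]
  by (simp_all add: wsmooth_add jW_add jW_ydiff assms fd_eq)

end

text \<open>One Picard step for the fixed point equation: division by the fibre degree inverts the
  Euler field, and the term of fibre degree zero is reset to the prescribed symbol.\<close>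

definition fed_iter :: "'n::finite matfield \<Rightarrow> (nat \<Rightarrow> 'n matfield) \<Rightarrow> (nat \<Rightarrow> complex^'n \<Rightarrow> complex) \<Rightarrow> 'n weyl \<Rightarrow> 'n weyl" where
  "fed_iter g \<alpha> f s k e z = (if e = (\<lambda>_. 0) then f k z else
    (\<Sum>B\<in>UNIV. ymul B (\<lambda>k e z. fedD g \<alpha> B s k e z + ydiff B s k e z) k e z) / of_nat (sum e UNIV))"

text \<open>The iteration is constant in weight \<open>2 k + |e|\<close> after as many steps.\<close>

definition fed_flat :: "'n::finite matfield \<Rightarrow> (nat \<Rightarrow> 'n matfield) \<Rightarrow> (nat \<Rightarrow> complex^'n \<Rightarrow> complex) \<Rightarrow> 'n weyl" where
  "fed_flat g \<alpha> f k e = ((fed_iter g \<alpha> f ^^ Suc (2 * k + sum e UNIV)) (\<lambda>k e z. 0)) k e"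

lemma fed_flat_symbol: "fed_flat g \<alpha> f k (\<lambda>_. 0) z = f k z"
  by (simp add: fed_flat_def fed_iter_def)

lemma wdeg_fw:
  fixes e :: "'b::finite wvar \<Rightarrow> nat"
  shows "wdeg fw e = 2 * e Hv + (\<Sum>B\<in>UNIV. e (Yv B))"
proof -
  have "wdeg fw e = (\<Sum>x\<in>UNIV. fw (Inl x) * e (Inl x)) + (\<Sum>u\<in>UNIV. fw (Inr u) * e (Inr u))"
    unfolding wdeg_def using sum_UNIV_Plus[of "\<lambda>v. fw v * e v"] by simp
  also have "(\<Sum>x\<in>UNIV. fw (Inl x) * e (Inl x)) = (\<Sum>B\<in>UNIV. e (Yv B))"
    by (subst sum_UNIV_Plus) simp
  also have "(\<Sum>u\<in>UNIV. fw (Inr u) * e (Inr u)) = 2 * e Hv"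
    by (simp add: UNIV_unit)
  finally show ?thesis by simp
qed

context kaehler_point
begin

lemma fed_iter_transfer:
  assumes f: "\<And>k. cinf_on S (f k)" and s: "wsmooth S s"
  shows "wsmooth S (fed_iter g \<alpha> f s)"
    and "euler YA (jW z (fed_iter g \<alpha> f s)) = (\<Sum>B\<in>UNIV. X (Yv B) * fx B (jW z s))"
    and "restr YA (jW z (fed_iter g \<alpha> f s)) = jW z (scalar_section f)"
proof -
  define t where "t k e w = (\<Sum>B\<in>UNIV. ymul B (fedD_delta B s) k e w)" for k e w
  have t: "wsmooth S t" unfolding t_def[abs_def] by (intro wsmooth_sum wsmooth_ymul fedD_delta_transfer s)
  have d: "fed_iter g \<alpha> f s k e = (if e = (\<lambda>_. 0) then f k else (\<lambda>w. (1 / of_nat (sum e UNIV)) * t k e w))" for k e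
    by (auto simp: fed_iter_def t_def fedD_delta_def[abs_def] fun_eq_iff)
  show "wsmooth S (fed_iter g \<alpha> f s)"
    unfolding wsmooth_def d
  proof (intro allI)
    fix k e
    have "cinf_on S (t k e)" using t by (simp add: wsmooth_def)
    then have "cinf_on S (\<lambda>w. (1 / of_nat (sum e UNIV)) * t k e w)"
      by (intro cinf_on_mult cinf_on_const open_S)
    then show "cinf_on S (if e = (\<lambda>_. 0) then f k else (\<lambda>w. (1 / of_nat (sum e UNIV)) * t k e w))"
      using f by simp
  qed
  have jt: "jW z t = (\<Sum>B\<in>UNIV. X (Yv B) * fx B (jW z s))"
    unfolding t_def[abs_def] by (simp add: jW_sum jW_ymul wsmooth_ymul fedD_delta_transfer s)
  show "restr YA (jW z (fed_iter g \<alpha> f s)) = jW z (scalar_section f)"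
    unfolding restr_jW by (simp add: d)
  have "of_nat (sum e YA) * mcoeff (jW z (fed_iter g \<alpha> f s)) e = mcoeff (jW z t) e" for e
  proof (cases "sum e YA = 0")
    case True
    then have "e (Yv B) = 0" for B by simp
    then have "mcoeff (jW z t) e = 0" by (simp add: jt mcoeff_X_mult)
    then show ?thesis by (simp only: True of_nat_0 mult_zero_left)
  next
    case False
    have n: "sum e YA = (\<Sum>B\<in>UNIV. e (Yv B))" by (subst sum.reindex) (simp_all add: inj_on_def)
    have "(\<lambda>B. e (Yv B)) \<noteq> (\<lambda>_. 0)"
    proof
      assume "(\<lambda>B. e (Yv B)) = (\<lambda>_. 0)"
      then have "e (Yv B) = 0" for B by (rule fun_cong)
      with False n show False by simp
    qed
    then have "mcoeff (jW z (fed_iter g \<alpha> f s)) e = 1 / of_nat (sum e YA) * mcoeff (jW z t) e"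
      unfolding mcoeff_jW d n using t by (simp only: if_False) (intro jet_mult_const, simp add: wsmooth_def)
    moreover have "(of_nat (sum e YA) :: complex) \<noteq> 0"
      using False by (simp only: of_nat_eq_0_iff not_False_eq_True)
    ultimately show ?thesis by (simp del: of_nat_sum)
  qed
  then show "euler YA (jW z (fed_iter g \<alpha> f s)) = (\<Sum>B\<in>UNIV. X (Yv B) * fx B (jW z s))"
    unfolding jt[symmetric] by (intro mps_eqI) (simp only: mcoeff_euler)
qed

lemma fed_flat_transfer:
  assumes f: "\<And>k. cinf_on S (f k)"
  shows "wsmooth S (fed_flat g \<alpha> f)"
    and "euler YA (jW z (fed_flat g \<alpha> f)) = (\<Sum>B\<in>UNIV. X (Yv B) * fx B (jW z (fed_flat g \<alpha> f)))"
proof -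
  define q where "q n = (fed_iter g \<alpha> f ^^ n) (\<lambda>k e z. 0)" for n
  have q_Suc: "q (Suc n) = fed_iter g \<alpha> f (q n)" for n by (simp add: q_def)
  have qs: "wsmooth S (q n)" for n
  proof (induction n)
    case 0
    show ?case by (simp add: q_def wsmooth_def cinf_on_const open_S)
  qed (simp add: q_Suc fed_iter_transfer(1) f)
  define \<sigma> where "\<sigma> n = jW z (q n)" for n
  have eu: "euler YA (\<sigma> (Suc n)) = (\<Sum>B\<in>UNIV. X (Yv B) * fx B (\<sigma> n))" for n
    unfolding \<sigma>_def q_Suc by (rule fed_iter_transfer(2)[OF f qs])
  have re: "restr YA (\<sigma> (Suc n)) = jW z (scalar_section f)" for n
    unfolding \<sigma>_def q_Suc by (rule fed_iter_transfer(3)[OF f qs])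
  \<comment> \<open>From the first iterate on, the symbol is fixed, so later differences have no
    part of fibre degree zero. The Euler field is then invertible on them, and the factor
    \<open>X (Yv B)\<close> gains one weight per step.\<close>
  have step: "vanishes fw n (\<sigma> (Suc n) - \<sigma> n)" for n
  proof (induction n)
    case (Suc n)
    have "vanishes fw (Suc n) (euler YA (\<sigma> (Suc (Suc n)) - \<sigma> (Suc n)))"
    proof -
      have "euler YA (\<sigma> (Suc (Suc n)) - \<sigma> (Suc n)) = (\<Sum>B\<in>UNIV. X (Yv B) * fx B (\<sigma> (Suc n) - \<sigma> n))"
        by (simp add: euler_diff eu fx_diff right_diff_distrib sum_subtractf)
      then show ?thesis
        using Suc by (auto intro!: vanishes_sum vanishes_X_mult[where m = n] vanishes_fx)
    qed
    moreover have "restr YA (\<sigma> (Suc (Suc n)) - \<sigma> (Suc n)) = 0" by (simp add: restr_diff re)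
    ultimately show ?case using vanishes_euler by blast
  qed simp
  have stab: "vanishes fw n (\<sigma> (n + m) - \<sigma> n)" for n m
  proof (induction m)
    case (Suc m)
    have "vanishes fw n (\<sigma> (Suc (n + m)) - \<sigma> (n + m))"
      by (rule vanishes_mono[OF step]) simp
    from vanishes_add[OF this Suc] show ?case by simp
  qed simp
  have flat_q: "fed_flat g \<alpha> f k e = q (Suc (2 * k + sum e UNIV)) k e" for k e
    by (simp add: fed_flat_def q_def)
  show "wsmooth S (fed_flat g \<alpha> f)"
    using qs by (simp add: wsmooth_def flat_q)
  let ?Q = "jW z (fed_flat g \<alpha> f)"
  \<comment> \<open>\<open>fed_flat\<close> selects the iterate by the exponents of hbar and of the
    fibre variables alone. The base displacement has weight 0, so this selection is compatible with
    the Taylor expansion of the coefficients.\<close>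
  have Q: "vanishes fw n (?Q - \<sigma> n)" for n
    unfolding vanishes_def
  proof (intro allI impI)
    fix e :: "('n + 'n) wvar \<Rightarrow> nat" assume n: "wdeg fw e < n"
    have "mcoeff ?Q e = mcoeff (\<sigma> (Suc (wdeg fw e))) e"
      by (simp add: mcoeff_jW flat_q wdeg_fw \<sigma>_def)
    moreover have "mcoeff (\<sigma> (Suc (wdeg fw e) + (n - Suc (wdeg fw e))) - \<sigma> (Suc (wdeg fw e))) e = 0"
      using stab[of "Suc (wdeg fw e)" "n - Suc (wdeg fw e)"] by (simp add: vanishes_def)
    ultimately show "mcoeff (?Q - \<sigma> n) e = 0" using n by simp
  qed
  have "vanishes fw n (euler YA ?Q - (\<Sum>B\<in>UNIV. X (Yv B) * fx B ?Q))" for n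
  proof -
    have "vanishes fw n (euler YA (?Q - \<sigma> (Suc n)))"
      by (rule vanishes_mono[OF vanishes_euler_op[OF Q]]) simp
    moreover have "vanishes fw n (\<Sum>B\<in>UNIV. X (Yv B) * fx B (?Q - \<sigma> n))"
      by (intro vanishes_sum vanishes_mult_left vanishes_fx Q)
    ultimately have "vanishes fw n (euler YA (?Q - \<sigma> (Suc n)) - (\<Sum>B\<in>UNIV. X (Yv B) * fx B (?Q - \<sigma> n)))"
      by (rule vanishes_diff)
    then show ?thesis
      by (simp add: euler_diff eu fx_diff right_diff_distrib sum_subtractf)
  qed
  then have "euler YA ?Q - (\<Sum>B\<in>UNIV. X (Yv B) * fx B ?Q) = 0" by (rule vanishes_imp_0)
  then show "euler YA ?Q = (\<Sum>B\<in>UNIV. X (Yv B) * fx B ?Q)" by simp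
qed

lemma fed_flat_flat:
  assumes f: "\<And>k. cinf_on S (f k)"
  shows "fedD g \<alpha> B (fed_flat g \<alpha> f) k e z = 0"
proof -
  have "jW z (fedD g \<alpha> B (fed_flat g \<alpha> f)) = 0"
    using fed_flat_transfer[OF f] by (simp add: fedD_transfer fixpoint_flat)
  then show ?thesis using mcoeff_jW_wmon[of z "fedD g \<alpha> B (fed_flat g \<alpha> f)" k e] by simp
qed

end

lemma (in kaehler_patch) flat_symbol_wick:
  assumes a: "wsmooth S a" "\<And>w B k e. w \<in> S \<Longrightarrow> fedD g \<alpha> B a k e w = 0"
    and b: "wsmooth S b" "\<And>w B k e. w \<in> S \<Longrightarrow> fedD g \<alpha> B b k e w = 0"
    and "(\<forall>w\<in>S. \<forall>k i. wirt (Inl i) (a k (\<lambda>_. 0)) w = 0) \<or> (\<forall>w\<in>S. \<forall>k j. wirt (Inr j) (b k (\<lambda>_. 0)) w = 0)"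
    and z: "z \<in> S"
  shows "wick g a b k (\<lambda>_. 0) z = (\<Sum>l\<le>k. a l (\<lambda>_. 0) z * b (k - l) (\<lambda>_. 0) z)"
proof -
  interpret p: kaehler_point S g \<alpha> z by (rule kaehler_point[OF z])
  have flat: "p.fd B (jW z a) = 0" "p.fd B (jW z b) = 0" for B
  proof -
    have "jW z (fedD g \<alpha> B a) = jW z (\<lambda>k e w. 0)" "jW z (fedD g \<alpha> B b) = jW z (\<lambda>k e w. 0)"
      by (rule p.jW_cong, simp only: a b)+
    then show "p.fd B (jW z a) = 0" "p.fd B (jW z b) = 0"
      by (simp_all add: p.fedD_transfer a b)
  qed
  have sm: "cinf_on S (a k e)" "cinf_on S (b k e)" for k e using a(1) b(1) by (auto simp: wsmooth_def)
  have "p.star (jW z a) (jW z b) = jW z (wick g a b)" by (simp add: p.jW_wick a b)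
  moreover have "restr p.YA (p.star (jW z a) (jW z b)) = restr p.YA (jW z a) * restr p.YA (jW z b)"
  proof (rule p.flat_wick)
    from assms(5) show "(\<forall>i. p.fd (Inl i) (jW z a) = 0 \<and> dZ (Inl i) (restr p.YA (jW z a)) = 0) \<or>
        (\<forall>l. p.fd (Inr l) (jW z b) = 0 \<and> dZ (Inr l) (restr p.YA (jW z b)) = 0)"
      by (simp add: flat p.restr_jW) (blast intro: p.dZ_jW_scalar_section_0 sm)
  qed
  \<comment> \<open>The product of the two symbols is presented as the symbol part of the undeformed
    product, so that the claim can be read off from one coefficient.\<close>
  ultimately have "restr p.YA (jW z (wick g a b)) = restr p.YA (jW z (wmult a b))"
    by (simp add: p.jW_wmult a b restr_mult)
  then have "mcoeff (restr p.YA (jW z (wick g a b))) (wmon k (\<lambda>_. 0)) = mcoeff (restr p.YA (jW z (wmult a b))) (wmon k (\<lambda>_. 0))"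
    by simp
  then have "wick g a b k (\<lambda>_. 0) z = wmult a b k (\<lambda>_. 0) z"
    by (simp add: mcoeff_restr mcoeff_jW_wmon)
  also have "{..(\<lambda>_. 0)} = {(\<lambda>_. 0) :: 'n + 'n \<Rightarrow> nat}" by (auto simp: le_fun_def)
  then have "wmult a b k (\<lambda>_. 0) z = (\<Sum>l\<le>k. a l (\<lambda>_. 0) z * b (k - l) (\<lambda>_. 0) z)"
    by (simp add: wmult_alt fun_diff_def)
  finally show ?thesis .
qed

section \<open>Change of coordinates\<close>

locale smooth_change =
  fixes S S' :: "(complex^'n::finite) set" and \<phi> :: "complex^'n \<Rightarrow> complex^'n"
  assumes open_S: "open S" and open_S': "open S'"
    and maps: "z \<in> S \<Longrightarrow> \<phi> z \<in> S'"
    and smooth_\<phi>: "cinf_on S (\<lambda>z. \<phi> z $ i)"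
    and holomorphic_\<phi>: "z \<in> S \<Longrightarrow> wirt (Inr j) (\<lambda>z. \<phi> z $ i) z = 0"
begin

text \<open>The new coordinates together with their conjugates, which gives the chain rule for
  Wirtinger derivatives a uniform shape.\<close>

definition frame_coord :: "'n + 'n \<Rightarrow> complex^'n \<Rightarrow> complex" where
  "frame_coord B z = (case B of Inl i \<Rightarrow> \<phi> z $ i | Inr i \<Rightarrow> cnj (\<phi> z $ i))"

lemma frame_coord_eq: "frame_coord (Inl i) = (\<lambda>z. \<phi> z $ i)" "frame_coord (Inr i) = (\<lambda>z. cnj (\<phi> z $ i))"
  by (simp_all add: frame_coord_def fun_eq_iff)

lemma smooth_frame_coord: "cinf_on S (frame_coord B)"
  by (cases B) (simp_all add: frame_coord_eq smooth_\<phi> cinf_on_cnj open_S)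

lemma compose_has_derivative:
  assumes z: "z \<in> S" and f: "(f has_derivative F) (at (\<phi> z))"
  shows "((\<lambda>z. f (\<phi> z)) has_derivative (\<lambda>v. F (\<chi> i. frechet_derivative (\<lambda>z. \<phi> z $ i) (at z) v))) (at z)"
proof -
  have "(\<phi> has_derivative (\<lambda>v. \<chi> i. frechet_derivative (\<lambda>z. \<phi> z $ i) (at z) v)) (at z)"
    unfolding has_derivative_componentwise_within[of \<phi>]
  proof
    fix b :: "complex^'n" assume "b \<in> Basis"
    then obtain i u where b: "b = axis i u" by (auto simp: Basis_vec_def)
    show "((\<lambda>x. \<phi> x \<bullet> b) has_derivative
        (\<lambda>x. (\<chi> i. frechet_derivative (\<lambda>z. \<phi> z $ i) (at z) x) \<bullet> b)) (at z)"
      unfolding b inner_axis vec_lambda_beta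
      by (rule has_derivative_inner_left[OF cinf_on_has_derivative[OF smooth_\<phi> z]])
  qed
  from has_derivative_compose[OF this f] show ?thesis .
qed

lemma frechet_compose:
  assumes z: "z \<in> S" and f: "cinf_on S' f"
  shows "F = frechet_derivative f (at (\<phi> z)) \<Longrightarrow> F (\<chi> i. frechet_derivative (\<lambda>z. \<phi> z $ i) (at z) v) =
    (\<Sum>B\<in>UNIV. wirt B f (\<phi> z) * frechet_derivative (frame_coord B) (at z) v)"
proof -
  have "frechet_derivative (frame_coord (Inr j)) (at z) v = cnj (frechet_derivative (frame_coord (Inl j)) (at z) v)" for j
    unfolding frame_coord_eq
    by (subst frechet_derivative_at[symmetric, OF has_derivative_cnj[OF cinf_on_has_derivative[OF smooth_\<phi> z]]]) simp
  then show "F = frechet_derivative f (at (\<phi> z)) \<Longrightarrow> F (\<chi> i. frechet_derivative (\<lambda>z. \<phi> z $ i) (at z) v) =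
    (\<Sum>B\<in>UNIV. wirt B f (\<phi> z) * frechet_derivative (frame_coord B) (at z) v)"
    by (simp add: frechet_derivative_wirt[OF f maps[OF z]] sum_UNIV_Plus sum.distrib frame_coord_eq)
qed

lemma cinf_on_compose:
  assumes "cinf_on S' f"
  shows "cinf_on S (\<lambda>z. f (\<phi> z))"
proof -
  \<comment> \<open>The derivative of a composition involves compositions with the functions
    \<open>wirt B f\<close>, so the induction on the order treats all \<open>f\<close> at
    once.\<close>
  have "\<forall>f. cinf_on S' f \<longrightarrow> Ck n S (\<lambda>z. f (\<phi> z))" for n
  proof (induction n)
    case (Suc n)
    show ?case
    proof (intro allI impI)
      fix f assume f: "cinf_on S' f"
      show "Ck (Suc n) S (\<lambda>z. f (\<phi> z))"
      proof (rule Ck_SucI[OF open_S])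
        show "((\<lambda>z. f (\<phi> z)) has_derivative (\<lambda>v. \<Sum>B\<in>UNIV. wirt B f (\<phi> z) * frechet_derivative (frame_coord B) (at z) v)) (at z)"
          if z: "z \<in> S" for z
          using compose_has_derivative[OF z cinf_on_has_derivative[OF f maps[OF z]]]
          unfolding frechet_compose[OF z f refl] .
        have Ck_sum: "Ck n S (\<lambda>z. \<Sum>x\<in>A. h x z)" if "finite A" "\<And>x. Ck n S (h x)" for A and h :: "'n + 'n \<Rightarrow> _"
          using that by (induction A) (simp_all add: Ck_add Ck_const open_S)
        show "Ck n S (\<lambda>z. \<Sum>B\<in>UNIV. wirt B f (\<phi> z) * frechet_derivative (frame_coord B) (at z) v)" for v
        proof (rule Ck_sum)
          fix B
          have "Ck n S (\<lambda>z. wirt B f (\<phi> z))" using Suc cinf_on_wirt[OF open_S' f] by blast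
          moreover have "Ck n S (\<lambda>z. frechet_derivative (frame_coord B) (at z) v)"
            using cinf_on_frechet[OF smooth_frame_coord] by (simp add: cinf_on_iff_Ck)
          ultimately show "Ck n S (\<lambda>z. wirt B f (\<phi> z) * frechet_derivative (frame_coord B) (at z) v)"
            by (rule Ck_mult[OF open_S])
        qed simp
      qed
    qed
  qed simp
  then show ?thesis using assms by (simp add: cinf_on_iff_Ck)
qed

lemma wirt_compose:
  assumes z: "z \<in> S" and f: "cinf_on S' f"
  shows "wirt C (\<lambda>z. f (\<phi> z)) z = (\<Sum>B\<in>UNIV. wirt B f (\<phi> z) * wirt C (frame_coord B) z)"
proof -
  have "wirt C (\<lambda>z. f (\<phi> z)) z =
      ((\<Sum>B\<in>UNIV. wirt B f (\<phi> z) * frechet_derivative (frame_coord B) (at z) (axis (widx C) 1)) +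
       wsgn C * (\<Sum>B\<in>UNIV. wirt B f (\<phi> z) * frechet_derivative (frame_coord B) (at z) (axis (widx C) \<i>))) / 2"
    by (subst wirt_has_derivative[OF compose_has_derivative[OF z cinf_on_has_derivative[OF f maps[OF z]]]])
      (simp only: frechet_compose[OF z f refl])
  also have "\<dots> = (\<Sum>B\<in>UNIV. wirt B f (\<phi> z) * wirt C (frame_coord B) z)"
    by (simp add: wirt_eq sum_distrib_left sum.distrib[symmetric] sum_divide_distrib distrib_left
        add_divide_distrib mult.left_commute)
  finally show ?thesis .
qed

definition Jm :: "'n \<Rightarrow> 'n \<Rightarrow> complex^'n \<Rightarrow> complex" where
  "Jm i j = wirt (Inl j) (\<lambda>z. \<phi> z $ i)"

lemma smooth_Jm: "cinf_on S (Jm i j)"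
  unfolding Jm_def by (rule cinf_on_wirt[OF open_S smooth_\<phi>])

lemma wirt_frame_coord: assumes "z \<in> S"
  shows "wirt (Inl j) (frame_coord (Inl i)) z = Jm i j z" "wirt (Inr j) (frame_coord (Inr i)) z = cnj (Jm i j z)"
    "wirt (Inr j) (frame_coord (Inl i)) z = 0" "wirt (Inl j) (frame_coord (Inr i)) z = 0"
  using assms by (simp_all add: frame_coord_eq Jm_def holomorphic_\<phi> wirt_cnj[OF smooth_\<phi>])

end

lemma wmon_zero: "wmon 0 (\<lambda>_. 0) = (\<lambda>_. 0)"
  by (auto simp: fun_eq_iff wmon_def split: sum.splits)

lemma jF_const_term: "mcoeff (jF z f) (\<lambda>_. 0) = f z"
  using mcoeff_jW_wmon[of z "scalar_fun f" 0 "\<lambda>_. 0"] by (simp add: wmon_zero scalar_fun_def)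

lemma pd_H_jF: "open S \<Longrightarrow> z \<in> S \<Longrightarrow> pd Hv (jF z f) = 0"
proof (rule mps_eqI)
  fix e assume S: "open S" "z \<in> S"
  have "scalar_fun f (Suc n) e' = (\<lambda>_. 0)" for n e' by (simp add: scalar_fun_def fun_eq_iff)
  then show "mcoeff (pd Hv (jF z f)) e = mcoeff 0 e"
    by (simp add: mcoeff_pd mcoeff_jW jet_const[OF S])
qed

locale change_point = smooth_change S S' \<phi> + jet_point S z
  for S S' :: "(complex^'n::finite) set" and \<phi> z
begin

definition M :: "'n + 'n \<Rightarrow> 'n + 'n \<Rightarrow> ('n + 'n) wvar mps" where
  "M B C = jF z (wirt C (frame_coord B))"

text \<open>The pullback of series at \<open>\<phi> z\<close> to series at \<open>z\<close> is the substitution of the jet of \<open>\<phi>\<close> for the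
  base displacement and of the Jacobian, applied to the fibre variables, for the fibre variables.\<close>

definition L :: "('n + 'n) wvar \<Rightarrow> ('n + 'n) wvar mps" where
  "L v = (case v of Inl (Inl B) \<Rightarrow> jF z (frame_coord B) - K (frame_coord B z)
     | Inl (Inr B) \<Rightarrow> (\<Sum>C\<in>UNIV. M B C * X (Yv C)) | Inr _ \<Rightarrow> X Hv)"

lemma L_simps [simp]: "L (Zv B) = jF z (frame_coord B) - K (frame_coord B z)"
  "L (Yv B) = (\<Sum>C\<in>UNIV. M B C * X (Yv C))" "L Hv = X Hv"
  by (simp_all add: L_def)

sublocale substitution L
proof
  fix v
  show "mcoeff (L v) (\<lambda>_. 0) = 0"
  proof (cases v)
    case (Inl x)
    then show ?thesis
      by (cases x) (simp_all add: jF_const_term mcoeff_K mult.commute[of "M _ _"] mcoeff_X_mult)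
  qed simp
qed

abbreviation T where "T \<equiv> subst L"

lemma fc_M: "fibre_const (M B C)"
  unfolding M_def by (rule fibre_const_jF)

lemma dY_M [simp]: "dY A (M B C) = 0"
  using fc_M by (simp add: fibre_const_def)

lemma dZ_frame_coord: "dZ C (jF z (frame_coord B)) = M B C"
  by (simp add: M_def jF_wirt smooth_frame_coord)

lemma jF_0: "(\<And>w. w \<in> S \<Longrightarrow> f w = 0) \<Longrightarrow> jF z f = 0"
  using jF_cong[of f "\<lambda>_. 0"] by (simp add: jF_const)

lemma M_eq: "M (Inl i) (Inl j) = jF z (Jm i j)" "M (Inr i) (Inr j) = jF z (\<lambda>w. cnj (Jm i j w))"
  "M (Inl i) (Inr j) = 0" "M (Inr i) (Inl j) = 0"
  unfolding M_def by ((rule jF_cong jF_0, simp add: wirt_frame_coord)+)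

abbreviation "mh i j \<equiv> M (Inl i) (Inl j)"
abbreviation "ma i j \<equiv> M (Inr i) (Inr j)"

lemma dZ_mixed: "dZ (Inr k) (mh i j) = 0" "dZ (Inl k) (ma i j) = 0"
proof -
  have "dZ (Inr k) (mh i j) = dZ (Inl j) (M (Inl i) (Inr k))" "dZ (Inl k) (ma i j) = dZ (Inr j) (M (Inr i) (Inl k))"
    unfolding dZ_frame_coord[symmetric] by (rule pd_commute)+
  then show "dZ (Inr k) (mh i j) = 0" "dZ (Inl k) (ma i j) = 0" by (simp_all add: M_eq)
qed

lemma hlinear_T: "hlinear T"
  by (simp add: hlinear_def subst_add subst_X_mult)

lemma sum_wvar: "(\<Sum>v\<in>UNIV. f v) = (\<Sum>B\<in>UNIV. f (Zv B)) + (\<Sum>B\<in>UNIV. f (Yv B)) + f Hv"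
  for f :: "('n + 'n) wvar \<Rightarrow> 'r::comm_monoid_add"
proof -
  have "(\<Sum>v\<in>UNIV. f v) = (\<Sum>x\<in>UNIV. f (Inl x)) + (\<Sum>u\<in>UNIV. f (Inr u))"
    using sum_UNIV_Plus[of f] by simp
  then show ?thesis using sum_UNIV_Plus[of "\<lambda>x. f (Inl x)"] by (simp add: UNIV_unit)
qed

lemma dY_T: "dY C (T a) = (\<Sum>B\<in>UNIV. M B C * T (dY B a))"
proof -
  have j: "dY C (jF z f) = 0" for f using fibre_const_jF by (simp add: fibre_const_def)
  have "dY C (L (Yv B)) = (\<Sum>D\<in>UNIV. if D = C then M B D else 0)" for B
    unfolding L_simps pd_sum by (intro sum.cong) (auto simp: pd_mult pd_X)
  then have "dY C (L (Yv B)) = M B C" for B by simp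
  then show ?thesis
    unfolding pd_subst sum_wvar by (simp add: j pd_X del: L_simps(2))
qed

text \<open>Taylor expansion commutes with composition. The defect \<open>D f\<close> has zero
  constant term, and by the chain rule on both sides its derivatives are combinations of defects of
  derivatives of \<open>f\<close>. The order of vanishing for all \<open>f\<close> together
  therefore increases without bound.\<close>

lemma pull: assumes "cinf_on S' f" shows "T (jF (\<phi> z) f) = jF z (\<lambda>w. f (\<phi> w))"
proof -
  interpret t: jet_point S' "\<phi> z" by unfold_locales (use open_S' maps[OF z_S] in auto)
  define D where "D f = T (jF (\<phi> z) f) - jF z (\<lambda>w. f (\<phi> w))" for f
  have jy: "dY C (jF z f) = 0" "dY C (jF (\<phi> z) f) = 0" for C f
    using fibre_const_jF t.fibre_const_jF by (simp_all add: fibre_const_def)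
  have jh: "pd Hv (jF z f) = 0" "pd Hv (jF (\<phi> z) f) = 0" for f
    using pd_H_jF open_S z_S t.open_S t.z_S by blast+
  have DZ: "dZ C (D f) = (\<Sum>B\<in>UNIV. M B C * D (wirt B f))" if f: "cinf_on S' f" for C f
  proof -
    have "dZ C (T (jF (\<phi> z) f)) = (\<Sum>B\<in>UNIV. M B C * T (jF (\<phi> z) (wirt B f)))"
      unfolding pd_subst sum_wvar by (simp add: jy jh dZ_frame_coord t.jF_wirt[OF f])
    moreover have "dZ C (jF z (\<lambda>w. f (\<phi> w))) = (\<Sum>B\<in>UNIV. M B C * jF z (\<lambda>w. wirt B f (\<phi> w)))"
    proof -
      have "dZ C (jF z (\<lambda>w. f (\<phi> w))) = jF z (\<lambda>w. \<Sum>B\<in>UNIV. wirt C (frame_coord B) w * wirt B f (\<phi> w))"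
        unfolding jF_wirt[OF cinf_on_compose[OF f], symmetric]
        by (rule jF_cong) (simp add: wirt_compose f mult.commute)
      then show ?thesis
        using cinf_on_compose[OF cinf_on_wirt[OF open_S' f]]
        by (simp add: jF_sum jF_mult M_def cinf_on_mult open_S cinf_on_wirt smooth_frame_coord)
    qed
    ultimately show ?thesis by (simp add: D_def right_diff_distrib sum_subtractf)
  qed
  have DY: "dY C (D f) = 0" for C f
    by (simp add: D_def dY_T jy)
  have DH: "pd Hv (D f) = 0" for f
    unfolding D_def pd_diff pd_subst sum_wvar by (simp add: jy jh)
  have const: "mcoeff (D f) (\<lambda>_. 0) = 0" for f
  proof -
    have "{e :: ('n + 'n) wvar \<Rightarrow> nat. wdeg tot e \<le> 0} = {\<lambda>_. 0}"
      by (auto simp: wdeg_tot fun_eq_iff)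
    then have "mcoeff (T a) (\<lambda>_. 0) = mcoeff a (\<lambda>_. 0)" for a
      unfolding mcoeff_subst psub_def by (simp add: mpow_def mcoeff_K)
    then show ?thesis by (simp add: D_def jF_const_term)
  qed
  have "\<forall>f. cinf_on S' f \<longrightarrow> vanishes tot n (D f)" for n
  proof (induction n)
    case (Suc n)
    show ?case
    proof (intro allI impI)
      fix f assume f: "cinf_on S' f"
      have "restr UNIV (D f) = 0"
        unfolding restr_eq_0_iff
      proof (intro allI impI)
        fix e :: "('n + 'n) wvar \<Rightarrow> nat" assume "sum e UNIV = 0"
        then have "e = (\<lambda>_. 0)" by (auto simp: fun_eq_iff)
        then show "mcoeff (D f) e = 0" by (simp add: const)
      qed
      moreover have "vanishes tot (Suc n) (euler UNIV (D f))"
      proof -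
        have eq: "euler UNIV (D f) = (\<Sum>C\<in>UNIV. X (Zv C) * (\<Sum>B\<in>UNIV. M B C * D (wirt B f)))"
          unfolding euler_def sum_wvar by (simp add: DZ[OF f] DY DH)
        have "vanishes tot n (\<Sum>B\<in>UNIV. M B C * D (wirt B f))" for C
          using Suc cinf_on_wirt[OF open_S' f] by (intro vanishes_sum vanishes_mult_left) blast
        then have "vanishes tot (Suc n) (X (Zv C) * (\<Sum>B\<in>UNIV. M B C * D (wirt B f)))" for C
          by - (rule vanishes_X_mult[where m = n], simp_all add: tot_def)
        then show ?thesis unfolding eq by (rule vanishes_sum)
      qed
      ultimately show "vanishes tot (Suc n) (D f)" using vanishes_euler by blast
    qed
  qed simp
  then have "D f = 0" using assms by (intro vanishes_imp_0) blast
  then show ?thesis by (simp add: D_def)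
qed

lemma jW_scalar_section_hsum:
  fixes w :: "complex^'n"
  assumes R: "open R" "w \<in> R"
  shows "jW w (scalar_section f) = hsum (\<lambda>k. jF w (f k))"
proof (rule mps_eqI)
  have jp: "jet_point R w" using R by (rule jet_point.intro)
  fix e :: "('n + 'n) wvar \<Rightarrow> nat"
  have "mcoeff (jF w (f k)) (e(Hv := e Hv - k)) = (if k = e Hv then mcoeff (jW w (scalar_section f)) e else 0)"
    if "k \<le> e Hv" for k
    using that by (auto simp: mcoeff_jW jet_point.scalar_fun_eq[OF jp] scalar_section_eq jet_const[OF R])
  then have "mcoeff (hsum (\<lambda>k. jF w (f k))) e = (\<Sum>k\<le>e Hv. if k = e Hv then mcoeff (jW w (scalar_section f)) e else 0)"
    unfolding mcoeff_hsum by (intro sum.cong) auto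
  then show "mcoeff (jW w (scalar_section f)) e = mcoeff (hsum (\<lambda>k. jF w (f k))) e" by simp
qed

lemma pull_scalar_section:
  assumes "\<And>k. cinf_on S' (f k)"
  shows "T (jW (\<phi> z) (scalar_section f)) = jW z (scalar_section (\<lambda>k w. f k (\<phi> w)))"
proof -
  have "T (jW (\<phi> z) (scalar_section f)) = hsum (\<lambda>k. T (jF (\<phi> z) (f k)))"
    unfolding jW_scalar_section_hsum[OF open_S' maps[OF z_S]] by (rule hlinear_hsum[OF hlinear_T])
  then show ?thesis by (simp add: pull assms jW_scalar_section_hsum[OF open_S z_S])
qed

end

context kaehler_series
begin

text \<open>The parallel frame behind \<open>curvature_hol\<close>; the naturality of the connection
  is tested on it.\<close>

lemma nab_lower_yl: "nb (Inl i) (\<Sum>m\<in>UNIV. om m q * yl m) = 0"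
proof -
  have "nb (Inl i) (\<Sum>m\<in>UNIV. om m q * yl m) = (\<Sum>m\<in>UNIV. dZ (Inl i) (om m q) * yl m) -
      (\<Sum>m\<in>UNIV. om m q * (\<Sum>k\<in>UNIV. gh i k m * yl k))"
    by (simp add: nab_sum nab_mult nab_yl nab_fibre_const fc_om sum.distrib sum_subtractf sum_negf)
  also have "(\<Sum>m\<in>UNIV. om m q * (\<Sum>k\<in>UNIV. gh i k m * yl k)) = (\<Sum>k\<in>UNIV. dZ (Inl i) (om k q) * yl k)"
    unfolding sum_matrix_assoc by (simp add: \<Gamma>_hol[symmetric] mult.commute)
  finally show ?thesis by simp
qed

lemma nab_lower_yr: "nb (Inr l) (\<Sum>q\<in>UNIV. om k q * yr q) = 0"
proof -
  have "nb (Inr l) (\<Sum>q\<in>UNIV. om k q * yr q) = (\<Sum>q\<in>UNIV. dZ (Inr l) (om k q) * yr q) -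
      (\<Sum>r\<in>UNIV. om k r * (\<Sum>q\<in>UNIV. ga l q r * yr q))"
    by (simp add: nab_sum nab_mult nab_yr nab_fibre_const fc_om sum.distrib sum_subtractf sum_negf)
  also have "(\<Sum>r\<in>UNIV. om k r * (\<Sum>q\<in>UNIV. ga l q r * yr q)) = (\<Sum>q\<in>UNIV. dZ (Inr l) (om k q) * yr q)"
    unfolding sum_matrix_assoc by (simp add: \<Gamma>_anti[symmetric] mult.commute)
  finally show ?thesis by simp
qed

lemma br_scalar: "fibre_const c \<Longrightarrow> br (c * a) b = c * br a b" "fibre_const c \<Longrightarrow> br a (c * b) = c * br a b"
  unfolding br_def
  by (simp_all add: Phi_scalar_left Phi_scalar_right right_diff_distrib[symmetric] mult.left_commute[of "K _"]
      hlinear_hsum[OF hlinear_mult, symmetric] del: Phi.simps)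

lemma br_sum: "br (sum f A) b = (\<Sum>x\<in>A. br (f x) b)" "br a (sum f A) = (\<Sum>x\<in>A. br a (f x))"
  by (induction A rule: infinite_finite_induct) (simp_all add: br_add)

end

locale patch_change = smooth_change S S' \<phi> + s: kaehler_patch S g \<alpha> + t: kaehler_patch S' g' \<alpha>'
  for S S' :: "(complex^'n::finite) set" and \<phi> g \<alpha> g' \<alpha>' +
  assumes omega_law: "z \<in> S \<Longrightarrow> omega g z $ i $ j =
      (\<Sum>p\<in>UNIV. \<Sum>q\<in>UNIV. omega g' (\<phi> z) $ p $ q * Jm p i z * cnj (Jm q j z))"
    and \<alpha>_law: "z \<in> S \<Longrightarrow> \<alpha> d z $ i $ j =
      (\<Sum>p\<in>UNIV. \<Sum>q\<in>UNIV. \<alpha>' d (\<phi> z) $ p $ q * Jm p i z * cnj (Jm q j z))"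
begin

definition Jmat :: "complex^'n \<Rightarrow> complex^'n^'n" where "Jmat z = (\<chi> i j. Jm i j z)"

text \<open>By the transformation law, a kernel vector of the Jacobian would be a kernel vector of
  the non-degenerate form \<open>omega g\<close>.\<close>

lemma invertible_Jmat: "z \<in> S \<Longrightarrow> invertible (Jmat z)"
proof (rule invertible_kernel)
  fix x :: "complex^'n" assume z: "z \<in> S" and x: "\<And>p. (\<Sum>i\<in>UNIV. Jmat z $ p $ i * x $ i) = 0"
  have "(\<Sum>i\<in>UNIV. omega g z $ i $ j * x $ i) = 0" for j
  proof -
    have "(\<Sum>i\<in>UNIV. omega g z $ i $ j * x $ i) =
        (\<Sum>i\<in>UNIV. \<Sum>p\<in>UNIV. \<Sum>q\<in>UNIV. omega g' (\<phi> z) $ p $ q * cnj (Jm q j z) * (Jmat z $ p $ i * x $ i))"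
      by (simp add: omega_law[OF z] sum_distrib_left sum_distrib_right Jmat_def mult_ac)
    also have "\<dots> = (\<Sum>p\<in>UNIV. \<Sum>i\<in>UNIV. \<Sum>q\<in>UNIV. omega g' (\<phi> z) $ p $ q * cnj (Jm q j z) * (Jmat z $ p $ i * x $ i))"
      by (rule sum.swap)
    also have "\<dots> = (\<Sum>p\<in>UNIV. \<Sum>q\<in>UNIV. \<Sum>i\<in>UNIV. omega g' (\<phi> z) $ p $ q * cnj (Jm q j z) * (Jmat z $ p $ i * x $ i))"
      by (intro sum.cong refl sum.swap)
    also have "\<dots> = 0" by (simp add: x flip: sum_distrib_left)
    finally show ?thesis .
  qed
  then have "\<i> * (\<Sum>i\<in>UNIV. g z $ i $ j * x $ i) = 0" for j
    by (simp add: omega_def sum_distrib_left mult.assoc)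
  then show "x = 0" using s.g_kernel(2)[OF z, of "\<lambda>i. x $ i"] by (simp add: vec_eq_iff)
qed

end

locale patch_change_point = patch_change S S' \<phi> g \<alpha> g' \<alpha>' + change_point S S' \<phi> z
  for S S' :: "(complex^'n::finite) set" and \<phi> g \<alpha> g' \<alpha>' z
begin

sublocale s: kaehler_point S g \<alpha> z
  by (rule s.kaehler_point[OF z_S])

sublocale t: kaehler_point S' g' \<alpha>' "\<phi> z"
  by (rule t.kaehler_point[OF maps[OF z_S]])

lemma smooth_Jinv: "cinf_on S (\<lambda>w. matrix_inv (Jmat w) $ i $ j)"
  by (rule cinf_on_matrix_inv[OF open_S _ invertible_Jmat]) (simp_all add: Jmat_def smooth_Jm)

lemma mh_inverse:
  "(\<Sum>j\<in>UNIV. mh i j * jF z (\<lambda>w. matrix_inv (Jmat w) $ j $ k)) = (if i = k then 1 else 0)"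
  "(\<Sum>j\<in>UNIV. jF z (\<lambda>w. matrix_inv (Jmat w) $ i $ j) * mh j k) = (if i = k then 1 else 0)"
  "(\<Sum>j\<in>UNIV. ma i j * jF z (\<lambda>w. cnj (matrix_inv (Jmat w) $ j $ k))) = (if i = k then 1 else 0)"
proof -
  have 1: "(\<Sum>j\<in>UNIV. Jm i j w * matrix_inv (Jmat w) $ j $ k) = (if i = k then 1 else 0)"
    "(\<Sum>j\<in>UNIV. matrix_inv (Jmat w) $ i $ j * Jm j k w) = (if i = k then 1 else 0)" if "w \<in> S" for w
    using matrix_inv_right_sum[OF invertible_Jmat[OF that], of i k] by (simp_all add: Jmat_def)
  have 2: "(\<Sum>j\<in>UNIV. cnj (Jm i j w) * cnj (matrix_inv (Jmat w) $ j $ k)) = (if i = k then 1 else 0)"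
    if "w \<in> S" for w
    using arg_cong[OF 1(1)[OF that], of cnj] by (auto simp: cnj_sum)
  have \<delta>: "jF z (\<lambda>w. if i = k then 1 else 0) = (if i = k then 1 else 0)"
    by (simp add: jF_const)
  have "(\<Sum>j\<in>UNIV. mh i j * jF z (\<lambda>w. matrix_inv (Jmat w) $ j $ k)) =
      jF z (\<lambda>w. \<Sum>j\<in>UNIV. Jm i j w * matrix_inv (Jmat w) $ j $ k)"
    by (simp add: jF_sum jF_mult M_eq smooth_Jm smooth_Jinv cinf_on_mult open_S)
  also have "\<dots> = (if i = k then 1 else 0)" unfolding \<delta>[symmetric] by (rule jF_cong) (rule 1)
  finally show "(\<Sum>j\<in>UNIV. mh i j * jF z (\<lambda>w. matrix_inv (Jmat w) $ j $ k)) = (if i = k then 1 else 0)" .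
  have "(\<Sum>j\<in>UNIV. jF z (\<lambda>w. matrix_inv (Jmat w) $ i $ j) * mh j k) =
      jF z (\<lambda>w. \<Sum>j\<in>UNIV. matrix_inv (Jmat w) $ i $ j * Jm j k w)"
    by (simp add: jF_sum jF_mult M_eq smooth_Jm smooth_Jinv cinf_on_mult open_S)
  also have "\<dots> = (if i = k then 1 else 0)" unfolding \<delta>[symmetric] by (rule jF_cong) (rule 1)
  finally show "(\<Sum>j\<in>UNIV. jF z (\<lambda>w. matrix_inv (Jmat w) $ i $ j) * mh j k) = (if i = k then 1 else 0)" .
  have "(\<Sum>j\<in>UNIV. ma i j * jF z (\<lambda>w. cnj (matrix_inv (Jmat w) $ j $ k))) =
      jF z (\<lambda>w. \<Sum>j\<in>UNIV. cnj (Jm i j w) * cnj (matrix_inv (Jmat w) $ j $ k))"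
    by (simp add: jF_sum jF_mult M_eq smooth_Jm smooth_Jinv cinf_on_cnj cinf_on_mult open_S)
  also have "\<dots> = (if i = k then 1 else 0)" unfolding \<delta>[symmetric] by (rule jF_cong) (rule 2)
  finally show "(\<Sum>j\<in>UNIV. ma i j * jF z (\<lambda>w. cnj (matrix_inv (Jmat w) $ j $ k))) = (if i = k then 1 else 0)" .
qed

text \<open>The sign \<open>\<epsilon>\<close> lets the lemma serve both for the Jacobian and for
  the Kaehler form, whose inverse carries a minus sign.\<close>

lemma cancel_right:
  fixes A B :: "'n \<Rightarrow> 'n \<Rightarrow> ('n + 'n) wvar mps"
  assumes inv: "\<And>i k. (\<Sum>j\<in>UNIV. A i j * B j k) = (if i = k then \<epsilon> else 0)" and \<epsilon>: "\<epsilon> * \<epsilon> = 1"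
    and 0: "\<And>j. (\<Sum>q\<in>UNIV. c q * A q j) = 0"
  shows "c r = 0"
proof -
  have "0 = (\<Sum>j\<in>UNIV. (\<Sum>q\<in>UNIV. c q * A q j) * B j r)" by (simp add: 0)
  also have "\<dots> = (\<Sum>q\<in>UNIV. if q = r then c q * \<epsilon> else 0)"
    unfolding sum_matrix_assoc[symmetric] inv by (intro sum.cong) auto
  finally have "c r * \<epsilon> = 0" by simp
  then have "c r * (\<epsilon> * \<epsilon>) = 0" by (simp add: mult.assoc[symmetric])
  then show ?thesis by (simp add: \<epsilon>)
qed

lemmas cancel_mh = cancel_right[OF mh_inverse(1), simplified]
  and cancel_ma = cancel_right[OF mh_inverse(3), simplified]

lemma cancel_mh_left: "(\<And>p. (\<Sum>i\<in>UNIV. mh p i * c i) = 0) \<Longrightarrow> c r = 0"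
proof -
  assume 0: "\<And>p. (\<Sum>i\<in>UNIV. mh p i * c i) = 0"
  have "0 = (\<Sum>p\<in>UNIV. jF z (\<lambda>w. matrix_inv (Jmat w) $ r $ p) * (\<Sum>i\<in>UNIV. mh p i * c i))" by (simp add: 0)
  also have "\<dots> = (\<Sum>i\<in>UNIV. if i = r then c i else 0)"
    unfolding sum_matrix_assoc mh_inverse(2) by (intro sum.cong) auto
  finally show ?thesis by simp
qed

section \<open>Naturality of the connection and of the Wick product\<close>

abbreviation "Tom p q \<equiv> T (t.Jom p q)"
abbreviation "T\<theta> p q \<equiv> T (t.J\<theta> p q)"

lemma T_inv: "(\<Sum>q\<in>UNIV. T\<theta> m q * Tom m' q) = (if m = m' then -1 else 0)"
  "(\<Sum>m\<in>UNIV. T\<theta> m q * Tom m q') = (if q = q' then -1 else 0)"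
  unfolding subst_mult[symmetric] subst_sum[symmetric] t.inv1 t.inv2
  using subst_diff[of L 0 1] by auto

lemma cancel_Tom_right:
  assumes "\<And>p. (\<Sum>q\<in>UNIV. c q * Tom p q) = 0"
  shows "c r = 0"
proof (rule cancel_right[where A = "\<lambda>q p. Tom p q" and B = T\<theta> and \<epsilon> = "-1"])
  show "(\<Sum>j\<in>UNIV. Tom j i * T\<theta> j k) = (if i = k then -1 else 0)" for i k
    using T_inv(2)[of k i] by (cases "i = k") (simp_all add: mult.commute)
qed (use assms in simp_all)

lemma Tom_eq: "Tom p q = jF z (\<lambda>w. omega g' (\<phi> w) $ p $ q)"
  by (rule pull) (rule t.smooth_omega)

lemma om_law: "s.Jom i j = (\<Sum>p\<in>UNIV. \<Sum>q\<in>UNIV. Tom p q * (mh p i * ma q j))"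
proof -
  have c: "cinf_on S (\<lambda>w. omega g' (\<phi> w) $ p $ q)" for p q
    using cinf_on_compose[OF t.smooth_omega] .
  have "s.Jom i j = jF z (\<lambda>w. \<Sum>p\<in>UNIV. \<Sum>q\<in>UNIV. omega g' (\<phi> w) $ p $ q * (Jm p i w * cnj (Jm q j w)))"
    by (rule jF_cong) (simp add: omega_law mult.assoc)
  then show ?thesis
    by (simp add: jF_sum jF_mult Tom_eq M_eq c smooth_Jm cinf_on_cnj cinf_on_mult cinf_on_sum open_S)
qed

lemma dZ_T: "dZ C (T a) = (\<Sum>B\<in>UNIV. M B C * T (dZ B a)) +
    (\<Sum>B\<in>UNIV. (\<Sum>D\<in>UNIV. dZ C (M B D) * X (Yv D)) * T (dY B a))"
  unfolding pd_subst sum_wvar by (simp add: dZ_frame_coord pd_mult pd_X)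

lemma fc_T: "fibre_const a \<Longrightarrow> fibre_const (T a)"
  by (simp add: fibre_const_def dY_T)

lemma T_yl: "T (s.yl p) = (\<Sum>i\<in>UNIV. mh p i * s.yl i)" and T_yr: "T (s.yr p) = (\<Sum>i\<in>UNIV. ma p i * s.yr i)"
  by (simp_all add: subst_X sum_UNIV_Plus M_eq)

text \<open>The failure of pullback to intertwine the two connections. It is a derivation along the
  pullback, so it is determined by the variables.\<close>

definition NT :: "'n + 'n \<Rightarrow> ('n + 'n) wvar mps \<Rightarrow> ('n + 'n) wvar mps" where
  "NT C a = s.nb C (T a) - (\<Sum>B\<in>UNIV. M B C * T (t.nb B a))"

lemma NT_add: "NT C (a + b) = NT C a + NT C b"
  by (simp add: NT_def subst_add nab_add distrib_left sum.distrib)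

lemma NT_sum: "NT C (sum f A) = (\<Sum>x\<in>A. NT C (f x))"
proof -
  have "NT C 0 = 0" by (simp add: NT_def)
  then show ?thesis by (induction A rule: infinite_finite_induct) (auto simp: NT_add)
qed

lemma NT_mult: "NT C (a * b) = NT C a * T b + T a * NT C b"
  by (simp add: NT_def subst_mult nab_mult subst_add distrib_left sum.distrib sum_distrib_left
      sum_distrib_right right_diff_distrib left_diff_distrib mult_ac)

lemma NT_fibre_const: "fibre_const a \<Longrightarrow> NT C a = 0"
  by (simp add: NT_def nab_fibre_const fc_T dZ_T) (simp add: fibre_const_def)

text \<open>In holomorphic directions the lowered frames of both charts are parallel, and the law
  for \<open>om\<close> relates them by the antiholomorphic Jacobian, which is constant in these
  directions and can be cancelled. In antiholomorphic directions both terms of the defect vanish.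
  Thus the transformation law of the Christoffel symbols is never written out.\<close>

lemma NT_yl: "NT C (s.yl m) = 0"
proof (cases C)
  case (Inl i)
  define u' where "u' q = (\<Sum>m\<in>UNIV. t.Jom m q * s.yl m)" for q
  have "(\<Sum>q\<in>UNIV. s.nb C (T (u' q)) * ma q j) = 0" for j
  proof -
    have "(\<Sum>m\<in>UNIV. s.Jom m j * s.yl m) = (\<Sum>q\<in>UNIV. ma q j * T (u' q))"
    proof -
      have "(\<Sum>m\<in>UNIV. s.Jom m j * s.yl m) =
          (\<Sum>m\<in>UNIV. \<Sum>p\<in>UNIV. \<Sum>q\<in>UNIV. ma q j * (Tom p q * (mh p m * s.yl m)))"
        unfolding om_law sum_distrib_right by (intro sum.cong refl) (simp add: mult_ac)
      also have "\<dots> = (\<Sum>p\<in>UNIV. \<Sum>m\<in>UNIV. \<Sum>q\<in>UNIV. ma q j * (Tom p q * (mh p m * s.yl m)))"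
        by (rule sum.swap)
      also have "\<dots> = (\<Sum>p\<in>UNIV. \<Sum>q\<in>UNIV. \<Sum>m\<in>UNIV. ma q j * (Tom p q * (mh p m * s.yl m)))"
        by (intro sum.cong refl sum.swap)
      also have "\<dots> = (\<Sum>q\<in>UNIV. \<Sum>p\<in>UNIV. \<Sum>m\<in>UNIV. ma q j * (Tom p q * (mh p m * s.yl m)))"
        by (rule sum.swap)
      also have "\<dots> = (\<Sum>q\<in>UNIV. ma q j * T (u' q))"
        by (simp add: u'_def subst_sum subst_mult T_yl sum_distrib_left)
      finally show ?thesis .
    qed
    then have "0 = s.nb C (\<Sum>q\<in>UNIV. ma q j * T (u' q))"
      using s.nab_lower_yl[of i j] Inl by simp
    then show ?thesis
      by (simp add: nab_sum nab_mult nab_fibre_const fc_M Inl dZ_mixed mult.commute)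
  qed
  then have n1: "s.nb C (T (u' q)) = 0" for q by (rule cancel_ma)
  have n2: "NT C (u' q) = 0" for q
    unfolding NT_def n1 using t.nab_lower_yl[of _ q] by (simp add: Inl sum_UNIV_Plus M_eq u'_def)
  have "s.yl m = - (\<Sum>q\<in>UNIV. t.J\<theta> m q * u' q)"
    by (rule t.solve_om) (simp add: u'_def mult.commute)
  then have "s.yl m = (\<Sum>q\<in>UNIV. (- t.J\<theta> m q) * u' q)" by (simp add: sum_negf)
  then have "NT C (s.yl m) = (\<Sum>q\<in>UNIV. NT C ((- t.J\<theta> m q) * u' q))" by (simp only: NT_sum)
  also have "\<dots> = 0"
    unfolding NT_mult n2 by (simp add: NT_fibre_const fibre_const_uminus t.fc_\<theta>)
  finally show ?thesis .
next
  case (Inr l)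
  have "s.nb C (T (s.yl m)) = 0"
    by (simp add: T_yl nab_sum nab_mult s.nab_yl nab_fibre_const fc_M Inr dZ_mixed)
  then show ?thesis by (simp add: NT_def Inr sum_UNIV_Plus M_eq t.nab_yl)
qed

lemma NT_yr: "NT C (s.yr m) = 0"
proof (cases C)
  case (Inr l)
  define u' where "u' p = (\<Sum>q\<in>UNIV. t.Jom p q * s.yr q)" for p
  have "(\<Sum>p\<in>UNIV. s.nb C (T (u' p)) * mh p i) = 0" for i
  proof -
    have "(\<Sum>j\<in>UNIV. s.Jom i j * s.yr j) = (\<Sum>p\<in>UNIV. mh p i * T (u' p))"
    proof -
      have "(\<Sum>j\<in>UNIV. s.Jom i j * s.yr j) =
          (\<Sum>j\<in>UNIV. \<Sum>p\<in>UNIV. \<Sum>q\<in>UNIV. mh p i * (Tom p q * (ma q j * s.yr j)))"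
        unfolding om_law sum_distrib_right by (intro sum.cong refl) (simp add: mult_ac)
      also have "\<dots> = (\<Sum>p\<in>UNIV. \<Sum>j\<in>UNIV. \<Sum>q\<in>UNIV. mh p i * (Tom p q * (ma q j * s.yr j)))"
        by (rule sum.swap)
      also have "\<dots> = (\<Sum>p\<in>UNIV. \<Sum>q\<in>UNIV. \<Sum>j\<in>UNIV. mh p i * (Tom p q * (ma q j * s.yr j)))"
        by (intro sum.cong refl sum.swap)
      also have "\<dots> = (\<Sum>p\<in>UNIV. mh p i * T (u' p))"
        by (simp add: u'_def subst_sum subst_mult T_yr sum_distrib_left)
      finally show ?thesis .
    qed
    then have "0 = s.nb C (\<Sum>p\<in>UNIV. mh p i * T (u' p))"
      using s.nab_lower_yr[of l i] Inr by simp
    then show ?thesis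
      by (simp add: nab_sum nab_mult nab_fibre_const fc_M Inr dZ_mixed mult.commute)
  qed
  then have n1: "s.nb C (T (u' q)) = 0" for q by (rule cancel_mh)
  have n2: "NT C (u' q) = 0" for q
    unfolding NT_def n1 using t.nab_lower_yr[of _ q] by (simp add: Inr sum_UNIV_Plus M_eq u'_def)
  have "s.yr m = - (\<Sum>p\<in>UNIV. t.J\<theta> p m * u' p)"
    by (rule t.solve_om') (simp add: u'_def mult.commute)
  then have "s.yr m = (\<Sum>p\<in>UNIV. (- t.J\<theta> p m) * u' p)" by (simp add: sum_negf)
  then have "NT C (s.yr m) = (\<Sum>p\<in>UNIV. NT C ((- t.J\<theta> p m) * u' p))" by (simp only: NT_sum)
  also have "\<dots> = 0"
    unfolding NT_mult n2 by (simp add: NT_fibre_const fibre_const_uminus t.fc_\<theta>)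
  finally show ?thesis .
next
  case (Inl l)
  have "s.nb C (T (s.yr m)) = 0"
    by (simp add: T_yr nab_sum nab_mult s.nab_yr nab_fibre_const fc_M Inl dZ_mixed)
  then show ?thesis by (simp add: NT_def Inl sum_UNIV_Plus M_eq t.nab_yr)
qed

lemma nab_T: "s.nb C (T a) = (\<Sum>B\<in>UNIV. M B C * T (t.nb B a))"
proof -
  have "NT C a = 0"
  proof (rule series_ext[where D = "NT C" and a = a and L = L])
    fix v a
    have "NT C (X v) = 0"
    proof (cases v rule: wvar_cases)
      case (1 B) then show ?thesis by (simp add: NT_fibre_const fibre_const_XZ)
    next
      case 2 then show ?thesis by (simp add: NT_fibre_const fibre_const_XH)
    next
      case (3 m) then show ?thesis by (simp add: NT_yl)
    next
      case (4 m) then show ?thesis by (simp add: NT_yr)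
    qed
    then show "NT C (X v * a) = L v * NT C a" by (simp add: NT_mult subst_X)
  qed (simp_all add: NT_add NT_fibre_const s.fibre_const_K const_free)
  then show ?thesis by (simp add: NT_def)
qed

text \<open>The right side is shown to satisfy the same inverse relation to the pulled back form as
  the left side does; a non-degenerate form has only one such inverse.\<close>

lemma \<theta>_law: "T\<theta> p q = (\<Sum>i\<in>UNIV. \<Sum>j\<in>UNIV. mh p i * (ma q j * s.J\<theta> i j))"
proof -
  define t where "t p q = (\<Sum>i\<in>UNIV. \<Sum>j\<in>UNIV. mh p i * (ma q j * s.J\<theta> i j))" for p q
  have "(\<Sum>q\<in>UNIV. t p q * Tom p' q) - (if p = p' then -1 else 0) = 0" for p p'
  proof (rule cancel_mh)
    fix i'
    have "(\<Sum>p'\<in>UNIV. (\<Sum>q\<in>UNIV. t p q * Tom p' q) * mh p' i') =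
        (\<Sum>q\<in>UNIV. t p q * (\<Sum>p'\<in>UNIV. Tom p' q * mh p' i'))"
      by (rule sum_matrix_assoc[symmetric])
    also have "\<dots> = (\<Sum>q\<in>UNIV. \<Sum>i\<in>UNIV. \<Sum>j\<in>UNIV. mh p i * s.J\<theta> i j * (ma q j * (\<Sum>p'\<in>UNIV. Tom p' q * mh p' i')))"
      unfolding t_def sum_distrib_right by (intro sum.cong refl) (simp add: mult_ac)
    also have "\<dots> = (\<Sum>i\<in>UNIV. \<Sum>q\<in>UNIV. \<Sum>j\<in>UNIV. mh p i * s.J\<theta> i j * (ma q j * (\<Sum>p'\<in>UNIV. Tom p' q * mh p' i')))"
      by (rule sum.swap)
    also have "\<dots> = (\<Sum>i\<in>UNIV. \<Sum>j\<in>UNIV. \<Sum>q\<in>UNIV. mh p i * s.J\<theta> i j * (ma q j * (\<Sum>p'\<in>UNIV. Tom p' q * mh p' i')))"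
      by (intro sum.cong refl sum.swap)
    also have "\<dots> = (\<Sum>i\<in>UNIV. mh p i * (\<Sum>j\<in>UNIV. s.J\<theta> i j * s.Jom i' j))"
    proof -
      have "s.Jom i' j = (\<Sum>q\<in>UNIV. ma q j * (\<Sum>p'\<in>UNIV. Tom p' q * mh p' i'))" for j
        unfolding om_law sum_distrib_left by (subst sum.swap) (simp add: mult_ac)
      then show ?thesis by (simp add: sum_distrib_left mult.assoc)
    qed
    also have "\<dots> = - mh p i'"
      unfolding s.inv1 by (simp add: if_distrib[of "\<lambda>x. _ * x"] cong: if_cong)
    finally have a: "(\<Sum>p'\<in>UNIV. (\<Sum>q\<in>UNIV. t p q * Tom p' q) * mh p' i') = - mh p i'" .
    have "(\<Sum>p'\<in>UNIV. (if p = p' then -1 else 0) * mh p' i') = (\<Sum>p'\<in>UNIV. if p' = p then - mh p i' else 0)"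
      by (intro sum.cong) auto
    then show "(\<Sum>p'\<in>UNIV. ((\<Sum>q\<in>UNIV. t p q * Tom p' q) - (if p = p' then -1 else 0)) * mh p' i') = 0"
      using a by (simp add: left_diff_distrib sum_subtractf)
  qed
  then have "(\<Sum>q\<in>UNIV. (T\<theta> p q - t p q) * Tom p' q) = 0" for p p'
    using T_inv(1)[of p p'] by (simp add: left_diff_distrib sum_subtractf)
  then have "T\<theta> p q - t p q = 0" by (rule cancel_Tom_right)
  then show ?thesis by (simp add: t_def)
qed

lemma T_Phi: "T (t.Phi k a b) = s.Phi k (T a) (T b)"
proof (induction k arbitrary: a b)
  case 0
  show ?case by (simp add: subst_mult)
next
  case (Suc k)
  let ?P = "\<lambda>p q. T (t.Phi k (dY (Inl p) a) (dY (Inr q) b))"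
  have d: "dY (Inl i) (T x) = (\<Sum>p\<in>UNIV. mh p i * T (dY (Inl p) x))"
    "dY (Inr i) (T x) = (\<Sum>p\<in>UNIV. ma p i * T (dY (Inr p) x))" for i x
    by (simp_all add: dY_T sum_UNIV_Plus M_eq)
  have "s.Phi (Suc k) (T a) (T b) = (\<Sum>i\<in>UNIV. \<Sum>j\<in>UNIV. \<Sum>q\<in>UNIV. \<Sum>p\<in>UNIV. mh p i * (ma q j * s.J\<theta> i j) * ?P p q)"
    unfolding s.Phi_Suc d
    by (simp add: s.Phi_sum_left s.Phi_sum_right s.Phi_scalar_left s.Phi_scalar_right fc_M Suc.IH
        sum_distrib_left mult_ac)
  also have "\<dots> = (\<Sum>i\<in>UNIV. \<Sum>j\<in>UNIV. \<Sum>p\<in>UNIV. \<Sum>q\<in>UNIV. mh p i * (ma q j * s.J\<theta> i j) * ?P p q)"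
    by (intro sum.cong refl sum.swap)
  also have "\<dots> = (\<Sum>i\<in>UNIV. \<Sum>p\<in>UNIV. \<Sum>j\<in>UNIV. \<Sum>q\<in>UNIV. mh p i * (ma q j * s.J\<theta> i j) * ?P p q)"
    by (intro sum.cong refl sum.swap)
  also have "\<dots> = (\<Sum>p\<in>UNIV. \<Sum>i\<in>UNIV. \<Sum>j\<in>UNIV. \<Sum>q\<in>UNIV. mh p i * (ma q j * s.J\<theta> i j) * ?P p q)"
    by (rule sum.swap)
  also have "\<dots> = (\<Sum>p\<in>UNIV. \<Sum>i\<in>UNIV. \<Sum>q\<in>UNIV. \<Sum>j\<in>UNIV. mh p i * (ma q j * s.J\<theta> i j) * ?P p q)"
    by (intro sum.cong refl sum.swap)
  also have "\<dots> = (\<Sum>p\<in>UNIV. \<Sum>q\<in>UNIV. \<Sum>i\<in>UNIV. \<Sum>j\<in>UNIV. mh p i * (ma q j * s.J\<theta> i j) * ?P p q)"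
    by (intro sum.cong refl sum.swap)
  also have "\<dots> = T (t.Phi (Suc k) a b)"
    by (simp only: t.Phi_Suc subst_sum subst_mult \<theta>_law sum_distrib_right)
  finally show ?case ..
qed

lemma T_br: "T (t.br a b) = s.br (T a) (T b)"
  unfolding t.br_def s.br_def hlinear_hsum[OF hlinear_T] by (simp only: subst_mult subst_K subst_diff T_Phi)

end

lemma (in substitution) vanishes_subst:
  assumes L: "\<And>v. vanishes w' (w v) (L v)" and a: "vanishes w n a"
  shows "vanishes w' n (subst L a)"
  unfolding vanishes_def mcoeff_subst psub_def mcoeff_sum mcoeff_K_mult
proof (intro allI impI sum.neutral ballI)
  fix e e' assume e: "wdeg w' e < n"
  have pow: "vanishes w' (k * w v) (L v ^ k)" for k :: nat and v
  proof (induction k)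
    case (Suc k)
    then show ?case using vanishes_mult[OF L Suc, of v] by simp
  qed simp
  have "vanishes w' (\<Sum>v\<in>F. e' v * w v) (\<Prod>v\<in>F. L v ^ e' v)" if "finite F" for F
    using that by (induction F rule: finite_induct) (simp_all add: vanishes_mult pow)
  from this[of UNIV] have m: "vanishes w' (wdeg w e') (mpow L e')"
    by (simp add: mpow_def wdeg_def mult.commute)
  show "mcoeff a e' * mcoeff (mpow L e') e = 0"
  proof (cases "wdeg w e' < n")
    case True
    then show ?thesis using a by (simp add: vanishes_def)
  next
    case False
    then have "wdeg w' e < wdeg w e'" using e by simp
    then show ?thesis using m by (simp add: vanishes_def)
  qed
qed

lemma restr_wy: "restr (range (\<lambda>i. Yv (Inl i))) a = 0 \<longleftrightarrow> vanishes wy 1 a"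
  unfolding restr_eq_0_iff vanishes_def wdeg_wy by simp

context patch_change_point
begin

section \<open>Naturality of the curvature and of the Fedosov connection\<close>

lemma nab_nab_T:
  "s.nb (Inl i) (s.nb (Inr l) (T x)) = (\<Sum>p\<in>UNIV. \<Sum>q\<in>UNIV. mh p i * (ma q l * T (t.nb (Inl p) (t.nb (Inr q) x))))"
  "s.nb (Inr l) (s.nb (Inl i) (T x)) = (\<Sum>p\<in>UNIV. \<Sum>q\<in>UNIV. mh p i * (ma q l * T (t.nb (Inr q) (t.nb (Inl p) x))))"
proof -
  have "s.nb (Inl i) (s.nb (Inr l) (T x)) = s.nb (Inl i) (\<Sum>q\<in>UNIV. ma q l * T (t.nb (Inr q) x))"
    by (simp add: nab_T sum_UNIV_Plus M_eq)
  also have "\<dots> = (\<Sum>q\<in>UNIV. ma q l * s.nb (Inl i) (T (t.nb (Inr q) x)))"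
    by (simp add: nab_sum nab_mult nab_fibre_const fc_M dZ_mixed)
  also have "\<dots> = (\<Sum>q\<in>UNIV. \<Sum>p\<in>UNIV. mh p i * (ma q l * T (t.nb (Inl p) (t.nb (Inr q) x))))"
    by (simp add: nab_T sum_UNIV_Plus M_eq sum_distrib_left mult_ac)
  finally show "s.nb (Inl i) (s.nb (Inr l) (T x)) = (\<Sum>p\<in>UNIV. \<Sum>q\<in>UNIV. mh p i * (ma q l * T (t.nb (Inl p) (t.nb (Inr q) x))))"
    by (subst sum.swap) simp
  have "s.nb (Inr l) (s.nb (Inl i) (T x)) = s.nb (Inr l) (\<Sum>p\<in>UNIV. mh p i * T (t.nb (Inl p) x))"
    by (simp add: nab_T sum_UNIV_Plus M_eq)
  also have "\<dots> = (\<Sum>p\<in>UNIV. mh p i * s.nb (Inr l) (T (t.nb (Inl p) x)))"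
    by (simp add: nab_sum nab_mult nab_fibre_const fc_M dZ_mixed)
  also have "\<dots> = (\<Sum>p\<in>UNIV. \<Sum>q\<in>UNIV. mh p i * (ma q l * T (t.nb (Inr q) (t.nb (Inl p) x))))"
    by (simp add: nab_T sum_UNIV_Plus M_eq sum_distrib_left)
  finally show "s.nb (Inr l) (s.nb (Inl i) (T x)) = (\<Sum>p\<in>UNIV. \<Sum>q\<in>UNIV. mh p i * (ma q l * T (t.nb (Inr q) (t.nb (Inl p) x))))" .
qed

lemma dY_T_split: "dY (Inl i) (T x) = (\<Sum>p\<in>UNIV. mh p i * T (dY (Inl p) x))"
  "dY (Inr i) (T x) = (\<Sum>p\<in>UNIV. ma p i * T (dY (Inr p) x))"
  by (simp_all add: dY_T sum_UNIV_Plus M_eq)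

text \<open>Both sides act by the bracket as the curvature, so their difference brackets to zero
  with all y^m and does not depend on the bar y^q. Being linear in the bar y^q, it vanishes.\<close>

lemma curv_series_law: "s.curv_series i l = (\<Sum>p\<in>UNIV. \<Sum>q\<in>UNIV. mh p i * (ma q l * T (t.curv_series p q)))"
proof -
  define c where "c = s.curv_series i l - (\<Sum>p\<in>UNIV. \<Sum>q\<in>UNIV. mh p i * (ma q l * T (t.curv_series p q)))"
  have c0: "s.br c (T x) = 0" for x
  proof -
    have "s.br (s.curv_series i l) (T x) = (\<Sum>p\<in>UNIV. \<Sum>q\<in>UNIV. mh p i * (ma q l * T (t.br (t.curv_series p q) x)))"
      unfolding s.curvature_mixed[symmetric] t.curvature_mixed[symmetric] nab_nab_T
      by (simp add: subst_diff right_diff_distrib sum_subtractf)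
    then show ?thesis
      by (simp add: c_def s.br_diff s.br_sum s.br_scalar fc_M T_br)
  qed
  have "(\<Sum>m\<in>UNIV. mh p m * s.br c (s.yl m)) = 0" for p
    using c0[of "s.yl p"] by (simp add: T_yl s.br_sum s.br_scalar fc_M)
  then have b0: "s.br c (s.yl m) = 0" for m by (rule cancel_mh_left)
  have "dY (Inr q) c = 0" for q
  proof (rule s.solve_\<theta>)
    show "(\<Sum>q\<in>UNIV. s.J\<theta> m q * dY (Inr q) c) = 0" for m
      using b0[of m] by (simp add: s.br_yl s.Phi_yl_right del: s.Phi.simps)
  qed
  moreover have "c = (\<Sum>q\<in>UNIV. s.yr q * dY (Inr q) c)"
  proof -
    have 1: "(\<Sum>q\<in>UNIV. s.yr q * dY (Inr q) (s.curv_series i l)) = s.curv_series i l" for i l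
      unfolding s.dY_curv_series unfolding s.curv_series_def by (subst sum.swap) (simp add: sum_distrib_left mult_ac)
    have 2: "(\<Sum>q\<in>UNIV. s.yr q * dY (Inr q) (t.curv_series i l)) = t.curv_series i l" for i l
      unfolding t.dY_curv_series unfolding t.curv_series_def by (subst sum.swap) (simp add: sum_distrib_left mult_ac)
    have 3: "(\<Sum>q\<in>UNIV. s.yr q * dY (Inr q) (T x)) = T (\<Sum>q\<in>UNIV. s.yr q * dY (Inr q) x)" for x
      unfolding dY_T_split sum_matrix_assoc subst_sum subst_mult T_yr by (simp add: mult.commute)
    have "(\<Sum>q\<in>UNIV. s.yr q * dY (Inr q) (\<Sum>p\<in>UNIV. \<Sum>q'\<in>UNIV. mh p i * (ma q' l * T (t.curv_series p q')))) =
        (\<Sum>p\<in>UNIV. \<Sum>q'\<in>UNIV. mh p i * (ma q' l * (\<Sum>q\<in>UNIV. s.yr q * dY (Inr q) (T (t.curv_series p q')))))"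
    proof -
      have "(\<Sum>q\<in>UNIV. s.yr q * dY (Inr q) (\<Sum>p\<in>UNIV. \<Sum>q'\<in>UNIV. mh p i * (ma q' l * T (t.curv_series p q')))) =
          (\<Sum>q\<in>UNIV. \<Sum>p\<in>UNIV. \<Sum>q'\<in>UNIV. mh p i * (ma q' l * (s.yr q * dY (Inr q) (T (t.curv_series p q')))))"
        by (simp add: pd_mult sum_distrib_left mult.left_commute)
      also have "\<dots> = (\<Sum>p\<in>UNIV. \<Sum>q\<in>UNIV. \<Sum>q'\<in>UNIV. mh p i * (ma q' l * (s.yr q * dY (Inr q) (T (t.curv_series p q')))))"
        by (rule sum.swap)
      also have "\<dots> = (\<Sum>p\<in>UNIV. \<Sum>q'\<in>UNIV. \<Sum>q\<in>UNIV. mh p i * (ma q' l * (s.yr q * dY (Inr q) (T (t.curv_series p q')))))"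
        by (intro sum.cong refl sum.swap)
      finally show ?thesis by (simp add: sum_distrib_left)
    qed
    then show ?thesis by (simp add: c_def right_diff_distrib sum_subtractf 1 3 2)
  qed
  ultimately have "c = 0" by simp
  then show ?thesis by (simp add: c_def)
qed

lemma al_law: "s.Jal i l = (\<Sum>p\<in>UNIV. \<Sum>q\<in>UNIV. mh p i * (ma q l * T (t.Jal p q)))"
proof -
  have T: "T (t.Jal p q) = jW z (scalar_section (\<lambda>k w. \<alpha>' k (\<phi> w) $ p $ q))" for p q
  proof -
    have "t.alpha_form p q = scalar_section (\<lambda>k w. \<alpha>' k w $ p $ q)"
      by (simp add: fun_eq_iff t.alpha_form_def scalar_section_def)
    then show ?thesis using pull_scalar_section[of "\<lambda>k w. \<alpha>' k w $ p $ q", OF t.smooth_\<alpha>] by simp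
  qed
  have sm: "wsmooth S (scalar_section (\<lambda>k w. \<alpha>' k (\<phi> w) $ p $ q))" for p q
    by (rule wsmooth_scalar_section) (rule cinf_on_compose[OF t.smooth_\<alpha>])
  have "s.Jal i l = jW z (\<lambda>k e w. \<Sum>p\<in>UNIV. \<Sum>q\<in>UNIV. Jm p i w * (cnj (Jm q l w) * scalar_section (\<lambda>k w. \<alpha>' k (\<phi> w) $ p $ q) k e w))"
    by (rule jW_cong) (simp add: s.alpha_form_def scalar_section_def \<alpha>_law mult_ac)
  also have "\<dots> = (\<Sum>p\<in>UNIV. \<Sum>q\<in>UNIV. mh p i * (ma q l * T (t.Jal p q)))"
    by (simp add: jW_sum jW_scale wsmooth_sum wsmooth_scale sm smooth_Jm cinf_on_cnj open_S M_eq T)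
  finally show ?thesis .
qed

lemma euler_Yl_T: "euler s.Yl (T a) = T (euler s.Yl a)"
  unfolding euler_def sum_range_Yl dY_T_split sum_matrix_assoc subst_sum subst_mult T_yl
  by (simp add: mult.commute)

text \<open>The pulled back series solves the Euler equation of this chart and has no part without
  y^i. Uniqueness in the \<open>wy\<close>-filtration identifies the two, which shows that I_alpha
  is globally defined.\<close>

lemma I_law: "s.JI l = (\<Sum>q\<in>UNIV. ma q l * T (t.JI q))"
proof -
  define I' where "I' = (\<Sum>q\<in>UNIV. ma q l * T (t.JI q))"
  let ?D = "\<lambda>p q. T (t.nb (Inl p) (t.JI q)) + T (t.curv_series p q) - T (t.Jal p q)"
  have "euler s.Yl I' = (\<Sum>q\<in>UNIV. ma q l * T (\<Sum>p\<in>UNIV. s.yl p * (t.nb (Inl p) (t.JI q) + t.curv_series p q - t.Jal p q)))"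
    unfolding I'_def euler_sum s.euler_scalar[OF fc_M] euler_Yl_T t.fedI_alpha_euler ..
  also have "\<dots> = (\<Sum>q\<in>UNIV. ma q l * (\<Sum>p\<in>UNIV. (\<Sum>i\<in>UNIV. s.yl i * mh p i) * ?D p q))"
    unfolding subst_sum subst_mult subst_diff subst_add T_yl by (simp only: mult.commute)
  also have "\<dots> = (\<Sum>q\<in>UNIV. ma q l * (\<Sum>i\<in>UNIV. s.yl i * (\<Sum>p\<in>UNIV. mh p i * ?D p q)))"
    unfolding sum_matrix_assoc ..
  also have "\<dots> = (\<Sum>i\<in>UNIV. s.yl i * (\<Sum>q\<in>UNIV. \<Sum>p\<in>UNIV. mh p i * (ma q l * ?D p q)))"
    unfolding sum_distrib_left by (subst sum.swap) (simp add: mult_ac)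
  also have "\<dots> = (\<Sum>i\<in>UNIV. s.yl i * (s.nb (Inl i) I' + s.curv_series i l - s.Jal i l))"
  proof -
    have "s.nb (Inl i) I' = (\<Sum>q\<in>UNIV. \<Sum>p\<in>UNIV. mh p i * (ma q l * T (t.nb (Inl p) (t.JI q))))" for i
      by (simp add: I'_def nab_sum nab_mult nab_fibre_const[OF fibre_const_jF]
          dZ_mixed[unfolded M_eq] nab_T sum_UNIV_Plus M_eq sum_distrib_left mult_ac)
    moreover have "s.curv_series i l = (\<Sum>q\<in>UNIV. \<Sum>p\<in>UNIV. mh p i * (ma q l * T (t.curv_series p q)))"
      "s.Jal i l = (\<Sum>q\<in>UNIV. \<Sum>p\<in>UNIV. mh p i * (ma q l * T (t.Jal p q)))" for i
      unfolding curv_series_law al_law by (rule sum.swap)+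
    ultimately show ?thesis
      by (simp only: distrib_left right_diff_distrib sum.distrib sum_subtractf)
  qed
  finally have e: "euler s.Yl I' = (\<Sum>i\<in>UNIV. s.yl i * (s.nb (Inl i) I' + s.curv_series i l - s.Jal i l))" .
  have "vanishes wy (wy v) (L v)" for v
  proof (cases v rule: wvar_cases)
    case (3 m)
    have "vanishes wy 1 (mh m i * s.yl i)" for i
      using vanishes_mult_left[OF vanishes_X[of wy "Yv (Inl i)"]] by simp
    then have "vanishes wy 1 (\<Sum>i\<in>UNIV. mh m i * s.yl i)" by (rule vanishes_sum)
    then show ?thesis by (simp add: 3 sum_UNIV_Plus M_eq)
  qed simp_all
  then have V: "vanishes wy 1 a \<Longrightarrow> vanishes wy 1 (T a)" for a by (rule vanishes_subst)
  have "vanishes wy 1 (ma q l * T (t.JI q))" for q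
    using V t.restr_fedI_alpha[of q] by (intro vanishes_mult_left) (simp only: restr_wy)
  then have r: "restr s.Yl I' = 0"
    unfolding restr_wy I'_def by (rule vanishes_sum)
  have "s.JI l - I' = 0"
  proof (rule euler_unique[where w = wy and S = s.Yl])
    show "mcoeff (s.JI l - I') x = 0" if "sum x s.Yl = 0" for x
      using that r s.restr_fedI_alpha[of l] by (simp only: restr_eq_0_iff mcoeff_diff diff_self)
    fix n assume n: "vanishes wy n (s.JI l - I')"
    have "euler s.Yl (s.JI l - I') = (\<Sum>i\<in>UNIV. s.yl i * s.nb (Inl i) (s.JI l - I'))"
      unfolding euler_diff e s.fedI_alpha_euler
      by (simp add: nab_diff right_diff_distrib distrib_left sum.distrib sum_subtractf)
    then show "vanishes wy (Suc n) (euler s.Yl (s.JI l - I'))"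
      using n by (auto intro!: vanishes_sum vanishes_X_mult[where m = n] s.vanishes_wy_nab)
  qed
  then show ?thesis by (simp add: I'_def)
qed

lemma fx_T: "s.fx C (T a) = (\<Sum>B\<in>UNIV. M B C * T (t.fx B a))"
proof (cases C)
  case (Inl i)
  then show ?thesis by (simp add: nab_T sum_UNIV_Plus M_eq)
next
  case (Inr l)
  have "s.fx (Inr l) (T a) = s.nb (Inr l) (T a) + s.br (s.JI l) (T a)" by (rule s.fx_simps)
  also have "s.br (s.JI l) (T a) = (\<Sum>q\<in>UNIV. ma q l * T (t.br (t.JI q) a))"
    unfolding I_law by (simp add: s.br_sum s.br_scalar fc_M T_br)
  finally show ?thesis
    by (simp add: Inr nab_T sum_UNIV_Plus M_eq subst_add distrib_left sum.distrib)
qed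

lemma restr_T: "restr s.YA (T a) = T (restr s.YA a)"
proof -
  define D where "D a = restr s.YA (T a) - T (restr s.YA a)" for a
  have "D a = 0"
  proof (rule series_ext[where D = D and a = a and L = "\<lambda>v. restr s.YA (L v)"])
    fix v a
    have "restr s.YA (L v) = T (restr s.YA (X v))"
    proof (cases v rule: wvar_cases)
      case (1 C)
      then show ?thesis
        by (simp add: restr_X subst_X restr_diff s.restr_fibre_const fibre_const_jF)
    qed (simp_all add: restr_X subst_X restr_sum restr_mult)
    then show "D (X v * a) = restr s.YA (L v) * D a"
      by (simp add: D_def subst_mult subst_X restr_mult right_diff_distrib)
  qed (simp_all add: D_def restr_add subst_add mcoeff_restr const_free)
  then show ?thesis by (simp add: D_def)
qed

lemma euler_YA_T: "euler s.YA (T a) = T (euler s.YA a)"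
proof -
  have "(\<Sum>v\<in>range Yv. f v) = (\<Sum>B\<in>UNIV. f (Yv B))" for f :: "('n + 'n) wvar \<Rightarrow> ('n + 'n) wvar mps"
    by (subst sum.reindex) (simp_all add: inj_on_def)
  then show ?thesis
    unfolding euler_def by (simp add: dY_T sum_matrix_assoc subst_sum subst_mult subst_X mult.commute)
qed

text \<open>Pullback intertwines the operators \<open>fx\<close>, the Euler fields and the
  restrictions to the zero section, so it maps the fixed point over one chart to a fixed point with
  the same symbol over the other.\<close>

theorem fed_flat_law:
  assumes f': "\<And>k. cinf_on S' (f' k)" and f: "\<And>k w. w \<in> S \<Longrightarrow> f k w = f' k (\<phi> w)"
  shows "T (jW (\<phi> z) (fed_flat g' \<alpha>' f')) = jW z (fed_flat g \<alpha> f)"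
proof -
  have sf: "cinf_on S (f k)" for k
    by (rule cinf_on_cong[OF open_S f[symmetric] cinf_on_compose[OF f']])
  let ?s' = "fed_flat g' \<alpha>' f'" and ?s = "fed_flat g \<alpha> f"
  have e1: "euler s.YA (T (jW (\<phi> z) ?s')) = (\<Sum>C\<in>UNIV. X (Yv C) * s.fx C (T (jW (\<phi> z) ?s')))"
    unfolding euler_YA_T t.fed_flat_transfer(2)[OF f'] fx_T
    by (simp add: subst_sum subst_mult subst_X sum_matrix_assoc mult.commute)
  have e2: "euler s.YA (jW z ?s) = (\<Sum>C\<in>UNIV. X (Yv C) * s.fx C (jW z ?s))"
    by (rule s.fed_flat_transfer(2)[OF sf])
  have r: "restr s.YA (T (jW (\<phi> z) ?s')) = restr s.YA (jW z ?s)"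
  proof -
    have "(\<lambda>k. ?s' k (\<lambda>_. 0)) = f'" "(\<lambda>k. ?s k (\<lambda>_. 0)) = f"
      by (simp_all add: fun_eq_iff fed_flat_symbol)
    then have "restr s.YA (T (jW (\<phi> z) ?s')) = jW z (scalar_section (\<lambda>k w. f' k (\<phi> w)))"
      unfolding restr_T t.restr_jW by (simp add: pull_scalar_section f')
    also have "\<dots> = jW z (scalar_section f)"
      by (rule jW_cong, simp add: scalar_section_def f)
    finally show ?thesis unfolding restr_jW \<open>(\<lambda>k. ?s k (\<lambda>_. 0)) = f\<close> .
  qed
  show ?thesis by (rule s.fixpoint_unique[OF e1 e2 r])
qed

end

subsection \<open>Evaluation of the homogeneous components\<close>

text \<open>Restriction to the base point, followed by evaluation of the fibre polynomial at \<open>v\<close>. The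
  variable \<open>False\<close> records its degree and \<open>True\<close> stands for \<open>\<hbar>\<close>.\<close>

definition evs :: "('b \<Rightarrow> complex) \<Rightarrow> 'b wvar \<Rightarrow> bool mps" where
  "evs v x = (case x of Inl (Inl B) \<Rightarrow> 0 | Inl (Inr B) \<Rightarrow> K (v B) * X False | Inr _ \<Rightarrow> X True)"

lemma evs_simps [simp]: "evs v (Zv B) = 0" "evs v (Yv B) = K (v B) * X False" "evs v Hv = X True"
  by (simp_all add: evs_def)

interpretation evs: substitution "evs v" for v :: "'b::finite \<Rightarrow> complex"
proof
  show "mcoeff (evs v x) (\<lambda>_. 0) = 0" for x
    by (auto simp: evs_def split: sum.splits)
qed

lemma prod_UNIV_Plus:
  "(\<Prod>B\<in>(UNIV :: ('m::finite + 'n::finite) set). f B) = (\<Prod>i\<in>UNIV. f (Inl i)) * (\<Prod>j\<in>UNIV. f (Inr j))"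
  by (subst UNIV_Plus_UNIV[symmetric], subst prod.Plus) auto

lemma mcoeff_X_powers:
  "mcoeff (X False ^ a * X True ^ b) e = (if e False = a \<and> e True = b then 1 else 0)"
proof (induction a arbitrary: e)
  case 0
  have "mcoeff (X True ^ b) e = (if e False = 0 \<and> e True = b then 1 else 0)"
  proof (induction b arbitrary: e)
    case 0
    have "e = (\<lambda>_. 0) \<longleftrightarrow> e False = 0 \<and> e True = 0" by (auto simp: fun_eq_iff all_bool_eq)
    then show ?case by (simp add: mcoeff_1)
  next
    case (Suc b)
    then show ?case by (auto simp: mcoeff_X_mult)
  qed
  then show ?case by simp
next
  case (Suc a)
  then show ?case by (auto simp: mcoeff_X_mult mult.assoc)
qed

lemma mpow_evs: "mpow (evs v) e = (if \<forall>B. e (Zv B) = 0 then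
    K (\<Prod>B\<in>UNIV. v B ^ e (Yv B)) * (X False ^ (\<Sum>B\<in>UNIV. e (Yv B)) * X True ^ e Hv) else 0)"
  for e :: "'b::finite wvar \<Rightarrow> nat"
proof -
  have "mpow (evs v) e = (\<Prod>B\<in>UNIV. 0 ^ e (Zv B)) * (\<Prod>B\<in>UNIV. (K (v B) * X False) ^ e (Yv B)) * X True ^ e Hv"
  proof -
    have "mpow (evs v) e = (\<Prod>x\<in>UNIV. evs v (Inl x) ^ e (Inl x)) * (\<Prod>u\<in>UNIV. evs v (Inr u) ^ e (Inr u))"
      unfolding mpow_def using prod_UNIV_Plus[of "\<lambda>x. evs v x ^ e x"] by simp
    then show ?thesis
      using prod_UNIV_Plus[of "\<lambda>x. evs v (Inl x) ^ e (Inl x)"] by (simp add: UNIV_unit)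
  qed
  moreover have "(\<Prod>B\<in>UNIV. 0 ^ e (Zv B) :: bool mps) = (if \<forall>B. e (Zv B) = 0 then 1 else 0)"
  proof (cases "\<forall>B. e (Zv B) = 0")
    case False
    then obtain B where "e (Zv B) > 0" by auto
    then have "(0 :: bool mps) ^ e (Zv B) = 0" by (rule zero_power)
    then have "(\<Prod>B\<in>UNIV. 0 ^ e (Zv B) :: bool mps) = 0" by (intro prod_zero) auto
    then show ?thesis using False by simp
  qed simp
  moreover have "(\<Prod>B\<in>UNIV. (K (v B) * X False) ^ e (Yv B)) =
      K (\<Prod>B\<in>UNIV. v B ^ e (Yv B)) * (X False ^ (\<Sum>B\<in>UNIV. e (Yv B)))"
  proof -
    have Kp: "K (c ^ n) = (K c ^ n :: bool mps)" for c n by (induction n) (simp_all add: K_mult)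
    have "K (\<Prod>B\<in>F. v B ^ e (Yv B)) = (\<Prod>B\<in>F. K (v B) ^ e (Yv B) :: bool mps)" if "finite F" for F
      using that by (induction F rule: finite_induct) (simp_all add: K_mult Kp)
    then show ?thesis by (simp add: power_mult_distrib prod.distrib power_sum)
  qed
  ultimately show ?thesis by (simp add: mult.assoc)
qed

lemma mcoeff_subst_evs:
  fixes a :: "'b::finite wvar mps"
  shows "mcoeff (subst (evs v) a) (\<lambda>b. if b then k else d) =
    (\<Sum>e | sum e UNIV = d. mcoeff a (wmon k e) * (\<Prod>B\<in>UNIV. v B ^ e B))"
proof -
  let ?m = "\<lambda>b. if b then k else d"
  have t: "wdeg tot ?m = d + k" by (simp add: wdeg_tot UNIV_bool)
  have w: "wdeg tot (wmon k e) = sum e UNIV + k" for e :: "'b \<Rightarrow> nat"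
  proof -
    have "wdeg tot (wmon k e) = (\<Sum>x\<in>UNIV. wmon k e (Inl x)) + (\<Sum>u\<in>UNIV. wmon k e (Inr u))"
      unfolding wdeg_tot using sum_UNIV_Plus[of "wmon k e"] by simp
    then show ?thesis using sum_UNIV_Plus[of "\<lambda>x. wmon k e (Inl x)"] by (simp add: UNIV_unit)
  qed
  have inj: "inj (wmon k :: ('b \<Rightarrow> nat) \<Rightarrow> _)"
    by (rule injI) (metis ext wmon_simps(2))
  have "mcoeff (subst (evs v) a) ?m = (\<Sum>e | wdeg tot e \<le> d + k. mcoeff a e * mcoeff (mpow (evs v) e) ?m)"
    unfolding mcoeff_subst psub_def t by simp
  also have "\<dots> = (\<Sum>e\<in>wmon k ` {e. sum e UNIV = d}. mcoeff a e * mcoeff (mpow (evs v) e) ?m)"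
  proof (rule sum.mono_neutral_right)
    show "wmon k ` {e :: 'b \<Rightarrow> nat. sum e UNIV = d} \<subseteq> {e. wdeg tot e \<le> d + k}"
      by (auto simp: w)
    show "\<forall>e\<in>{e. wdeg tot e \<le> d + k} - wmon k ` {e. sum e UNIV = d}. mcoeff a e * mcoeff (mpow (evs v) e) ?m = 0"
    proof
      fix e :: "'b wvar \<Rightarrow> nat" assume e: "e \<in> {e. wdeg tot e \<le> d + k} - wmon k ` {e. sum e UNIV = d}"
      have "\<not> ((\<forall>B. e (Zv B) = 0) \<and> (\<Sum>B\<in>UNIV. e (Yv B)) = d \<and> e Hv = k)"
      proof
        assume *: "(\<forall>B. e (Zv B) = 0) \<and> (\<Sum>B\<in>UNIV. e (Yv B)) = d \<and> e Hv = k"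
        then have "e = wmon k (\<lambda>B. e (Yv B))"
          by (auto simp: fun_eq_iff wmon_def split: sum.splits)
        then show False using * e by blast
      qed
      then show "mcoeff a e * mcoeff (mpow (evs v) e) ?m = 0"
        by (auto simp: mpow_evs mcoeff_X_powers)
    qed
  qed simp
  also have "\<dots> = (\<Sum>e | sum e UNIV = d. mcoeff a (wmon k e) * (\<Prod>B\<in>UNIV. v B ^ e B))"
    by (subst sum.reindex[OF inj_on_subset[OF inj subset_UNIV]])
      (auto intro!: sum.cong simp: mpow_evs mcoeff_X_powers)
  finally show ?thesis .
qed

lemma mcoeff_subst_zero: "mcoeff (subst L a) (\<lambda>_. 0) = mcoeff a (\<lambda>_. 0)"
  for a :: "'v::finite mps"
proof -
  have "{e :: 'v \<Rightarrow> nat. wdeg tot e \<le> 0} = {\<lambda>_. 0}"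
    by (auto simp: wdeg_tot fun_eq_iff)
  then show ?thesis
    unfolding mcoeff_subst psub_def by (simp add: mpow_def mcoeff_K)
qed

lemma subst_evs_jF:
  assumes "open S" "z \<in> S"
  shows "subst (evs v) (jF z f) = K (f z)"
proof -
  interpret jet_point S z by unfold_locales (rule assms)+
  have "pd x (subst (evs v) (jF z f)) = 0" for x
  proof -
    have "pd w (jF z f) = 0 \<or> evs v w = 0" for w
      using fibre_const_jF[of f] pd_H_jF[OF assms, of f]
      by (cases w rule: wvar_cases) (auto simp: fibre_const_def)
    then have "pd x (evs v w) * subst (evs v) (pd w (jF z f)) = 0" for w
      by (metis mult_zero_left mult_zero_right pd_0 subst_0)
    then show ?thesis unfolding evs.pd_subst by simp
  qed
  then have r: "restr UNIV (subst (evs v) (jF z f)) = subst (evs v) (jF z f)"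
    by (intro restr_const) simp
  show ?thesis
  proof (rule mps_eqI)
    fix e
    have "mcoeff (subst (evs v) (jF z f)) e = (if e = (\<lambda>_. 0) then f z else 0)"
    proof (cases "e = (\<lambda>_. 0)")
      case True
      then show ?thesis by (simp add: mcoeff_subst_zero jF_const_term)
    next
      case False
      then obtain x where "e x \<noteq> 0" by (auto simp: fun_eq_iff)
      then show ?thesis using False by (subst r[symmetric]) (auto simp: mcoeff_restr)
    qed
    then show "mcoeff (subst (evs v) (jF z f)) e = mcoeff (K (f z)) e" by (simp add: mcoeff_K)
  qed
qed

context patch_change_point
begin

text \<open>At displacement zero the series \<open>M B C\<close> reduces to an entry of the Jacobian
  at \<open>z\<close>. Evaluation after pullback is therefore evaluation at the image of
  \<open>v\<close> under the differential.\<close>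

lemma subst_evs_T: "subst (evs v) (T a) = subst (evs (\<lambda>B. \<Sum>C\<in>UNIV. wirt C (frame_coord B) z * v C)) a"
proof -
  define v' where "v' B = (\<Sum>C\<in>UNIV. wirt C (frame_coord B) z * v C)" for B
  define D where "D a = subst (evs v) (T a) - subst (evs v') a" for a
  have "D a = 0"
  proof (rule series_ext[where D = D and a = a and L = "evs v'"])
    fix w a
    have "subst (evs v) (L w) = evs v' w"
    proof -
      have "subst (evs v) (L (Yv B)) = evs v' (Yv B)" for B
      proof -
        have "subst (evs v) (L (Yv B)) = (\<Sum>C\<in>UNIV. K (wirt C (frame_coord B) z * v C)) * X False"
          by (simp add: subst_sum evs.subst_mult evs.subst_X M_def subst_evs_jF[OF open_S z_S]
              K_mult sum_distrib_right mult.assoc)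
        also have "(\<Sum>C\<in>UNIV. K (wirt C (frame_coord B) z * v C)) = (K (v' B) :: bool mps)"
        proof -
          have "(\<Sum>C\<in>F. K (h C)) = (K (\<Sum>C\<in>F. h C) :: bool mps)" if "finite F" for F :: "('n + 'n) set" and h
            using that by (induction F rule: finite_induct) (simp_all add: K_add)
          then show ?thesis by (simp add: v'_def)
        qed
        finally show ?thesis by simp
      qed
      moreover have "subst (evs v) (L (Zv B)) = 0" for B
        by (simp add: subst_diff subst_evs_jF[OF open_S z_S])
      ultimately show ?thesis
        by (cases w rule: wvar_cases) (simp_all only: evs_simps L_simps(3) evs.subst_X)
    qed
    then show "D (X w * a) = evs v' w * D a"
      by (simp only: D_def subst_X_mult evs.subst_mult evs.subst_X_mult evs.subst_X right_diff_distrib)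
  qed (simp_all add: D_def subst_add evs.const_free)
  then show ?thesis by (simp add: D_def v'_def[abs_def])
qed

theorem fed_flat_compatible:
  assumes "\<And>k. cinf_on S' (f' k)" "\<And>k w. w \<in> S \<Longrightarrow> f k w = f' k (\<phi> w)"
  shows "(\<Sum>e | sum e UNIV = d. fed_flat g \<alpha> f k e z * (\<Prod>B\<in>UNIV. v B ^ e B)) =
    (\<Sum>e | sum e UNIV = d. fed_flat g' \<alpha>' f' k e (\<phi> z) *
      (\<Prod>B\<in>UNIV. (\<Sum>C\<in>UNIV. wirt C (frame_coord B) z * v C) ^ e B))"
proof -
  have "mcoeff (subst (evs v) (jW z (fed_flat g \<alpha> f))) (\<lambda>b. if b then k else d) =
      mcoeff (subst (evs (\<lambda>B. \<Sum>C\<in>UNIV. wirt C (frame_coord B) z * v C)) (jW (\<phi> z) (fed_flat g' \<alpha>' f'))) (\<lambda>b. if b then k else d)"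
    unfolding subst_evs_T[symmetric] using fed_flat_law[OF assms] by simp
  then show ?thesis by (simp only: mcoeff_subst_evs mcoeff_jW_wmon)
qed

end

section \<open>Existence of flat sections and the Wick property\<close>

locale kaehler_setup =
  fixes A :: "('a::{t2_space,second_countable_topology}, 'n::finite) chart set"
    and g :: "('a, 'n) chart \<Rightarrow> 'n matfield"
    and \<alpha> :: "nat \<Rightarrow> ('a, 'n) chart \<Rightarrow> 'n matfield"
  assumes kaehler: "kaehler_manifold A g" and closed_form: "closed_formal_form11 A \<alpha>"
begin

lemma chart: assumes "c \<in> A"
  shows "open (coord c UNIV)" "homeomorphism (fst c) (coord c UNIV) (snd c) (point c)"
    "open (fst c)"
  using kaehler assms by (auto simp: kaehler_manifold_def complex_atlas_def)

lemma point_snd: "c \<in> A \<Longrightarrow> x \<in> fst c \<Longrightarrow> point c (snd c x) = x"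
  using chart(2)[of c] by (simp add: homeomorphism_def)

lemma coordE:
  assumes "c \<in> A" "z \<in> coord c U"
  obtains x where "x \<in> U" "x \<in> fst c" "z = snd c x" "point c z = x"
  using assms point_snd by (auto simp: coord_def)

lemma open_coord: "c \<in> A \<Longrightarrow> open U \<Longrightarrow> open (coord c U)"
proof -
  assume c: "c \<in> A" and U: "open U"
  have "openin (top_of_set (fst c)) (U \<inter> fst c)"
    using U by (metis Int_commute openin_open_Int)
  then have "openin (top_of_set (coord c UNIV)) (coord c U)"
    unfolding coord_def[of c U] by (rule homeomorphism_imp_open_map[OF chart(2)[OF c]])
  then show "open (coord c U)" using chart(1)[OF c] by (simp add: openin_open_eq)
qed

lemma coord_mono: "U \<subseteq> V \<Longrightarrow> coord c U \<subseteq> coord c V"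
  by (auto simp: coord_def)

lemma patch: "c \<in> A \<Longrightarrow> open U \<Longrightarrow> kaehler_patch (coord c U) (g c) (\<lambda>k. \<alpha> k c)"
proof -
  assume c: "c \<in> A" and U: "open U"
  have sub: "coord c U \<subseteq> coord c UNIV" by (rule coord_mono) simp
  have f: "form11 A (\<lambda>c. omega (g c))" "closed11 A (\<lambda>c. omega (g c))"
    "form11 A (\<alpha> k)" "closed11 A (\<alpha> k)" for k
    using kaehler closed_form by (auto simp: kaehler_manifold_def closed_formal_form11_def)
  show ?thesis
  proof
    show "open (coord c U)" by (rule open_coord[OF c U])
    show "cinf_on (coord c U) (\<lambda>z. omega (g c) z $ i $ j)" "cinf_on (coord c U) (\<lambda>z. \<alpha> d c z $ i $ j)" for i j d
      by (rule cinf_on_subset[OF _ sub], use f(1) f(3)[of d] c in \<open>unfold form11_def, blast\<close>)+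
  next
    fix z i j k assume "z \<in> coord c U"
    then have z: "z \<in> coord c UNIV" using sub by blast
    show "wirt (Inl k) (\<lambda>z. omega (g c) z $ i $ j) z = wirt (Inl i) (\<lambda>z. omega (g c) z $ k $ j) z"
      "wirt (Inr k) (\<lambda>z. omega (g c) z $ i $ j) z = wirt (Inr j) (\<lambda>z. omega (g c) z $ i $ k) z"
      using f(2) c z unfolding closed11_def by blast+
    show "wirt (Inl k) (\<lambda>z. \<alpha> d c z $ i $ j) z = wirt (Inl i) (\<lambda>z. \<alpha> d c z $ k $ j) z"
      "wirt (Inr k) (\<lambda>z. \<alpha> d c z $ i $ j) z = wirt (Inr j) (\<lambda>z. \<alpha> d c z $ i $ k) z" for d
      using f(4)[of d] c z unfolding closed11_def by blast+
    show "\<alpha> 0 c z = 0"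
      using closed_form c z unfolding closed_formal_form11_def by blast
    show "0 < Re (\<Sum>i\<in>UNIV. \<Sum>j\<in>UNIV. g c z $ i $ j * v $ i * cnj (v $ j))" if "v \<noteq> 0" for v
      using kaehler c z that unfolding kaehler_manifold_def by blast
  qed
qed

lemma change: "c \<in> A \<Longrightarrow> c' \<in> A \<Longrightarrow> open U \<Longrightarrow>
    patch_change (coord c (U \<inter> fst c')) (coord c' (U \<inter> fst c)) (transition c c')
      (g c) (\<lambda>k. \<alpha> k c) (g c') (\<lambda>k. \<alpha> k c')"
proof -
  assume c: "c \<in> A" "c' \<in> A" and U: "open U"
  have o: "open (U \<inter> fst c')" "open (U \<inter> fst c)" by (rule open_Int[OF U chart(3)[OF c(2)]], rule open_Int[OF U chart(3)[OF c(1)]])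
  have sub: "coord c (U \<inter> fst c') \<subseteq> coord c (fst c')" by (rule coord_mono) simp
  have hol: "holomorphic_map_on (coord c (fst c')) (transition c c')"
    using kaehler c by (auto simp: kaehler_manifold_def complex_atlas_def)
  interpret sc: smooth_change "coord c (U \<inter> fst c')" "coord c' (U \<inter> fst c)" "transition c c'"
  proof
    show "open (coord c (U \<inter> fst c'))" "open (coord c' (U \<inter> fst c))"
      using o c by (auto intro: open_coord)
    show "transition c c' z \<in> coord c' (U \<inter> fst c)" if "z \<in> coord c (U \<inter> fst c')" for z
    proof (rule coordE[OF c(1) that])
      fix x assume x: "x \<in> U \<inter> fst c'" "x \<in> fst c" "z = snd c x" "point c z = x"
      show ?thesis unfolding transition_def coord_def x(4) using x(1,2) by blast
    qed
    show "cinf_on (coord c (U \<inter> fst c')) (\<lambda>z. transition c c' z $ i)" for i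
      using hol sub by (auto simp: holomorphic_map_on_def intro: cinf_on_subset)
    show "wirt (Inr j) (\<lambda>z. transition c c' z $ i) z = 0" if "z \<in> coord c (U \<inter> fst c')" for z i j
      using hol sub that by (auto simp: holomorphic_map_on_def)
  qed
  interpret s: kaehler_patch "coord c (U \<inter> fst c')" "g c" "\<lambda>k. \<alpha> k c" by (rule patch[OF c(1) o(1)])
  interpret t: kaehler_patch "coord c' (U \<inter> fst c)" "g c'" "\<lambda>k. \<alpha> k c'" by (rule patch[OF c(2) o(2)])
  have j: "jac c c' z $ i $ j = sc.Jm i j z" for i j z
    by (simp add: jac_def sc.Jm_def)
  have f: "form11 A (\<lambda>c. omega (g c))" "form11 A (\<alpha> k)" for k
    using kaehler closed_form by (auto simp: kaehler_manifold_def closed_formal_form11_def)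
  show ?thesis
  proof
    fix z i j d assume "z \<in> coord c (U \<inter> fst c')"
    then have z: "z \<in> coord c (fst c')" using sub by blast
    show "omega (g c) z $ i $ j = (\<Sum>p\<in>UNIV. \<Sum>q\<in>UNIV.
        omega (g c') (transition c c' z) $ p $ q * sc.Jm p i z * cnj (sc.Jm q j z))"
      "\<alpha> d c z $ i $ j = (\<Sum>p\<in>UNIV. \<Sum>q\<in>UNIV.
        \<alpha> d c' (transition c c' z) $ p $ q * sc.Jm p i z * cnj (sc.Jm q j z))"
      using f(1) f(2)[of d] c z unfolding form11_def j[symmetric] by blast+
  qed
qed

definition flat_lift :: "(nat \<Rightarrow> 'a \<Rightarrow> complex) \<Rightarrow> ('a, 'n) chart \<Rightarrow> 'n weyl" where
  "flat_lift f c = fed_flat (g c) (\<lambda>k. \<alpha> k c) (\<lambda>k z. f k (point c z))"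

lemma flat_lift_flat:
  assumes U: "open U" and f: "\<And>k. smooth_fun_on A U (f k)"
  shows "flat_section A g \<alpha> U (flat_lift f)"
  unfolding flat_section_def weyl_section_def
proof (intro conjI ballI allI)
  fix c k e assume c: "c \<in> A"
  interpret p: kaehler_patch "coord c U" "g c" "\<lambda>k. \<alpha> k c" by (rule patch[OF c U])
  have sf: "cinf_on (coord c U) (\<lambda>z. f k (point c z))" for k
    using f c by (simp add: smooth_fun_on_def)
  \<comment> \<open>Smoothness is obtained from a locale anchored at a point of the domain, so the
    empty domain, over which every function is smooth, is treated separately.\<close>
  show "cinf_on (coord c U) (flat_lift f c k e)"
  proof (cases "coord c U = {}")
    case True
    then show ?thesis by (simp add: cinf_on_iff_Ck) (metis Ck_const Ck_cong empty_iff open_empty)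
  next
    case False
    then obtain z where "z \<in> coord c U" by blast
    then interpret q: kaehler_point "coord c U" "g c" "\<lambda>k. \<alpha> k c" z by (rule p.kaehler_point)
    show ?thesis using q.fed_flat_transfer(1)[OF sf] by (simp add: flat_lift_def wsmooth_def)
  qed
next
  fix c z B k e assume c: "c \<in> A" and z: "z \<in> coord c U"
  interpret p: kaehler_patch "coord c U" "g c" "\<lambda>k. \<alpha> k c" by (rule patch[OF c U])
  interpret q: kaehler_point "coord c U" "g c" "\<lambda>k. \<alpha> k c" z by (rule p.kaehler_point[OF z])
  show "fedD (g c) (\<lambda>k. \<alpha> k c) B (flat_lift f c) k e z = 0"
    unfolding flat_lift_def using f c by (intro q.fed_flat_flat) (simp add: smooth_fun_on_def)
next
  fix c c' z k d v assume c: "c \<in> A" "c' \<in> A" and z: "z \<in> coord c (U \<inter> fst c')"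
  interpret pc: patch_change "coord c (U \<inter> fst c')" "coord c' (U \<inter> fst c)" "transition c c'"
      "g c" "\<lambda>k. \<alpha> k c" "g c'" "\<lambda>k. \<alpha> k c'"
    by (rule change[OF c U])
  interpret q: patch_change_point "coord c (U \<inter> fst c')" "coord c' (U \<inter> fst c)" "transition c c'"
      "g c" "\<lambda>k. \<alpha> k c" "g c'" "\<lambda>k. \<alpha> k c'" z
    by unfold_locales (rule pc.open_S z)+
  have push: "(\<Sum>C\<in>UNIV. wirt C (pc.frame_coord B) z * v C) = push c c' z v B" for B
  proof -
    have "jac c c' z $ i $ j = pc.Jm i j z" for i j by (simp add: jac_def pc.Jm_def)
    then show ?thesis
      by (cases B) (simp_all add: push_def sum_UNIV_Plus pc.wirt_frame_coord[OF z])
  qed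
  have "cinf_on (coord c' (U \<inter> fst c)) (\<lambda>w. f k (point c' w))" for k
    using f[of k] c(2) coord_mono[of "U \<inter> fst c" U c'] by (auto simp: smooth_fun_on_def intro: cinf_on_subset)
  moreover have "f k (point c w) = f k (point c' (transition c c' w))" if "w \<in> coord c (U \<inter> fst c')" for k w
  proof -
    obtain x where "x \<in> fst c'" "point c w = x" using coordE[OF c(1) \<open>w \<in> _\<close>] by auto
    then show ?thesis by (simp add: transition_def point_snd c)
  qed
  ultimately show "(\<Sum>e | sum e UNIV = d. flat_lift f c k e z * (\<Prod>B\<in>UNIV. v B ^ e B)) =
      (\<Sum>e | sum e UNIV = d. flat_lift f c' k e (transition c c' z) * (\<Prod>B\<in>UNIV. push c c' z v B ^ e B))"
    unfolding flat_lift_def push[symmetric] by (intro q.fed_flat_compatible) auto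
qed

lemma some_chart: "(SOME c. c \<in> A \<and> x \<in> fst c) \<in> A \<and> x \<in> fst (SOME c. c \<in> A \<and> x \<in> fst c)"
proof (rule someI_ex)
  have "x \<in> (\<Union>c\<in>A. fst c)" using kaehler by (simp add: kaehler_manifold_def complex_atlas_def)
  then show "\<exists>c. c \<in> A \<and> x \<in> fst c" by blast
qed

text \<open>\<open>flat_lift f\<close> is a witness for the choice in \<open>quantization\<close>,
  so the chosen section has the defining properties.\<close>

lemma quantization_flat:
  assumes U: "open U" and f: "\<And>k. smooth_fun_on A U (f k)"
  shows "flat_section A g \<alpha> U (quantization A g \<alpha> U f)"
    and "x \<in> U \<Longrightarrow> symbol A (quantization A g \<alpha> U f) k x = f k x"
proof -
  have symbol: "symbol A (flat_lift f) k x = f k x" for k x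
    using some_chart[of x] by (simp add: symbol_def Let_def flat_lift_def fed_flat_symbol point_snd)
  then have "\<exists>s. flat_section A g \<alpha> U s \<and> (\<forall>k. \<forall>x\<in>U. symbol A s k x = f k x)"
    using flat_lift_flat[OF assms] symbol by (intro exI[of _ "flat_lift f"]) simp
  from someI_ex[OF this]
  have "flat_section A g \<alpha> U (quantization A g \<alpha> U f) \<and>
      (\<forall>k. \<forall>x\<in>U. symbol A (quantization A g \<alpha> U f) k x = f k x)"
    unfolding quantization_def .
  then show "flat_section A g \<alpha> U (quantization A g \<alpha> U f)"
    "x \<in> U \<Longrightarrow> symbol A (quantization A g \<alpha> U f) k x = f k x"
    by simp_all
qed

lemma symbol_chart:
  assumes s: "weyl_section A U s" and c: "c \<in> A" and z: "z \<in> coord c U"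
  shows "symbol A s k (point c z) = s c k (\<lambda>_. 0) z"
proof -
  obtain x where x: "x \<in> U" "x \<in> fst c" "z = snd c x" "point c z = x" by (rule coordE[OF c z])
  define c' where "c' = (SOME c. c \<in> A \<and> x \<in> fst c)"
  have c': "c' \<in> A" "x \<in> fst c'" using some_chart[of x] by (simp_all add: c'_def)
  have "z \<in> coord c (U \<inter> fst c')" using x c' by (auto simp: coord_def)
  \<comment> \<open>In degree zero only the zero exponent remains and its monomial is 0^0 = 1, so
    compatibility of the components becomes equality of the symbols.\<close>
  then have "(\<Sum>e | sum e UNIV = 0. s c k e z * (\<Prod>B\<in>UNIV. 0 ^ e B)) =
      (\<Sum>e | sum e UNIV = 0. s c' k e (transition c c' z) * (\<Prod>B\<in>UNIV. push c c' z (\<lambda>_. 0) B ^ e B))"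
    using s[unfolded weyl_section_def, THEN conjunct2, rule_format, OF c c'(1), where z = z and d = 0 and k = k and v = "\<lambda>_. 0"] by blast
  moreover have "{e :: 'n + 'n \<Rightarrow> nat. sum e UNIV = 0} = {\<lambda>_. 0}" by (auto simp: fun_eq_iff)
  ultimately have "s c k (\<lambda>_. 0) z = s c' k (\<lambda>_. 0) (snd c' x)"
    by (simp add: transition_def x(4))
  then show ?thesis by (simp add: symbol_def x(4) Let_def c'_def[symmetric])
qed

theorem fedosov_star_wick_type: "wick_type A (fedosov_star A g \<alpha>)"
  unfolding wick_type_def
proof (intro allI impI ballI)
  fix U W :: "'a set" and f h :: "nat \<Rightarrow> 'a \<Rightarrow> complex" and x k
  assume *: "open U \<and> open W \<and> W \<subseteq> U \<and> (\<forall>k. smooth_fun_on A U (f k)) \<and> (\<forall>k. smooth_fun_on A U (h k)) \<and>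
       ((\<forall>k. antiholomorphic_fun_on A W (f k)) \<or> (\<forall>k. holomorphic_fun_on A W (h k)))"
    and x: "x \<in> W"
  define c where "c = (SOME c. c \<in> A \<and> x \<in> fst c)"
  have c: "c \<in> A" "x \<in> fst c" using some_chart[of x] by (simp_all add: c_def)
  define z where "z = snd c x"
  have z: "z \<in> coord c W" "point c z = x" using x c by (auto simp: z_def coord_def point_snd)
  have W: "open W" and U: "open U" and sub: "coord c W \<subseteq> coord c U"
    using * by (auto intro!: coord_mono)
  \<comment> \<open>The sections are formed over \<open>U\<close>, but smoothness, flatness and
    symbol restrict to the open part \<open>W\<close>, where holomorphy or antiholomorphy is given.
    The pointwise theory is then applied over \<open>W\<close>.\<close>
  have q: "wsmooth (coord c W) (quantization A g \<alpha> U f c) \<and>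
      (\<forall>w\<in>coord c W. \<forall>B k e. fedD (g c) (\<lambda>k. \<alpha> k c) B (quantization A g \<alpha> U f c) k e w = 0) \<and>
      (\<forall>w\<in>coord c W. \<forall>k. quantization A g \<alpha> U f c k (\<lambda>_. 0) w = f k (point c w))"
    if f: "\<And>k. smooth_fun_on A U (f k)" for f
  proof (intro conjI ballI allI)
    have flat: "flat_section A g \<alpha> U (quantization A g \<alpha> U f)" by (rule quantization_flat[OF U f])
    then have ws: "weyl_section A U (quantization A g \<alpha> U f)" by (simp add: flat_section_def)
    show "wsmooth (coord c W) (quantization A g \<alpha> U f c)"
      unfolding wsmooth_def
      by (intro allI cinf_on_subset[OF _ sub] ws[unfolded weyl_section_def, THEN conjunct1, rule_format, OF c(1)])
    fix w assume w: "w \<in> coord c W"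
    show "fedD (g c) (\<lambda>k. \<alpha> k c) B (quantization A g \<alpha> U f c) k e w = 0" for B k e
      using flat c(1) sub w by (auto simp: flat_section_def)
    obtain y where "y \<in> W" "point c w = y" using coordE[OF c(1) w] by auto
    then have "point c w \<in> U" using * by auto
    then show "quantization A g \<alpha> U f c k (\<lambda>_. 0) w = f k (point c w)" for k
      using symbol_chart[OF ws c(1), where z = w and k = k] quantization_flat(2)[OF U f, where x = "point c w" and k = k] sub w by auto
  qed
  note qf = q[of f, OF *[THEN conjunct2, THEN conjunct2, THEN conjunct2, THEN conjunct1, rule_format]]
  note qh = q[of h, OF *[THEN conjunct2, THEN conjunct2, THEN conjunct2, THEN conjunct2, THEN conjunct1, rule_format]]
  have wf: "wirt B (quantization A g \<alpha> U f c k (\<lambda>_. 0)) w = wirt B (\<lambda>w. f k (point c w)) w"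
    "wirt B (quantization A g \<alpha> U h c k (\<lambda>_. 0)) w = wirt B (\<lambda>w. h k (point c w)) w"
    if "w \<in> coord c W" for B k w
    by (rule wirt_cong_open[OF open_coord[OF c(1) W] that], use qf qh in blast)+
  interpret p: kaehler_patch "coord c W" "g c" "\<lambda>k. \<alpha> k c" by (rule patch[OF c(1) W])
  have "fedosov_star A g \<alpha> U f h k x =
      Defs.wick (g c) (quantization A g \<alpha> U f c) (quantization A g \<alpha> U h c) k (\<lambda>_. 0) z"
    by (simp add: fedosov_star_def symbol_def Let_def c_def[symmetric] z_def)
  also have "\<dots> = (\<Sum>l\<le>k. quantization A g \<alpha> U f c l (\<lambda>_. 0) z * quantization A g \<alpha> U h c (k - l) (\<lambda>_. 0) z)"
  proof (rule p.flat_symbol_wick)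
    show "(\<forall>w\<in>coord c W. \<forall>k i. wirt (Inl i) (quantization A g \<alpha> U f c k (\<lambda>_. 0)) w = 0) \<or>
        (\<forall>w\<in>coord c W. \<forall>k j. wirt (Inr j) (quantization A g \<alpha> U h c k (\<lambda>_. 0)) w = 0)"
      using * c(1) by (auto simp: wf antiholomorphic_fun_on_def holomorphic_fun_on_def)
  qed (use qf qh z in blast)+
  also have "\<dots> = (\<Sum>l\<le>k. f l x * h (k - l) x)"
    using qf qh z by simp
  finally show "fedosov_star A g \<alpha> U f h k x = (\<Sum>l\<le>k. f l x * h (k - l) x)" .
qed

end

theorem proposition2p21:
  fixes A :: "('a::{t2_space,second_countable_topology}, 'n::finite) chart set"
    and g :: "('a, 'n) chart \<Rightarrow> 'n matfield"
    and \<alpha> :: "nat \<Rightarrow> ('a, 'n) chart \<Rightarrow> 'n matfield"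
  assumes "kaehler_manifold A g"
    and "closed_formal_form11 A \<alpha>"
  shows "wick_type A (fedosov_star A g \<alpha>)"
  using assms by (intro kaehler_setup.fedosov_star_wick_type kaehler_setup.intro)

end
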